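(* Let $f:[0,\infty)\to[0,\infty)$ be a non-decreasing, slowly growing control function. Let $M$ be a compact Riemannian manifold with universal cover $\widetilde{M}$, and let $x_0\in\widetilde{M}$ be a fixed point. Put $\rho(x)=1/f(d(x,x_0))$ for $x\in\widetilde{M}$, and suppose there is a constant $C>0$ such that $$\int_{\widetilde{M}}\eta(x)^2\rho(x)\,v\ \le\ C\int_{\widetilde{M}}|\nabla\eta|^2\,v$$ for every smooth compactly supported function $\eta:\widetilde{M}\to\mathbb{R}$, where $v$ is the volume form of $\widetilde M$. Then $[\Gamma]=0$ in $H_0^f(\Gamma)$, where $\Gamma=\pi_1(M)$.
   Context: $M$ is connected and without boundary, and $\widetilde{M}$ carries the lifted Riemannian metric, with distance $d$. A control function is a non-decreasing $f:[0,\infty)\to[0,\infty)$ with $f(0)=1$ such that for every $K>0$ there is $L>0$ with $f(t+K)\le Lf(t)$ and $f(Kt)\le Lf(t)$ for all $t>0$. It is slowly growing if for every $\varepsilon>0$ there is $t_0$ such that $f(t+1)\le f(t)+\varepsilon$ for all $t>t_0$. The finitely generated group $\Gamma$ carries a word length metric $d$ of a finite symmetric generating set, with base point the identity $e$. For $\overline{x}=(x_0,\dots,x_n)\in\Gamma^{n+1}$ put $|\overline{x}|=\max_i d(x_i,e)$, and for tuples $d(\overline{x},\overline{y})=\max_i d(x_i,y_i)$. $C_n^f(\Gamma)$ is the real vector space of functions $c:\Gamma^{n+1}\to\mathbb{R}$ (also written as formal sums of simplices) that are alternating (a permutation of the vertices multiplies the value by its sign), have finite propagation (there is $R$ with $c_{\overline{x}}=0$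 whenever $d(\overline{x},\Delta_{n+1})\ge R$, where $\Delta_{n+1}$ is the diagonal), and satisfy $|c_{\overline{x}}|\le K_cf(|\overline{x}|)$ for a constant $K_c$ depending on $c$. The differential is the linear extension of $\partial[x_0,\dots,x_n]=\sum_i(-1)^i[x_0,\dots,\hat{x_i},\dots,x_n]$ (each simplex counted once up to reordering of its vertices); on functions, $(\partial c)(y_0,\dots,y_{n-1})=\sum_{z}c(z,y_0,\dots,y_{n-1})$, in particular $\partial\psi(x)=\sum_y\psi(y,x)$ for a $1$-chain. $H_*^f(\Gamma)$ is the homology of this complex, and $[\Gamma]\in H_0^f(\Gamma)$ is the class of $\sum_{x\in\Gamma}[x]$. *)

theory Defs
  imports
    "HOL-Analysis.Analysis"
    "HOL-Algebra.Coset"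
    "HOL-Algebra.Generated_Groups"
begin

section \<open>Control functions\<close>

text \<open>Functions on \<open>[0,\<infinity>)\<close> are functions on \<open>real\<close> whose values at negative arguments are
  never used.\<close>

definition control_function :: "(real \<Rightarrow> real) \<Rightarrow> bool" where
  "control_function f \<longleftrightarrow>
     (\<forall>t\<ge>0. f t \<ge> 0) \<and> mono_on {0..} f \<and> f 0 = 1 \<and>
     (\<forall>K>0. \<exists>L>0. \<forall>t>0. f (t + K) \<le> L * f t \<and> f (K * t) \<le> L * f t)"

definition slowly_growing :: "(real \<Rightarrow> real) \<Rightarrow> bool" where
  "slowly_growing f \<longleftrightarrow> (\<forall>\<epsilon>>0. \<exists>t\<^sub>0\<ge>0. \<forall>t>t\<^sub>0. f (t + 1) \<le> f t + \<epsilon>)"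


section \<open>Riemannian manifolds\<close>

text \<open>\<open>C\<^sup>k\<close> maps on an open set, by recursion on directional derivatives.\<close>

primrec Ck_on :: "nat \<Rightarrow> 'a::real_normed_vector set \<Rightarrow> ('a \<Rightarrow> 'b::real_normed_vector) \<Rightarrow> bool" where
  "Ck_on 0 S F \<longleftrightarrow> continuous_on S F"
| "Ck_on (Suc k) S F \<longleftrightarrow>
     (\<forall>x\<in>S. F differentiable (at x)) \<and>
     (\<forall>w. Ck_on k S (\<lambda>x. frechet_derivative F (at x) w))"

definition smooth_on :: "'a::real_normed_vector set \<Rightarrow> ('a \<Rightarrow> 'b::real_normed_vector) \<Rightarrow> bool" where
  "smooth_on S F \<longleftrightarrow> (\<forall>k. Ck_on k S F)"

text \<open>A manifold is a whole topological space, and a chart is its domain together with the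
  coordinate map, of which only the values on the domain matter.\<close>

type_synonym ('m, 'n) chart = "'m set \<times> ('m \<Rightarrow> real ^ 'n)"

definition chart_image :: "('m, 'n::finite) chart \<Rightarrow> (real ^ 'n) set" where
  "chart_image c = snd c ` fst c"

definition chart_inv :: "('m, 'n::finite) chart \<Rightarrow> real ^ 'n \<Rightarrow> 'm" where
  "chart_inv c = inv_into (fst c) (snd c)"

definition smooth_atlas :: "('m::topological_space, 'n::finite) chart set \<Rightarrow> bool" where
  "smooth_atlas A \<longleftrightarrow>
     (\<forall>c\<in>A. open (fst c) \<and> open (chart_image c) \<and>
            homeomorphism (fst c) (chart_image c) (snd c) (chart_inv c)) \<and>
     (\<Union>c\<in>A. fst c) = UNIV \<and>
     (\<forall>c\<in>A. \<forall>c'\<in>A. smooth_on (snd c ` (fst c \<inter> fst c')) (snd c' \<circ> chart_inv c))"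

text \<open>A tangent vector at \<open>x\<close> is written in the coordinates of a chart around \<open>x\<close>. A metric
  assigns to a chart \<open>c\<close> and a point \<open>x\<close> of its domain the inner product on \<open>T\<^sub>xM\<close> in the
  coordinates of \<open>c\<close>.\<close>

type_synonym ('m, 'n) metric_field =
  "('m, 'n) chart \<Rightarrow> 'm \<Rightarrow> real ^ 'n \<Rightarrow> real ^ 'n \<Rightarrow> real"

definition riemannian_metric ::
    "('m::topological_space, 'n::finite) chart set \<Rightarrow> ('m, 'n) metric_field \<Rightarrow> bool" where
  "riemannian_metric A g \<longleftrightarrow>
     (\<forall>c\<in>A. \<forall>x\<in>fst c.
        bilinear (g c x) \<and> (\<forall>u w. g c x u w = g c x w u) \<and> (\<forall>u. u \<noteq> 0 \<longrightarrow> g c x u u > 0)) \<and>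
     (\<forall>c\<in>A. \<forall>u w. smooth_on (chart_image c) (\<lambda>y. g c (chart_inv c y) u w)) \<and>
     (\<forall>c\<in>A. \<forall>c'\<in>A. \<forall>x\<in>fst c \<inter> fst c'. \<forall>u w.
        (let D = frechet_derivative (snd c' \<circ> chart_inv c) (at (snd c x))
         in g c' x (D u) (D w) = g c x u w))"

definition riemannian_manifold ::
    "('m::{t2_space,second_countable_topology}, 'n::finite) chart set \<Rightarrow> ('m, 'n) metric_field \<Rightarrow> bool"
  where
  "riemannian_manifold A g \<longleftrightarrow> smooth_atlas A \<and> riemannian_metric A g"

text \<open>Some chart around \<open>x\<close>; what is defined through it does not depend on the choice.\<close>

definition chart_at :: "('m, 'n) chart set \<Rightarrow> 'm \<Rightarrow> ('m, 'n) chart" where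
  "chart_at A x = (SOME c. c \<in> A \<and> x \<in> fst c)"

definition smooth_real_function ::
    "('m::topological_space, 'n::finite) chart set \<Rightarrow> ('m \<Rightarrow> real) \<Rightarrow> bool" where
  "smooth_real_function A \<eta> \<longleftrightarrow> (\<forall>c\<in>A. smooth_on (chart_image c) (\<eta> \<circ> chart_inv c))"

definition compactly_supported :: "('m::topological_space \<Rightarrow> real) \<Rightarrow> bool" where
  "compactly_supported \<eta> \<longleftrightarrow> compact (closure {x. \<eta> x \<noteq> 0})"

text \<open>The gradient in the coordinates of \<open>c\<close>: the metric dual of the differential.\<close>

definition gradient ::
    "('m, 'n::finite) metric_field \<Rightarrow> ('m \<Rightarrow> real) \<Rightarrow> ('m, 'n) chart \<Rightarrow> 'm \<Rightarrow> real ^ 'n" where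
  "gradient g \<eta> c x =
     (THE w. \<forall>u. g c x w u = frechet_derivative (\<eta> \<circ> chart_inv c) (at (snd c x)) u)"

definition gradient_norm ::
    "('m, 'n::finite) chart set \<Rightarrow> ('m, 'n) metric_field \<Rightarrow> ('m \<Rightarrow> real) \<Rightarrow> 'm \<Rightarrow> real" where
  "gradient_norm A g \<eta> x =
     (let c = chart_at A x; w = gradient g \<eta> c x in sqrt (g c x w w))"

definition piecewise_C1_curve ::
    "('m::topological_space, 'n::finite) chart set \<Rightarrow> (real \<Rightarrow> 'm) \<Rightarrow> bool" where
  "piecewise_C1_curve A \<gamma> \<longleftrightarrow>
     path \<gamma> \<and>
     (\<exists>F. finite F \<and>
        (\<forall>c\<in>A. (snd c \<circ> \<gamma>) C1_differentiable_on {t \<in> {0<..<1} - F. \<gamma> t \<in> fst c}))"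

definition curve_speed ::
    "('m, 'n::finite) chart set \<Rightarrow> ('m, 'n) metric_field \<Rightarrow> (real \<Rightarrow> 'm) \<Rightarrow> real \<Rightarrow> real" where
  "curve_speed A g \<gamma> t =
     (let c = chart_at A (\<gamma> t); u = vector_derivative (snd c \<circ> \<gamma>) (at t)
      in sqrt (g c (\<gamma> t) u u))"

text \<open>As in the library notion \<^const>\<open>piecewise_C1_differentiable_on\<close>, the velocity may be
  unbounded near the exceptional times, so lengths take values in \<open>[0,\<infinity>]\<close>.\<close>

definition curve_length ::
    "('m, 'n::finite) chart set \<Rightarrow> ('m, 'n) metric_field \<Rightarrow> (real \<Rightarrow> 'm) \<Rightarrow> ennreal" where
  "curve_length A g \<gamma> = (\<integral>\<^sup>+t\<in>{0..1}. ennreal (curve_speed A g \<gamma> t) \<partial>lborel)"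

definition riemannian_dist ::
    "('m::topological_space, 'n::finite) chart set \<Rightarrow> ('m, 'n) metric_field \<Rightarrow> 'm \<Rightarrow> 'm \<Rightarrow> real" where
  "riemannian_dist A g x y =
     enn2real (INF \<gamma>\<in>{\<gamma>. piecewise_C1_curve A \<gamma> \<and> pathstart \<gamma> = x \<and> pathfinish \<gamma> = y}.
                 curve_length A g \<gamma>)"

text \<open>The measure of the Riemannian volume form. On a second countable manifold it exists and is
  determined by its values \<open>\<integral> sqrt (det g\<^sub>i\<^sub>j)\<close> on the Borel subsets of chart domains.\<close>

definition volume_density ::
    "('m, 'n::finite) metric_field \<Rightarrow> ('m, 'n) chart \<Rightarrow> 'm \<Rightarrow> real" where
  "volume_density g c x = sqrt (det (\<chi> i j. g c x (axis i 1) (axis j 1)))"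

definition riemannian_volume ::
    "('m::topological_space, 'n::finite) chart set \<Rightarrow> ('m, 'n) metric_field \<Rightarrow> 'm measure \<Rightarrow> bool"
  where
  "riemannian_volume A g v \<longleftrightarrow>
     sets v = sets borel \<and>
     (\<forall>c\<in>A. \<forall>B\<in>sets borel. B \<subseteq> fst c \<longrightarrow>
        emeasure v B = (\<integral>\<^sup>+y\<in>snd c ` B. ennreal (volume_density g c (chart_inv c y)) \<partial>lborel))"

text \<open>In charts \<open>p\<close> is smooth and \<open>g'\<close> is the pullback of \<open>g\<close> under \<open>p\<close>. For a covering \<open>p\<close> this
  says that the covering space carries the lifted smooth structure and the lifted metric.\<close>

definition local_isometry ::
    "('u::topological_space, 'n::finite) chart set \<Rightarrow> ('u, 'n) metric_field \<Rightarrow> ('u \<Rightarrow> 'm) \<Rightarrow>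
     ('m::topological_space, 'n) chart set \<Rightarrow> ('m, 'n) metric_field \<Rightarrow> bool" where
  "local_isometry A' g' p A g \<longleftrightarrow>
     (\<forall>c'\<in>A'. \<forall>c\<in>A.
        let U = fst c' \<inter> p -` fst c; F = snd c \<circ> p \<circ> chart_inv c'
        in smooth_on (snd c' ` U) F \<and>
           (\<forall>x\<in>U. \<forall>u w.
              let D = frechet_derivative F (at (snd c' x))
              in g' c' x u w = g c (p x) (D u) (D w)))"

definition riemannian_universal_cover ::
    "('u::{t2_space,second_countable_topology}, 'n::finite) chart set \<Rightarrow> ('u, 'n) metric_field \<Rightarrow>
     ('u \<Rightarrow> 'm) \<Rightarrow>
     ('m::{t2_space,second_countable_topology}, 'n) chart set \<Rightarrow> ('m, 'n) metric_field \<Rightarrow> bool" where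
  "riemannian_universal_cover A' g' p A g \<longleftrightarrow>
     riemannian_manifold A' g' \<and> simply_connected (UNIV :: 'u set) \<and>
     covering_space UNIV p UNIV \<and> local_isometry A' g' p A g"


section \<open>The fundamental group\<close>

definition loops_at :: "'a::topological_space \<Rightarrow> (real \<Rightarrow> 'a) set" where
  "loops_at a = {\<gamma>. path \<gamma> \<and> pathstart \<gamma> = a \<and> pathfinish \<gamma> = a}"

definition homotopy_class :: "(real \<Rightarrow> 'a::topological_space) \<Rightarrow> (real \<Rightarrow> 'a) set" where
  "homotopy_class \<gamma> = {\<delta>. homotopic_paths UNIV \<gamma> \<delta>}"

definition fundamental_group :: "'a::topological_space \<Rightarrow> (real \<Rightarrow> 'a) set monoid" where
  "fundamental_group a =
     \<lparr>carrier = homotopy_class ` loops_at a,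
      mult = (\<lambda>X Y. \<Union>\<gamma>\<in>X. \<Union>\<delta>\<in>Y. homotopy_class (\<gamma> +++ \<delta>)),
      one = homotopy_class (\<lambda>_. a)\<rparr>"


section \<open>Word metrics\<close>

definition finite_symmetric_generating_set :: "('g, 'b) monoid_scheme \<Rightarrow> 'g set \<Rightarrow> bool" where
  "finite_symmetric_generating_set G S \<longleftrightarrow>
     finite S \<and> S \<subseteq> carrier G \<and> (\<forall>s\<in>S. inv\<^bsub>G\<^esub> s \<in> S) \<and> generate G S = carrier G"

definition word_length :: "('g, 'b) monoid_scheme \<Rightarrow> 'g set \<Rightarrow> 'g \<Rightarrow> nat" where
  "word_length G S x =
     (LEAST n. \<exists>ws. length ws = n \<and> set ws \<subseteq> S \<and> foldr (mult G) ws \<one>\<^bsub>G\<^esub> = x)"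

definition word_dist :: "('g, 'b) monoid_scheme \<Rightarrow> 'g set \<Rightarrow> 'g \<Rightarrow> 'g \<Rightarrow> real" where
  "word_dist G S x y = real (word_length G S (inv\<^bsub>G\<^esub> x \<otimes>\<^bsub>G\<^esub> y))"


section \<open>Controlled uniformly finite homology\<close>

text \<open>An element \<open>(x\<^sub>0,\<dots>,x\<^sub>n)\<close> of \<open>\<Gamma>\<^sup>n\<^sup>+\<^sup>1\<close> is a list of length \<open>n + 1\<close>.\<close>

definition tuples :: "('g, 'b) monoid_scheme \<Rightarrow> nat \<Rightarrow> 'g list set" where
  "tuples G n = {xs. length xs = Suc n \<and> set xs \<subseteq> carrier G}"

definition tuple_dist :: "('g, 'b) monoid_scheme \<Rightarrow> 'g set \<Rightarrow> 'g list \<Rightarrow> 'g list \<Rightarrow> real" where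
  "tuple_dist G S xs ys = Max {word_dist G S (xs ! i) (ys ! i) | i. i < length xs}"

definition tuple_norm :: "('g, 'b) monoid_scheme \<Rightarrow> 'g set \<Rightarrow> 'g list \<Rightarrow> real" where
  "tuple_norm G S xs = Max ((\<lambda>x. word_dist G S x \<one>\<^bsub>G\<^esub>) ` set xs)"

definition diagonal_dist :: "('g, 'b) monoid_scheme \<Rightarrow> 'g set \<Rightarrow> 'g list \<Rightarrow> real" where
  "diagonal_dist G S xs = (INF x\<in>carrier G. tuple_dist G S xs (replicate (length xs) x))"

text \<open>Chains vanish by convention at lists that are not in \<open>\<Gamma>\<^sup>n\<^sup>+\<^sup>1\<close>, so that they can be identified
  with functions on \<open>\<Gamma>\<^sup>n\<^sup>+\<^sup>1\<close>.\<close>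

definition chains ::
    "('g, 'b) monoid_scheme \<Rightarrow> 'g set \<Rightarrow> (real \<Rightarrow> real) \<Rightarrow> nat \<Rightarrow> ('g list \<Rightarrow> real) set" where
  "chains G S f n =
     {c. (\<forall>xs. xs \<notin> tuples G n \<longrightarrow> c xs = 0) \<and>
         (\<forall>xs\<in>tuples G n. \<forall>\<pi>. \<pi> permutes {..<Suc n} \<longrightarrow>
            c (permute_list \<pi> xs) = of_int (sign \<pi>) * c xs) \<and>
         (\<exists>R. \<forall>xs\<in>tuples G n. diagonal_dist G S xs \<ge> R \<longrightarrow> c xs = 0) \<and>
         (\<exists>K. \<forall>xs\<in>tuples G n. \<bar>c xs\<bar> \<le> K * f (tuple_norm G S xs))}"

text \<open>The sum runs over the support of \<open>\<lambda>z. c (z # ys)\<close>, which is finite by finite propagation if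
  \<open>ys\<close> is not empty. The differential of a 0-chain is 0.\<close>

definition boundary :: "('g list \<Rightarrow> real) \<Rightarrow> 'g list \<Rightarrow> real" where
  "boundary c ys = (if ys = [] then 0 else \<Sum>z | c (z # ys) \<noteq> 0. c (z # ys))"

definition cycle_group ::
    "('g, 'b) monoid_scheme \<Rightarrow> 'g set \<Rightarrow> (real \<Rightarrow> real) \<Rightarrow> nat \<Rightarrow> ('g list \<Rightarrow> real) monoid" where
  "cycle_group G S f n =
     \<lparr>carrier = {c \<in> chains G S f n. boundary c = (\<lambda>_. 0)},
      mult = (\<lambda>c c' xs. c xs + c' xs),
      one = (\<lambda>_. 0)\<rparr>"

definition boundaries ::
    "('g, 'b) monoid_scheme \<Rightarrow> 'g set \<Rightarrow> (real \<Rightarrow> real) \<Rightarrow> nat \<Rightarrow> ('g list \<Rightarrow> real) set" where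
  "boundaries G S f n = boundary ` chains G S f (Suc n)"

definition homology ::
    "('g, 'b) monoid_scheme \<Rightarrow> 'g set \<Rightarrow> (real \<Rightarrow> real) \<Rightarrow> nat \<Rightarrow> ('g list \<Rightarrow> real) set monoid" where
  "homology G S f n = cycle_group G S f n Mod boundaries G S f n"

definition homology_class ::
    "('g, 'b) monoid_scheme \<Rightarrow> 'g set \<Rightarrow> (real \<Rightarrow> real) \<Rightarrow> nat \<Rightarrow> ('g list \<Rightarrow> real) \<Rightarrow>
     ('g list \<Rightarrow> real) set" where
  "homology_class G S f n c = boundaries G S f n #>\<^bsub>cycle_group G S f n\<^esub> c"

text \<open>The class of the formal sum of all \<open>[x]\<close> with \<open>x \<in> \<Gamma>\<close>.\<close>

definition fundamental_class ::
    "('g, 'b) monoid_scheme \<Rightarrow> 'g set \<Rightarrow> (real \<Rightarrow> real) \<Rightarrow> ('g list \<Rightarrow> real) set" where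
  "fundamental_class G S f = homology_class G S f 0 (indicator (tuples G 0))"

end

theory Submission
  imports Defs
begin

text \<open>The hypothesis is transplanted from the universal cover to \<open>\<Gamma>\<close>: a finitely supported function
  \<open>h\<close> on \<open>\<Gamma>\<close> extends to the cover by a \<open>\<Gamma>\<close>-invariant partition of unity subordinate to the sheets
  over finitely many coordinate balls of \<open>M\<close>. On a sheet the extension and its gradient are controlled
  by the oscillation of \<open>h\<close>, and there the weight is comparable to \<open>1 / f\<close> of the word length. This gives
  \<open>\<Sum> h(x)\<^sup>2 / f \<bar>x\<bar> \<le> C \<Sum> (h y - h x)\<^sup>2\<close>, the right-hand sum over the pairs at word distance at most \<open>R\<close>.

  For a finite set \<open>T\<close> the test function \<open>h = sqrt (f \<bar>x\<bar>)\<close> on \<open>T\<close> turns this into the isoperimetric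
  inequality \<open>card T \<le> K \<Sum> f \<bar>x\<bar>\<close>, the sum over the boundary edges of \<open>T\<close>; slow growth makes the
  interior differences of \<open>h\<close> absorbable. By a min-cut argument and compactness there is then a flow,
  bounded on edges by a multiple of \<open>f\<close>, with inflow \<open>1\<close> at every vertex. Such a flow is a 1-chain with
  boundary \<open>\<Sum> [x]\<close>.\<close>

section \<open>Flows in networks\<close>

text \<open>Invariance under \<open>\<Gamma>\<close> enters through the base: the work of deck
  transformations is done by lifts. A class corresponds to the end of its lift from
  \<open>b\<close>, and right multiplication by a class follows the lift of a loop in M. So every
  constant that must be the same at all of \<open>\<Gamma>\<close> is found by compactness in M, and
  the left-invariant metric |x^-1 y| is the one that fits. The weight is compared in the direction
  that bounds 1 / f from below: the distance to the base point is at most L (|X| + 1). The square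
  root is chosen because h^2 / f becomes 1, an edge leaving T costs f at its inner end, and between
  values at least 1 the root does not increase differences. Slow growth is silent near the identity:
  edges in a fixed ball cost a constant that does not depend on T. It is absorbed because the edge
  boundary of a nonempty T has weight at least 1 once \<open>\<Gamma>\<close> is infinite, and a
  finite \<open>\<Gamma>\<close> would contradict the inequality for the function 1.\<close>

definition inflow :: "('a \<Rightarrow> 'a set) \<Rightarrow> ('a \<times> 'a \<Rightarrow> real) \<Rightarrow> 'a \<Rightarrow> real" where
  "inflow N \<psi> x = (\<Sum>y\<in>N x. \<psi> (y, x))"

lemma continuous_on_coordinate: "continuous_on S (\<lambda>\<psi> :: 'i \<Rightarrow> real. \<psi> e)"
  by (rule continuous_on_product_then_coordinatewise) (rule continuous_on_id)

lemma continuous_on_inflow: "continuous_on S (\<lambda>\<psi>. inflow N \<psi> x)"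
  unfolding inflow_def by (intro continuous_intros continuous_on_coordinate)

text \<open>Tychonoff: a product of compact intervals over an index set that may be infinite, in the
  topology of pointwise convergence.\<close>

lemma compact_box: "compact {\<psi> :: 'i \<Rightarrow> real. \<forall>e. \<bar>\<psi> e\<bar> \<le> c e}"
proof -
  have "{\<psi> :: 'i \<Rightarrow> real. \<forall>e. \<bar>\<psi> e\<bar> \<le> c e} = PiE UNIV (\<lambda>e. {- c e..c e})"
    by (simp add: PiE_def Pi_def abs_le_iff minus_le_iff conj_commute)
  moreover have "compactin (product_topology (\<lambda>_. euclidean) UNIV) (PiE UNIV (\<lambda>e. {- c e..c e}))"
    by (simp add: compactin_PiE)
  ultimately show ?thesis
    by (simp add: euclidean_product_topology)
qed

text \<open>\<open>iso\<close> is the cut condition for unit demand at every vertex: the edges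
  leaving \<open>T\<close> can carry \<open>card T\<close>. By \<open>sum_inflow\<close> a flow with
  inflow 1 on \<open>X\<close> forces it; \<open>unit_flow\<close> is the converse, a max-flow
  min-cut theorem on a locally finite graph.\<close>

locale capacity_network =
  fixes X :: "'a set" and N :: "'a \<Rightarrow> 'a set" and c :: "'a \<times> 'a \<Rightarrow> real"
  assumes fin: "finite (N x)"
    and c_nonneg: "c e \<ge> 0"
    and c_sym: "c (x, y) = c (y, x)"
    and c_supp: "c (x, y) \<noteq> 0 \<Longrightarrow> y \<in> N x"
    and iso: "finite T \<Longrightarrow> T \<subseteq> X \<Longrightarrow> real (card T) \<le> (\<Sum>x\<in>T. \<Sum>y\<in>N x - T. c (x, y))"
begin

definition flows :: "('a \<times> 'a \<Rightarrow> real) set" where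
  "flows = {\<psi>. (\<forall>e. \<bar>\<psi> e\<bar> \<le> c e) \<and> (\<forall>x y. \<psi> (x, y) = - \<psi> (y, x))}"

lemma flows_supp: "\<psi> \<in> flows \<Longrightarrow> y \<notin> N x \<Longrightarrow> \<psi> (y, x) = 0"
  unfolding flows_def using c_supp[of x y] c_sym[of x y] by (metis (mono_tags, lifting) abs_le_zero_iff mem_Collect_eq)

lemma compact_flows: "compact flows"
proof -
  have "closed {\<psi> :: 'a \<times> 'a \<Rightarrow> real. \<psi> (x, y) = - \<psi> (y, x)}" for x y
    by (rule closed_Collect_eq; intro continuous_intros continuous_on_coordinate)
  then have "closed (\<Inter>x y. {\<psi> :: 'a \<times> 'a \<Rightarrow> real. \<psi> (x, y) = - \<psi> (y, x)})"
    by blast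
  moreover have "flows = {\<psi>. \<forall>e. \<bar>\<psi> e\<bar> \<le> c e} \<inter> (\<Inter>x y. {\<psi>. \<psi> (x, y) = - \<psi> (y, x)})"
    by (auto simp: flows_def)
  ultimately show ?thesis
    by (simp add: compact_Int_closed compact_box del: split_paired_All)
qed

text \<open>Antisymmetry cancels the flow along edges with both ends in \<open>T\<close>; what
  remains crosses the boundary of \<open>T\<close>.\<close>

lemma sum_inflow:
  assumes "\<psi> \<in> flows" "finite T"
  shows "(\<Sum>x\<in>T. inflow N \<psi> x) = (\<Sum>x\<in>T. \<Sum>y\<in>N x - T. \<psi> (y, x))"
proof -
  have anti: "\<psi> (x, y) = - \<psi> (y, x)" for x y
    using assms(1) unfolding flows_def by blast
  have *: "inflow N \<psi> x = (\<Sum>y\<in>N x - T. \<psi> (y, x)) + (\<Sum>y\<in>T. \<psi> (y, x))" for x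
  proof -
    have "inflow N \<psi> x = (\<Sum>y\<in>N x - T. \<psi> (y, x)) + (\<Sum>y\<in>N x \<inter> T. \<psi> (y, x))"
      unfolding inflow_def using fin[of x]
      by (metis sum.Int_Diff add.commute)
    moreover have "(\<Sum>y\<in>N x \<inter> T. \<psi> (y, x)) = (\<Sum>y\<in>T. \<psi> (y, x))"
      by (rule sum.mono_neutral_left) (use assms flows_supp in auto)
    ultimately show ?thesis by simp
  qed
  have "(\<Sum>x\<in>T. \<Sum>y\<in>T. \<psi> (y, x)) = (\<Sum>x\<in>T. \<Sum>y\<in>T. - \<psi> (y, x))"
    by (subst sum.swap) (intro sum.cong refl anti)
  then have "(\<Sum>x\<in>T. \<Sum>y\<in>T. \<psi> (y, x)) = 0"
    by (simp add: sum_negf)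
  then show ?thesis
    using * by (simp add: sum.distrib)
qed

text \<open>A flow minimising the squared deficiency saturates the edges from small to large deficiency
  \<open>r\<close>, hence all edges into \<open>{r > 0}\<close> and out of \<open>{r < 0}\<close>; the capacity condition excludes both sets
  unless they are empty.\<close>

lemma flow_on_finite:
  assumes F: "finite F" "F \<subseteq> X"
  shows "\<exists>\<psi>\<in>flows. \<forall>x\<in>F. inflow N \<psi> x = 1"
proof -
  define \<Phi> where "\<Phi> \<psi> = (\<Sum>x\<in>F. (1 - inflow N \<psi> x)\<^sup>2)" for \<psi>
  have "continuous_on flows \<Phi>"
    unfolding \<Phi>_def by (intro continuous_intros continuous_on_inflow)
  moreover have "(\<lambda>_. 0) \<in> flows"
    by (simp add: flows_def c_nonneg)
  ultimately obtain \<psi> where \<psi>: "\<psi> \<in> flows" and min: "\<And>\<phi>. \<phi> \<in> flows \<Longrightarrow> \<Phi> \<psi> \<le> \<Phi> \<phi>"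
    using continuous_attains_inf[OF compact_flows] by blast
  \<comment> \<open>Vertices outside \<open>F\<close> get deficiency 0: they lie between the two
    sets excluded below, and flow may be pushed into or out of them at no cost.\<close>
  define r where "r x = (if x \<in> F then 1 - inflow N \<psi> x else 0)" for x
  have bound: "\<bar>\<psi> e\<bar> \<le> c e" and anti: "\<psi> (x, y) = - \<psi> (y, x)" for e x y
    using \<psi> unfolding flows_def by blast+
  have saturated: "\<psi> (y, x) = c (y, x)" if "r x > r y" for x y
  proof (rule ccontr)
    assume "\<psi> (y, x) \<noteq> c (y, x)"
    then have less: "\<psi> (y, x) < c (y, x)"
      using bound[of "(y, x)"] by linarith
    have "x \<noteq> y"
      using that by auto
    \<comment> \<open>The first entry keeps the new flow within capacity. Half of the difference
      makes the change 2 \<epsilon> (\<epsilon> - (r x - r y)) computed below negative.\<close>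
    define \<epsilon> where "\<epsilon> = min (c (y, x) - \<psi> (y, x)) ((r x - r y) / 2)"
    have \<epsilon>: "\<epsilon> > 0" "\<epsilon> \<le> c (y, x) - \<psi> (y, x)" "\<epsilon> < r x - r y"
      using less that by (simp_all add: \<epsilon>_def min_less_iff_disj)
    define \<phi> where "\<phi> = \<psi>((y, x) := \<psi> (y, x) + \<epsilon>, (x, y) := \<psi> (x, y) - \<epsilon>)"
    have "\<phi> \<in> flows"
    proof -
      have "\<bar>\<phi> e\<bar> \<le> c e" for e
      proof -
        consider "e = (y, x)" | "e = (x, y)" | "e \<noteq> (y, x)" "e \<noteq> (x, y)" by blast
        then show ?thesis
        proof cases
          case 1
          then have "\<phi> e = \<psi> (y, x) + \<epsilon>"
            using \<open>x \<noteq> y\<close> by (simp add: \<phi>_def)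
          then show ?thesis
            using 1 \<epsilon>(1,2) bound[of "(y, x)"] by (simp add: abs_le_iff)
        next
          case 2
          then have "\<phi> e = - (\<psi> (y, x) + \<epsilon>)"
            using anti[of x y] by (simp add: \<phi>_def)
          then show ?thesis
            using 2 \<epsilon>(1,2) bound[of "(y, x)"] c_sym[of x y] by (simp add: abs_le_iff)
        next
          case 3
          then show ?thesis
            using bound[of e] by (simp add: \<phi>_def)
        qed
      qed
      moreover have "\<phi> (z, w) = - \<phi> (w, z)" for z w
        using anti[of z w] anti[of x y] \<open>x \<noteq> y\<close> unfolding \<phi>_def fun_upd_apply prod.inject
        by (smt (verit))
      ultimately show ?thesis
        unfolding flows_def by blast
    qed
    have "c (y, x) \<noteq> 0"
      using less bound[of "(y, x)"] by linarith
    then have N: "y \<in> N x" "x \<in> N y"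
      using c_supp c_sym by metis+
    define d where "d z = (if z = x then \<epsilon> else if z = y then - \<epsilon> else 0)" for z
    have infl: "inflow N \<phi> z = inflow N \<psi> z + d z" for z
    proof -
      have "inflow N \<phi> z = (\<Sum>w\<in>N z. \<psi> (w, z) + (if w = y \<and> z = x then \<epsilon> else 0) +
              (if w = x \<and> z = y then - \<epsilon> else 0))"
        unfolding inflow_def by (rule sum.cong) (use \<open>x \<noteq> y\<close> in \<open>auto simp: \<phi>_def\<close>)
      also have "\<dots> = inflow N \<psi> z + d z"
        using N fin \<open>x \<noteq> y\<close> by (auto simp: sum.distrib inflow_def d_def sum.delta)
      finally show ?thesis .
    qed
    have "\<Phi> \<phi> = (\<Sum>z\<in>F. (r z)\<^sup>2 + ((d z)\<^sup>2 - 2 * d z * r z))"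
      unfolding \<Phi>_def by (rule sum.cong) (auto simp: r_def infl power2_eq_square algebra_simps)
    also have "\<dots> = \<Phi> \<psi> + (\<Sum>z\<in>F. (d z)\<^sup>2 - 2 * d z * r z)"
      by (simp add: sum.distrib \<Phi>_def r_def)
    also have "(\<Sum>z\<in>F. (d z)\<^sup>2 - 2 * d z * r z) = (\<Sum>z\<in>F \<inter> {x, y}. (d z)\<^sup>2 - 2 * d z * r z)"
      by (rule sum.mono_neutral_right) (use F in \<open>auto simp: d_def\<close>)
    \<comment> \<open>A vertex outside \<open>F\<close> has r = 0 and would contribute (d z)^2, so
      adding it does not decrease the sum.\<close>
    also have "\<dots> \<le> (\<Sum>z\<in>{x, y}. (d z)\<^sup>2 - 2 * d z * r z)"
      by (rule sum_mono2) (auto simp: r_def)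
    also have "\<dots> = 2 * \<epsilon> * (\<epsilon> - (r x - r y))"
      using \<open>x \<noteq> y\<close> by (simp add: d_def power2_eq_square algebra_simps)
    also have "\<dots> < 0"
      using \<epsilon> by (simp add: mult_less_0_iff)
    finally show False
      using min[OF \<open>\<phi> \<in> flows\<close>] by simp
  qed
  have "{x\<in>F. r x > 0} = {}"
  proof (rule ccontr)
    define T where "T = {x\<in>F. r x > 0}"
    assume "{x\<in>F. r x > 0} \<noteq> {}"
    then have T: "T \<noteq> {}" "finite T" "T \<subseteq> X"
      using F by (auto simp: T_def)
    have "real (card T) \<le> (\<Sum>x\<in>T. \<Sum>y\<in>N x - T. c (x, y))"
      using iso T by blast
    also have "\<dots> = (\<Sum>x\<in>T. \<Sum>y\<in>N x - T. \<psi> (y, x))"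
    proof (intro sum.cong refl)
      fix x y assume "x \<in> T" "y \<in> N x - T"
      then have "r x > r y"
        by (auto simp: T_def r_def split: if_splits)
      then show "c (x, y) = \<psi> (y, x)"
        using saturated c_sym by metis
    qed
    also have "\<dots> = (\<Sum>x\<in>T. inflow N \<psi> x)"
      using sum_inflow[OF \<psi>] T by simp
    also have "\<dots> < (\<Sum>x\<in>T. 1)"
      by (rule sum_strict_mono) (use T in \<open>auto simp: T_def r_def split: if_splits\<close>)
    finally show False by simp
  qed
  moreover have "{x\<in>F. r x < 0} = {}"
  proof (rule ccontr)
    define T where "T = {x\<in>F. r x < 0}"
    assume "{x\<in>F. r x < 0} \<noteq> {}"
    then have T: "T \<noteq> {}" "finite T" "T \<subseteq> X"
      using F by (auto simp: T_def)
    \<comment> \<open>Negative deficiency means inflow above 1, whereas saturation leaves no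
      boundary edge of \<open>T\<close> with flow directed inwards: the signs collide.\<close>
    have "0 < (\<Sum>x\<in>T. inflow N \<psi> x)"
      by (rule sum_pos) (use T in \<open>auto simp: T_def r_def split: if_splits\<close>)
    also have "\<dots> = (\<Sum>x\<in>T. \<Sum>y\<in>N x - T. \<psi> (y, x))"
      using sum_inflow[OF \<psi>] T by simp
    also have "\<dots> \<le> 0"
    proof (intro sum_nonpos)
      fix x y assume "x \<in> T" "y \<in> N x - T"
      then have "r x < r y"
        by (auto simp: T_def r_def split: if_splits)
      then show "\<psi> (y, x) \<le> 0"
        using saturated[of x y] anti[of y x] c_nonneg by simp
    qed
    finally show False by simp
  qed
  ultimately have "r x = 0" if "x \<in> F" for x
    using that by (smt (verit) empty_Collect_eq)
  then show ?thesis
    using \<psi> by (auto simp: r_def intro!: bexI[of _ \<psi>])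
qed

text \<open>Each condition involves finitely many coordinates, hence is closed in the product
  topology, and finitely many of them hold together by \<open>flow_on_finite\<close>. The finite
  intersection property of the compact set \<open>flows\<close> gives all of them at once.\<close>

theorem unit_flow: "\<exists>\<psi>\<in>flows. \<forall>x\<in>X. inflow N \<psi> x = 1"
proof -
  let ?D = "\<lambda>x. {\<psi>. inflow N \<psi> x = 1}"
  have "flows \<inter> \<Inter>(?D ` X) \<noteq> {}"
  proof (rule compact_imp_fip[OF compact_flows])
    fix D assume "D \<in> ?D ` X"
    then show "closed D"
      by (auto intro!: closed_Collect_eq continuous_on_inflow continuous_intros)
  next
    fix \<D> assume "finite \<D>" "\<D> \<subseteq> ?D ` X"
    then obtain F where "F \<subseteq> X" "finite F" "\<D> = ?D ` F"
      by (meson finite_subset_image)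
    then show "flows \<inter> \<Inter>\<D> \<noteq> {}"
      using flow_on_finite[of F] by auto
  qed
  then show ?thesis by auto
qed

end

section \<open>Word metrics and degree zero homology\<close>

locale word_metric = group G for G :: "('g, 'b) monoid_scheme" (structure) +
  fixes S :: "'g set"
  assumes gen_set: "finite_symmetric_generating_set G S"
begin

abbreviation word_prod :: "'g list \<Rightarrow> 'g" where
  "word_prod ws \<equiv> foldr (mult G) ws \<one>"

abbreviation wlen :: "'g \<Rightarrow> nat" where
  "wlen \<equiv> word_length G S"

lemma S_carrier: "S \<subseteq> carrier G" and finite_S: "finite S"
  and inv_S: "s \<in> S \<Longrightarrow> inv s \<in> S" and generate_S: "generate G S = carrier G"
  using gen_set unfolding finite_symmetric_generating_set_def by auto

lemma word_prod_closed: "set ws \<subseteq> carrier G \<Longrightarrow> word_prod ws \<in> carrier G"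
  by (induction ws) auto

lemma word_prod_append:
  "set ws \<subseteq> carrier G \<Longrightarrow> set vs \<subseteq> carrier G \<Longrightarrow> word_prod (ws @ vs) = word_prod ws \<otimes> word_prod vs"
  by (induction ws) (auto simp: m_assoc word_prod_closed)

lemma word_exists:
  assumes "x \<in> carrier G"
  shows "\<exists>ws. set ws \<subseteq> S \<and> word_prod ws = x"
proof -
  have "x \<in> generate G S"
    using assms generate_S by simp
  then show ?thesis
  proof induction
    case one
    then show ?case by (intro exI[of _ "[]"]) simp
  next
    case (incl h)
    then show ?case using S_carrier by (intro exI[of _ "[h]"]) auto
  next
    case (inv h)
    then show ?case using S_carrier inv_S by (intro exI[of _ "[inv h]"]) auto
  next
    case (eng h1 h2)
    then obtain ws vs where "set ws \<subseteq> S" "word_prod ws = h1" "set vs \<subseteq> S" "word_prod vs = h2"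
      by blast
    then show ?case using S_carrier by (intro exI[of _ "ws @ vs"]) (auto simp: word_prod_append simp del: foldr_append)
  qed
qed

lemma obtain_word:
  assumes "x \<in> carrier G"
  obtains ws where "set ws \<subseteq> S" "word_prod ws = x" "length ws = wlen x"
proof -
  have "\<exists>n ws. length ws = n \<and> set ws \<subseteq> S \<and> word_prod ws = x"
    using word_exists[OF assms] by blast
  from LeastI_ex[OF this] show ?thesis
    using that unfolding word_length_def by blast
qed

lemma wlen_le: "set ws \<subseteq> S \<Longrightarrow> wlen (word_prod ws) \<le> length ws"
  unfolding word_length_def by (rule Least_le) blast

lemma wlen_one [simp]: "wlen \<one> = 0"
  using wlen_le[of "[]"] by simp

lemma wlen_mult:
  assumes "x \<in> carrier G" "y \<in> carrier G"
  shows "wlen (x \<otimes> y) \<le> wlen x + wlen y"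
proof -
  obtain ws where ws: "set ws \<subseteq> S" "word_prod ws = x" "length ws = wlen x"
    using obtain_word[OF assms(1)] .
  obtain vs where vs: "set vs \<subseteq> S" "word_prod vs = y" "length vs = wlen y"
    using obtain_word[OF assms(2)] .
  from ws vs have "set (ws @ vs) \<subseteq> S" "word_prod (ws @ vs) = x \<otimes> y" "length (ws @ vs) = wlen x + wlen y"
    using S_carrier word_prod_append[of ws vs] by auto
  then show ?thesis
    using wlen_le[of "ws @ vs"] by simp
qed

lemma wlen_inv_le:
  assumes "x \<in> carrier G"
  shows "wlen (inv x) \<le> wlen x"
proof -
  have "set ws \<subseteq> S \<Longrightarrow> \<exists>vs. set vs \<subseteq> S \<and> length vs = length ws \<and> word_prod vs = inv (word_prod ws)" for ws
  proof (induction ws)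
    case Nil
    then show ?case by auto
  next
    case (Cons a ws)
    then obtain vs where "set vs \<subseteq> S" "length vs = length ws" "word_prod vs = inv (word_prod ws)"
      by auto
    moreover have "a \<in> S" "a \<in> carrier G" "set ws \<subseteq> carrier G" "set vs \<subseteq> carrier G"
      using Cons.prems S_carrier calculation by auto
    ultimately show ?case
      using inv_S word_prod_append[of vs "[inv a]"] word_prod_closed[of ws]
      by (intro exI[of _ "vs @ [inv a]"]) (simp add: inv_mult_group del: foldr_append)
  qed
  then show ?thesis
    using obtain_word[OF assms] wlen_le by metis
qed

lemma wlen_inv [simp]: "x \<in> carrier G \<Longrightarrow> wlen (inv x) = wlen x"
  using wlen_inv_le[of x] wlen_inv_le[of "inv x"] by simp

lemma finite_ball: "finite {x \<in> carrier G. wlen x \<le> n}"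
proof (rule finite_subset)
  show "{x \<in> carrier G. wlen x \<le> n} \<subseteq> word_prod ` {ws. set ws \<subseteq> S \<and> length ws \<le> n}"
  proof
    fix x assume x: "x \<in> {x \<in> carrier G. wlen x \<le> n}"
    then obtain ws where "set ws \<subseteq> S" "word_prod ws = x" "length ws = wlen x"
      using obtain_word by blast
    then show "x \<in> word_prod ` {ws. set ws \<subseteq> S \<and> length ws \<le> n}"
      using x by force
  qed
qed (use finite_lists_length_le finite_S in blast)

lemma word_dist_one: "x \<in> carrier G \<Longrightarrow> word_dist G S x \<one> = wlen x"
  by (simp add: word_dist_def)

lemma word_dist_self: "x \<in> carrier G \<Longrightarrow> word_dist G S x x = 0"
  by (simp add: word_dist_def)

lemma word_dist_nonneg: "word_dist G S x y \<ge> 0"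
  by (simp add: word_dist_def)

lemma inv_mult_inv: "x \<in> carrier G \<Longrightarrow> y \<in> carrier G \<Longrightarrow> inv (inv x \<otimes> y) = inv y \<otimes> x"
  by (simp add: inv_mult_group)

lemma word_dist_sym: "x \<in> carrier G \<Longrightarrow> y \<in> carrier G \<Longrightarrow> word_dist G S x y = word_dist G S y x"
  unfolding word_dist_def by (metis inv_closed inv_mult_inv m_closed wlen_inv)

lemma word_dist_triangle:
  assumes "x \<in> carrier G" "y \<in> carrier G" "z \<in> carrier G"
  shows "word_dist G S x z \<le> word_dist G S x y + word_dist G S y z"
proof -
  have "y \<otimes> (inv y \<otimes> z) = z"
    using assms by (simp add: m_assoc[symmetric])
  then have "inv x \<otimes> z = (inv x \<otimes> y) \<otimes> (inv y \<otimes> z)"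
    using assms by (simp add: m_assoc)
  then show ?thesis
    unfolding word_dist_def using wlen_mult[of "inv x \<otimes> y" "inv y \<otimes> z"] assms by simp
qed

section \<open>Balls in the word metric\<close>

definition nbhd :: "nat \<Rightarrow> 'g \<Rightarrow> 'g set" where
  "nbhd R x = {y \<in> carrier G. word_dist G S x y \<le> R}"

lemma finite_nbhd:
  assumes "x \<in> carrier G"
  shows "finite (nbhd R x)"
proof (rule finite_subset)
  show "nbhd R x \<subseteq> (\<lambda>s. x \<otimes> s) ` {s \<in> carrier G. wlen s \<le> R}"
  proof
    fix y assume "y \<in> nbhd R x"
    then have "y = x \<otimes> (inv x \<otimes> y)" "inv x \<otimes> y \<in> {s \<in> carrier G. wlen s \<le> R}"
      using assms by (auto simp: nbhd_def word_dist_def m_assoc[symmetric])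
    then show "y \<in> (\<lambda>s. x \<otimes> s) ` {s \<in> carrier G. wlen s \<le> R}" by blast
  qed
qed (use finite_ball in blast)

lemma nbhd_sym: "x \<in> carrier G \<Longrightarrow> y \<in> carrier G \<Longrightarrow> y \<in> nbhd R x \<longleftrightarrow> x \<in> nbhd R y"
  by (simp add: nbhd_def word_dist_sym)

section \<open>Chains and boundaries in degrees 0 and 1\<close>

lemma tuple_dist_pair:
  "tuple_dist G S [x, y] [u, w] = max (word_dist G S x u) (word_dist G S y w)"
proof -
  have "{word_dist G S ([x, y] ! i) ([u, w] ! i) | i. i < length [x, y]} = {word_dist G S x u, word_dist G S y w}"
    by (auto simp: less_Suc_eq) (metis nth_Cons_0 zero_less_Suc, metis One_nat_def lessI nth_Cons_0 nth_Cons_Suc)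
  then show ?thesis
    by (simp add: tuple_dist_def)
qed

lemma tuple_norm_pair:
  "x \<in> carrier G \<Longrightarrow> y \<in> carrier G \<Longrightarrow> tuple_norm G S [x, y] = max (wlen x) (wlen y)"
  by (simp add: tuple_norm_def word_dist_one)

text \<open>Together with \<open>dist_le_diagonal_dist\<close>: for an edge the distance to the
  diagonal lies between half of the length and the length, so finite propagation of a 1-chain means
  bounded edge length.\<close>

lemma diagonal_dist_pair_le:
  assumes "x \<in> carrier G" "y \<in> carrier G"
  shows "diagonal_dist G S [x, y] \<le> word_dist G S x y"
proof -
  have "diagonal_dist G S [x, y] \<le> tuple_dist G S [x, y] (replicate (length [x, y]) x)"
    unfolding diagonal_dist_def
  proof (rule cINF_lower)
    show "bdd_below ((\<lambda>z. tuple_dist G S [x, y] (replicate (length [x, y]) z)) ` carrier G)"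
      by (rule bdd_belowI[of _ 0]) (auto simp: tuple_dist_pair numeral_2_eq_2 word_dist_nonneg le_max_iff_disj)
  qed fact
  also have "\<dots> = word_dist G S x y"
    using assms by (simp add: tuple_dist_pair numeral_2_eq_2 word_dist_self word_dist_nonneg word_dist_sym)
  finally show ?thesis .
qed

lemma dist_le_diagonal_dist:
  assumes "x \<in> carrier G" "y \<in> carrier G" "diagonal_dist G S [x, y] < R"
  shows "word_dist G S x y < 2 * R"
proof -
  have "\<exists>z\<in>carrier G. tuple_dist G S [x, y] (replicate (length [x, y]) z) < R"
  proof (rule ccontr)
    assume "\<not> ?thesis"
    then have "R \<le> diagonal_dist G S [x, y]"
      unfolding diagonal_dist_def by (intro cINF_greatest) auto
    then show False using assms by simp
  qed
  then obtain z where z: "z \<in> carrier G" "word_dist G S x z < R" "word_dist G S y z < R"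
    by (auto simp: tuple_dist_pair numeral_2_eq_2)
  then show ?thesis
    using word_dist_triangle[of x z y] word_dist_sym[of z y] assms by simp
qed

lemma tuples_0: "tuples G 0 = {[x] | x. x \<in> carrier G}"
  by (auto simp: tuples_def length_Suc_conv)

lemma tuples_1: "tuples G (Suc 0) = {[x, y] | x y. x \<in> carrier G \<and> y \<in> carrier G}"
  by (auto simp: tuples_def length_Suc_conv)

text \<open>Reduces the alternating condition on 1-chains to antisymmetry under one
  transposition.\<close>

lemma permutes_lessThan_2:
  assumes "\<pi> permutes {..<Suc (Suc 0)}"
  shows "\<pi> = id \<or> \<pi> = Transposition.transpose 0 (Suc 0)"
proof -
  have "{..<Suc (Suc 0)} = {0, Suc 0}"
    by auto
  then have "\<pi> permutes {0, Suc 0}"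
    using assms by simp
  then show ?thesis
    using permutes_doubleton_iff[of \<pi> 0 "Suc 0"] by simp
qed

text \<open>\<open>boundary\<close> sums over a support, and the sum over an infinite set is 0 by
  convention. Finite propagation in a group with finite balls excludes this, which makes
  \<open>boundary\<close> additive.\<close>

lemma finite_chain_support:
  assumes "c \<in> chains G S f (Suc 0)"
  shows "finite {z. c (z # ys) \<noteq> 0}"
proof -
  obtain R where R: "\<And>xs. xs \<in> tuples G (Suc 0) \<Longrightarrow> diagonal_dist G S xs \<ge> R \<Longrightarrow> c xs = 0"
    using assms unfolding chains_def by blast
  have zero: "\<And>xs. xs \<notin> tuples G (Suc 0) \<Longrightarrow> c xs = 0"
    using assms unfolding chains_def by blast
  show ?thesis
  proof (cases "\<exists>y\<in>carrier G. ys = [y]")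
    case True
    then obtain y where y: "y \<in> carrier G" "ys = [y]" by blast
    have "{z. c (z # ys) \<noteq> 0} \<subseteq> nbhd (nat \<lceil>2 * R\<rceil>) y"
    proof
      fix z assume "z \<in> {z. c (z # ys) \<noteq> 0}"
      then have "[z, y] \<in> tuples G (Suc 0)" "c [z, y] \<noteq> 0"
        using zero y by auto
      then have "z \<in> carrier G" "diagonal_dist G S [z, y] < R"
        using R[of "[z, y]"] by (auto simp: tuples_1 not_le[symmetric])
      then show "z \<in> nbhd (nat \<lceil>2 * R\<rceil>) y"
        using dist_le_diagonal_dist[of z y R] y word_dist_sym[of z y] unfolding nbhd_def by simp linarith
    qed
    then show ?thesis
      using finite_nbhd y finite_subset by blast
  next
    case False
    then have "c (z # ys) = 0" for z
      by (intro zero) (auto simp: tuples_1)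
    then show ?thesis by simp
  qed
qed

lemma boundary_add:
  assumes "c \<in> chains G S f (Suc 0)" "d \<in> chains G S f (Suc 0)"
  shows "boundary (\<lambda>xs. c xs + k * d xs) ys = boundary c ys + k * boundary d ys"
proof (cases "ys = []")
  case False
  let ?A = "{z. c (z # ys) \<noteq> 0} \<union> {z. d (z # ys) \<noteq> 0}"
  have fin: "finite ?A"
    using assms finite_chain_support by blast
  have "boundary e ys = (\<Sum>z\<in>?A. e (z # ys))" if "{z. e (z # ys) \<noteq> 0} \<subseteq> ?A" for e
    unfolding boundary_def using False that fin by (auto intro: sum.mono_neutral_left)
  note * = this
  have "boundary (\<lambda>xs. c xs + k * d xs) ys = (\<Sum>z\<in>?A. c (z # ys) + k * d (z # ys))"
    by (rule *) auto
  also have "\<dots> = boundary c ys + k * boundary d ys"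
    by (subst (1 2) *) (auto simp: sum.distrib sum_distrib_left)
  finally show ?thesis .
qed (simp add: boundary_def)

lemma chains_add:
  assumes "c \<in> chains G S f n" "d \<in> chains G S f n" "\<And>t. t \<ge> 0 \<Longrightarrow> f t \<ge> 0"
  shows "(\<lambda>xs. c xs + k * d xs) \<in> chains G S f n"
proof -
  obtain R K where R: "\<And>xs. xs \<in> tuples G n \<Longrightarrow> diagonal_dist G S xs \<ge> R \<Longrightarrow> c xs = 0"
    and K: "\<And>xs. xs \<in> tuples G n \<Longrightarrow> \<bar>c xs\<bar> \<le> K * f (tuple_norm G S xs)"
    using assms(1) unfolding chains_def by blast
  obtain R' K' where R': "\<And>xs. xs \<in> tuples G n \<Longrightarrow> diagonal_dist G S xs \<ge> R' \<Longrightarrow> d xs = 0"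
    and K': "\<And>xs. xs \<in> tuples G n \<Longrightarrow> \<bar>d xs\<bar> \<le> K' * f (tuple_norm G S xs)"
    using assms(2) unfolding chains_def by blast
  have "\<bar>c xs + k * d xs\<bar> \<le> (K + \<bar>k\<bar> * K') * f (tuple_norm G S xs)" if "xs \<in> tuples G n" for xs
  proof -
    have "\<bar>c xs + k * d xs\<bar> \<le> \<bar>c xs\<bar> + \<bar>k\<bar> * \<bar>d xs\<bar>"
      by (metis abs_mult abs_triangle_ineq)
    also have "\<dots> \<le> K * f (tuple_norm G S xs) + \<bar>k\<bar> * (K' * f (tuple_norm G S xs))"
      using K[OF that] K'[OF that] by (intro add_mono mult_left_mono) auto
    finally show ?thesis by (simp add: algebra_simps)
  qed
  moreover have "c xs + k * d xs = 0" if "xs \<in> tuples G n" "diagonal_dist G S xs \<ge> max R R'" for xs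
    using R[OF that(1)] R'[OF that(1)] that(2) by simp
  moreover have "\<forall>xs. xs \<notin> tuples G n \<longrightarrow> c xs + k * d xs = 0"
    using assms(1,2) unfolding chains_def by simp
  moreover have "\<forall>xs\<in>tuples G n. \<forall>\<pi>. \<pi> permutes {..<Suc n} \<longrightarrow>
      c (permute_list \<pi> xs) + k * d (permute_list \<pi> xs) = of_int (sign \<pi>) * (c xs + k * d xs)"
    using assms(1,2) unfolding chains_def by (simp add: algebra_simps)
  ultimately show ?thesis
    unfolding chains_def by blast
qed

text \<open>A flow of finite range is a 1-chain: antisymmetry is alternation, the range gives finite
  propagation, and inflow 1 says that its boundary is the fundamental cycle. The coset of a boundary
  is the subgroup itself, the unit of the quotient.\<close>

lemma fundamental_class_trivial:
  fixes f :: "real \<Rightarrow> real" and \<psi> :: "'g \<times> 'g \<Rightarrow> real"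
  assumes f: "\<And>t. t \<ge> 0 \<Longrightarrow> f t \<ge> 0"
    and anti: "\<And>x y. \<psi> (x, y) = - \<psi> (y, x)"
    and supp: "\<And>x y. \<psi> (x, y) \<noteq> 0 \<Longrightarrow> x \<in> carrier G \<and> y \<in> nbhd R x"
    and growth: "\<And>x y. \<psi> (x, y) \<noteq> 0 \<Longrightarrow> \<bar>\<psi> (x, y)\<bar> \<le> K * f (max (wlen x) (wlen y))"
    and flow: "\<And>x. x \<in> carrier G \<Longrightarrow> (\<Sum>y\<in>nbhd R x. \<psi> (y, x)) = 1"
    and K: "K \<ge> 0"
  shows "fundamental_class G S f = \<one>\<^bsub>homology G S f 0\<^esub>"
proof -
  define c where "c xs = (if length xs = Suc (Suc 0) then \<psi> (xs ! 0, xs ! Suc 0) else 0)" for xs :: "'g list"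
  have c_pair: "c [x, y] = \<psi> (x, y)" for x y
    by (simp add: c_def)
  have c_supp: "xs \<in> tuples G (Suc 0)" if "c xs \<noteq> 0" for xs
  proof -
    have "length xs = Suc (Suc 0)"
      using that unfolding c_def by meson
    then obtain x y where xs: "xs = [x, y]"
      by (auto simp: length_Suc_conv)
    then have "\<psi> (x, y) \<noteq> 0"
      using that c_pair by metis
    with xs show ?thesis
      using supp[of x y] by (auto simp: tuples_1 nbhd_def)
  qed
  have c: "c \<in> chains G S f (Suc 0)"
  proof -
    have "c (permute_list \<pi> xs) = of_int (sign \<pi>) * c xs"
      if xs_in: "xs \<in> tuples G (Suc 0)" and \<pi>: "\<pi> permutes {..<Suc (Suc 0)}" for xs \<pi>
    proof -
      obtain x y where xs: "xs = [x, y]"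
        using xs_in by (auto simp: tuples_1)
      show ?thesis
        using permutes_lessThan_2[OF \<pi>]
      proof
        assume "\<pi> = Transposition.transpose 0 (Suc 0)"
        then show ?thesis
          using anti[of y x] by (simp only: xs) (simp add: permute_list_def c_pair sign_swap_id)
      qed (simp add: sign_id)
    qed
    \<comment> \<open>\<open>nbhd R\<close> is a closed ball and propagation is tested with \<ge>,
      hence the margin R + 1 instead of R.\<close>
    moreover have "c xs = 0" if xs_in: "xs \<in> tuples G (Suc 0)" and far: "diagonal_dist G S xs \<ge> real R + 1" for xs
    proof -
      obtain x y where xs: "xs = [x, y]" "x \<in> carrier G" "y \<in> carrier G"
        using xs_in by (auto simp: tuples_1)
      then have "y \<notin> nbhd R x"
        using diagonal_dist_pair_le[of x y] far by (simp add: nbhd_def)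
      then show ?thesis
        using supp[of x y] xs c_pair by auto
    qed
    moreover have "\<bar>c xs\<bar> \<le> K * f (tuple_norm G S xs)" if xs_in: "xs \<in> tuples G (Suc 0)" for xs
    proof -
      obtain x y where xs: "xs = [x, y]" "x \<in> carrier G" "y \<in> carrier G"
        using xs_in by (auto simp: tuples_1)
      show ?thesis
      \<comment> \<open>The hypothesis \<open>growth\<close> speaks of edges with nonzero flow; on
        the others the bound follows from K \<ge> 0.\<close>
      proof (cases "\<psi> (x, y) = 0")
        case True
        then show ?thesis
          using K f[of "real (max (wlen x) (wlen y))"] by (simp add: xs c_pair tuple_norm_pair)
      next
        case False
        then show ?thesis
          using growth[of x y] by (simp add: xs c_pair tuple_norm_pair of_nat_max)
      qed
    qed
    ultimately show ?thesis
      unfolding chains_def using c_supp by blast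
  qed
  have bc: "boundary c = indicator (tuples G 0)"
  proof
    fix ys
    show "boundary c ys = indicator (tuples G 0) ys"
    proof (cases "ys \<in> tuples G 0")
      case True
      then obtain x where x: "ys = [x]" "x \<in> carrier G"
        by (auto simp: tuples_0)
      have "boundary c ys = (\<Sum>y | \<psi> (y, x) \<noteq> 0. \<psi> (y, x))"
        by (simp add: boundary_def x c_pair)
      also have "\<dots> = (\<Sum>y\<in>nbhd R x. \<psi> (y, x))"
      proof (rule sum.mono_neutral_left)
        show "{y. \<psi> (y, x) \<noteq> 0} \<subseteq> nbhd R x"
        proof
          fix y assume "y \<in> {y. \<psi> (y, x) \<noteq> 0}"
          then have "\<psi> (x, y) \<noteq> 0"
            using anti[of x y] by simp
          then show "y \<in> nbhd R x"
            using supp by blast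
        qed
      qed (use finite_nbhd x in auto)
      also have "\<dots> = 1"
        using flow x by blast
      finally show ?thesis
        using True by simp
    next
      case False
      then have "c (z # ys) = 0" for z
        using c_supp[of "z # ys"] by (auto simp: tuples_0 tuples_1)
      then show ?thesis
        using False by (simp add: boundary_def)
    qed
  qed
  \<comment> \<open>Adding or subtracting the chain \<open>c\<close> moves between the coset and the
    subgroup.\<close>
  have "{(\<lambda>xs. b xs + indicator (tuples G 0) xs) |b. b \<in> boundaries G S f 0} = boundaries G S f 0"
    (is "?A = ?B")
  proof
    show "?A \<subseteq> ?B"
    proof
      fix e assume "e \<in> ?A"
      then obtain d where d: "d \<in> chains G S f (Suc 0)"
        "e = (\<lambda>xs. boundary d xs + boundary c xs)"
        unfolding boundaries_def bc[symmetric] by blast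
      then have "e = boundary (\<lambda>xs. d xs + 1 * c xs)"
        using boundary_add[OF d(1) c, of 1] by auto
      then show "e \<in> ?B"
        unfolding boundaries_def using chains_add[OF d(1) c f, of 1] by blast
    qed
    show "?B \<subseteq> ?A"
    proof
      fix e assume "e \<in> ?B"
      then obtain d where d: "d \<in> chains G S f (Suc 0)" "e = boundary d"
        unfolding boundaries_def by auto
      let ?d = "\<lambda>xs. d xs + (-1) * c xs"
      have "?d \<in> chains G S f (Suc 0)"
        using chains_add[OF d(1) c f, of "-1"] by blast
      moreover have "e = (\<lambda>xs. boundary ?d xs + indicator (tuples G 0) xs)"
        unfolding bc[symmetric] d(2) using boundary_add[OF d(1) c, of "-1"] by auto
      ultimately show "e \<in> ?A"
        unfolding boundaries_def by blast
    qed
  qed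
  then show ?thesis
    unfolding fundamental_class_def homology_class_def homology_def FactGroup_def
    by (auto simp: r_coset_def cycle_group_def)
qed

end

section \<open>The discrete Poincare inequality\<close>

lemma control_functionD:
  assumes "control_function f"
  shows "0 \<le> s \<Longrightarrow> s \<le> t \<Longrightarrow> f s \<le> f t" and "0 \<le> t \<Longrightarrow> 1 \<le> f t"
    and "K > 0 \<Longrightarrow> \<exists>L>0. \<forall>t>0. f (t + K) \<le> L * f t \<and> f (K * t) \<le> L * f t"
proof -
  have mono: "mono_on {0..} f" and "f 0 = 1"
    and bounds: "\<forall>K>0. \<exists>L>0. \<forall>t>0. f (t + K) \<le> L * f t \<and> f (K * t) \<le> L * f t"
    using assms unfolding control_function_def by blast+
  show "0 \<le> s \<Longrightarrow> s \<le> t \<Longrightarrow> f s \<le> f t"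
    using mono_onD[OF mono, of s t] by auto
  show "0 \<le> t \<Longrightarrow> 1 \<le> f t"
    using mono_onD[OF mono, of 0 t] \<open>f 0 = 1\<close> by auto
  show "K > 0 \<Longrightarrow> \<exists>L>0. \<forall>t>0. f (t + K) \<le> L * f t \<and> f (K * t) \<le> L * f t"
    using bounds by blast
qed

lemma slowly_growing_iterate:
  assumes "\<And>t. t > t\<^sub>0 \<Longrightarrow> f (t + 1) \<le> f t + \<epsilon>" "t > t\<^sub>0"
  shows "f (t + real n) \<le> f t + real n * \<epsilon>"
proof (induction n)
  case (Suc n)
  have "f (t + real (Suc n)) = f ((t + real n) + 1)"
    by (simp add: algebra_simps)
  also have "\<dots> \<le> f (t + real n) + \<epsilon>"
    by (rule assms(1)) (use assms(2) in linarith)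
  finally show ?case
    using Suc by (simp add: algebra_simps)
qed simp

text \<open>a - b is sqrt a - sqrt b times a factor that is at least 1. The first bound transfers
  slow growth from f to its root; the second serves near the identity, where slow growth says
  nothing.\<close>

lemma sqrt_diff_square_le:
  assumes "1 \<le> a" "1 \<le> b"
  shows "(sqrt a - sqrt b)\<^sup>2 \<le> (a - b)\<^sup>2" and "a \<le> m \<Longrightarrow> b \<le> m \<Longrightarrow> (sqrt a - sqrt b)\<^sup>2 \<le> m"
proof -
  have "a - b = (sqrt a - sqrt b) * (sqrt a + sqrt b)"
    using assms by (simp add: square_diff_square_factored[symmetric] algebra_simps)
  then have "(a - b)\<^sup>2 = (sqrt a - sqrt b)\<^sup>2 * (sqrt a + sqrt b)\<^sup>2"
    by (simp add: power_mult_distrib)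
  moreover have "1 \<le> (sqrt a + sqrt b)\<^sup>2"
    using assms by (intro one_le_power) (smt (verit) real_sqrt_ge_1_iff)
  ultimately show "(sqrt a - sqrt b)\<^sup>2 \<le> (a - b)\<^sup>2"
    by (metis mult.right_neutral mult_left_mono zero_le_power2)
  show "(sqrt a - sqrt b)\<^sup>2 \<le> m" if "a \<le> m" "b \<le> m"
  proof -
    have "\<bar>sqrt a - sqrt b\<bar> \<le> sqrt m"
      using assms that real_sqrt_le_mono[of a m] real_sqrt_le_mono[of b m] real_sqrt_ge_zero[of a] real_sqrt_ge_zero[of b]
      by linarith
    then have "(sqrt a - sqrt b)\<^sup>2 \<le> (sqrt m)\<^sup>2"
      by (metis abs_ge_zero power2_abs power_mono)
    then show ?thesis
      using assms that by simp
  qed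
qed

section \<open>From the discrete Poincare inequality to the isoperimetric inequality and the
  flow\<close>

context word_metric
begin

text \<open>Left translation carries the ball around the identity to the ball around
  \<open>x\<close>, so one constant bounds the valency everywhere.\<close>

lemma card_nbhd_le:
  assumes "x \<in> carrier G"
  shows "card (nbhd R x) \<le> card {s \<in> carrier G. wlen s \<le> R}"
proof -
  have "nbhd R x \<subseteq> (\<lambda>s. x \<otimes> s) ` {s \<in> carrier G. wlen s \<le> R}"
  proof
    fix y assume "y \<in> nbhd R x"
    then have "y = x \<otimes> (inv x \<otimes> y)" "inv x \<otimes> y \<in> {s \<in> carrier G. wlen s \<le> R}"
      using assms by (auto simp: nbhd_def word_dist_def m_assoc[symmetric])
    then show "y \<in> (\<lambda>s. x \<otimes> s) ` {s \<in> carrier G. wlen s \<le> R}" by blast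
  qed
  then show ?thesis
    by (rule surj_card_le[OF finite_ball])
qed

lemma wlen_nbhd: "x \<in> carrier G \<Longrightarrow> y \<in> nbhd R x \<Longrightarrow> wlen y \<le> wlen x + R"
  using word_dist_triangle[of \<one> x y] by (simp add: nbhd_def word_dist_def)

lemma mem_nbhd_mult: "x \<in> carrier G \<Longrightarrow> s \<in> carrier G \<Longrightarrow> wlen s \<le> R \<Longrightarrow> x \<otimes> s \<in> nbhd R x"
  by (simp add: nbhd_def word_dist_def m_assoc[symmetric])

lemma wlen_generator: "s \<in> S \<Longrightarrow> wlen s \<le> 1"
  using wlen_le[of "[s]"] S_carrier by auto

text \<open>A finite nonempty set without outgoing edges would be closed under right multiplication
  by generators, hence contain the whole infinite group. R \<ge> 1 makes each generator an
  edge.\<close>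

lemma edge_boundary_nonempty:
  assumes "infinite (carrier G)" "finite T" "T \<subseteq> carrier G" "T \<noteq> {}" "R \<ge> 1"
  shows "\<exists>x\<in>T. nbhd R x - T \<noteq> {}"
proof (rule ccontr)
  assume "\<not> ?thesis"
  then have cl: "x \<otimes> s \<in> T" if "x \<in> T" "s \<in> S" for x s
    using that mem_nbhd_mult[of x s R] wlen_generator[of s] S_carrier assms by fastforce
  have words: "set ws \<subseteq> S \<Longrightarrow> x \<in> T \<Longrightarrow> x \<otimes> word_prod ws \<in> T" for ws x
  proof (induction ws arbitrary: x)
    case Nil
    then show ?case using assms by auto
  next
    case (Cons s ws)
    then have "(x \<otimes> s) \<otimes> word_prod ws \<in> T"
      using cl by simp
    moreover have "x \<in> carrier G" "s \<in> carrier G" "word_prod ws \<in> carrier G"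
      using Cons.prems S_carrier assms by (auto intro!: word_prod_closed)
    ultimately show ?case
      by (simp add: m_assoc)
  qed
  obtain x where x: "x \<in> T" "x \<in> carrier G"
    using assms by blast
  have "carrier G \<subseteq> T"
  proof
    fix z assume z: "z \<in> carrier G"
    then obtain ws where ws: "set ws \<subseteq> S" "word_prod ws = inv x \<otimes> z"
      using word_exists[of "inv x \<otimes> z"] x by auto
    have "x \<otimes> word_prod ws = z"
      unfolding ws using x z by (simp add: m_assoc[symmetric])
    then show "z \<in> T"
      using words[OF ws(1) x(1)] by simp
  qed
  then show False
    using assms finite_subset by blast
qed

text \<open>The energy runs over ordered pairs that start in \<open>T\<close>: a pair inside
  \<open>T\<close> is counted in both orders, an edge leaving \<open>T\<close> once. Between points
  outside \<open>T\<close> the function does not change.\<close>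

definition poincare_inequality :: "(real \<Rightarrow> real) \<Rightarrow> nat \<Rightarrow> real \<Rightarrow> bool" where
  "poincare_inequality f R C \<longleftrightarrow>
     (\<forall>T h. finite T \<longrightarrow> T \<subseteq> carrier G \<longrightarrow> (\<forall>x. x \<notin> T \<longrightarrow> h x = (0 :: real)) \<longrightarrow>
        (\<Sum>x\<in>T. (h x)\<^sup>2 / f (wlen x)) \<le> C * (\<Sum>x\<in>T. \<Sum>y\<in>nbhd R x. (h y - h x)\<^sup>2))"

text \<open>For h = sqrt f on \<open>T\<close> the weighted norm is \<open>card T\<close>. Edges
  inside \<open>T\<close> split by distance from the identity: far out their squared differences,
  times \<open>C\<close>, add up to at most half of \<open>card T\<close>; close to the identity
  they add up to at most the constant \<open>B\<close>. Edges leaving \<open>T\<close> give exactly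
  the boundary term.\<close>

lemma isoperimetric_inequality:
  assumes f: "control_function f" "slowly_growing f"
    and poinc: "poincare_inequality f R C" and C: "C > 0" and R: "R \<ge> 1"
    and inf: "infinite (carrier G)"
  shows "\<exists>K\<ge>0. \<forall>T. finite T \<longrightarrow> T \<subseteq> carrier G \<longrightarrow>
           real (card T) \<le> K * (\<Sum>x\<in>T. \<Sum>y\<in>nbhd R x - T. f (wlen x))"
proof -
  note f_mono = control_functionD(1)[OF f(1)] and f_ge_1 = control_functionD(2)[OF f(1)]
  define W where "W = real (card {s \<in> carrier G. wlen s \<le> R})"
  have W: "W \<ge> 0" and card_W: "x \<in> carrier G \<Longrightarrow> card (nbhd R x) \<le> W" for x
    using card_nbhd_le by (simp_all add: W_def)
  \<comment> \<open>As q \<ge> 1, also q^2 \<ge> q \<ge> 2 C W; so increments of at most 1 / q per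
    edge give C W / q^2 \<le> 1 / 2.\<close>
  define q where "q = 2 * C * W + 1"
  have q: "q \<ge> 1" "2 * C * W \<le> q\<^sup>2"
    using C W by (auto simp: q_def power2_eq_square algebra_simps)
  \<comment> \<open>An edge spans at most \<open>R\<close> unit steps of word length, so f changes
    along it by at most R \<epsilon> \<le> 1 / q.\<close>
  define \<epsilon> where "\<epsilon> = 1 / ((real R + 1) * q)"
  have "\<epsilon> > 0"
    using q by (simp add: \<epsilon>_def)
  then obtain t\<^sub>0 where t\<^sub>0: "t\<^sub>0 \<ge> 0" and growth: "\<And>t. t > t\<^sub>0 \<Longrightarrow> f (t + 1) \<le> f t + \<epsilon>"
    using f(2) unfolding slowly_growing_def by blast
  have growth_R: "f (real (t + R)) \<le> f t + R * \<epsilon>" if "real t > t\<^sub>0" for t :: nat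
    using slowly_growing_iterate[where f = f and \<epsilon> = \<epsilon> and t = "real t" and n = R, OF growth that] by simp
  have "R * \<epsilon> \<le> 1 / q"
  proof -
    have "R * \<epsilon> = (R / (R + 1)) * (1 / q)"
      by (simp add: \<epsilon>_def)
    also have "\<dots> \<le> 1 * (1 / q)"
      using q by (intro mult_right_mono) auto
    finally show ?thesis by simp
  qed
  then have "(R * \<epsilon>)\<^sup>2 \<le> (1 / q)\<^sup>2"
    using \<open>\<epsilon> > 0\<close> by (intro power_mono) auto
  then have "C * W * (R * \<epsilon>)\<^sup>2 \<le> C * W * (1 / q)\<^sup>2"
    using C W by (intro mult_left_mono) auto
  also have "\<dots> \<le> 1 / 2"
  proof -
    have "q\<^sup>2 > 0"
      using q by simp
    then show ?thesis
      using q by (simp add: power_divide pos_divide_le_eq)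
  qed
  finally have small: "C * W * (R * \<epsilon>)\<^sup>2 \<le> 1 / 2" .
  \<comment> \<open>If one end of an edge lies within \<open>t\<^sub>0\<close> of the identity, both
    ends lie within \<open>m\<close>.\<close>
  define m where "m = nat \<lceil>t\<^sub>0\<rceil> + R"
  define b where "b = real (card {x \<in> carrier G. wlen x \<le> m})"
  \<comment> \<open>At most \<open>b\<close> vertices near the identity, at most \<open>W\<close>
    edges at each, each costing at most f m.\<close>
  define B where "B = W * b * f m"
  have "f m \<ge> 1" "b \<ge> 0" "B \<ge> 0"
    using f_ge_1[of m] W by (auto simp: B_def b_def)
  have "real (card T) \<le> (2 * C * (B + 1)) * (\<Sum>x\<in>T. \<Sum>y\<in>nbhd R x - T. f (wlen x))"
    if T: "finite T" "T \<subseteq> carrier G" for T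
  proof (cases "T = {}")
    case False
    let ?bd = "\<Sum>x\<in>T. \<Sum>y\<in>nbhd R x - T. f (wlen x)"
    define h where "h x = (if x \<in> T then sqrt (f (wlen x)) else 0)" for x
    have sq: "(h y - h x)\<^sup>2 \<le> (R * \<epsilon>)\<^sup>2 + (if wlen x \<le> m then f m else 0)"
      if "x \<in> T" "y \<in> nbhd R x \<inter> T" for x y
    proof -
      have mem: "x \<in> carrier G" "y \<in> carrier G" "y \<in> nbhd R x" "x \<in> nbhd R y"
        using that T nbhd_sym[of x y R] by auto
      have h: "h x = sqrt (f (wlen x))" "h y = sqrt (f (wlen y))"
        using that by (auto simp: h_def)
      have len: "wlen y \<le> wlen x + R" "wlen x \<le> wlen y + R"
        using mem wlen_nbhd by blast+
      show ?thesis
      proof (cases "real (wlen x) > t\<^sub>0 \<and> real (wlen y) > t\<^sub>0")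
        case True
        have "f (wlen y) \<le> f (wlen x) + R * \<epsilon>"
          using growth_R[of "wlen x"] True f_mono[of "wlen y" "wlen x + R"] len by simp
        moreover have "f (wlen x) \<le> f (wlen y) + R * \<epsilon>"
          using growth_R[of "wlen y"] True f_mono[of "wlen x" "wlen y + R"] len by simp
        ultimately have "\<bar>f (wlen y) - f (wlen x)\<bar> \<le> R * \<epsilon>"
          by linarith
        then have "(f (wlen y) - f (wlen x))\<^sup>2 \<le> (R * \<epsilon>)\<^sup>2"
          by (metis abs_ge_zero power2_abs power_mono)
        then show ?thesis
          using sqrt_diff_square_le(1)[of "f (wlen y)" "f (wlen x)"] f_ge_1[of "wlen x"] f_ge_1[of "wlen y"] \<open>f m \<ge> 1\<close>
          unfolding h by (auto intro: order_trans add_increasing2)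
      next
        case False
        then have le: "wlen x \<le> m" "wlen y \<le> m"
          using len unfolding m_def by linarith+
        then have "f (wlen x) \<le> f m" "f (wlen y) \<le> f m"
          using f_mono by auto
        then have "(h y - h x)\<^sup>2 \<le> f m"
          unfolding h using f_ge_1 by (intro sqrt_diff_square_le(2)) auto
        then show ?thesis
          using le by (smt (verit) zero_le_power2)
      qed
    qed
    have inner: "(\<Sum>y\<in>nbhd R x. (h y - h x)\<^sup>2) \<le>
        W * (R * \<epsilon>)\<^sup>2 + (if wlen x \<le> m then W * f m else 0) + (\<Sum>y\<in>nbhd R x - T. f (wlen x))"
      if x: "x \<in> T" for x
    proof -
      have xc: "x \<in> carrier G" using x T by blast
      have "(\<Sum>y\<in>nbhd R x. (h y - h x)\<^sup>2) =
          (\<Sum>y\<in>nbhd R x \<inter> T. (h y - h x)\<^sup>2) + (\<Sum>y\<in>nbhd R x - T. (h y - h x)\<^sup>2)"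
        by (rule sum.Int_Diff) (use finite_nbhd xc in blast)
      moreover have "(\<Sum>y\<in>nbhd R x - T. (h y - h x)\<^sup>2) = (\<Sum>y\<in>nbhd R x - T. f (wlen x))"
      proof (rule sum.cong)
        have "f (wlen x) \<ge> 0"
          using f_ge_1[of "wlen x"] by simp
        then show "(h y - h x)\<^sup>2 = f (wlen x)" if "y \<in> nbhd R x - T" for y
          using that x by (simp add: h_def)
      qed simp
      moreover have "(\<Sum>y\<in>nbhd R x \<inter> T. (h y - h x)\<^sup>2) \<le> (\<Sum>y\<in>nbhd R x \<inter> T. (R * \<epsilon>)\<^sup>2 + (if wlen x \<le> m then f m else 0))"
        by (intro sum_mono sq x) auto
      moreover have "\<dots> = card (nbhd R x \<inter> T) * ((R * \<epsilon>)\<^sup>2 + (if wlen x \<le> m then f m else 0))"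
        by simp
      moreover have "\<dots> \<le> W * ((R * \<epsilon>)\<^sup>2 + (if wlen x \<le> m then f m else 0))"
      proof (rule mult_right_mono)
        have "card (nbhd R x \<inter> T) \<le> card (nbhd R x)"
          by (intro card_mono finite_nbhd xc) auto
        then show "real (card (nbhd R x \<inter> T)) \<le> W"
          using card_W[OF xc] by linarith
      qed (use \<open>f m \<ge> 1\<close> in auto)
      ultimately show ?thesis
        by (simp add: algebra_simps split: if_splits)
    qed
    have "real (card T) = (\<Sum>x\<in>T. (h x)\<^sup>2 / f (wlen x))"
    proof -
      have "(h x)\<^sup>2 / f (wlen x) = 1" if "x \<in> T" for x
        using that f_ge_1[of "wlen x"] by (simp add: h_def)
      then have "(\<Sum>x\<in>T. (h x)\<^sup>2 / f (wlen x)) = (\<Sum>x\<in>T. 1)"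
        by (rule sum.cong[OF refl])
      then show ?thesis by simp
    qed
    also have "\<dots> \<le> C * (\<Sum>x\<in>T. \<Sum>y\<in>nbhd R x. (h y - h x)\<^sup>2)"
    proof -
      have "\<forall>x. x \<notin> T \<longrightarrow> h x = 0"
        by (simp add: h_def)
      then show ?thesis
        using poinc T unfolding poincare_inequality_def by blast
    qed
    also have "\<dots> \<le> C * (\<Sum>x\<in>T. W * (R * \<epsilon>)\<^sup>2 + (if wlen x \<le> m then W * f m else 0) +
        (\<Sum>y\<in>nbhd R x - T. f (wlen x)))"
      using C inner by (intro mult_left_mono sum_mono) auto
    also have "(\<Sum>x\<in>T. W * (R * \<epsilon>)\<^sup>2 + (if wlen x \<le> m then W * f m else 0) +
        (\<Sum>y\<in>nbhd R x - T. f (wlen x))) =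
        card T * (W * (R * \<epsilon>)\<^sup>2) + (\<Sum>x\<in>T. if wlen x \<le> m then W * f m else 0) + ?bd"
      by (simp only: sum.distrib sum_constant)
    also have "(\<Sum>x\<in>T. if wlen x \<le> m then W * f m else 0) \<le> B"
    proof -
      have "(\<Sum>x\<in>T. if wlen x \<le> m then W * f m else 0) = card {x \<in> T. wlen x \<le> m} * (W * f m)"
        using T by (subst sum.inter_filter[symmetric]) auto
      also have "\<dots> \<le> b * (W * f m)"
      proof (rule mult_right_mono)
        show "real (card {x \<in> T. wlen x \<le> m}) \<le> b"
          unfolding b_def using T by (intro of_nat_mono card_mono finite_ball) auto
      qed (use W \<open>f m \<ge> 1\<close> in auto)
      finally show ?thesis
        by (simp add: B_def mult_ac)
    qed
    finally have "real (card T) \<le> C * (card T * (W * (R * \<epsilon>)\<^sup>2) + B + ?bd)"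
      using C by simp
    also have "\<dots> = card T * (C * W * (R * \<epsilon>)\<^sup>2) + C * B + C * ?bd"
      by (simp add: algebra_simps)
    also have "\<dots> \<le> card T * (1 / 2) + C * B + C * ?bd"
      using small by (intro add_right_mono mult_left_mono) auto
    \<comment> \<open>Half of \<open>card T\<close> moves to the left side, which doubles the other
      constants.\<close>
    finally have main: "real (card T) \<le> 2 * C * B + 2 * C * ?bd"
      by simp
    \<comment> \<open>A single outgoing edge already has weight f \<ge> 1. This lets the boundary
      term absorb the constant 2 C B.\<close>
    have "?bd \<ge> 1"
    proof -
      obtain x y where x: "x \<in> T" and y: "y \<in> nbhd R x - T"
        using edge_boundary_nonempty[OF inf T False R] by blast
      have nonneg: "0 \<le> f (wlen z)" for z
        using f_ge_1[of "wlen z"] by simp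
      have "1 \<le> f (wlen x)"
        using f_ge_1 by simp
      also have "\<dots> \<le> (\<Sum>y\<in>nbhd R x - T. f (wlen x))"
        using x y T finite_nbhd[of x R] nonneg by (intro member_le_sum[where f = "\<lambda>_. f (wlen x)"]) auto
      also have "\<dots> \<le> ?bd"
        using x T nonneg by (intro member_le_sum[where f = "\<lambda>x. \<Sum>y\<in>nbhd R x - T. f (wlen x)"] sum_nonneg) auto
      finally show ?thesis .
    qed
    then have "2 * C * B * 1 \<le> 2 * C * B * ?bd"
      using C \<open>B \<ge> 0\<close> by (intro mult_left_mono) auto
    then show ?thesis
      using main by (simp add: algebra_simps)
  qed simp
  moreover have "2 * C * (B + 1) \<ge> 0"
    using C \<open>B \<ge> 0\<close> by simp
  ultimately show ?thesis
    by blast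
qed

theorem poincare_imp_fundamental_class_trivial:
  assumes f: "control_function f" "slowly_growing f"
    and poinc: "poincare_inequality f R C" and C: "C > 0" and R: "R \<ge> 1"
  shows "fundamental_class G S f = \<one>\<^bsub>homology G S f 0\<^esub>"
proof -
  note f_mono = control_functionD(1)[OF f(1)] and f_ge_1 = control_functionD(2)[OF f(1)]
  \<comment> \<open>On a finite group the function 1 has no energy but a positive weighted
    norm.\<close>
  have inf: "infinite (carrier G)"
  proof
    assume fin: "finite (carrier G)"
    define h where "h x = (if x \<in> carrier G then 1 else 0 :: real)" for x
    have "(\<Sum>x\<in>carrier G. (h x)\<^sup>2 / f (wlen x)) \<le> C * (\<Sum>x\<in>carrier G. \<Sum>y\<in>nbhd R x. (h y - h x)\<^sup>2)"
    proof -
      have "\<forall>x. x \<notin> carrier G \<longrightarrow> h x = 0"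
        by (simp add: h_def)
      then show ?thesis
        using poinc fin unfolding poincare_inequality_def by blast
    qed
    also have "(\<Sum>x\<in>carrier G. \<Sum>y\<in>nbhd R x. (h y - h x)\<^sup>2) = 0"
      by (intro sum.neutral ballI) (simp add: h_def nbhd_def)
    finally have "(\<Sum>x\<in>carrier G. (h x)\<^sup>2 / f (wlen x)) \<le> 0"
      by simp
    moreover have "(\<Sum>x\<in>carrier G. (h x)\<^sup>2 / f (wlen x)) > 0"
    proof (rule sum_pos[OF fin])
      fix x assume "x \<in> carrier G"
      then show "(h x)\<^sup>2 / f (wlen x) > 0"
        using f_ge_1[of "wlen x"] by (simp add: h_def)
    qed auto
    ultimately show False by simp
  qed
  obtain K where K: "K \<ge> 0" and iso: "\<And>T. finite T \<Longrightarrow> T \<subseteq> carrier G \<Longrightarrow>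
           real (card T) \<le> K * (\<Sum>x\<in>T. \<Sum>y\<in>nbhd R x - T. f (wlen x))"
    using isoperimetric_inequality[OF f poinc C R inf] by blast
  define N where "N x = (if x \<in> carrier G then nbhd R x else {})" for x
  \<comment> \<open>The maximum makes the capacity symmetric, and it dominates f at the inner end
    \<open>x\<close>, where the isoperimetric inequality weighs the edge.\<close>
  define c where "c = (\<lambda>(x, y). if y \<in> N x then K * f (max (wlen x) (wlen y)) else 0)"
  have N_sym: "y \<in> N x \<longleftrightarrow> x \<in> N y" for x y
    using nbhd_sym[of x y R] by (auto simp: N_def nbhd_def)
  interpret capacity_network "carrier G" N c
  proof
    show "finite (N x)" for x
      using finite_nbhd by (simp add: N_def)
    show "c e \<ge> 0" for e
      using K f_ge_1[of "max (wlen (fst e)) (wlen (snd e))"]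
      by (auto simp: c_def split: prod.splits)
    show "c (x, y) = c (y, x)" for x y
      using N_sym by (auto simp: c_def max.commute)
    show "y \<in> N x" if "c (x, y) \<noteq> 0" for x y
      using that by (auto simp: c_def split: if_splits)
    show "real (card T) \<le> (\<Sum>x\<in>T. \<Sum>y\<in>N x - T. c (x, y))" if T: "finite T" "T \<subseteq> carrier G" for T
    proof -
      have "real (card T) \<le> (\<Sum>x\<in>T. \<Sum>y\<in>nbhd R x - T. K * f (wlen x))"
        using iso[OF T] by (simp add: sum_distrib_left mult_ac)
      also have "\<dots> \<le> (\<Sum>x\<in>T. \<Sum>y\<in>N x - T. c (x, y))"
      proof (rule sum_mono)
        fix x assume "x \<in> T"
        then have Nx: "N x = nbhd R x"
          using T by (auto simp: N_def)
        show "(\<Sum>y\<in>nbhd R x - T. K * f (wlen x)) \<le> (\<Sum>y\<in>N x - T. c (x, y))"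
          unfolding Nx
        proof (rule sum_mono)
          fix y assume "y \<in> nbhd R x - T"
          then show "K * f (wlen x) \<le> c (x, y)"
            using Nx K f_mono[of "wlen x" "max (wlen x) (wlen y)"] by (auto simp: c_def intro!: mult_left_mono)
        qed
      qed
      finally show ?thesis .
    qed
  qed
  obtain \<psi> where \<psi>: "\<psi> \<in> flows" and unit: "\<And>x. x \<in> carrier G \<Longrightarrow> inflow N \<psi> x = 1"
    using unit_flow by blast
  have bound: "\<bar>\<psi> e\<bar> \<le> c e" and anti: "\<psi> (x, y) = - \<psi> (y, x)" for e x y
    using \<psi> unfolding flows_def by blast+
  show ?thesis
  proof (rule fundamental_class_trivial[where R = R and K = K and \<psi> = \<psi>])
    show "f t \<ge> 0" if "t \<ge> 0" for t
      using f_ge_1[OF that] by simp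
    show "\<psi> (x, y) = - \<psi> (y, x)" for x y
      by (rule anti)
    show "(\<Sum>y\<in>nbhd R x. \<psi> (y, x)) = 1" if "x \<in> carrier G" for x
      using unit[OF that] that by (simp add: inflow_def N_def)
    fix x y assume "\<psi> (x, y) \<noteq> 0"
    then have "c (x, y) \<noteq> 0"
      using bound[of "(x, y)"] by auto
    then have "y \<in> N x"
      by (rule c_supp)
    then show "x \<in> carrier G \<and> y \<in> nbhd R x"
      by (auto simp: N_def split: if_splits)
    show "\<bar>\<psi> (x, y)\<bar> \<le> K * f (max (wlen x) (wlen y))"
      using bound[of "(x, y)"] \<open>y \<in> N x\<close> by (simp add: c_def)
  qed (rule K)
qed

end

section \<open>Lifting in covering spaces\<close>

text \<open>The library proves lifting only for subsets of normed spaces.\<close>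

definition evenly_covered :: "('u::topological_space \<Rightarrow> 'm::topological_space) \<Rightarrow> 'm set \<Rightarrow> 'u set set \<Rightarrow> bool" where
  "evenly_covered p T \<V> \<longleftrightarrow> open T \<and> \<Union>\<V> = p -` T \<and> (\<forall>V\<in>\<V>. open V) \<and> pairwise disjnt \<V> \<and>
     (\<forall>V\<in>\<V>. \<exists>q. homeomorphism V T p q)"

text \<open>Allows evenly covered sets to be shrunk to coordinate balls.\<close>

lemma evenly_covered_subset:
  assumes "evenly_covered p T \<V>" "open U" "U \<subseteq> T" and p: "continuous_on UNIV p"
  shows "evenly_covered p U ((\<lambda>V. V \<inter> p -` U) ` \<V>)"
proof -
  have "open (p -` U)"
    using p assms(2) open_vimage by blast
  moreover have "\<exists>q. homeomorphism (V \<inter> p -` U) U p q" if V: "V \<in> \<V>" for V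
  proof -
    obtain q where q: "homeomorphism V T p q"
      using assms(1) V unfolding evenly_covered_def by blast
    then have pq: "\<And>x. x \<in> V \<Longrightarrow> q (p x) = x" "\<And>y. y \<in> T \<Longrightarrow> p (q y) = y" "\<And>y. y \<in> T \<Longrightarrow> q y \<in> V"
      and pqc: "continuous_on V p" "continuous_on T q"
      unfolding homeomorphism_def by blast+
    have "homeomorphism (V \<inter> p -` U) U p q"
    proof (rule homeomorphismI)
      show "continuous_on (V \<inter> p -` U) p" "continuous_on U q"
        using pqc \<open>U \<subseteq> T\<close> continuous_on_subset by blast+
      show "p ` (V \<inter> p -` U) \<subseteq> U" "q ` U \<subseteq> V \<inter> p -` U"
        using pq \<open>U \<subseteq> T\<close> by auto
    qed (use pq \<open>U \<subseteq> T\<close> in auto)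
    then show ?thesis by blast
  qed
  moreover have "\<Union>\<V> = p -` T" "\<forall>V\<in>\<V>. open V" "pairwise disjnt \<V>"
    using assms(1) by (auto simp: evenly_covered_def)
  moreover have "pairwise disjnt ((\<lambda>V. V \<inter> p -` U) ` \<V>)"
    using \<open>pairwise disjnt \<V>\<close> unfolding pairwise_def disjnt_def by blast
  moreover have "\<Union>((\<lambda>V. V \<inter> p -` U) ` \<V>) = p -` U"
  proof -
    have "\<Union>((\<lambda>V. V \<inter> p -` U) ` \<V>) = \<Union>\<V> \<inter> p -` U"
      by auto
    then show ?thesis
      using \<open>\<Union>\<V> = p -` T\<close> \<open>U \<subseteq> T\<close> by auto
  qed
  ultimately show ?thesis
    unfolding evenly_covered_def using \<open>open U\<close> by (simp add: open_Int)
qed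

lemma evenly_covered_sheet:
  assumes "evenly_covered p T \<V>" "p x \<in> T"
  obtains V q where "V \<in> \<V>" "x \<in> V" "open V" "homeomorphism V T p q"
proof -
  have "x \<in> \<Union>\<V>"
    using assms by (simp add: evenly_covered_def)
  then obtain V where V: "V \<in> \<V>" "x \<in> V" by blast
  then obtain q where "homeomorphism V T p q" "open V"
    using assms(1) by (auto simp: evenly_covered_def)
  then show ?thesis
    using V that by blast
qed

lemma evenly_covered_disjoint:
  assumes "evenly_covered p T \<V>" "V \<in> \<V>" "V' \<in> \<V>" "x \<in> V" "x \<in> V'"
  shows "V = V'"
proof -
  have "pairwise disjnt \<V>"
    using assms(1) by (simp add: evenly_covered_def)
  then show ?thesis
    using assms unfolding pairwise_def disjnt_iff by blast
qed

section \<open>Path lifting and monodromy\<close>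

text \<open>A relation between end points: path lifting says that it is total over the start of
  \<open>l\<close>, uniqueness that it is functional, and concatenation of paths becomes composition
  of relations.\<close>

definition lifts :: "('u::topological_space \<Rightarrow> 'm::topological_space) \<Rightarrow> (real \<Rightarrow> 'm) \<Rightarrow> 'u \<Rightarrow> 'u \<Rightarrow> bool" where
  "lifts p l x y \<longleftrightarrow>
     (\<exists>\<sigma>. path \<sigma> \<and> pathstart \<sigma> = x \<and> pathfinish \<sigma> = y \<and> (\<forall>t\<in>{0..1}. p (\<sigma> t) = l t))"

lemma liftsI: "path \<sigma> \<Longrightarrow> pathstart \<sigma> = x \<Longrightarrow> pathfinish \<sigma> = y \<Longrightarrow> (\<And>t. t \<in> {0..1} \<Longrightarrow> p (\<sigma> t) = l t) \<Longrightarrow> lifts p l x y"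
  unfolding lifts_def by blast

lemma lifts_reversepath:
  assumes "lifts p l x y"
  shows "lifts p (reversepath l) y x"
proof -
  obtain \<sigma> where \<sigma>: "path \<sigma>" "pathstart \<sigma> = x" "pathfinish \<sigma> = y" "\<forall>t\<in>{0..1}. p (\<sigma> t) = l t"
    using assms unfolding lifts_def by blast
  show ?thesis
    by (rule liftsI[of "reversepath \<sigma>"]) (use \<sigma> in simp_all, simp add: reversepath_def)
qed

lemma lifts_join:
  assumes "lifts p l x y" "lifts p m y z"
  shows "lifts p (l +++ m) x z"
proof -
  obtain \<sigma> where "path \<sigma>" "pathstart \<sigma> = x" "pathfinish \<sigma> = y" "\<forall>t\<in>{0..1}. p (\<sigma> t) = l t"
    using assms(1) unfolding lifts_def by blast
  moreover obtain \<tau> where "path \<tau>" "pathstart \<tau> = y" "pathfinish \<tau> = z" "\<forall>t\<in>{0..1}. p (\<tau> t) = m t"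
    using assms(2) unfolding lifts_def by blast
  ultimately show ?thesis
    by (intro liftsI[of "\<sigma> +++ \<tau>"]) (simp_all, simp add: joinpaths_def)
qed

lemma lifts_endpoints: "lifts p l x y \<Longrightarrow> p x = pathstart l" "lifts p l x y \<Longrightarrow> p y = pathfinish l"
  unfolding lifts_def pathstart_def pathfinish_def by auto

locale covering =
  fixes p :: "'u::topological_space \<Rightarrow> 'm::topological_space"
  assumes covering: "covering_space UNIV p UNIV"
begin

lemma cont: "continuous_on UNIV p"
  using covering covering_space_imp_continuous by blast

lemma surj: "surj p"
  using covering covering_space_imp_surjective by blast

lemma evenly_covered_nhd:
  obtains T \<V> where "x \<in> T" "evenly_covered p T \<V>"
proof -
  have "\<exists>T. x \<in> T \<and> open T \<and> (\<exists>v. \<Union>v = p -` T \<and> (\<forall>u\<in>v. open u) \<and> pairwise disjnt v \<and>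
      (\<forall>u\<in>v. \<exists>q. homeomorphism u T p q))"
    using covering unfolding covering_space_def by simp
  then show ?thesis
    using that unfolding evenly_covered_def by metis
qed

text \<open>Agreement is locally constant: near a point each map stays in one sheet over the same
  evenly covered set. If they agree somewhere nearby, the two sheets meet and hence coincide, and
  \<open>p\<close> is injective on a sheet.\<close>

lemma lift_unique:
  assumes "connected C" and g: "continuous_on C g" "continuous_on C g'"
    and eq: "\<And>x. x \<in> C \<Longrightarrow> p (g x) = p (g' x)" and "a \<in> C" "g a = g' a" "x \<in> C"
  shows "g x = g' x"
proof (rule connected_induction_simple[OF \<open>connected C\<close> \<open>a \<in> C\<close> \<open>x \<in> C\<close>, where P = "\<lambda>x. g x = g' x"])
  fix b assume b: "b \<in> C"
  obtain T \<V> where T: "p (g b) \<in> T" "evenly_covered p T \<V>"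
    using evenly_covered_nhd .
  obtain V q where V: "V \<in> \<V>" "g b \<in> V" "open V" and "homeomorphism V T p q"
    using evenly_covered_sheet[OF T(2,1)] .
  then have inj: "inj_on p V"
    by (auto simp: homeomorphism_def intro: inj_on_inverseI)
  have "p (g' b) \<in> T"
    using T(1) eq[OF b] by simp
  then obtain V' q' where V': "V' \<in> \<V>" "g' b \<in> V'" "open V'"
    using evenly_covered_sheet[OF T(2)] by metis
  let ?N = "(C \<inter> g -` V) \<inter> (C \<inter> g' -` V')"
  have "openin (top_of_set C) ?N"
    using g V V' by (intro openin_Int continuous_openin_preimage_gen)
  moreover have "g z = g' z" if "y \<in> ?N" "z \<in> ?N" "g y = g' y" for y z
  proof -
    have "V = V'"
      using evenly_covered_disjoint[OF T(2) V(1) V'(1), of "g y"] that by auto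
    then show ?thesis
      using that eq[of z] inj by (auto dest: inj_onD)
  qed
  ultimately show "\<exists>T. openin (top_of_set C) T \<and> b \<in> T \<and> (\<forall>y\<in>T. \<forall>z\<in>T. g y = g' y \<longrightarrow> g z = g' z)"
    using b V V' by (intro exI[of _ ?N]) blast
qed fact

text \<open>The composite of \<sigma>, \<open>p\<close> and \<open>q\<close> lifts the same curve
  and agrees with \<sigma> at \<open>a\<close>, so uniqueness of lifts identifies the two.\<close>

lemma lift_in_sheet:
  assumes "homeomorphism V T p q" and C: "connected C" "continuous_on C \<sigma>"
    and T: "\<And>t. t \<in> C \<Longrightarrow> p (\<sigma> t) \<in> T" and "a \<in> C" "\<sigma> a \<in> V" "t \<in> C"
  shows "\<sigma> t = q (p (\<sigma> t))" "\<sigma> t \<in> V"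
proof -
  have q: "continuous_on T q" "q (p (\<sigma> a)) = \<sigma> a" "\<And>y. y \<in> T \<Longrightarrow> p (q y) = y" "q ` T = V"
    using assms(1) \<open>\<sigma> a \<in> V\<close> by (auto simp: homeomorphism_def)
  have "continuous_on C (\<lambda>t. p (\<sigma> t))"
    by (rule continuous_on_compose2[OF cont C(2)]) auto
  then have "continuous_on C (\<lambda>t. q (p (\<sigma> t)))"
    using q(1) T by (intro continuous_on_compose2[of T q C "\<lambda>t. p (\<sigma> t)"]) auto
  from lift_unique[OF C(1,2) this _ \<open>a \<in> C\<close> _ \<open>t \<in> C\<close>]
  show eq: "\<sigma> t = q (p (\<sigma> t))"
    using q T by simp
  show "\<sigma> t \<in> V"
    using q(4) T[OF \<open>t \<in> C\<close>] eq by (metis imageI)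
qed

text \<open>Having a lift over [0, t] spreads over a neighbourhood of each time: while
  \<open>l\<close> stays in an evenly covered set, a lift on [0, s] is continued by the inverse
  branch \<open>q\<close> on the sheet that contains its end. Connectedness of [0, 1] does the
  rest.\<close>

lemma lift_path:
  assumes "path l" "p x = pathstart l"
  obtains \<sigma> where "path \<sigma>" "pathstart \<sigma> = x" "\<And>t. t \<in> {0..1} \<Longrightarrow> p (\<sigma> t) = l t"
proof -
  define P where "P t \<longleftrightarrow> (\<exists>\<sigma>. continuous_on {0..t} \<sigma> \<and> \<sigma> 0 = x \<and> (\<forall>s\<in>{0..t}. p (\<sigma> s) = l s))" for t :: real
  have l: "continuous_on {0..1} l"
    using assms by (simp add: path_def)
  have "P 1"
  proof (rule connected_induction_simple[of "{0..1::real}" 0 1 P])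
    show "P 0"
      unfolding P_def using assms by (intro exI[of _ "\<lambda>_. x"]) (auto simp: pathstart_def)
    fix a :: real assume a: "a \<in> {0..1}"
    obtain T \<V> where T: "l a \<in> T" "evenly_covered p T \<V>"
      using evenly_covered_nhd .
    have "open T"
      using T(2) by (simp add: evenly_covered_def)
    then have "\<forall>\<^sub>F s in at a within {0..1}. l s \<in> T"
      using l a T(1) by (auto simp: continuous_on_def tendsto_def)
    then obtain d where d: "d > 0" "\<And>s. s \<in> {0..1} \<Longrightarrow> dist s a < d \<Longrightarrow> l s \<in> T"
      unfolding eventually_at using T(1) by (metis dist_pos_lt)
    let ?N = "{0..1} \<inter> ball a d"
    have "P t" if s: "s \<in> ?N" and t: "t \<in> ?N" and Ps: "P s" for s t
    proof (cases "t \<le> s")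
      case True
      then show ?thesis
        using Ps continuous_on_subset[of "{0..s}" _ "{0..t}"] unfolding P_def by fastforce
    next
      case False
      obtain \<sigma> where \<sigma>: "continuous_on {0..s} \<sigma>" "\<sigma> 0 = x" "\<And>r. r \<in> {0..s} \<Longrightarrow> p (\<sigma> r) = l r"
        using Ps unfolding P_def by blast
      have lT: "l r \<in> T" if "r \<in> {s..t}" for r
        using d(2)[of r] s t that by (auto simp: dist_real_def)
      have "s \<ge> 0" using s by simp
      then have "p (\<sigma> s) = l s"
        using \<sigma>(3)[of s] by simp
      moreover have "l s \<in> T"
        using lT[of s] False by simp
      ultimately obtain V q where V: "V \<in> \<V>" "\<sigma> s \<in> V" "homeomorphism V T p q"
        using evenly_covered_sheet[OF T(2), of "\<sigma> s"] by metis
      then have q: "continuous_on T q" "q (l s) = \<sigma> s" "\<And>y. y \<in> T \<Longrightarrow> p (q y) = y"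
        using \<open>p (\<sigma> s) = l s\<close> by (auto simp: homeomorphism_def)
      define \<tau> where "\<tau> r = (if r \<le> s then \<sigma> r else q (l r))" for r
      have "continuous_on {s..t} (\<lambda>r. q (l r))"
        using q(1) lT s t by (intro continuous_on_compose2[of T q "{s..t}" l] continuous_on_subset[OF l]) auto
      then have "continuous_on ({0..s} \<union> {s..t}) \<tau>"
        unfolding \<tau>_def using \<sigma>(1) q(2)
        by (intro continuous_on_cases) auto
      moreover have "{0..s} \<union> {s..t} = {0..t}"
        using False \<open>s \<ge> 0\<close> by auto
      moreover have "p (\<tau> r) = l r" if "r \<in> {0..t}" for r
        using that \<sigma>(3)[of r] lT[of r] q(3)[of "l r"] by (auto simp: \<tau>_def)
      ultimately show ?thesis
        unfolding P_def using \<sigma>(2) \<open>s \<ge> 0\<close> by (intro exI[of _ \<tau>]) (auto simp: \<tau>_def)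
    qed
    then show "\<exists>T. openin (top_of_set {0..1}) T \<and> a \<in> T \<and> (\<forall>x\<in>T. \<forall>y\<in>T. P x \<longrightarrow> P y)"
      using a d(1) openin_open_Int[OF open_ball, of "{0..1}" a d] centre_in_ball[of a d] by (intro exI[of _ ?N]) blast
  qed auto
  then show ?thesis
    using that unfolding P_def path_def pathstart_def by metis
qed

lemma lifts_exists:
  assumes "path l" "p x = pathstart l"
  obtains y where "lifts p l x y"
  using lift_path[OF assms] unfolding lifts_def by metis

lemma lifts_unique:
  assumes "lifts p l x y" "lifts p l x y'"
  shows "y = y'"
proof -
  obtain \<sigma> where \<sigma>: "path \<sigma>" "pathstart \<sigma> = x" "pathfinish \<sigma> = y" "\<forall>t\<in>{0..1}. p (\<sigma> t) = l t"
    using assms(1) unfolding lifts_def by blast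
  obtain \<tau> where \<tau>: "path \<tau>" "pathstart \<tau> = x" "pathfinish \<tau> = y'" "\<forall>t\<in>{0..1}. p (\<tau> t) = l t"
    using assms(2) unfolding lifts_def by blast
  have "\<sigma> 1 = \<tau> 1"
    using \<sigma> \<tau> by (intro lift_unique[of "{0..1}" \<sigma> \<tau> 0 1]) (auto simp: path_def pathstart_def)
  then show ?thesis
    using \<sigma> \<tau> by (simp add: pathfinish_def)
qed

text \<open>The lifts from \<open>x\<close> of the intermediate paths have ends that depend
  continuously on the homotopy parameter and lie over one point, so the end is constant. Only this
  curve of ends is studied, not a lift of the whole square.\<close>

theorem monodromy:
  assumes hom: "homotopic_paths UNIV l m" and "lifts p l x y" "lifts p m x y'"
  shows "y = y'"
proof -
  let ?I = "{0..1::real}"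
  obtain h where h: "continuous_on (?I \<times> ?I) h" "\<And>t. t \<in> ?I \<Longrightarrow> h (0, t) = l t" "\<And>t. t \<in> ?I \<Longrightarrow> h (1, t) = m t"
    and "\<forall>s\<in>?I. pathstart (h \<circ> Pair s) = pathstart l \<and> pathfinish (h \<circ> Pair s) = pathfinish l"
    using hom unfolding homotopic_paths by blast
  then have ends: "h (s, 0) = l 0" "h (s, 1) = l 1" if "s \<in> ?I" for s
    using that by (auto simp: pathstart_def pathfinish_def)
  have "p x = l 0"
    using lifts_endpoints(1)[OF assms(2)] by (simp add: pathstart_def)
  have "\<exists>\<sigma>. path \<sigma> \<and> pathstart \<sigma> = x \<and> (\<forall>t\<in>?I. p (\<sigma> t) = h (s, t))" if s: "s \<in> ?I" for s
  proof -
    have "path (\<lambda>t. h (s, t))"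
      unfolding path_def using s by (intro continuous_on_compose2[OF h(1)] continuous_intros) auto
    moreover have "p x = pathstart (\<lambda>t. h (s, t))"
      using ends(1)[OF s] \<open>p x = l 0\<close> by (simp add: pathstart_def)
    ultimately show ?thesis
      using lift_path by metis
  qed
  note ex = this
  \<comment> \<open>On [0, 1] the lift from \<open>x\<close> of the path at parameter
    \<open>s\<close> is unique, so the choice does not affect continuity in
    \<open>s\<close>.\<close>
  define \<sigma> where "\<sigma> s = (SOME \<sigma>. path \<sigma> \<and> pathstart \<sigma> = x \<and> (\<forall>t\<in>?I. p (\<sigma> t) = h (s, t)))" for s
  have all: "path (\<sigma> s) \<and> pathstart (\<sigma> s) = x \<and> (\<forall>t\<in>?I. p (\<sigma> s t) = h (s, t))" if "s \<in> ?I" for s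
    unfolding \<sigma>_def by (rule someI_ex[OF ex[OF that]])
  have \<sigma>: "s \<in> ?I \<Longrightarrow> path (\<sigma> s)" "s \<in> ?I \<Longrightarrow> pathstart (\<sigma> s) = x"
      "s \<in> ?I \<Longrightarrow> t \<in> ?I \<Longrightarrow> p (\<sigma> s t) = h (s, t)" for s t
    using all by blast+
  \<comment> \<open>Induction along \<open>t\<close>: continuity in \<open>s\<close> near
    \<open>s\<^sub>0\<close> holds at t = 0, where all lifts start in \<open>x\<close>, and it
    spreads along every interval over which the homotopy stays in one evenly covered set.\<close>
  have loc: "\<exists>d>0. continuous_on (?I \<inter> ball s\<^sub>0 d) (\<lambda>s. \<sigma> s 1)" if s\<^sub>0: "s\<^sub>0 \<in> ?I" for s\<^sub>0
  proof (rule connected_induction_simple[of ?I 0 1 "\<lambda>t. \<exists>d>0. continuous_on (?I \<inter> ball s\<^sub>0 d) (\<lambda>s. \<sigma> s t)"])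
    have "continuous_on (?I \<inter> ball s\<^sub>0 1) (\<lambda>s. \<sigma> s 0) \<longleftrightarrow> continuous_on (?I \<inter> ball s\<^sub>0 1) (\<lambda>s. x)"
      using \<sigma>(2) by (intro continuous_on_cong) (auto simp: pathstart_def)
    then show "\<exists>d>0. continuous_on (?I \<inter> ball s\<^sub>0 d) (\<lambda>s. \<sigma> s 0)"
      by (intro exI[of _ 1]) simp
    fix a assume a: "a \<in> ?I"
    obtain T \<V> where T: "h (s\<^sub>0, a) \<in> T" "evenly_covered p T \<V>"
      using evenly_covered_nhd .
    have "open T"
      using T(2) by (simp add: evenly_covered_def)
    then have "\<forall>\<^sub>F w in at (s\<^sub>0, a) within ?I \<times> ?I. h w \<in> T"
      using h(1) a s\<^sub>0 T(1) by (auto simp: continuous_on_def tendsto_def)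
    then obtain e where e: "e > 0" "\<And>w. w \<in> ?I \<times> ?I \<Longrightarrow> dist w (s\<^sub>0, a) < e \<Longrightarrow> h w \<in> T"
      unfolding eventually_at using T(1) by (metis dist_pos_lt)
    define d where "d = e / 2"
    have d: "d > 0" "h (s, t) \<in> T" if "s \<in> ?I" "t \<in> ?I" "dist s s\<^sub>0 < d" "dist t a < d" for s t
    proof -
      have "dist (s, t) (s\<^sub>0, a) \<le> dist s s\<^sub>0 + dist t a"
        unfolding dist_Pair_Pair by (rule sqrt_sum_squares_le_sum) auto
      then show "h (s, t) \<in> T"
        using that by (intro e(2)) (auto simp: d_def)
    qed (use e in \<open>simp add: d_def\<close>)
    have "d > 0" using e by (simp add: d_def)
    let ?N = "?I \<inter> ball a d"
    have conn: "connected ?N"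
      by (intro convex_connected convex_Int) auto
    have "\<exists>d>0. continuous_on (?I \<inter> ball s\<^sub>0 d) (\<lambda>s. \<sigma> s t2)"
      if t1: "t1 \<in> ?N" and t2: "t2 \<in> ?N" and ex: "\<exists>d>0. continuous_on (?I \<inter> ball s\<^sub>0 d) (\<lambda>s. \<sigma> s t1)" for t1 t2
    proof -
      obtain d1 where d1: "d1 > 0" "continuous_on (?I \<inter> ball s\<^sub>0 d1) (\<lambda>s. \<sigma> s t1)"
        using ex by blast
      have "p (\<sigma> s\<^sub>0 t1) \<in> T"
        using d(2)[of s\<^sub>0 t1] \<sigma>(3)[of s\<^sub>0 t1] s\<^sub>0 t1 \<open>d > 0\<close> by (simp add: dist_commute)
      then obtain V q where V: "V \<in> \<V>" "\<sigma> s\<^sub>0 t1 \<in> V" "open V" "homeomorphism V T p q"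
        using evenly_covered_sheet[OF T(2)] by metis
      have "\<forall>\<^sub>F s in at s\<^sub>0 within ?I \<inter> ball s\<^sub>0 d1. \<sigma> s t1 \<in> V"
        using d1 s\<^sub>0 V by (auto simp: continuous_on_def tendsto_def)
      then obtain d2 where d2: "d2 > 0" "\<And>s. s \<in> ?I \<inter> ball s\<^sub>0 d1 \<Longrightarrow> dist s s\<^sub>0 < d2 \<Longrightarrow> \<sigma> s t1 \<in> V"
        unfolding eventually_at using V(2) by (metis dist_pos_lt)
      define d3 where "d3 = min d (min d1 d2)"
      have "d3 > 0" using \<open>d > 0\<close> d1 d2 by (simp add: d3_def)
      have eq: "\<sigma> s t2 = q (h (s, t2))" and hT: "h (s, t2) \<in> T" if s: "s \<in> ?I \<inter> ball s\<^sub>0 d3" for s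
      proof -
        have close: "s \<in> ?I" "dist s s\<^sub>0 < d" "s \<in> ?I \<inter> ball s\<^sub>0 d1" "dist s s\<^sub>0 < d2"
          using s by (auto simp: d3_def dist_commute)
        have N: "p (\<sigma> s t) \<in> T" if "t \<in> ?N" for t
          using d(2)[of s t] \<sigma>(3)[of s t] close that by (simp add: dist_commute)
        have cs: "continuous_on ?N (\<sigma> s)"
          using \<sigma>(1)[OF close(1)] continuous_on_subset unfolding path_def by blast
        have "\<sigma> s t2 = q (p (\<sigma> s t2))"
          using lift_in_sheet(1)[where \<sigma> = "\<sigma> s" and a = t1 and t = t2, OF V(4) conn cs N t1 d2(2)[OF close(3,4)] t2] .
        then show "\<sigma> s t2 = q (h (s, t2))"
          using \<sigma>(3)[of s t2] close t2 by simp
        show "h (s, t2) \<in> T"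
          using N[OF t2] \<sigma>(3)[of s t2] close t2 by simp
      qed
      have hc: "continuous_on (?I \<inter> ball s\<^sub>0 d3) (\<lambda>s. h (s, t2))"
        using t2 by (intro continuous_on_compose2[OF h(1)] continuous_intros) auto
      have "continuous_on T q"
        using V(4) by (simp add: homeomorphism_def)
      then have "continuous_on (?I \<inter> ball s\<^sub>0 d3) (\<lambda>s. q (h (s, t2)))"
        by (rule continuous_on_compose2[OF _ hc]) (use hT in blast)
      then have "continuous_on (?I \<inter> ball s\<^sub>0 d3) (\<lambda>s. \<sigma> s t2)"
        by (rule continuous_on_eq) (simp add: eq)
      then show ?thesis
        using \<open>d3 > 0\<close> by blast
    qed
    then show "\<exists>T. openin (top_of_set ?I) T \<and> a \<in> T \<and> (\<forall>x\<in>T. \<forall>y\<in>T.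
        (\<exists>d>0. continuous_on (?I \<inter> ball s\<^sub>0 d) (\<lambda>s. \<sigma> s x)) \<longrightarrow> (\<exists>d>0. continuous_on (?I \<inter> ball s\<^sub>0 d) (\<lambda>s. \<sigma> s y)))"
      using a \<open>d > 0\<close> openin_open_Int[OF open_ball, of "?I" a d] centre_in_ball[of a d] by (intro exI[of _ ?N]) blast
  qed auto
  have "continuous_on ?I (\<lambda>s. \<sigma> s 1)"
  proof (subst continuous_on_eq_continuous_within, intro ballI)
    fix s\<^sub>0 assume s\<^sub>0: "s\<^sub>0 \<in> ?I"
    obtain d where d: "d > 0" "continuous_on (?I \<inter> ball s\<^sub>0 d) (\<lambda>s. \<sigma> s 1)"
      using loc[OF s\<^sub>0] by blast
    have "at s\<^sub>0 within (?I \<inter> ball s\<^sub>0 d) = at s\<^sub>0 within ?I"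
      using d(1) by (intro at_within_nhd[of _ "ball s\<^sub>0 d"]) auto
    moreover have "continuous (at s\<^sub>0 within (?I \<inter> ball s\<^sub>0 d)) (\<lambda>s. \<sigma> s 1)"
      using d s\<^sub>0 by (simp add: continuous_on_eq_continuous_within)
    ultimately show "continuous (at s\<^sub>0 within ?I) (\<lambda>s. \<sigma> s 1)"
      by simp
  qed
  \<comment> \<open>The curve of ends lies over the single point l 1, so it agrees with the constant
    lift.\<close>
  then have "\<sigma> 0 1 = \<sigma> 1 1"
    by (intro lift_unique[of ?I "\<lambda>_. \<sigma> 0 1" "\<lambda>s. \<sigma> s 1" 0 1]) (auto simp: \<sigma>(3) ends)
  moreover have "y = \<sigma> 0 1"
    by (rule lifts_unique[OF assms(2)], rule liftsI[of "\<sigma> 0"]) (use \<sigma> h in \<open>auto simp: pathfinish_def\<close>)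
  moreover have "y' = \<sigma> 1 1"
    by (rule lifts_unique[OF assms(3)], rule liftsI[of "\<sigma> 1"]) (use \<sigma> h in \<open>auto simp: pathfinish_def\<close>)
  ultimately show ?thesis
    by simp
qed

end

section \<open>Homotopies of paths\<close>

text \<open>Homotopies in an arbitrary space are obtained as images of straight-line homotopies in a
  parameter domain. The unit and inverse laws of paths and the square of a free homotopy are all
  treated in this way.\<close>

lemma homotopic_paths_convex_image:
  fixes S :: "'c::real_normed_vector set"
  assumes "convex S" "continuous_on S F" "path \<alpha>" "path \<beta>" "path_image \<alpha> \<subseteq> S" "path_image \<beta> \<subseteq> S"
    "pathstart \<beta> = pathstart \<alpha>" "pathfinish \<beta> = pathfinish \<alpha>"
  shows "homotopic_paths UNIV (F \<circ> \<alpha>) (F \<circ> \<beta>)"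
proof -
  have "closed_segment (\<alpha> t) (\<beta> t) \<subseteq> S" if "t \<in> {0..1}" for t
    using assms that by (intro closed_segment_subset) (auto simp: path_image_def)
  then have "homotopic_paths S \<alpha> \<beta>"
    using assms by (intro homotopic_paths_linear) auto
  then show ?thesis
    using assms(2) by (rule homotopic_paths_continuous_image) auto
qed

lemma path_const: "path (\<lambda>_. c)"
  by (simp add: path_def)

lemma pathstart_const [simp]: "pathstart (\<lambda>_. c) = c" and pathfinish_const [simp]: "pathfinish (\<lambda>_. c) = c"
  by (simp_all add: pathstart_def pathfinish_def)

lemma homotopic_paths_inverse:
  fixes w :: "real \<Rightarrow> 'a::topological_space"
  assumes "path w"
  shows "homotopic_paths UNIV (w +++ reversepath w) (\<lambda>_. pathstart w)"
proof -
  have "homotopic_paths UNIV (w \<circ> (linepath 0 1 +++ linepath 1 0)) (w \<circ> (\<lambda>_. 0))"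
    using assms
    by (intro homotopic_paths_convex_image[of "{0..1}"])
      (auto simp: path_def[of w] path_const path_image_join closed_segment_eq_real_ivl path_image_def[of "\<lambda>_. 0"])
  moreover have "w \<circ> (linepath 0 1 +++ linepath 1 0) = w +++ reversepath w"
    by (auto simp: joinpaths_def reversepath_def linepath_def fun_eq_iff algebra_simps)
  ultimately show ?thesis
    by (simp add: comp_def pathstart_def)
qed

lemma homotopic_paths_left_unit:
  fixes w :: "real \<Rightarrow> 'a::topological_space"
  assumes "path w" "pathstart w = x"
  shows "homotopic_paths UNIV ((\<lambda>_. x) +++ w) w"
proof -
  have "homotopic_paths UNIV (w \<circ> ((\<lambda>_. 0) +++ linepath 0 1)) (w \<circ> linepath 0 1)"
    using assms
    by (intro homotopic_paths_convex_image[of "{0..1}"])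
      (auto simp: path_def[of w] path_const path_image_join closed_segment_eq_real_ivl path_image_def[of "\<lambda>_. 0"])
  moreover have "w \<circ> ((\<lambda>_. 0) +++ linepath 0 1) = (\<lambda>_. x) +++ w" "w \<circ> linepath 0 1 = w"
    using assms(2) by (auto simp: joinpaths_def linepath_def fun_eq_iff pathstart_def)
  ultimately show ?thesis
    by simp
qed

lemma homotopic_paths_right_unit:
  fixes w :: "real \<Rightarrow> 'a::topological_space"
  assumes "path w" "pathfinish w = y"
  shows "homotopic_paths UNIV (w +++ (\<lambda>_. y)) w"
proof -
  have "homotopic_paths UNIV (w \<circ> (linepath 0 1 +++ (\<lambda>_. 1))) (w \<circ> linepath 0 1)"
    using assms
    by (intro homotopic_paths_convex_image[of "{0..1}"])
      (auto simp: path_def[of w] path_const path_image_join closed_segment_eq_real_ivl path_image_def[of "\<lambda>_. 1"])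
  moreover have "w \<circ> (linepath 0 1 +++ (\<lambda>_. 1)) = w +++ (\<lambda>_. y)" "w \<circ> linepath 0 1 = w"
    using assms(2) by (auto simp: joinpaths_def linepath_def fun_eq_iff pathfinish_def)
  ultimately show ?thesis
    by simp
qed

lemma homotopic_paths_inverse':
  fixes w :: "real \<Rightarrow> 'a::topological_space"
  assumes "path w"
  shows "homotopic_paths UNIV (reversepath w +++ w) (\<lambda>_. pathfinish w)"
  using homotopic_paths_inverse[of "reversepath w"] assms by simp

text \<open>\<open>simply_connected\<close> makes any two loops freely homotopic. For the constant
  loops at \<open>x\<close> and \<open>y\<close> the track of one point under the homotopy is the
  path.\<close>

lemma simply_connected_path_connected:
  assumes "simply_connected (UNIV :: 'a::topological_space set)"
  obtains w :: "real \<Rightarrow> 'a::topological_space" where "path w" "pathstart w = x" "pathfinish w = y"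
proof -
  have "homotopic_loops UNIV (\<lambda>_. x) (\<lambda>_. y)"
    using assms unfolding simply_connected_def by (simp add: path_const)
  then obtain h :: "real \<times> real \<Rightarrow> 'a" where h: "continuous_on ({0..1} \<times> {0..1}) h"
     "\<And>t. t \<in> {0..1} \<Longrightarrow> h (0, t) = x" "\<And>t. t \<in> {0..1} \<Longrightarrow> h (1, t) = y"
    unfolding homotopic_loops by auto
  have "path (\<lambda>s. h (s, 0))"
    unfolding path_def by (intro continuous_on_compose2[OF h(1)] continuous_intros) auto
  then show ?thesis
    using h(2,3)[of 0] by (intro that[of "\<lambda>s. h (s, 0)"]) (auto simp: pathstart_def pathfinish_def)
qed

text \<open>A free homotopy to a constant loop bounds a square whose left edge is the loop.\<close>

lemma simply_connected_loop_null:
  fixes l :: "real \<Rightarrow> 'a::topological_space"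
  assumes "simply_connected (UNIV :: 'a set)" "path l" "pathfinish l = pathstart l"
  shows "homotopic_paths UNIV l (\<lambda>_. pathstart l)"
proof -
  let ?I = "{0..1::real}" and ?x = "pathstart l"
  have "homotopic_loops UNIV l (\<lambda>_. ?x)"
    using assms unfolding simply_connected_def by (simp add: path_const)
  then obtain h :: "real \<times> real \<Rightarrow> 'a" where h: "continuous_on (?I \<times> ?I) h"
     "\<And>t. t \<in> ?I \<Longrightarrow> h (0, t) = l t" "\<And>t. t \<in> ?I \<Longrightarrow> h (1, t) = ?x"
     and loops: "\<And>s. s \<in> ?I \<Longrightarrow> h (s, 1) = h (s, 0)"
    unfolding homotopic_loops by (auto simp: pathfinish_def pathstart_def)
  \<comment> \<open>The track of the base point is both the bottom edge and, as all intermediate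
    curves are loops, the top edge of the square.\<close>
  define w where "w s = h (s, 0)" for s
  have w: "path w"
    unfolding path_def w_def by (intro continuous_on_compose2[OF h(1)] continuous_intros) auto
  have ends: "pathstart w = ?x" "pathfinish w = ?x"
    using h(2,3)[of 0] by (auto simp: w_def pathstart_def pathfinish_def)
  have conv: "convex (?I \<times> ?I)"
    by (intro convex_Times) auto
  let ?left = "linepath (0, 0) (0, 1) :: real \<Rightarrow> real \<times> real"
  let ?bot = "linepath (0, 0) (1, 0) :: real \<Rightarrow> real \<times> real"
  let ?right = "linepath (1, 0) (1, 1) :: real \<Rightarrow> real \<times> real"
  let ?top = "linepath (1, 1) (0, 1) :: real \<Rightarrow> real \<times> real"
  have im: "path_image (linepath a b) \<subseteq> ?I \<times> ?I" if "a \<in> ?I \<times> ?I" "b \<in> ?I \<times> ?I" for a b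
    using closed_segment_subset[OF that conv] by simp
  have ims: "path_image ?left \<subseteq> ?I \<times> ?I" "path_image ?bot \<subseteq> ?I \<times> ?I" "path_image ?right \<subseteq> ?I \<times> ?I"
      "path_image ?top \<subseteq> ?I \<times> ?I"
    by (rule im; simp)+
  then have "path_image (?bot +++ ?right +++ ?top) \<subseteq> ?I \<times> ?I"
    by (intro subset_path_image_join)
  then have 1: "homotopic_paths UNIV (h \<circ> ?left) (h \<circ> (?bot +++ ?right +++ ?top))"
    using ims(1) by (intro homotopic_paths_convex_image[OF conv h(1)]) simp_all
  have paths: "path (h \<circ> ?left)" "path (h \<circ> ?bot)" "path (h \<circ> ?right)" "path (h \<circ> ?top)"
    by (rule path_continuous_image, simp, rule continuous_on_subset[OF h(1)], rule ims)+
  have 2: "homotopic_paths UNIV (h \<circ> ?bot) w" "homotopic_paths UNIV (h \<circ> ?right) (\<lambda>_. ?x)"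
      "homotopic_paths UNIV (h \<circ> ?top) (reversepath w)"
    by (rule homotopic_paths_eq[OF paths(2)], simp, simp add: linepath_def w_def)
      (rule homotopic_paths_eq[OF paths(3)], simp, simp add: linepath_def h,
       rule homotopic_paths_eq[OF paths(4)], simp, simp add: linepath_def w_def reversepath_def loops)
  have 0: "homotopic_paths UNIV (h \<circ> ?left) l"
    by (rule homotopic_paths_eq[OF paths(1)], simp, simp add: linepath_def h)
  have "homotopic_paths UNIV l (h \<circ> (?bot +++ ?right +++ ?top))"
    using 0 1 homotopic_paths_sym homotopic_paths_trans by blast
  also have "h \<circ> (?bot +++ ?right +++ ?top) = (h \<circ> ?bot) +++ (h \<circ> ?right) +++ (h \<circ> ?top)"
    by (simp add: path_compose_join)
  also have "homotopic_paths UNIV \<dots> (w +++ (\<lambda>_. ?x) +++ reversepath w)"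
    using 2 by (intro homotopic_paths_join) (simp_all add: pathfinish_compose pathstart_compose)
  also have "homotopic_paths UNIV \<dots> (w +++ reversepath w)"
    using w ends by (intro homotopic_paths_join homotopic_paths_left_unit) auto
  also have "homotopic_paths UNIV \<dots> (\<lambda>_. ?x)"
    using homotopic_paths_inverse[OF w] ends by simp
  finally show ?thesis .
qed

lemma homotopic_paths_cancel:
  fixes s t :: "real \<Rightarrow> 'a::topological_space"
  assumes "path s" "path t" "pathstart t = pathstart s" "pathfinish t = pathfinish s"
    and "homotopic_paths UNIV (s +++ reversepath t) (\<lambda>_. pathstart s)"
  shows "homotopic_paths UNIV s t"
proof -
  have "homotopic_paths UNIV s (s +++ (\<lambda>_. pathfinish s))"
    using homotopic_paths_right_unit[of s] assms homotopic_paths_sym by blast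
  also have "homotopic_paths UNIV \<dots> (s +++ reversepath t +++ t)"
    using assms homotopic_paths_inverse'[of t] by (intro homotopic_paths_join) (auto intro: homotopic_paths_sym)
  also have "homotopic_paths UNIV \<dots> ((s +++ reversepath t) +++ t)"
    using assms by (intro homotopic_paths_assoc) auto
  also have "homotopic_paths UNIV \<dots> ((\<lambda>_. pathstart s) +++ t)"
    using assms by (intro homotopic_paths_join) auto
  also have "homotopic_paths UNIV \<dots> t"
    using assms by (intro homotopic_paths_left_unit) auto
  finally show ?thesis .
qed

lemma simply_connected_homotopic_paths:
  fixes s t :: "real \<Rightarrow> 'a::topological_space"
  assumes "simply_connected (UNIV :: 'a set)" "path s" "path t" "pathstart t = pathstart s" "pathfinish t = pathfinish s"
  shows "homotopic_paths UNIV s t"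
proof (rule homotopic_paths_cancel[OF assms(2-5)])
  show "homotopic_paths UNIV (s +++ reversepath t) (\<lambda>_. pathstart s)"
    using simply_connected_loop_null[OF assms(1), of "s +++ reversepath t"] assms(2-5) by simp
qed

section \<open>The fundamental group\<close>

lemma homotopy_class_eq_iff:
  "path l \<Longrightarrow> homotopy_class l = homotopy_class m \<longleftrightarrow> homotopic_paths UNIV l m"
  unfolding homotopy_class_def
  by (auto intro: homotopic_paths_trans homotopic_paths_sym)

lemma loops_atD: "l \<in> loops_at a \<Longrightarrow> path l \<and> pathstart l = a \<and> pathfinish l = a"
  by (simp add: loops_at_def)

lemma mem_homotopy_classD: "m \<in> homotopy_class l \<Longrightarrow> homotopic_paths UNIV l m"
  by (simp add: homotopy_class_def)

text \<open>The product in the definition is a union over all pairs of representatives. Joining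
  respects homotopy, so all members of the union are one class; the classes are inhabited, so the
  union is not empty.\<close>

lemma fundamental_group_mult:
  assumes "l \<in> loops_at a" "m \<in> loops_at a"
  shows "homotopy_class l \<otimes>\<^bsub>fundamental_group a\<^esub> homotopy_class m = homotopy_class (l +++ m)"
proof -
  have eq: "homotopy_class (l' +++ m') = homotopy_class (l +++ m)"
    if "l' \<in> homotopy_class l" "m' \<in> homotopy_class m" for l' m'
  proof -
    have "homotopic_paths UNIV (l +++ m) (l' +++ m')"
      using assms that by (intro homotopic_paths_join) (auto simp: loops_at_def homotopy_class_def)
    then show ?thesis
      using assms by (metis homotopy_class_eq_iff loops_atD path_join_imp)
  qed
  have mem: "l \<in> homotopy_class l" "m \<in> homotopy_class m"
    using assms by (auto simp: homotopy_class_def loops_at_def)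
  have "(\<Union>l'\<in>homotopy_class l. \<Union>m'\<in>homotopy_class m. homotopy_class (l' +++ m')) =
      (\<Union>l'\<in>homotopy_class l. \<Union>m'\<in>homotopy_class m. homotopy_class (l +++ m))"
    by (intro SUP_cong refl eq)
  also have "\<dots> = homotopy_class (l +++ m)"
    using mem by (metis SUP_const empty_iff)
  finally show ?thesis
    by (simp add: fundamental_group_def)
qed

lemma loops_at_join: "l \<in> loops_at a \<Longrightarrow> m \<in> loops_at a \<Longrightarrow> l +++ m \<in> loops_at a"
  by (auto simp: loops_at_def)

lemma carrier_fundamental_groupE:
  assumes "X \<in> carrier (fundamental_group a)"
  obtains l where "l \<in> loops_at a" "X = homotopy_class l"
  using assms by (auto simp: fundamental_group_def)

lemma mem_carrier_fundamental_group: "l \<in> loops_at a \<Longrightarrow> homotopy_class l \<in> carrier (fundamental_group a)"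
  by (simp add: fundamental_group_def)

lemma one_fundamental_group: "\<one>\<^bsub>fundamental_group a\<^esub> = homotopy_class (\<lambda>_. a)"
  by (simp add: fundamental_group_def)

lemma const_loop: "(\<lambda>_. a) \<in> loops_at a"
  by (simp add: loops_at_def path_const)

lemma group_fundamental_group: "group (fundamental_group (a :: 'a::topological_space))"
proof (rule groupI)
  show "\<one>\<^bsub>fundamental_group a\<^esub> \<in> carrier (fundamental_group a)"
    by (simp add: one_fundamental_group mem_carrier_fundamental_group const_loop)
  fix X assume "X \<in> carrier (fundamental_group a)"
  then obtain l where l: "l \<in> loops_at a" "X = homotopy_class l"
    by (rule carrier_fundamental_groupE)
  have "homotopic_paths UNIV ((\<lambda>_. a) +++ l) l"
    using l by (intro homotopic_paths_left_unit) (auto dest: loops_atD)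
  then show "\<one>\<^bsub>fundamental_group a\<^esub> \<otimes>\<^bsub>fundamental_group a\<^esub> X = X"
    using l by (simp add: one_fundamental_group fundamental_group_mult const_loop homotopy_class_eq_iff path_const loops_atD)
  have rev: "reversepath l \<in> loops_at a"
    using l by (auto simp: loops_at_def)
  have "homotopic_paths UNIV (reversepath l +++ l) (\<lambda>_. a)"
    using l homotopic_paths_inverse'[of l] by (auto dest!: loops_atD)
  then have "homotopy_class (reversepath l) \<otimes>\<^bsub>fundamental_group a\<^esub> X = \<one>\<^bsub>fundamental_group a\<^esub>"
    using l rev by (simp add: one_fundamental_group fundamental_group_mult homotopy_class_eq_iff loops_atD)
  then show "\<exists>Y\<in>carrier (fundamental_group a). Y \<otimes>\<^bsub>fundamental_group a\<^esub> X = \<one>\<^bsub>fundamental_group a\<^esub>"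
    using mem_carrier_fundamental_group[OF rev] by blast
  fix Y assume "Y \<in> carrier (fundamental_group a)"
  then obtain m where m: "m \<in> loops_at a" "Y = homotopy_class m"
    by (rule carrier_fundamental_groupE)
  show "X \<otimes>\<^bsub>fundamental_group a\<^esub> Y \<in> carrier (fundamental_group a)"
    using l m by (simp add: fundamental_group_mult mem_carrier_fundamental_group loops_at_join)
  fix Z assume "Z \<in> carrier (fundamental_group a)"
  then obtain n where n: "n \<in> loops_at a" "Z = homotopy_class n"
    by (rule carrier_fundamental_groupE)
  have "homotopic_paths UNIV (l +++ m +++ n) ((l +++ m) +++ n)"
    using l m n by (intro homotopic_paths_assoc) (auto dest: loops_atD)
  then have "homotopy_class (l +++ m +++ n) = homotopy_class ((l +++ m) +++ n)"
    using l m n by (simp add: homotopy_class_eq_iff loops_atD)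
  then show "X \<otimes>\<^bsub>fundamental_group a\<^esub> Y \<otimes>\<^bsub>fundamental_group a\<^esub> Z =
      X \<otimes>\<^bsub>fundamental_group a\<^esub> (Y \<otimes>\<^bsub>fundamental_group a\<^esub> Z)"
    using l m n by (simp add: fundamental_group_mult loops_at_join)
qed

section \<open>The fibre of the universal cover\<close>

locale universal_covering = covering p
  for p :: "'u::topological_space \<Rightarrow> 'm::topological_space" +
  fixes b :: 'u
  assumes simply_connected: "simply_connected (UNIV :: 'u set)"
begin

abbreviation \<Gamma> :: "(real \<Rightarrow> 'm) set monoid" where
  "\<Gamma> \<equiv> fundamental_group (p b)"

text \<open>The end of the lift from \<open>b\<close> of any representative, well defined by
  \<open>monodromy\<close>. It is a bijection from \<open>\<Gamma>\<close> to the fibre over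
  \<open>p b\<close>, by \<open>inj_orbit_point\<close> and \<open>orbit_point_surj\<close>.\<close>

definition orbit_point :: "(real \<Rightarrow> 'm) set \<Rightarrow> 'u" where
  "orbit_point X = (SOME y. \<exists>l\<in>X. lifts p l b y)"

lemma lifts_orbit_point:
  assumes "l \<in> loops_at (p b)"
  shows "lifts p l b (orbit_point (homotopy_class l))"
proof -
  have l: "path l" "pathstart l = p b" "l \<in> homotopy_class l"
    using assms by (auto simp: loops_at_def homotopy_class_def)
  then obtain y where y: "lifts p l b y"
    using lifts_exists by metis
  then have "\<exists>y. \<exists>m\<in>homotopy_class l. lifts p m b y"
    using l by blast
  then have "\<exists>m\<in>homotopy_class l. lifts p m b (orbit_point (homotopy_class l))"
    unfolding orbit_point_def by (rule someI_ex)
  then obtain m where "homotopic_paths UNIV l m" "lifts p m b (orbit_point (homotopy_class l))"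
    using mem_homotopy_classD by blast
  then show ?thesis
    using monodromy[of l m b y] y by blast
qed

lemma p_orbit_point: "X \<in> carrier \<Gamma> \<Longrightarrow> p (orbit_point X) = p b"
  by (metis carrier_fundamental_groupE lifts_endpoints(2) lifts_orbit_point loops_atD)

text \<open>Following the lift of a loop from an orbit point is right multiplication by its class.
  This is the link between bounded moves in the cover and bounded steps in the word metric.\<close>

lemma orbit_point_mult:
  assumes "X \<in> carrier \<Gamma>" "l \<in> loops_at (p b)" "lifts p l (orbit_point X) y"
  shows "y = orbit_point (X \<otimes>\<^bsub>\<Gamma>\<^esub> homotopy_class l)"
proof -
  obtain m where m: "m \<in> loops_at (p b)" "X = homotopy_class m"
    using assms(1) by (rule carrier_fundamental_groupE)
  then have "lifts p (m +++ l) b y"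
    using lifts_orbit_point assms(3) lifts_join by blast
  moreover have "lifts p (m +++ l) b (orbit_point (X \<otimes>\<^bsub>\<Gamma>\<^esub> homotopy_class l))"
    using m assms(2) by (simp add: fundamental_group_mult lifts_orbit_point loops_at_join)
  ultimately show ?thesis
    by (rule lifts_unique)
qed

lemma orbit_point_one: "orbit_point \<one>\<^bsub>\<Gamma>\<^esub> = b"
proof -
  have "lifts p (\<lambda>_. p b) b b"
    by (rule liftsI[of "\<lambda>_. b"]) (auto simp: path_const)
  then show ?thesis
    using lifts_orbit_point[OF const_loop] lifts_unique by (simp add: one_fundamental_group)
qed

text \<open>Lifts with common ends are homotopic in the simply connected cover, and \<open>p\<close>
  carries the homotopy down to the loops.\<close>

lemma inj_orbit_point: "inj_on orbit_point (carrier \<Gamma>)"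
proof (rule inj_onI)
  fix X Y assume XY: "X \<in> carrier \<Gamma>" "Y \<in> carrier \<Gamma>" "orbit_point X = orbit_point Y"
  obtain l where l: "l \<in> loops_at (p b)" "X = homotopy_class l"
    using XY(1) by (rule carrier_fundamental_groupE)
  obtain m where m: "m \<in> loops_at (p b)" "Y = homotopy_class m"
    using XY(2) by (rule carrier_fundamental_groupE)
  obtain \<sigma> where \<sigma>: "path \<sigma>" "pathstart \<sigma> = b" "pathfinish \<sigma> = orbit_point X" "\<forall>t\<in>{0..1}. p (\<sigma> t) = l t"
    using lifts_orbit_point[OF l(1)] l(2) unfolding lifts_def by blast
  obtain \<tau> where \<tau>: "path \<tau>" "pathstart \<tau> = b" "pathfinish \<tau> = orbit_point Y" "\<forall>t\<in>{0..1}. p (\<tau> t) = m t"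
    using lifts_orbit_point[OF m(1)] m(2) unfolding lifts_def by blast
  have "homotopic_paths UNIV \<sigma> \<tau>"
    using \<sigma> \<tau> XY(3) by (intro simply_connected_homotopic_paths simply_connected) auto
  then have "homotopic_paths UNIV (p \<circ> \<sigma>) (p \<circ> \<tau>)"
    using cont by (rule homotopic_paths_continuous_image) auto
  moreover have "homotopic_paths UNIV l (p \<circ> \<sigma>)" "homotopic_paths UNIV m (p \<circ> \<tau>)"
    using \<sigma> \<tau> l m by (auto intro!: homotopic_paths_eq dest: loops_atD)
  ultimately have "homotopic_paths UNIV l m"
    by (meson homotopic_paths_sym homotopic_paths_trans)
  then show "X = Y"
    using l m by (simp add: homotopy_class_eq_iff loops_atD)
qed

lemma orbit_point_surj:
  assumes "p z = p b"
  obtains X where "X \<in> carrier \<Gamma>" "orbit_point X = z"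
proof -
  obtain \<sigma> where \<sigma>: "path \<sigma>" "pathstart \<sigma> = b" "pathfinish \<sigma> = z"
    using simply_connected_path_connected[OF simply_connected] .
  have "path (p \<circ> \<sigma>)"
    using \<sigma>(1) cont continuous_on_subset by (intro path_continuous_image) blast+
  then have l: "p \<circ> \<sigma> \<in> loops_at (p b)"
    using \<sigma> assms by (auto simp: loops_at_def pathstart_compose pathfinish_compose)
  moreover have "lifts p (p \<circ> \<sigma>) b z"
    using \<sigma> by (intro liftsI[of \<sigma>]) auto
  ultimately have "orbit_point (homotopy_class (p \<circ> \<sigma>)) = z"
    using lifts_orbit_point lifts_unique by blast
  then show ?thesis
    using that mem_carrier_fundamental_group[OF l] by blast
qed

lemma path_between:
  obtains l where "path l" "pathstart l = x" "pathfinish l = (y :: 'm)"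
proof -
  obtain x' y' where xy: "p x' = x" "p y' = y"
    using surj by (metis surjD)
  obtain \<sigma> where \<sigma>: "path \<sigma>" "pathstart \<sigma> = x'" "pathfinish \<sigma> = y'"
    using simply_connected_path_connected[OF simply_connected] .
  have "path (p \<circ> \<sigma>)"
    using \<sigma>(1) cont continuous_on_subset by (intro path_continuous_image) blast+
  then show ?thesis
    using that[of "p \<circ> \<sigma>"] \<sigma> xy by (simp add: pathstart_compose pathfinish_compose)
qed

end

section \<open>Smooth functions\<close>

lemma Ck_on_cong:
  assumes "open S" "\<And>x. x \<in> S \<Longrightarrow> F x = G x" "Ck_on k S F"
  shows "Ck_on k S G"
  using assms(2,3)
proof (induction k arbitrary: F G)
  case 0
  then show ?case using continuous_on_eq[of S F G] by simp
next
  case (Suc k)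
  have diff: "G differentiable (at x)" if "x \<in> S" for x
  proof -
    have "(F has_derivative frechet_derivative F (at x)) (at x)"
      using Suc.prems(2) that by (simp add: frechet_derivative_works[symmetric])
    then have "(G has_derivative frechet_derivative F (at x)) (at x)"
      by (rule has_derivative_transform_within_open[OF _ assms(1) that Suc.prems(1)])
    then show ?thesis
      by (rule differentiableI)
  qed
  moreover have "Ck_on k S (\<lambda>x. frechet_derivative G (at x) w)" for w
  proof (rule Suc.IH)
    show "Ck_on k S (\<lambda>x. frechet_derivative F (at x) w)"
      using Suc.prems(2) by simp
    show "frechet_derivative F (at x) w = frechet_derivative G (at x) w" if "x \<in> S" for x
      by (subst frechet_derivative_transform_within_open[of F x S G]) (use Suc.prems that assms(1) in simp_all)
  qed
  ultimately show ?case by simp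
qed

lemma Ck_on_subset: "Ck_on k S F \<Longrightarrow> T \<subseteq> S \<Longrightarrow> Ck_on k T F"
  by (induction k arbitrary: F) (auto intro: continuous_on_subset)

lemma Ck_on_local:
  assumes "\<And>x. x \<in> S \<Longrightarrow> \<exists>T. open T \<and> x \<in> T \<and> Ck_on k T F"
  shows "Ck_on k S F"
  using assms
proof (induction k arbitrary: F)
  case 0
  have "isCont F x" if x: "x \<in> S" for x
  proof -
    obtain T where "open T" "x \<in> T" "continuous_on T F"
      using 0[OF x] by auto
    then show ?thesis
      by (simp add: continuous_on_eq_continuous_at)
  qed
  then show ?case
    by (simp add: continuous_at_imp_continuous_on)
next
  case (Suc k)
  have "F differentiable (at x)" if x: "x \<in> S" for x
    using Suc.prems[OF x] by auto
  moreover have "Ck_on k S (\<lambda>x. frechet_derivative F (at x) w)" for w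
  proof (rule Suc.IH)
    fix x assume x: "x \<in> S"
    obtain T where "open T" "x \<in> T" "Ck_on (Suc k) T F"
      using Suc.prems[OF x] by blast
    then show "\<exists>T. open T \<and> x \<in> T \<and> Ck_on k T (\<lambda>x. frechet_derivative F (at x) w)"
      by auto
  qed
  ultimately show ?case by simp
qed

text \<open>Takes the derivative as a given formula, so that closure of C^k under an operation
  becomes an induction on \<open>k\<close> over the differentiation rule.\<close>

lemma Ck_on_SucI:
  assumes "open S" "\<And>x. x \<in> S \<Longrightarrow> (F has_derivative F' x) (at x)" "\<And>w. Ck_on k S (\<lambda>x. F' x w)"
  shows "Ck_on (Suc k) S F"
proof -
  have "F differentiable (at x)" if "x \<in> S" for x
    using assms(2)[OF that] by (rule differentiableI)
  moreover have "Ck_on k S (\<lambda>x. frechet_derivative F (at x) w)" for w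
    by (rule Ck_on_cong[OF assms(1) _ assms(3)[of w]]) (use assms(2) frechet_derivative_at in metis)
  ultimately show ?thesis by simp
qed

lemma Ck_on_has_derivative:
  "Ck_on (Suc k) S F \<Longrightarrow> x \<in> S \<Longrightarrow> (F has_derivative frechet_derivative F (at x)) (at x)"
  by (simp add: frechet_derivative_works[symmetric])

lemma Ck_on_imp_continuous_on: "Ck_on k S F \<Longrightarrow> continuous_on S F"
  by (cases k) (auto intro: continuous_at_imp_continuous_on differentiable_imp_continuous_within)

lemma Ck_on_Suc_imp: "Ck_on (Suc k) S F \<Longrightarrow> Ck_on k S F"
proof (induction k arbitrary: F)
  case 0
  then show ?case using Ck_on_imp_continuous_on by fastforce
qed auto

lemma Ck_on_const: "Ck_on k S (\<lambda>_. c)"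
  by (induction k arbitrary: c) (auto simp: frechet_derivative_const)

lemma Ck_on_bounded_linear:
  assumes "bounded_linear L" "open S"
  shows "Ck_on k S L"
proof (cases k)
  case 0
  then show ?thesis
    using assms by (simp add: linear_continuous_on)
next
  case (Suc j)
  show ?thesis
    unfolding Suc
    by (rule Ck_on_SucI[OF assms(2), of _ "\<lambda>_. L"]) (auto intro: bounded_linear_imp_has_derivative assms Ck_on_const)
qed

lemma Ck_on_linear_compose:
  assumes "open S" "bounded_linear L" "Ck_on k S F"
  shows "Ck_on k S (\<lambda>x. L (F x))"
  using assms(3)
proof (induction k arbitrary: F)
  case 0
  then show ?case
    using assms(2) by (simp add: bounded_linear.continuous_on)
next
  case (Suc k)
  show ?case
  proof (rule Ck_on_SucI[OF assms(1)])
    show "((\<lambda>x. L (F x)) has_derivative (\<lambda>w. L (frechet_derivative F (at x) w))) (at x)" if "x \<in> S" for x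
      using Ck_on_has_derivative[OF Suc.prems that] assms(2) by (rule bounded_linear.has_derivative[rotated])
  qed (use Suc in simp)
qed

lemma Ck_on_add:
  assumes "open S" "Ck_on k S F" "Ck_on k S G"
  shows "Ck_on k S (\<lambda>x. F x + G x)"
  using assms(2,3)
proof (induction k arbitrary: F G)
  case 0
  then show ?case by (simp add: continuous_on_add)
next
  case (Suc k)
  show ?case
  proof (rule Ck_on_SucI[OF assms(1)])
    show "((\<lambda>x. F x + G x) has_derivative (\<lambda>w. frechet_derivative F (at x) w + frechet_derivative G (at x) w)) (at x)"
      if "x \<in> S" for x
      by (intro has_derivative_add Ck_on_has_derivative[OF Suc.prems(1) that] Ck_on_has_derivative[OF Suc.prems(2) that])
  qed (use Suc in simp)
qed

lemma Ck_on_sum: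
  assumes "open S" "\<And>i. i \<in> I \<Longrightarrow> Ck_on k S (F i)"
  shows "Ck_on k S (\<lambda>x. \<Sum>i\<in>I. F i x)"
  using assms(2)
proof (induction I rule: infinite_finite_induct)
  case (insert i I)
  then show ?case
    using Ck_on_add[OF assms(1), of k "F i" "\<lambda>x. \<Sum>i\<in>I. F i x"] by simp
qed (auto simp: Ck_on_const)

lemma Ck_on_mult:
  fixes F G :: "'a::real_normed_vector \<Rightarrow> real"
  assumes "open S" "Ck_on k S F" "Ck_on k S G"
  shows "Ck_on k S (\<lambda>x. F x * G x)"
  using assms(2,3)
proof (induction k arbitrary: F G)
  case 0
  then show ?case by (simp add: continuous_on_mult)
next
  case (Suc k)
  show ?case
  proof (rule Ck_on_SucI[OF assms(1)])
    show "((\<lambda>x. F x * G x) has_derivative (\<lambda>w. F x * frechet_derivative G (at x) w + frechet_derivative F (at x) w * G x)) (at x)"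
      if "x \<in> S" for x
      by (intro has_derivative_mult Ck_on_has_derivative[OF Suc.prems(1) that] Ck_on_has_derivative[OF Suc.prems(2) that])
    show "Ck_on k S (\<lambda>x. F x * frechet_derivative G (at x) w + frechet_derivative F (at x) w * G x)" for w
      using Suc.prems Ck_on_Suc_imp[OF Suc.prems(1)] Ck_on_Suc_imp[OF Suc.prems(2)]
      by (intro Ck_on_add[OF assms(1)] Suc.IH) auto
  qed
qed

lemma Ck_on_inverse:
  fixes F :: "'a::real_normed_vector \<Rightarrow> real"
  assumes "open S" "Ck_on k S F" "\<And>x. x \<in> S \<Longrightarrow> F x \<noteq> 0"
  shows "Ck_on k S (\<lambda>x. inverse (F x))"
  using assms(2)
proof (induction k)
  case 0
  then show ?case using assms(3) by (simp add: continuous_on_inverse)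
next
  case (Suc k)
  note IH = Suc.IH[OF Ck_on_Suc_imp[OF Suc.prems]]
  show ?case
  proof (rule Ck_on_SucI[OF assms(1)])
    show "((\<lambda>x. inverse (F x)) has_derivative (\<lambda>w. (-1) * (inverse (F x) * frechet_derivative F (at x) w * inverse (F x)))) (at x)"
      if "x \<in> S" for x
      using Deriv.has_derivative_inverse[OF assms(3)[OF that] Ck_on_has_derivative[OF Suc.prems that]] by simp
    show "Ck_on k S (\<lambda>x. (-1) * (inverse (F x) * frechet_derivative F (at x) w * inverse (F x)))" for w
      using Suc.prems by (intro Ck_on_mult[OF assms(1)] Ck_on_const IH) auto
  qed
qed

text \<open>Expanding the chain rule in a basis writes the derivative as a sum of products (Dg w
  \<bullet> b) * (Df b). The factor Df b is again a real function composed with g and falls under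
  the induction hypothesis.\<close>

lemma Ck_on_compose:
  fixes f :: "'b::euclidean_space \<Rightarrow> real" and g :: "'a::real_normed_vector \<Rightarrow> 'b"
  assumes "open S" "open T" "Ck_on k T f" "Ck_on k S g" "g ` S \<subseteq> T"
  shows "Ck_on k S (\<lambda>x. f (g x))"
  using assms(3,4)
proof (induction k arbitrary: f)
  case 0
  then show ?case using assms(5) by (auto intro: continuous_on_compose2)
next
  case (Suc k)
  let ?df = "\<lambda>x. frechet_derivative f (at (g x))" and ?dg = "\<lambda>x. frechet_derivative g (at x)"
  show ?case
  proof (rule Ck_on_SucI[OF assms(1)])
    fix x assume x: "x \<in> S"
    have f: "(f has_derivative ?df x) (at (g x))"
      using Ck_on_has_derivative[OF Suc.prems(1)] x assms(5) by blast
    have "((\<lambda>x. f (g x)) has_derivative (\<lambda>w. ?df x (?dg x w))) (at x)"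
      using has_derivative_compose[OF Ck_on_has_derivative[OF Suc.prems(2) x] f] .
    moreover have "?df x (?dg x w) = (\<Sum>b\<in>Basis. (?dg x w \<bullet> b) * ?df x b)" for w
    proof -
      have "linear (?df x)"
        using f has_derivative_linear by blast
      then have "?df x (\<Sum>b\<in>Basis. (?dg x w \<bullet> b) *\<^sub>R b) = (\<Sum>b\<in>Basis. (?dg x w \<bullet> b) *\<^sub>R ?df x b)"
        by (simp add: linear_sum linear_cmul)
      then show ?thesis
        by (simp add: euclidean_representation)
    qed
    ultimately show "((\<lambda>x. f (g x)) has_derivative (\<lambda>w. \<Sum>b\<in>Basis. (?dg x w \<bullet> b) * ?df x b)) (at x)"
      by simp
  next
    fix w
    have "Ck_on k S (\<lambda>x. ?df x b)" for b
      using Suc.IH[of "\<lambda>y. frechet_derivative f (at y) b"] Suc.prems Ck_on_Suc_imp[OF Suc.prems(2)] by simp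
    moreover have "Ck_on k S (\<lambda>x. ?dg x w \<bullet> b)" for b
      using Suc.prems(2) by (intro Ck_on_linear_compose[OF assms(1) bounded_linear_inner_left]) simp
    ultimately show "Ck_on k S (\<lambda>x. \<Sum>b\<in>Basis. (?dg x w \<bullet> b) * ?df x b)"
      by (intro Ck_on_sum[OF assms(1)] Ck_on_mult[OF assms(1)])
  qed
qed

lemma smooth_on_imp_continuous_on: "smooth_on S F \<Longrightarrow> continuous_on S F"
  unfolding smooth_on_def using Ck_on_imp_continuous_on by blast

lemma smooth_on_has_derivative:
  "smooth_on S F \<Longrightarrow> x \<in> S \<Longrightarrow> (F has_derivative frechet_derivative F (at x)) (at x)"
  unfolding smooth_on_def using Ck_on_has_derivative by blast

lemma smooth_on_derivative: "smooth_on S F \<Longrightarrow> smooth_on S (\<lambda>x. frechet_derivative F (at x) w)"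
  unfolding smooth_on_def by (metis Ck_on.simps(2))

lemma smooth_on_subset: "smooth_on S F \<Longrightarrow> T \<subseteq> S \<Longrightarrow> smooth_on T F"
  unfolding smooth_on_def using Ck_on_subset by blast

lemma smooth_on_local:
  assumes "\<And>x. x \<in> S \<Longrightarrow> \<exists>T. open T \<and> x \<in> T \<and> smooth_on T F"
  shows "smooth_on S F"
  unfolding smooth_on_def by (intro allI Ck_on_local) (use assms in \<open>unfold smooth_on_def, blast\<close>)

lemma smooth_on_cong:
  "open S \<Longrightarrow> (\<And>x. x \<in> S \<Longrightarrow> F x = G x) \<Longrightarrow> smooth_on S F \<Longrightarrow> smooth_on S G"
  unfolding smooth_on_def using Ck_on_cong by blast

lemma smooth_on_const: "smooth_on S (\<lambda>_. c)"
  by (simp add: smooth_on_def Ck_on_const)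

lemma smooth_on_mult:
  fixes F G :: "'a::real_normed_vector \<Rightarrow> real"
  shows "open S \<Longrightarrow> smooth_on S F \<Longrightarrow> smooth_on S G \<Longrightarrow> smooth_on S (\<lambda>x. F x * G x)"
  by (simp add: smooth_on_def Ck_on_mult)

lemma smooth_on_sum:
  "open S \<Longrightarrow> (\<And>i. i \<in> I \<Longrightarrow> smooth_on S (F i)) \<Longrightarrow> smooth_on S (\<lambda>x. \<Sum>i\<in>I. F i x)"
  by (simp add: smooth_on_def Ck_on_sum)

lemma smooth_on_divide:
  fixes F G :: "'a::real_normed_vector \<Rightarrow> real"
  shows "open S \<Longrightarrow> smooth_on S F \<Longrightarrow> smooth_on S G \<Longrightarrow> (\<And>x. x \<in> S \<Longrightarrow> G x \<noteq> 0) \<Longrightarrow> smooth_on S (\<lambda>x. F x / G x)"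
  unfolding divide_inverse by (simp add: smooth_on_def Ck_on_mult Ck_on_inverse)

lemma smooth_on_compose:
  fixes f :: "'b::euclidean_space \<Rightarrow> real" and g :: "'a::real_normed_vector \<Rightarrow> 'b"
  shows "open S \<Longrightarrow> open T \<Longrightarrow> smooth_on T f \<Longrightarrow> smooth_on S g \<Longrightarrow> g ` S \<subseteq> T \<Longrightarrow> smooth_on S (\<lambda>x. f (g x))"
  by (simp add: smooth_on_def Ck_on_compose)

section \<open>Bump functions\<close>

text \<open>The powers of \<open>t\<close> in the denominator make the family closed under differentiation.\<close>

definition flat_exp :: "nat \<Rightarrow> real \<Rightarrow> real" where
  "flat_exp m t = (if t \<le> 0 then 0 else exp (- (1 / t)) / t ^ m)"

text \<open>Substituting x = 1 / t turns the decay at 0 from the right into that of x^m / exp x at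
  infinity.\<close>

lemma flat_exp_tendsto_0: "(flat_exp m \<longlongrightarrow> 0) (at 0)"
proof (rule filterlim_split_at)
  have "((\<lambda>x. x ^ m / exp x) \<longlongrightarrow> (0::real)) at_top"
    by (rule tendsto_power_div_exp_0)
  then have "((\<lambda>t. inverse t ^ m / exp (inverse t)) \<longlongrightarrow> (0::real)) (at_right 0)"
    using filterlim_inverse_at_top_right by (rule filterlim_compose)
  then show "(flat_exp m \<longlongrightarrow> 0) (at_right 0)"
    by (rule Lim_transform_eventually)
      (auto simp: flat_exp_def eventually_at_filter exp_minus field_simps inverse_eq_divide)
  show "(flat_exp m \<longlongrightarrow> 0) (at_left 0)"
    by (rule Lim_transform_eventually[OF tendsto_const])
      (auto simp: flat_exp_def eventually_at_filter)
qed

lemma has_real_derivative_flat_exp: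
  "(flat_exp m has_real_derivative flat_exp (m + 2) t - real m * flat_exp (m + 1) t) (at t)"
proof (cases t "0 :: real" rule: linorder_cases)
  case less
  have "((\<lambda>_. 0) has_real_derivative 0) (at t)"
    by simp
  then have "(flat_exp m has_real_derivative 0) (at t)"
    by (rule has_field_derivative_transform_within_open[of _ _ _ "{..<0}"]) (use less in \<open>auto simp: flat_exp_def\<close>)
  then show ?thesis
    using less by (simp add: flat_exp_def)
next
  case equal
  \<comment> \<open>The difference quotient at 0 is \<open>flat_exp (Suc m)\<close>.\<close>
  have "((\<lambda>h. (flat_exp m (0 + h) - flat_exp m 0) / h) \<longlongrightarrow> 0) (at 0)"
    by (rule Lim_transform_eventually[OF flat_exp_tendsto_0[of "Suc m"]])
      (auto simp: flat_exp_def eventually_at_filter)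
  then have "(flat_exp m has_real_derivative 0) (at 0)"
    by (simp add: DERIV_def)
  then show ?thesis
    using equal by (simp add: flat_exp_def)
next
  case greater
  have "((\<lambda>t. exp (- (1 / t)) / t ^ m) has_real_derivative
      (exp (- (1 / t)) * (1 / t\<^sup>2) * t ^ m - exp (- (1 / t)) * (real m * t ^ (m - 1))) / (t ^ m * t ^ m)) (at t)"
    using greater by (auto intro!: derivative_eq_intros simp: power2_eq_square divide_simps)
  also have "(exp (- (1 / t)) * (1 / t\<^sup>2) * t ^ m - exp (- (1 / t)) * (real m * t ^ (m - 1))) / (t ^ m * t ^ m)
      = flat_exp (m + 2) t - real m * flat_exp (m + 1) t"
    using greater by (cases m) (auto simp: flat_exp_def field_simps power2_eq_square)
  finally show ?thesis
    by (rule has_field_derivative_transform_within_open[of _ _ _ "{0<..}"]) (use greater in \<open>auto simp: flat_exp_def\<close>)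
qed

lemma Ck_on_flat_exp: "Ck_on k UNIV (flat_exp m)"
proof (induction k arbitrary: m)
  case 0
  have "isCont (flat_exp m) t" for t
    using has_real_derivative_flat_exp by (rule DERIV_isCont)
  then show ?case
    by (simp add: continuous_at_imp_continuous_on)
next
  case (Suc k)
  show ?case
  proof (rule Ck_on_SucI)
    show "(flat_exp m has_derivative (\<lambda>w. w * (flat_exp (m + 2) t + (- real m) * flat_exp (m + 1) t))) (at t)" for t
      using has_real_derivative_flat_exp[of m t] unfolding has_field_derivative_def
      by (rule has_derivative_eq_rhs) (auto simp: fun_eq_iff)
    show "Ck_on k UNIV (\<lambda>t. w * (flat_exp (m + 2) t + (- real m) * flat_exp (m + 1) t))" for w
      by (intro Ck_on_mult Ck_on_add Ck_on_const Suc) auto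
  qed auto
qed

text \<open>The squared norm keeps the function smooth at the centre.\<close>

definition bump :: "'a::euclidean_space \<Rightarrow> real \<Rightarrow> 'a \<Rightarrow> real" where
  "bump c r y = flat_exp 0 (r\<^sup>2 - (norm (y - c))\<^sup>2)"

lemma bump_nonneg: "bump c r y \<ge> 0"
  by (simp add: bump_def flat_exp_def)

lemma bump_zero: "r \<ge> 0 \<Longrightarrow> norm (y - c) \<ge> r \<Longrightarrow> bump c r y = 0"
  by (simp add: bump_def flat_exp_def power_mono)

lemma smooth_on_bump: "smooth_on UNIV (bump c r)"
  unfolding smooth_on_def
proof
  fix k
  \<comment> \<open>Written as a polynomial in the coordinates, with differences as sums, so that
    the closure rules for sums and products apply.\<close>
  have *: "r\<^sup>2 - (norm (y - c))\<^sup>2 = r\<^sup>2 + (\<Sum>b\<in>Basis. (-1) * ((y \<bullet> b + (- (c \<bullet> b))) * (y \<bullet> b + (- (c \<bullet> b)))))" for y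
    unfolding power2_norm_eq_inner by (subst euclidean_inner) (simp add: inner_diff_left sum_negf)
  have "Ck_on k UNIV (\<lambda>y. r\<^sup>2 - (norm (y - c))\<^sup>2)"
    unfolding * by (intro Ck_on_add Ck_on_sum Ck_on_mult Ck_on_const Ck_on_bounded_linear bounded_linear_inner_left) auto
  then show "Ck_on k UNIV (bump c r)"
    unfolding bump_def by (rule Ck_on_compose[OF open_UNIV open_UNIV Ck_on_flat_exp]) simp
qed

section \<open>Change of variables\<close>

text \<open>Absolute gauge integrability refers to the Lebesgue completion; for a Borel integrand it
  agrees with integrability over \<open>lborel\<close>.\<close>

lemma absolutely_integrable_on_eq_integrable_lborel:
  fixes \<theta> :: "real ^ 'n::finite \<Rightarrow> real"
  assumes "(\<lambda>y. indicator T y * \<theta> y) \<in> borel_measurable borel"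
  shows "\<theta> absolutely_integrable_on T \<longleftrightarrow> integrable lborel (\<lambda>y. indicator T y * \<theta> y)"
    and "\<theta> absolutely_integrable_on T \<Longrightarrow> integral T \<theta> = integral\<^sup>L lborel (\<lambda>y. indicator T y * \<theta> y)"
proof -
  show "\<theta> absolutely_integrable_on T \<longleftrightarrow> integrable lborel (\<lambda>y. indicator T y * \<theta> y)"
    unfolding set_integrable_def using assms by (simp add: integrable_completion)
  show "integral T \<theta> = integral\<^sup>L lborel (\<lambda>y. indicator T y * \<theta> y)" if "\<theta> absolutely_integrable_on T"
    using set_lebesgue_integral_eq_integral(2)[OF that] assms
    by (simp add: set_lebesgue_integral_def integral_completion)
qed

lemma nn_integral_nonintegrable:
  fixes h :: "'a \<Rightarrow> real"
  assumes "h \<in> borel_measurable M" "\<And>x. h x \<ge> 0" "\<not> integrable M h"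
  shows "(\<integral>\<^sup>+x. ennreal (h x) \<partial>M) = \<infinity>"
proof (rule ccontr)
  assume "(\<integral>\<^sup>+x. ennreal (h x) \<partial>M) \<noteq> \<infinity>"
  then have "(\<integral>\<^sup>+x. ennreal (h x) \<partial>M) < \<infinity>"
    by (simp add: less_top[symmetric])
  then have "integrable M h"
    using assms(1,2) by (intro integrableI_nonneg) auto
  then show False
    using assms(3) by blast
qed

text \<open>The substitution theorem for signed integrals gives equal values and equivalent
  integrability. For a nonnegative integrand this settles both cases: a common finite value, or
  \<infinity> on both sides.\<close>

lemma nn_integral_change_of_variables_wellorder:
  fixes F :: "real ^ 'm::{finite,wellorder} \<Rightarrow> real ^ 'm::_" and \<theta> :: "real ^ 'm::_ \<Rightarrow> real"
  assumes S: "S \<in> sets borel"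
    and der: "\<And>x. x \<in> S \<Longrightarrow> (F has_derivative D x) (at x)"
    and inj: "inj_on F S"
    and m1: "(\<lambda>y. indicator (F ` S) y * \<theta> y) \<in> borel_measurable borel"
    and m2: "(\<lambda>x. indicator S x * (\<bar>det (matrix (D x))\<bar> * \<theta> (F x))) \<in> borel_measurable borel"
    and pos: "\<And>x. x \<in> S \<Longrightarrow> \<theta> (F x) \<ge> 0"
  shows "(\<integral>\<^sup>+y. ennreal (indicator (F ` S) y * \<theta> y) \<partial>lborel) =
         (\<integral>\<^sup>+x. ennreal (indicator S x * (\<bar>det (matrix (D x))\<bar> * \<theta> (F x))) \<partial>lborel)"
    (is "nn_integral _ (\<lambda>y. ennreal (?b y)) = nn_integral _ (\<lambda>x. ennreal (?a x))")
proof -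
  let ?J = "\<lambda>x. \<bar>det (matrix (D x))\<bar> * \<theta> (F x)"
  have SL: "S \<in> sets lebesgue"
    using S by simp
  have derw: "(F has_derivative D x) (at x within S)" if "x \<in> S" for x
    using der[OF that] by (rule has_derivative_at_withinI)
  \<comment> \<open>\<open>vec\<close> turns the real integrand into one with values in
    \<open>real ^ 1\<close>, the form in which the substitution theorem takes it.\<close>
  have change: "(?J absolutely_integrable_on S \<and> integral S ?J = r) \<longleftrightarrow>
      (\<theta> absolutely_integrable_on (F ` S) \<and> integral (F ` S) \<theta> = r)" for r
    using has_absolute_integral_change_of_variables[OF SL derw inj, of "\<lambda>y. vec (\<theta> y) :: real ^ 1" "vec r"]
    unfolding absolutely_integrable_on_1_iff integral_on_1_eq
    by (auto simp: o_def)
  have a: "?a x \<ge> 0" for x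
    using pos by (simp add: indicator_def)
  have b: "?b x \<ge> 0" for x
    using pos by (auto simp: indicator_def)
  have a_iff: "?J absolutely_integrable_on S \<longleftrightarrow> integrable lborel ?a"
    and b_iff: "\<theta> absolutely_integrable_on (F ` S) \<longleftrightarrow> integrable lborel ?b"
    by (rule absolutely_integrable_on_eq_integrable_lborel[OF m2] absolutely_integrable_on_eq_integrable_lborel[OF m1])+
  have iff: "integrable lborel ?a \<longleftrightarrow> integrable lborel ?b"
    using change[of "integral S ?J"] change[of "integral (F ` S) \<theta>"] a_iff b_iff by blast
  show ?thesis
  proof (cases "integrable lborel ?b")
    case True
    then have "integral S ?J = integral (F ` S) \<theta>"
      using change[of "integral (F ` S) \<theta>"] b_iff by blast
    then have "integral\<^sup>L lborel ?a = integral\<^sup>L lborel ?b"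
      using True iff a_iff b_iff absolutely_integrable_on_eq_integrable_lborel(2)[OF m2]
        absolutely_integrable_on_eq_integrable_lborel(2)[OF m1] by simp
    then show ?thesis
      using True iff a b by (simp add: nn_integral_eq_integral)
  next
    case False
    have "(\<integral>\<^sup>+y. ennreal (?b y) \<partial>lborel) = \<infinity>"
      using False m1 b by (intro nn_integral_nonintegrable) auto
    moreover have "(\<integral>\<^sup>+y. ennreal (?a y) \<partial>lborel) = \<infinity>"
      using False iff m2 a by (intro nn_integral_nonintegrable) auto
    ultimately show ?thesis
      by simp
  qed
qed

text \<open>The library states the change of variables for wellordered index types only, so an
  arbitrary finite index type is replaced by a wellordered copy.\<close>

typedef ('n::finite) index = "{..<CARD('n)} :: nat set"
  using zero_less_card_finite by blast

instance index :: (finite) finite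
proof
  have "inj (Rep_index :: 'a index \<Rightarrow> nat)"
    by (simp add: inj_def Rep_index_inject)
  moreover have "range (Rep_index :: 'a index \<Rightarrow> nat) \<subseteq> {..<CARD('a)}"
    using Rep_index by blast
  ultimately show "finite (UNIV :: 'a index set)"
    by (metis finite_imageD finite_lessThan finite_subset)
qed

instantiation index :: (finite) wellorder
begin

definition "x \<le> y \<longleftrightarrow> Rep_index x \<le> Rep_index y"
definition "x < y \<longleftrightarrow> Rep_index x < Rep_index y"

instance
proof
  fix P :: "'a index \<Rightarrow> bool" and a
  assume step: "\<And>x. (\<And>y. y < x \<Longrightarrow> P y) \<Longrightarrow> P x"
  show "P a"
  proof (induction "Rep_index a" arbitrary: a rule: less_induct)
    case less
    then show ?case
      using step less_index_def by blast
  qed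
qed (auto simp: less_eq_index_def less_index_def Rep_index_inject)

end

lemma card_index: "CARD('n index) = CARD('n::finite)"
  using type_definition.card[OF type_definition_index] by simp

text \<open>Conjugation by \<open>e\<close> is a bijection between the permutations of the two index
  types that preserves signs and reorders the factors of each product.\<close>

lemma det_reindex:
  fixes A :: "real ^ 'n::finite ^ 'n" and e :: "'k::finite \<Rightarrow> 'n"
  assumes "bij e"
  shows "det (\<chi> i j. A $ e i $ e j) = det A"
proof -
  have e: "inv_into UNIV e (e i) = i" "e (inv_into UNIV e j) = j" for i j
    using assms by (simp_all add: bij_is_inj bij_is_surj surj_f_inv_f)
  have e': "bij (inv_into UNIV e)"
    using assms by (rule bij_imp_bij_inv)
  have inj_inv: "inj (inv_into UNIV e)" and inj_e: "inj e"
    using e' assms bij_is_inj by blast+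
  have perm: "(e \<circ> p \<circ> inv_into UNIV e) permutes UNIV" if "p permutes UNIV" for p
    using permutes_bij[OF that] assms e' by (intro bij_imp_permutes bij_comp) auto
  have perm': "(inv_into UNIV e \<circ> p \<circ> e) permutes UNIV" if "p permutes UNIV" for p
    using permutes_bij[OF that] assms e' by (intro bij_imp_permutes bij_comp) auto
  have sgn: "sign (e \<circ> p \<circ> inv_into UNIV e) = sign p" if "p permutes UNIV" for p
  proof -
    have "map_permutation UNIV e p = e \<circ> p \<circ> inv_into UNIV e"
      using assms by (auto simp: map_permutation_def restrict_id_def bij_is_surj)
    then show ?thesis
      using sign_map_permutation[OF inj_e that] by simp
  qed
  show ?thesis
    unfolding det_def
  proof (rule sum.reindex_bij_witness[where i = "\<lambda>q. inv_into UNIV e \<circ> q \<circ> e" and j = "\<lambda>p. e \<circ> p \<circ> inv_into UNIV e"])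
    fix p :: "'k \<Rightarrow> 'k" assume p: "p \<in> {p. p permutes UNIV}"
    have "(\<Prod>j\<in>UNIV. A $ j $ (e \<circ> p \<circ> inv_into UNIV e) j) = (\<Prod>i\<in>UNIV. A $ e i $ (e \<circ> p \<circ> inv_into UNIV e) (e i))"
      using prod.reindex_bij_betw[OF assms, of "\<lambda>j. A $ j $ (e \<circ> p \<circ> inv_into UNIV e) j"] by simp
    then show "of_int (sign (e \<circ> p \<circ> inv_into UNIV e)) * (\<Prod>i\<in>UNIV. A $ i $ (e \<circ> p \<circ> inv_into UNIV e) i) =
        of_int (sign p) * (\<Prod>i\<in>UNIV. (\<chi> i j. A $ e i $ e j) $ i $ p i)"
      using p sgn by (simp add: e)
  qed (auto simp: e fun_eq_iff intro: perm perm')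
qed

definition reindex :: "('k \<Rightarrow> 'n) \<Rightarrow> real ^ 'n::finite \<Rightarrow> real ^ 'k::finite" where
  "reindex e v = (\<chi> i. v $ e i)"

lemma reindex_nth [simp]: "reindex e v $ i = v $ e i"
  by (simp add: reindex_def)

lemma linear_reindex: "linear (reindex e)"
  by (rule linearI) (simp_all add: vec_eq_iff)

lemma bounded_linear_reindex: "bounded_linear (reindex e)"
  using linear_reindex by (simp add: linear_conv_bounded_linear)

lemma continuous_on_reindex: "continuous_on S (reindex e)"
  using bounded_linear_reindex by (rule linear_continuous_on)

lemma reindex_inv: "bij e \<Longrightarrow> reindex (inv_into UNIV e) (reindex e v) = v" "bij e \<Longrightarrow> reindex e (reindex (inv_into UNIV e) w) = w"
  by (simp_all add: vec_eq_iff bij_is_inj bij_is_surj surj_f_inv_f)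

lemma borel_measurable_reindex: "reindex e \<in> borel \<rightarrow>\<^sub>M borel"
  by (intro borel_measurable_continuous_onI continuous_on_reindex)

lemma emeasure_lborel_box_cart:
  fixes l u :: "real ^ 'n::finite"
  assumes "\<And>i. l $ i \<le> u $ i"
  shows "emeasure lborel (box l u) = ennreal (\<Prod>i\<in>UNIV. u $ i - l $ i)"
proof -
  have "(\<Prod>b\<in>Basis. (u - l) \<bullet> b) = (\<Prod>i\<in>UNIV. (u - l) \<bullet> axis i 1)"
    unfolding Basis_vec_def by (simp add: prod.reindex inj_on_def axis_eq_axis UNION_singleton_eq_range)
  moreover have "l \<bullet> b \<le> u \<bullet> b" if "b \<in> Basis" for b
    using that assms by (auto simp: Basis_vec_def inner_axis)
  ultimately show ?thesis
    by (simp add: emeasure_lborel_box_eq inner_axis)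
qed

text \<open>Renaming coordinates keeps the side lengths of boxes, and Lebesgue measure is determined
  by boxes.\<close>

lemma lborel_reindex:
  fixes e :: "'k::finite \<Rightarrow> 'n::finite"
  assumes "bij e"
  shows "distr lborel borel (reindex e) = (lborel :: (real ^ 'k) measure)"
proof (rule lborel_eqI[symmetric])
  fix l u :: "real ^ 'k" assume le: "\<And>b. b \<in> Basis \<Longrightarrow> l \<bullet> b \<le> u \<bullet> b"
  have le': "l $ i \<le> u $ i" for i
    using le[of "axis i 1"] by (auto simp: inner_axis Basis_vec_def)
  have ie: "e (inv_into UNIV e j) = j" "inv_into UNIV e (e i) = i" for i j
    using assms by (simp_all add: bij_is_inj bij_is_surj surj_f_inv_f)
  have "reindex e -` box l u = box (reindex (inv_into UNIV e) l) (reindex (inv_into UNIV e) u)"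
    unfolding mem_box_cart set_eq_iff vimage_eq reindex_nth using ie by metis
  then have "emeasure (distr lborel borel (reindex e)) (box l u) = (\<Prod>j\<in>UNIV. u $ inv_into UNIV e j - l $ inv_into UNIV e j)"
    using le' by (simp add: emeasure_distr borel_measurable_reindex emeasure_lborel_box_cart)
  also have "(\<Prod>j\<in>UNIV. u $ inv_into UNIV e j - l $ inv_into UNIV e j) = (\<Prod>i\<in>UNIV. u $ i - l $ i)"
    using assms by (intro prod.reindex_bij_betw bij_imp_bij_inv)
  also have "ennreal \<dots> = emeasure lborel (box l u)"
    using le' by (simp add: emeasure_lborel_box_cart)
  also have "\<dots> = (\<Prod>b\<in>Basis. (u - l) \<bullet> b)"
    using le by (simp add: emeasure_lborel_box_eq)
  finally show "emeasure (distr lborel borel (reindex e)) (box l u) = (\<Prod>b\<in>Basis. (u - l) \<bullet> b)" .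
qed simp

lemma nn_integral_lborel_reindex:
  fixes e :: "'k::finite \<Rightarrow> 'n::finite"
  assumes "bij e" "h \<in> borel_measurable borel"
  shows "(\<integral>\<^sup>+w. h w \<partial>lborel) = (\<integral>\<^sup>+v. h (reindex e v) \<partial>lborel)"
  using assms by (subst lborel_reindex[OF assms(1), symmetric]) (simp add: nn_integral_distr borel_measurable_reindex)

lemma det_matrix_reindex:
  fixes e :: "'k::finite \<Rightarrow> 'n::finite" and D :: "real ^ 'n \<Rightarrow> real ^ 'n"
  assumes "bij e"
  shows "det (matrix (\<lambda>w. reindex e (D (reindex (inv_into UNIV e) w)))) = det (matrix D)"
proof -
  have "reindex (inv_into UNIV e) (axis j 1) = axis (e j) 1" for j
    using assms by (auto simp: vec_eq_iff axis_def bij_is_inj bij_is_surj surj_f_inv_f bij_inv_eq_iff)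
  then have "matrix (\<lambda>w. reindex e (D (reindex (inv_into UNIV e) w))) = (\<chi> i j. matrix D $ e i $ e j)"
    unfolding matrix_def by (simp add: fun_eq_iff)
  then show ?thesis
    using det_reindex[OF assms] by simp
qed

text \<open>Conjugating \<open>F\<close> with the renaming of coordinates changes neither the
  integrals nor the Jacobian determinant.\<close>

theorem nn_integral_change_of_variables:
  fixes F :: "real ^ 'n::finite \<Rightarrow> real ^ 'n" and \<theta> :: "real ^ 'n \<Rightarrow> real"
  assumes S: "S \<in> sets borel"
    and der: "\<And>x. x \<in> S \<Longrightarrow> (F has_derivative D x) (at x)"
    and inj: "inj_on F S"
    and m1: "(\<lambda>y. indicator (F ` S) y * \<theta> y) \<in> borel_measurable borel"
    and m2: "(\<lambda>x. indicator S x * (\<bar>det (matrix (D x))\<bar> * \<theta> (F x))) \<in> borel_measurable borel"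
    and pos: "\<And>x. x \<in> S \<Longrightarrow> \<theta> (F x) \<ge> 0"
  shows "(\<integral>\<^sup>+y. ennreal (indicator (F ` S) y * \<theta> y) \<partial>lborel) =
         (\<integral>\<^sup>+x. ennreal (indicator S x * (\<bar>det (matrix (D x))\<bar> * \<theta> (F x))) \<partial>lborel)"
proof -
  obtain e :: "'n index \<Rightarrow> 'n" where e: "bij e"
    using finite_same_card_bij[of "UNIV :: 'n index set" "UNIV :: 'n set"] card_index by auto
  let ?r = "reindex e" and ?s = "reindex (inv_into UNIV e)"
  note rs = reindex_inv[OF e]
  have bs: "bij (inv_into UNIV e)"
    using e by (rule bij_imp_bij_inv)
  let ?F = "\<lambda>w. ?r (F (?s w))" and ?D = "\<lambda>w u. ?r (D (?s w) (?s u))" and ?\<theta> = "\<lambda>w. \<theta> (?s w)"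
  let ?S = "?s -` S"
  have mem: "w \<in> ?F ` ?S \<longleftrightarrow> ?s w \<in> F ` S" for w
  proof
    assume "?s w \<in> F ` S"
    then obtain x where x: "x \<in> S" "?s w = F x" by blast
    have "w = ?r (?s w)" "?s (?r x) = x"
      by (simp_all only: rs)
    then have "w = ?F (?r x)" "?r x \<in> ?S"
      using x by simp_all
    then show "w \<in> ?F ` ?S" by blast
  qed (use rs in auto)
  have detD: "det (matrix (?D w)) = det (matrix (D (?s w)))" for w
    using det_matrix_reindex[OF e, of "D (?s w)"] .
  have ind1: "indicator (?F ` ?S) w = (indicator (F ` S) (?s w) :: real)" for w
    using mem[of w] by (simp add: indicator_def)
  have ind2: "indicator ?S w = (indicator S (?s w) :: real)" for w
    by (simp add: indicator_def)
  have meas1: "(\<lambda>w. indicator (?F ` ?S) w * ?\<theta> w) \<in> borel_measurable borel"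
    unfolding ind1 using measurable_compose[OF borel_measurable_reindex m1] .
  have meas2: "(\<lambda>w. indicator ?S w * (\<bar>det (matrix (?D w))\<bar> * ?\<theta> (?F w))) \<in> borel_measurable borel"
    unfolding ind2 detD rs using measurable_compose[OF borel_measurable_reindex m2] .
  have "(\<integral>\<^sup>+y. ennreal (indicator (F ` S) y * \<theta> y) \<partial>lborel) =
      (\<integral>\<^sup>+w. ennreal (indicator (?F ` ?S) w * ?\<theta> w) \<partial>lborel)"
    unfolding ind1 by (rule nn_integral_lborel_reindex[OF bs]) (use m1 in measurable)
  also have "\<dots> = (\<integral>\<^sup>+w. ennreal (indicator ?S w * (\<bar>det (matrix (?D w))\<bar> * ?\<theta> (?F w))) \<partial>lborel)"
  proof (rule nn_integral_change_of_variables_wellorder[OF _ _ _ meas1 meas2])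
    show "?S \<in> sets borel"
      using measurable_sets[OF borel_measurable_reindex S] by simp
    show "(?F has_derivative ?D w) (at w)" if "w \<in> ?S" for w
    proof -
      have "(F has_derivative D (?s w)) (at (?s w))"
        using der that by simp
      from has_derivative_compose[OF bounded_linear_imp_has_derivative[OF bounded_linear_reindex] this]
      show ?thesis
        by (rule bounded_linear.has_derivative[OF bounded_linear_reindex])
    qed
    show "inj_on ?F ?S"
      using inj rs unfolding inj_on_def by (metis vimage_eq)
    show "?\<theta> (?F w) \<ge> 0" if "w \<in> ?S" for w
      using pos that by (simp add: rs)
  qed
  also have "\<dots> = (\<integral>\<^sup>+x. ennreal (indicator S x * (\<bar>det (matrix (D x))\<bar> * \<theta> (F x))) \<partial>lborel)"
    unfolding ind2 detD rs by (rule nn_integral_lborel_reindex[OF bs, symmetric]) (use m2 in measurable)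
  finally show ?thesis .
qed

section \<open>Continuous families of inner products\<close>

text \<open>A Riemannian metric read in coordinates, with continuity as the only regularity
  retained; compactness bounds and measurability rest on it.\<close>

definition metric_on :: "'a::euclidean_space set \<Rightarrow> ('a \<Rightarrow> 'a \<Rightarrow> 'a \<Rightarrow> real) \<Rightarrow> bool" where
  "metric_on B m \<longleftrightarrow>
     (\<forall>y\<in>B. bilinear (m y) \<and> (\<forall>u w. m y u w = m y w u) \<and> (\<forall>u. u \<noteq> 0 \<longrightarrow> m y u u > 0)) \<and>
     (\<forall>u w. continuous_on B (\<lambda>y. m y u w))"

lemma metric_on_subset: "metric_on B m \<Longrightarrow> B' \<subseteq> B \<Longrightarrow> metric_on B' m"
  unfolding metric_on_def by (meson continuous_on_subset subsetD)

lemma bilinear_expand: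
  fixes h :: "'a::euclidean_space \<Rightarrow> 'a \<Rightarrow> real"
  assumes "bilinear h"
  shows "h u w = (\<Sum>b\<in>Basis. \<Sum>b'\<in>Basis. (u \<bullet> b) * (w \<bullet> b') * h b b')"
proof -
  have "h u w = h (\<Sum>b\<in>Basis. (u \<bullet> b) *\<^sub>R b) (\<Sum>b'\<in>Basis. (w \<bullet> b') *\<^sub>R b')"
    by (simp add: euclidean_representation)
  also have "\<dots> = (\<Sum>(b, b')\<in>Basis \<times> Basis. h ((u \<bullet> b) *\<^sub>R b) ((w \<bullet> b') *\<^sub>R b'))"
    by (rule bilinear_sum[OF assms])
  also have "\<dots> = (\<Sum>b\<in>Basis. \<Sum>b'\<in>Basis. (u \<bullet> b) * (w \<bullet> b') * h b b')"
    by (simp add: sum.cartesian_product[symmetric] bilinear_lmul[OF assms] bilinear_rmul[OF assms] mult_ac)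
  finally show ?thesis .
qed

lemma bilinear_scale_square: "bilinear h \<Longrightarrow> h (r *\<^sub>R u) (r *\<^sub>R u) = r\<^sup>2 * (h u u :: real)"
  by (simp add: bilinear_lmul bilinear_rmul power2_eq_square)

text \<open>Continuity for fixed vectors becomes joint continuity after expanding the form in a
  basis, where finitely many continuous coefficients remain.\<close>

lemma metric_on_continuous_on:
  assumes "metric_on B m" "continuous_on T e" "e ` T \<subseteq> B" "continuous_on T u" "continuous_on T w"
  shows "continuous_on T (\<lambda>t. m (e t) (u t) (w t))"
proof -
  have "continuous_on T (\<lambda>t. m (e t) b b')" for b b'
    using assms unfolding metric_on_def by (auto intro: continuous_on_compose2[of B "\<lambda>y. m y b b'"])
  then have "continuous_on T (\<lambda>t. \<Sum>b\<in>Basis. \<Sum>b'\<in>Basis. (u t \<bullet> b) * (w t \<bullet> b') * m (e t) b b')"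
    using assms by (intro continuous_intros)
  moreover have "m (e t) (u t) (w t) = (\<Sum>b\<in>Basis. \<Sum>b'\<in>Basis. (u t \<bullet> b) * (w t \<bullet> b') * m (e t) b b')"
    if "t \<in> T" for t
    using assms that unfolding metric_on_def by (intro bilinear_expand) blast
  ultimately show ?thesis
    by (simp cong: continuous_on_cong_simp)
qed

lemma metric_on_pos: "metric_on B m \<Longrightarrow> y \<in> B \<Longrightarrow> u \<noteq> 0 \<Longrightarrow> m y u u > 0"
  unfolding metric_on_def by blast

text \<open>Extreme values over the compact product of \<open>K\<close> with the unit sphere,
  extended to all vectors by homogeneity.\<close>

lemma metric_on_bounds:
  fixes m :: "'a::euclidean_space \<Rightarrow> 'a \<Rightarrow> 'a \<Rightarrow> real"
  assumes "metric_on K m" "compact K"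
  shows "\<exists>\<mu>>0. \<forall>y\<in>K. \<forall>w. \<mu> * norm w \<le> sqrt (m y w w)"
    and "\<exists>\<Lambda>>0. \<forall>y\<in>K. \<forall>w. sqrt (m y w w) \<le> \<Lambda> * norm w"
proof -
  let ?S = "K \<times> sphere (0::'a) 1" and ?q = "\<lambda>z. sqrt (m (fst z) (snd z) (snd z))"
  have comp: "compact ?S"
    using assms(2) by (intro compact_Times) auto
  have cont: "continuous_on ?S ?q"
    by (intro continuous_on_real_sqrt metric_on_continuous_on[OF assms(1)] continuous_intros) auto
  have pos: "?q z > 0" if "z \<in> ?S" for z
  proof -
    have "fst z \<in> K" "snd z \<noteq> 0"
      using that by auto
    then show ?thesis
      using metric_on_pos[OF assms(1)] by simp
  qed
  have scale: "sqrt (m y w w) = norm w * ?q (y, w /\<^sub>R norm w)" "(y, w /\<^sub>R norm w) \<in> ?S"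
    if "y \<in> K" "w \<noteq> 0" for y w
  proof -
    have "bilinear (m y)"
      using assms(1) that unfolding metric_on_def by blast
    from bilinear_scale_square[OF this, of "norm w" "w /\<^sub>R norm w"]
    show "sqrt (m y w w) = norm w * ?q (y, w /\<^sub>R norm w)"
      using that by (simp add: real_sqrt_mult)
  qed (use that in auto)
  have zero: "m y 0 0 = 0" if "y \<in> K" for y
    using assms(1) that unfolding metric_on_def by (blast intro: bilinear_lzero)
  show "\<exists>\<mu>>0. \<forall>y\<in>K. \<forall>w. \<mu> * norm w \<le> sqrt (m y w w)"
  proof (cases "?S = {}")
    case True
    \<comment> \<open>A Euclidean space has a nonempty basis, so the sphere is not the factor that
      makes the product empty.\<close>
    then have "K = {}"
      using scale(2)[of _ "SOME b. b \<in> Basis"] nonzero_Basis some_in_eq[of Basis] by fastforce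
    then show ?thesis by (intro exI[of _ 1]) auto
  next
    case False
    then obtain z where z: "z \<in> ?S" "\<And>z'. z' \<in> ?S \<Longrightarrow> ?q z \<le> ?q z'"
      using continuous_attains_inf[OF comp _ cont] by blast
    have "?q z * norm w \<le> sqrt (m y w w)" if "y \<in> K" for y w
    proof (cases "w = 0")
      case False
      then show ?thesis
        using z(2)[OF scale(2)[OF that False]] scale(1)[OF that False] by (metis mult.commute mult_left_mono norm_ge_zero)
    qed (simp add: zero that)
    then show ?thesis
      using pos[OF z(1)] by blast
  qed
  show "\<exists>\<Lambda>>0. \<forall>y\<in>K. \<forall>w. sqrt (m y w w) \<le> \<Lambda> * norm w"
  proof (cases "?S = {}")
    case True
    then have "K = {}"
      using scale(2)[of _ "SOME b. b \<in> Basis"] nonzero_Basis some_in_eq[of Basis] by fastforce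
    then show ?thesis by (intro exI[of _ 1]) auto
  next
    case False
    then obtain z where z: "z \<in> ?S" "\<And>z'. z' \<in> ?S \<Longrightarrow> ?q z' \<le> ?q z"
      using continuous_attains_sup[OF comp _ cont] by blast
    have "sqrt (m y w w) \<le> ?q z * norm w" if "y \<in> K" for y w
    proof (cases "w = 0")
      case False
      then show ?thesis
        using z(2)[OF scale(2)[OF that False]] scale(1)[OF that False] by (metis mult.commute mult_left_mono norm_ge_zero)
    qed (simp add: zero that)
    then show ?thesis
      using pos[OF z(1)] by blast
  qed
qed

text \<open>The partial derivatives are bounded on \<open>K\<close>, and there the metric dominates
  the Euclidean norm. A bound by the metric length of the vector is what
  \<open>gradient_norm_le\<close> asks for.\<close>

lemma derivative_bound:
  fixes \<beta> :: "'a::euclidean_space \<Rightarrow> real"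
  assumes m: "metric_on K m" "compact K" and \<beta>: "smooth_on UNIV \<beta>" "\<And>y. y \<notin> K \<Longrightarrow> \<beta> y = 0"
  shows "\<exists>G\<ge>0. \<forall>y\<in>K. \<forall>w. \<bar>frechet_derivative \<beta> (at y) w\<bar> \<le> G * sqrt (m y w w)"
proof -
  obtain \<mu> where \<mu>: "\<mu> > 0" "\<And>y w. y \<in> K \<Longrightarrow> \<mu> * norm w \<le> sqrt (m y w w)"
    using metric_on_bounds(1)[OF m] by blast
  let ?d = "\<lambda>y w. frechet_derivative \<beta> (at y) w"
  have "continuous_on K (\<lambda>y. \<Sum>b\<in>Basis. \<bar>?d y b\<bar>)"
    using smooth_on_imp_continuous_on[OF smooth_on_derivative[OF \<beta>(1)]]
    by (intro continuous_intros) (auto intro: continuous_on_subset)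
  then have "bounded ((\<lambda>y. \<Sum>b\<in>Basis. \<bar>?d y b\<bar>) ` K)"
    using m(2) compact_continuous_image compact_imp_bounded by blast
  then obtain L where L: "L > 0" "\<And>y. y \<in> K \<Longrightarrow> (\<Sum>b\<in>Basis. \<bar>?d y b\<bar>) \<le> L"
    unfolding bounded_pos by (auto simp: sum_nonneg)
  have "\<bar>?d y w\<bar> \<le> (L / \<mu>) * sqrt (m y w w)" if y: "y \<in> K" for y w
  proof -
    have lin: "linear (?d y)"
      using smooth_on_has_derivative[OF \<beta>(1)] has_derivative_linear by blast
    have "?d y w = ?d y (\<Sum>b\<in>Basis. (w \<bullet> b) *\<^sub>R b)"
      by (simp add: euclidean_representation)
    also have "\<dots> = (\<Sum>b\<in>Basis. (w \<bullet> b) * ?d y b)"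
      using lin by (simp add: linear_sum linear_cmul)
    finally have "\<bar>?d y w\<bar> \<le> (\<Sum>b\<in>Basis. \<bar>(w \<bullet> b) * ?d y b\<bar>)"
      by (simp add: sum_abs)
    also have "\<dots> \<le> (\<Sum>b\<in>Basis. norm w * \<bar>?d y b\<bar>)"
      by (intro sum_mono) (simp add: abs_mult Basis_le_norm mult_right_mono)
    also have "\<dots> \<le> norm w * L"
      using L(2)[OF y] by (simp add: sum_distrib_left[symmetric] mult_left_mono)
    also have "\<dots> = (L / \<mu>) * (\<mu> * norm w)"
      using \<mu>(1) by simp
    also have "\<dots> \<le> (L / \<mu>) * sqrt (m y w w)"
      using \<mu> L(1) y by (intro mult_left_mono) auto
    finally show ?thesis .
  qed
  then show ?thesis
    using L(1) \<mu>(1) by (intro exI[of _ "L / \<mu>"]) auto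
qed

text \<open>Riesz representation for a positive definite form: the operator \<open>T\<close> with T
  w \<bullet> u = h w u is injective, hence onto. It makes the \<open>THE\<close> in
  \<open>gradient\<close> well defined.\<close>

lemma linear_functional_representation:
  fixes h :: "'a::euclidean_space \<Rightarrow> 'a \<Rightarrow> real" and d :: "'a \<Rightarrow> real"
  assumes h: "bilinear h" "\<And>u. u \<noteq> 0 \<Longrightarrow> h u u > 0" and d: "linear d"
  shows "\<exists>!w. \<forall>u. h w u = d u"
proof -
  define T where "T w = (\<Sum>b\<in>Basis. h w b *\<^sub>R b)" for w
  have lin: "linear T"
    unfolding T_def by (rule linearI)
      (simp_all add: bilinear_ladd[OF h(1)] bilinear_lmul[OF h(1)] scaleR_left_distrib sum.distrib scaleR_sum_right)
  have T: "T w \<bullet> u = h w u" for w u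
  proof -
    have "h w u = h w (\<Sum>b\<in>Basis. (u \<bullet> b) *\<^sub>R b)"
      by (simp add: euclidean_representation)
    also have "\<dots> = (\<Sum>b\<in>Basis. (u \<bullet> b) * h w b)"
      using h(1) by (simp add: bilinear_def linear_sum linear_cmul)
    also have "\<dots> = T w \<bullet> u"
      by (simp add: T_def inner_sum_left inner_commute[of u] mult.commute)
    finally show ?thesis by simp
  qed
  have "inj T"
  proof (rule linear_injective_0[OF lin, THEN iffD2], intro allI impI)
    fix w assume "T w = 0"
    then show "w = 0"
      using T[of w w] h(2)[of w] by force
  qed
  then have "surj T"
    using lin linear_injective_imp_surjective by blast
  then obtain w where w: "T w = (\<Sum>b\<in>Basis. d b *\<^sub>R b)"
    by (metis surjD)
  have "h w u = d u" for u
  proof -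
    have "h w u = (\<Sum>b\<in>Basis. (u \<bullet> b) * d b)"
      unfolding T[symmetric] w by (simp add: inner_sum_left inner_commute[of u] mult.commute)
    also have "\<dots> = d (\<Sum>b\<in>Basis. (u \<bullet> b) *\<^sub>R b)"
      using d by (simp add: linear_sum linear_cmul)
    finally show ?thesis
      by (simp add: euclidean_representation)
  qed
  moreover have "w' = w" if "\<forall>u. h w' u = d u" for w'
  proof -
    have "T w' \<bullet> u = T w \<bullet> u" for u
      using that calculation by (simp add: T)
    then have "T w' = T w"
      using vector_eq_rdot by blast
    then show ?thesis
      using \<open>inj T\<close> by (simp add: inj_eq)
  qed
  ultimately show ?thesis by blast
qed

section \<open>Isometric coordinates\<close>

text \<open>\<open>\<kappa>\<close> is compared with every chart but is not itself taken from the
  atlas: on the cover it will be a chart of the base composed with \<open>p\<close>. The clause on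
  \<open>g\<close> says that \<open>g\<close> is the pullback of \<open>m\<close>.\<close>

definition isometric_coordinates ::
    "('u::topological_space, 'n::finite) chart set \<Rightarrow> ('u, 'n) metric_field \<Rightarrow> 'u set \<Rightarrow> ('u \<Rightarrow> real ^ 'n) \<Rightarrow>
     (real ^ 'n \<Rightarrow> real ^ 'n \<Rightarrow> real ^ 'n \<Rightarrow> real) \<Rightarrow> bool" where
  "isometric_coordinates A g V \<kappa> m \<longleftrightarrow> open V \<and>
     (\<forall>c\<in>A. smooth_on (snd c ` (fst c \<inter> V)) (\<kappa> \<circ> chart_inv c) \<and>
        (\<forall>x\<in>fst c \<inter> V. \<forall>u w.
           g c x u w = m (\<kappa> x) (frechet_derivative (\<kappa> \<circ> chart_inv c) (at (snd c x)) u)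
             (frechet_derivative (\<kappa> \<circ> chart_inv c) (at (snd c x)) w)))"

lemma isometric_coordinatesD:
  assumes "isometric_coordinates A g V \<kappa> m"
  shows "open V" "c \<in> A \<Longrightarrow> smooth_on (snd c ` (fst c \<inter> V)) (\<kappa> \<circ> chart_inv c)"
    "c \<in> A \<Longrightarrow> x \<in> fst c \<Longrightarrow> x \<in> V \<Longrightarrow>
       g c x u w = m (\<kappa> x) (frechet_derivative (\<kappa> \<circ> chart_inv c) (at (snd c x)) u)
             (frechet_derivative (\<kappa> \<circ> chart_inv c) (at (snd c x)) w)"
  using assms unfolding isometric_coordinates_def by simp_all

lemma isometric_coordinates_subset:
  assumes "isometric_coordinates A g V \<kappa> m" "open W" "W \<subseteq> V"
  shows "isometric_coordinates A g W \<kappa> m"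
  unfolding isometric_coordinates_def
proof (intro conjI ballI allI)
  fix c assume c: "c \<in> A"
  have "snd c ` (fst c \<inter> W) \<subseteq> snd c ` (fst c \<inter> V)"
    using assms(3) by blast
  then show "smooth_on (snd c ` (fst c \<inter> W)) (\<kappa> \<circ> chart_inv c)"
    using smooth_on_subset isometric_coordinatesD(2)[OF assms(1) c] by blast
next
  fix c x u w assume "c \<in> A" "x \<in> fst c \<inter> W"
  then show "g c x u w = m (\<kappa> x) (frechet_derivative (\<kappa> \<circ> chart_inv c) (at (snd c x)) u)
             (frechet_derivative (\<kappa> \<circ> chart_inv c) (at (snd c x)) w)"
    using assms(3) by (intro isometric_coordinatesD(3)[OF assms(1)]) auto
qed (rule assms(2))

locale riemannian =
  fixes A :: "('u::{t2_space,second_countable_topology}, 'n::finite) chart set" and g :: "('u, 'n) metric_field"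
  assumes manifold: "riemannian_manifold A g"
begin

lemma chart:
  assumes "c \<in> A"
  shows "open (fst c)" "open (chart_image c)" "homeomorphism (fst c) (chart_image c) (snd c) (chart_inv c)"
  using manifold assms unfolding riemannian_manifold_def smooth_atlas_def by blast+

lemma chart_cover: "\<exists>c\<in>A. x \<in> fst c"
proof -
  have "(\<Union>c\<in>A. fst c) = UNIV"
    using manifold unfolding riemannian_manifold_def smooth_atlas_def by blast
  then show ?thesis by blast
qed

lemma chart_at: "chart_at A x \<in> A" "x \<in> fst (chart_at A x)"
proof -
  have "\<exists>c. c \<in> A \<and> x \<in> fst c"
    using chart_cover by blast
  then have "chart_at A x \<in> A \<and> x \<in> fst (chart_at A x)"
    unfolding chart_at_def by (rule someI_ex)
  then show "chart_at A x \<in> A" "x \<in> fst (chart_at A x)" by auto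
qed

lemma chart_inv_snd: "c \<in> A \<Longrightarrow> x \<in> fst c \<Longrightarrow> chart_inv c (snd c x) = x"
  and snd_chart_inv: "c \<in> A \<Longrightarrow> y \<in> chart_image c \<Longrightarrow> snd c (chart_inv c y) = y"
  and chart_inv_mem: "c \<in> A \<Longrightarrow> y \<in> chart_image c \<Longrightarrow> chart_inv c y \<in> fst c"
  and snd_mem: "c \<in> A \<Longrightarrow> x \<in> fst c \<Longrightarrow> snd c x \<in> chart_image c"
  and chart_cont: "c \<in> A \<Longrightarrow> continuous_on (fst c) (snd c)"
  and chart_inv_cont: "c \<in> A \<Longrightarrow> continuous_on (chart_image c) (chart_inv c)"
  using chart(3) unfolding homeomorphism_def by blast+

lemma open_chart_image:
  assumes "c \<in> A" "open W"
  shows "open (snd c ` (fst c \<inter> W))"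
proof -
  have "openin (top_of_set (fst c)) (fst c \<inter> W)"
    using assms(2) by blast
  then have "openin (top_of_set (chart_image c)) (snd c ` (fst c \<inter> W))"
    by (rule homeomorphism_imp_open_map[OF chart(3)[OF assms(1)]])
  then show ?thesis
    using chart(2)[OF assms(1)] openin_open_eq by blast
qed

lemma metric_properties:
  assumes "c \<in> A" "x \<in> fst c"
  shows "bilinear (g c x)" "g c x u w = g c x w u" "u \<noteq> 0 \<Longrightarrow> g c x u u > 0"
  using manifold assms unfolding riemannian_manifold_def riemannian_metric_def by blast+

lemma metric_on_chart:
  assumes "c \<in> A"
  shows "metric_on (chart_image c) (\<lambda>y. g c (chart_inv c y))"
proof -
  have "smooth_on (chart_image c) (\<lambda>y. g c (chart_inv c y) u w)" for u w
    using manifold assms unfolding riemannian_manifold_def riemannian_metric_def by blast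
  then have "continuous_on (chart_image c) (\<lambda>y. g c (chart_inv c y) u w)" for u w
    by (rule smooth_on_imp_continuous_on)
  moreover have "\<forall>y\<in>chart_image c. bilinear (g c (chart_inv c y)) \<and>
      (\<forall>u w. g c (chart_inv c y) u w = g c (chart_inv c y) w u) \<and> (\<forall>u. u \<noteq> 0 \<longrightarrow> g c (chart_inv c y) u u > 0)"
    using metric_properties[OF assms chart_inv_mem[OF assms]] by blast
  ultimately show ?thesis
    unfolding metric_on_def by blast
qed

lemma metric_nonneg: "c \<in> A \<Longrightarrow> x \<in> fst c \<Longrightarrow> g c x u u \<ge> 0"
  using metric_properties[of c x] by (cases "u = 0") (auto simp: bilinear_lzero less_imp_le)

lemma smooth_real_function_imp_continuous:
  assumes "smooth_real_function A \<eta>"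
  shows "continuous_on UNIV \<eta>"
proof (rule continuous_at_imp_continuous_on, intro ballI)
  fix x
  obtain c where c: "c \<in> A" "x \<in> fst c"
    using chart_cover by blast
  have "continuous_on (chart_image c) (\<eta> \<circ> chart_inv c)"
    using assms c smooth_on_imp_continuous_on unfolding smooth_real_function_def by blast
  then have "continuous_on (fst c) (\<lambda>z. (\<eta> \<circ> chart_inv c) (snd c z))"
    by (rule continuous_on_compose2[OF _ chart_cont[OF c(1)]]) (use snd_mem[OF c(1)] in blast)
  then have "continuous_on (fst c) \<eta>"
    by (rule continuous_on_eq) (simp add: chart_inv_snd[OF c(1)])
  then show "isCont \<eta> x"
    using c chart(1) by (simp add: continuous_on_eq_continuous_at)
qed

lemma smooth_real_functionI:
  assumes "\<And>x. \<exists>W. open W \<and> x \<in> W \<and> (\<forall>c\<in>A. smooth_on (snd c ` (fst c \<inter> W)) (\<eta> \<circ> chart_inv c))"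
  shows "smooth_real_function A \<eta>"
  unfolding smooth_real_function_def
proof (intro ballI smooth_on_local)
  fix c y assume c: "c \<in> A" and y: "y \<in> chart_image c"
  obtain W where W: "open W" "chart_inv c y \<in> W" "smooth_on (snd c ` (fst c \<inter> W)) (\<eta> \<circ> chart_inv c)"
    using assms[of "chart_inv c y"] c by blast
  have "y \<in> snd c ` (fst c \<inter> W)"
    using W(2) chart_inv_mem[OF c y] snd_chart_inv[OF c y] by (metis IntI imageI)
  then show "\<exists>T. open T \<and> y \<in> T \<and> smooth_on T (\<eta> \<circ> chart_inv c)"
    using W open_chart_image[OF c W(1)] by blast
qed

text \<open>|w|^2 = d w \<le> G |w| for the gradient w, which exists by
  \<open>linear_functional_representation\<close>.\<close>

lemma gradient_norm_le:
  assumes c: "c = chart_at A x" and G: "G \<ge> 0"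
    and der: "(\<eta> \<circ> chart_inv c has_derivative d) (at (snd c x))"
    and bound: "\<And>u. \<bar>d u\<bar> \<le> G * sqrt (g c x u u)"
  shows "gradient_norm A g \<eta> x \<le> G"
proof -
  have mem: "c \<in> A" "x \<in> fst c"
    using chart_at c by auto
  have d: "frechet_derivative (\<eta> \<circ> chart_inv c) (at (snd c x)) = d"
    using frechet_derivative_at[OF der] by simp
  have "\<exists>!w. \<forall>u. g c x w u = d u"
    using metric_properties[OF mem] der has_derivative_linear by (intro linear_functional_representation) blast+
  then have w: "\<forall>u. g c x (gradient g \<eta> c x) u = d u"
    unfolding gradient_def d by (rule theI')
  let ?n = "sqrt (g c x (gradient g \<eta> c x) (gradient g \<eta> c x))"
  have nn: "0 \<le> g c x (gradient g \<eta> c x) (gradient g \<eta> c x)"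
    by (rule metric_nonneg[OF mem])
  have "?n * ?n = g c x (gradient g \<eta> c x) (gradient g \<eta> c x)"
    by (rule real_sqrt_mult_self[THEN trans]) (simp add: nn)
  also have "\<dots> = d (gradient g \<eta> c x)"
    using w by blast
  also have "\<dots> \<le> G * ?n"
    using bound[of "gradient g \<eta> c x"] by linarith
  finally have "?n * ?n \<le> G * ?n" .
  \<comment> \<open>Division by the gradient norm, including the case where it is 0.\<close>
  moreover have "t \<le> G" if "t * t \<le> G * t" "t \<ge> 0" for t :: real
    using that G by (cases "t = 0") (auto dest: mult_right_le_imp_le)
  ultimately have "?n \<le> G"
    using real_sqrt_ge_zero[OF nn] by blast
  then show ?thesis
    by (simp add: gradient_norm_def Let_def c)
qed

lemma isometric_coordinates_derivative:
  assumes V: "isometric_coordinates A g V \<kappa> m" and c: "c \<in> A" and x: "x \<in> fst c \<inter> V"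
  shows "(\<kappa> \<circ> chart_inv c has_derivative frechet_derivative (\<kappa> \<circ> chart_inv c) (at (snd c x))) (at (snd c x))"
  by (rule smooth_on_has_derivative[OF isometric_coordinatesD(2)[OF V c]]) (use x in blast)

text \<open>Two open sets cover the manifold: \<open>V\<close>, where \<open>H\<close> is locally
  constant and the product is smooth, and the complement of the closed set \<open>K\<close>, where
  the function is 0. Later \<open>H\<close> is a function of the index of the sheet.\<close>

lemma coordinate_function_smooth:
  fixes \<beta> :: "real ^ 'n \<Rightarrow> real"
  assumes V: "isometric_coordinates A g V \<kappa> m" and \<beta>: "smooth_on UNIV \<beta>"
    and K: "closed K" "K \<subseteq> V" "\<And>x. x \<in> V - K \<Longrightarrow> \<beta> (\<kappa> x) = 0"
    and H: "\<And>x. x \<in> V \<Longrightarrow> \<exists>W. open W \<and> x \<in> W \<and> W \<subseteq> V \<and> (\<forall>y\<in>W. H y = H x)"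
  shows "smooth_real_function A (\<lambda>x. if x \<in> V then H x * \<beta> (\<kappa> x) else 0)"
proof (rule smooth_real_functionI)
  fix x
  show "\<exists>W. open W \<and> x \<in> W \<and> (\<forall>c\<in>A. smooth_on (snd c ` (fst c \<inter> W)) ((\<lambda>x. if x \<in> V then H x * \<beta> (\<kappa> x) else 0) \<circ> chart_inv c))"
  proof (cases "x \<in> V")
    case True
    then obtain W where W: "open W" "x \<in> W" "W \<subseteq> V" "\<forall>y\<in>W. H y = H x"
      using H[OF True] by blast
    have "smooth_on (snd c ` (fst c \<inter> W)) ((\<lambda>x. if x \<in> V then H x * \<beta> (\<kappa> x) else 0) \<circ> chart_inv c)" if c: "c \<in> A" for c
    proof (rule smooth_on_cong[OF open_chart_image[OF c W(1)]])
      have "smooth_on (snd c ` (fst c \<inter> W)) (\<kappa> \<circ> chart_inv c)"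
        by (rule isometric_coordinatesD(2)[OF isometric_coordinates_subset[OF V W(1,3)] c])
      from smooth_on_compose[OF open_chart_image[OF c W(1)] open_UNIV \<beta> this]
      show "smooth_on (snd c ` (fst c \<inter> W)) (\<lambda>y. H x * \<beta> ((\<kappa> \<circ> chart_inv c) y))"
        by (intro smooth_on_mult smooth_on_const open_chart_image c W(1)) simp
      fix y assume "y \<in> snd c ` (fst c \<inter> W)"
      then have "chart_inv c y \<in> W"
        using chart_inv_snd[OF c] by auto
      then have "chart_inv c y \<in> V" "H (chart_inv c y) = H x"
        using W(3,4) by blast+
      then show "H x * \<beta> ((\<kappa> \<circ> chart_inv c) y) = ((\<lambda>x. if x \<in> V then H x * \<beta> (\<kappa> x) else 0) \<circ> chart_inv c) y"
        by simp
    qed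
    then show ?thesis
      using W by blast
  next
    case False
    have "smooth_on (snd c ` (fst c \<inter> - K)) ((\<lambda>x. if x \<in> V then H x * \<beta> (\<kappa> x) else 0) \<circ> chart_inv c)" if c: "c \<in> A" for c
    proof (rule smooth_on_cong[OF open_chart_image[OF c] _ smooth_on_const])
      show "open (- K)" using K(1) by blast
      fix y assume "y \<in> snd c ` (fst c \<inter> - K)"
      then have "chart_inv c y \<notin> K"
        using chart_inv_snd[OF c] by auto
      then show "0 = ((\<lambda>x. if x \<in> V then H x * \<beta> (\<kappa> x) else 0) \<circ> chart_inv c) y"
        using K(3)[of "chart_inv c y"] by auto
    qed
    then show ?thesis
      using False K(1,2) by (intro exI[of _ "- K"]) auto
  qed
qed

lemma smooth_real_function_sum:
  assumes "\<And>i. i \<in> I \<Longrightarrow> smooth_real_function A (F i)"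
  shows "smooth_real_function A (\<lambda>x. \<Sum>i\<in>I. F i x)"
proof -
  have "smooth_on (chart_image c) (\<lambda>y. \<Sum>i\<in>I. (F i \<circ> chart_inv c) y)" if "c \<in> A" for c
    using assms that chart(2) unfolding smooth_real_function_def by (intro smooth_on_sum) blast+
  then show ?thesis
    unfolding smooth_real_function_def comp_def by blast
qed

lemma smooth_real_function_divide:
  assumes "smooth_real_function A \<eta>" "smooth_real_function A \<theta>" "\<And>x. \<theta> x \<noteq> 0"
  shows "smooth_real_function A (\<lambda>x. \<eta> x / \<theta> x)"
proof -
  have "smooth_on (chart_image c) (\<lambda>y. (\<eta> \<circ> chart_inv c) y / (\<theta> \<circ> chart_inv c) y)" if "c \<in> A" for c
    using assms(1,2) that unfolding smooth_real_function_def
    by (intro smooth_on_divide chart(2)[OF that]) (blast, blast, simp add: assms(3))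
  then show ?thesis
    unfolding smooth_real_function_def comp_def by blast
qed

end

section \<open>Riemannian volume in isometric coordinates\<close>

definition gram :: "(real ^ 'n \<Rightarrow> real ^ 'n \<Rightarrow> real) \<Rightarrow> real ^ 'n ^ 'n::finite" where
  "gram h = (\<chi> i j. h (axis i 1) (axis j 1))"

lemma volume_density_gram: "volume_density g c x = sqrt (det (gram (g c x)))"
  by (simp add: volume_density_def gram_def)

lemma bilinear_expand_cart:
  fixes h :: "real ^ 'n::finite \<Rightarrow> real ^ 'n \<Rightarrow> real"
  assumes "bilinear h"
  shows "h u w = (\<Sum>k\<in>UNIV. \<Sum>l\<in>UNIV. u $ k * w $ l * h (axis k 1) (axis l 1))"
proof -
  have *: "(\<Sum>b\<in>Basis. F b) = (\<Sum>k\<in>UNIV. F (axis k 1))" for F :: "real ^ 'n \<Rightarrow> real"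
    unfolding Basis_vec_def by (simp add: sum.reindex inj_on_def axis_eq_axis UNION_singleton_eq_range)
  show ?thesis
    by (subst bilinear_expand[OF assms]) (simp add: * inner_axis)
qed

lemma inner_gram: "bilinear h \<Longrightarrow> u \<bullet> (gram h *v w) = h u w"
  by (subst bilinear_expand_cart) (simp_all add: gram_def inner_vec_def matrix_vector_mult_def sum_distrib_left mult_ac)

lemma det_gram_nonzero:
  fixes h :: "real ^ 'n::finite \<Rightarrow> real ^ 'n \<Rightarrow> real"
  assumes "bilinear h" "\<And>u. u \<noteq> 0 \<Longrightarrow> h u u > 0"
  shows "det (gram h) \<noteq> 0"
proof -
  have "w = 0" if "gram h *v w = 0" for w
    using inner_gram[OF assms(1), of w w] assms(2)[of w] that by force
  then have "inj ((*v) (gram h))"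
    using linear_injective_0[of "(*v) (gram h)"] by (simp add: matrix_vector_mul_linear)
  then have "invertible (gram h)"
    using invertible_left_inverse matrix_left_invertible_injective by blast
  then show ?thesis
    by (simp add: invertible_det_nz)
qed

text \<open>The determinant does not vanish on the segment from the Euclidean inner product to \<open>h\<close>.\<close>

lemma det_gram_pos:
  fixes h :: "real ^ 'n::finite \<Rightarrow> real ^ 'n \<Rightarrow> real"
  assumes "bilinear h" "\<And>u. u \<noteq> 0 \<Longrightarrow> h u u > 0"
  shows "det (gram h) > 0"
proof (rule ccontr)
  assume neg: "\<not> det (gram h) > 0"
  define k where "k t u w = (1 - t) * (u \<bullet> w) + t * h u w" for t u w
  have bil: "bilinear (k t)" for t
    unfolding bilinear_def k_def
    by (auto intro!: linearI simp: bilinear_ladd[OF assms(1)] bilinear_radd[OF assms(1)]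
        bilinear_lmul[OF assms(1)] bilinear_rmul[OF assms(1)] inner_add_left inner_add_right algebra_simps)
  have pos: "k t u u > 0" if "t \<in> {0..1}" "u \<noteq> 0" for t u
  proof (cases "t = 0")
    case False
    then have "t * h u u > 0" "(1 - t) * (u \<bullet> u) \<ge> 0"
      using that assms(2)[of u] by auto
    then show ?thesis by (simp add: k_def)
  qed (use that in \<open>simp add: k_def\<close>)
  have "continuous_on {0..1} (\<lambda>t. det (gram (k t)))"
    unfolding det_def gram_def k_def by (simp, intro continuous_intros)
  moreover have "det (gram (k 0)) = 1"
  proof -
    have "gram (k 0) = mat 1"
      by (simp add: gram_def k_def mat_def vec_eq_iff inner_axis_axis)
    then show ?thesis by simp
  qed
  moreover have "gram (k 1) = gram h"
    by (simp add: gram_def k_def)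
  ultimately have "\<exists>t\<ge>0. t \<le> 1 \<and> det (gram (k t)) = 0"
    using neg by (intro IVT2') auto
  then show False
    using det_gram_nonzero[OF bil pos] by auto
qed

lemma det_gram_pullback:
  fixes h :: "real ^ 'n::finite \<Rightarrow> real ^ 'n \<Rightarrow> real"
  assumes "bilinear h"
  shows "det (gram (\<lambda>u w. h (D u) (D w))) = (det (matrix D))\<^sup>2 * det (gram h)"
proof -
  have "gram (\<lambda>u w. h (D u) (D w)) = transpose (matrix D) ** (gram h ** matrix D)"
    unfolding vec_eq_iff
  proof (intro allI)
    fix i j
    have "gram (\<lambda>u w. h (D u) (D w)) $ i $ j = D (axis i 1) \<bullet> (gram h *v D (axis j 1))"
      by (simp add: inner_gram[OF assms]) (simp add: gram_def)
    then show "gram (\<lambda>u w. h (D u) (D w)) $ i $ j = (transpose (matrix D) ** (gram h ** matrix D)) $ i $ j"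
      by (simp add: matrix_matrix_mult_def transpose_def matrix_def inner_vec_def matrix_vector_mult_def)
  qed
  then show ?thesis
    by (simp add: det_mul power2_eq_square)
qed

text \<open>The direct image is the preimage under the inverse, which is continuous on the open set
  \<open>Y\<close>.\<close>

lemma homeomorphism_borel_image:
  fixes f :: "'a::topological_space \<Rightarrow> 'b::topological_space"
  assumes "homeomorphism X Y f f'" "open Y" "E \<in> sets borel" "E \<subseteq> X"
  shows "f ` E \<in> sets borel"
proof -
  have "f' \<in> borel_measurable (restrict_space borel Y)"
    using assms(1) by (intro borel_measurable_continuous_on_restrict) (simp add: homeomorphism_def)
  then have "f' -` E \<inter> space (restrict_space borel Y) \<in> sets (restrict_space borel Y)"
    using assms(3) by (rule measurable_sets)
  then have "f' -` E \<inter> Y \<in> sets borel"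
    using assms(2) by (simp add: space_restrict_space sets_restrict_space_iff)
  moreover have "f ` E = f' -` E \<inter> Y"
    using assms(1,4) unfolding homeomorphism_def by force
  ultimately show ?thesis by simp
qed

lemma metric_on_density:
  fixes m :: "real ^ 'n::finite \<Rightarrow> real ^ 'n \<Rightarrow> real ^ 'n \<Rightarrow> real"
  assumes "metric_on B m"
  shows "continuous_on B (\<lambda>y. sqrt (det (gram (m y))))" "y \<in> B \<Longrightarrow> sqrt (det (gram (m y))) > 0"
proof -
  have "continuous_on B (\<lambda>y. m y u w)" for u w
    using assms unfolding metric_on_def by blast
  then show "continuous_on B (\<lambda>y. sqrt (det (gram (m y))))"
    unfolding det_def gram_def by (simp, intro continuous_intros)
  show "sqrt (det (gram (m y))) > 0" if "y \<in> B"
    using assms that det_gram_pos[of "m y"] unfolding metric_on_def by simp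
qed

context riemannian
begin

text \<open>The Gram determinants in the two coordinate systems differ by the square of the Jacobian
  determinant, whose root is the factor of the substitution rule.\<close>

lemma volume_in_chart:
  assumes v: "riemannian_volume A g v" and V: "isometric_coordinates A g V \<kappa> m"
    and hom: "homeomorphism V B \<kappa> j" and B: "open B" and m: "metric_on B m"
    and c: "c \<in> A" and E: "E \<in> sets borel" "E \<subseteq> V" "E \<subseteq> fst c"
  shows "emeasure v E = (\<integral>\<^sup>+y. ennreal (indicator (\<kappa> ` E) y * sqrt (det (gram (m y)))) \<partial>lborel)"
proof -
  let ?\<theta> = "\<lambda>y. sqrt (det (gram (m y)))" and ?S = "snd c ` E" and ?F = "\<kappa> \<circ> chart_inv c"
  let ?D = "\<lambda>y. frechet_derivative ?F (at y)" and ?T = "snd c ` (fst c \<inter> V)"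
  have inv: "chart_inv c (snd c x) = x" if "x \<in> E" for x
    using that E(3) chart_inv_snd[OF c] by blast
  have openT: "open ?T"
    using open_chart_image[OF c isometric_coordinatesD(1)[OF V]] .
  have ST: "?S \<subseteq> ?T" using E by blast
  have smooth: "smooth_on ?T ?F"
    by (rule isometric_coordinatesD(2)[OF V c])
  have F_S: "?F ` ?S = \<kappa> ` E"
    using inv by (force simp: image_iff)
  have \<kappa>: "\<kappa> x \<in> B" "j (\<kappa> x) = x" if "x \<in> V" for x
    using hom that unfolding homeomorphism_def by blast+
  have S: "?S \<in> sets borel"
    using homeomorphism_borel_image[OF chart(3)[OF c] chart(2)[OF c] E(1,3)] .
  have \<kappa>E: "\<kappa> ` E \<in> sets borel" "\<kappa> ` E \<subseteq> B"
    using homeomorphism_borel_image[OF hom B E(1,2)] \<kappa> E(2) by blast+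
  have der: "(?F has_derivative ?D y) (at y)" if "y \<in> ?S" for y
    using smooth_on_has_derivative[OF smooth] ST that by blast
  have FT: "?F y \<in> B" if "y \<in> ?T" for y
    using that \<kappa>(1) chart_inv_snd[OF c] by auto
  have dens: "volume_density g c (chart_inv c y) = \<bar>det (matrix (?D y))\<bar> * ?\<theta> (?F y)" if y: "y \<in> ?S" for y
  proof -
    obtain x where x: "x \<in> E" "y = snd c x" using y by blast
    have "g c x = (\<lambda>u w. m (\<kappa> x) (?D y u) (?D y w))"
      using isometric_coordinatesD(3)[OF V c] x E by (intro ext) blast
    moreover have "bilinear (m (\<kappa> x))"
      using m \<kappa>(1) x E(2) unfolding metric_on_def by blast
    ultimately have "det (gram (g c x)) = (det (matrix (?D y)))\<^sup>2 * det (gram (m (\<kappa> x)))"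
      by (simp add: det_gram_pullback)
    then show ?thesis
      using inv[OF x(1)] by (simp add: volume_density_gram x(2) real_sqrt_mult)
  qed
  have "emeasure v E = (\<integral>\<^sup>+y\<in>?S. ennreal (volume_density g c (chart_inv c y)) \<partial>lborel)"
    using v c E unfolding riemannian_volume_def by blast
  also have "\<dots> = (\<integral>\<^sup>+y. ennreal (indicator ?S y * (\<bar>det (matrix (?D y))\<bar> * ?\<theta> (?F y))) \<partial>lborel)"
    using dens by (intro nn_integral_cong) (auto simp: indicator_def)
  also have "\<dots> = (\<integral>\<^sup>+y. ennreal (indicator (?F ` ?S) y * ?\<theta> y) \<partial>lborel)"
  proof (rule nn_integral_change_of_variables[symmetric, OF S der])
    show "inj_on ?F ?S"
    proof (rule inj_onI)
      fix y z assume "y \<in> ?S" "z \<in> ?S" "?F y = ?F z"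
      then obtain x x' where "x \<in> E" "x' \<in> E" "y = snd c x" "z = snd c x'" "\<kappa> x = \<kappa> x'"
        using inv by auto
      then show "y = z"
        using \<kappa>(2) E(2) by (metis subsetD)
    qed
    have "(\<lambda>y. indicator (\<kappa> ` E) y *\<^sub>R ?\<theta> y) \<in> borel_measurable borel"
      using \<kappa>E metric_on_density(1)[OF m]
      by (intro borel_measurable_continuous_on_indicator) (auto intro: continuous_on_subset)
    then show "(\<lambda>y. indicator (?F ` ?S) y * ?\<theta> y) \<in> borel_measurable borel"
      by (simp only: F_S) simp
    have "continuous_on ?T (\<lambda>y. ?D y u)" for u
      by (rule smooth_on_imp_continuous_on[OF smooth_on_derivative[OF smooth]])
    then have "continuous_on ?T (\<lambda>y. det (matrix (?D y)))"
      unfolding det_def matrix_def by (simp, intro continuous_intros)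
    moreover have "continuous_on ?T (\<lambda>y. ?\<theta> (?F y))"
      using smooth_on_imp_continuous_on[OF smooth]
      by (rule continuous_on_compose2[OF metric_on_density(1)[OF m]]) (use FT in blast)
    ultimately have "continuous_on ?T (\<lambda>y. \<bar>det (matrix (?D y))\<bar> * ?\<theta> (?F y))"
      by (intro continuous_on_mult continuous_on_rabs)
    then have "(\<lambda>y. indicator ?S y *\<^sub>R (\<bar>det (matrix (?D y))\<bar> * ?\<theta> (?F y))) \<in> borel_measurable borel"
      using S ST by (intro borel_measurable_continuous_on_indicator) (auto intro: continuous_on_subset)
    then show "(\<lambda>y. indicator ?S y * (\<bar>det (matrix (?D y))\<bar> * ?\<theta> (?F y))) \<in> borel_measurable borel"
      by simp
    show "?\<theta> (?F y) \<ge> 0" if "y \<in> ?S" for y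
      using metric_on_density(2)[OF m FT] that ST by (meson less_imp_le subsetD)
  qed
  finally show ?thesis
    by (simp only: F_S)
qed

text \<open>\<open>riemannian_volume\<close> prescribes the measure of subsets of a single chart
  domain. By Lindelof countably many domains cover, and \<open>E\<close> is cut along them into
  disjoint parts to which \<open>volume_in_chart\<close> applies.\<close>

theorem volume_in_coordinates:
  assumes v: "riemannian_volume A g v" and V: "isometric_coordinates A g V \<kappa> m"
    and hom: "homeomorphism V B \<kappa> j" and B: "open B" and m: "metric_on B m"
    and E: "E \<in> sets borel" "E \<subseteq> V"
  shows "emeasure v E = (\<integral>\<^sup>+y\<in>\<kappa> ` E. ennreal (sqrt (det (gram (m y)))) \<partial>lborel)"
proof -
  let ?\<theta> = "\<lambda>y. indicator B y * sqrt (det (gram (m y)))"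
  let ?\<nu> = "density lborel (\<lambda>y. ennreal (?\<theta> y))"
  have "(\<lambda>y. indicator B y *\<^sub>R sqrt (det (gram (m y)))) \<in> borel_measurable borel"
    using B metric_on_density(1)[OF m] by (intro borel_measurable_continuous_on_indicator) auto
  then have meas: "(\<lambda>y. ennreal (?\<theta> y)) \<in> borel_measurable lborel"
    by simp
  have \<kappa>: "\<kappa> x \<in> B" "j (\<kappa> x) = x" if "x \<in> V" for x
    using hom that unfolding homeomorphism_def by blast+
  have borel: "\<kappa> ` E' \<in> sets borel" if "E' \<in> sets borel" "E' \<subseteq> V" for E'
    using homeomorphism_borel_image[OF hom B that] .
  have \<nu>: "emeasure ?\<nu> (\<kappa> ` E') = (\<integral>\<^sup>+y. ennreal (indicator (\<kappa> ` E') y * sqrt (det (gram (m y)))) \<partial>lborel)"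
    if E': "E' \<in> sets borel" "E' \<subseteq> V" for E'
  proof -
    have "\<kappa> ` E' \<subseteq> B" using \<kappa>(1) E'(2) by blast
    then have "ennreal (?\<theta> y) * indicator (\<kappa> ` E') y = ennreal (indicator (\<kappa> ` E') y * sqrt (det (gram (m y))))" for y
      by (cases "y \<in> \<kappa> ` E'") (simp_all add: subset_iff)
    moreover have "emeasure ?\<nu> (\<kappa> ` E') = (\<integral>\<^sup>+y\<in>\<kappa> ` E'. ennreal (?\<theta> y) \<partial>lborel)"
      using borel[OF E'] by (intro emeasure_density[OF meas]) simp
    ultimately show ?thesis
      by simp
  qed
  obtain \<F> where \<F>: "\<F> \<subseteq> fst ` A" "countable \<F>" "\<Union>\<F> = \<Union>(fst ` A)"
    using Lindelof[of "fst ` A"] chart(1) by blast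
  have "\<Union>(fst ` A) = UNIV"
    using chart_cover by blast
  then have "\<F> \<noteq> {}" using \<F>(3) by auto
  then obtain U :: "nat \<Rightarrow> 'u set" where U: "range U = \<F>"
    using \<F>(2) by (metis range_from_nat_into)
  define E' where "E' n = E \<inter> disjointed U n" for n
  have cover: "(\<Union>n. E' n) = E"
    using U \<F>(3) \<open>\<Union>(fst ` A) = UNIV\<close> UN_disjointed_eq[of U] by (auto simp: E'_def)
  have disj: "disjoint_family E'"
    using disjoint_family_disjointed[of U] by (auto simp: disjoint_family_on_def E'_def)
  have U_chart: "\<exists>c\<in>A. U n = fst c" for n
  proof -
    have "U n \<in> fst ` A"
      using \<F>(1) rangeI[of U n] unfolding U by (rule subsetD)
    then show ?thesis by auto
  qed
  then have openU: "open (U n)" for n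
    using chart(1) by metis
  have E'_sets: "E' n \<in> sets borel" for n
  proof -
    have "range (disjointed U) \<subseteq> sets borel"
      using openU by (intro sets.range_disjointed_sets) auto
    then show ?thesis
      unfolding E'_def using E(1) by blast
  qed
  have E'_sub: "E' n \<subseteq> V" for n
    using E(2) by (auto simp: E'_def)
  have "emeasure v (E' n) = emeasure ?\<nu> (\<kappa> ` E' n)" for n
  proof -
    obtain c where "c \<in> A" "U n = fst c"
      using U_chart by blast
    moreover have "E' n \<subseteq> U n"
      using disjointed_subset[of U n] by (auto simp: E'_def)
    ultimately show ?thesis
      using volume_in_chart[OF v V hom B m _ E'_sets E'_sub] \<nu>[OF E'_sets E'_sub] by auto
  qed
  then have "(\<Sum>n. emeasure v (E' n)) = (\<Sum>n. emeasure ?\<nu> (\<kappa> ` E' n))"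
    by simp
  moreover have "(\<Sum>n. emeasure v (E' n)) = emeasure v E"
    using v E'_sets disj cover unfolding riemannian_volume_def by (subst suminf_emeasure) auto
  moreover have "(\<Sum>n. emeasure ?\<nu> (\<kappa> ` E' n)) = emeasure ?\<nu> (\<kappa> ` E)"
  proof -
    have "disjoint_family (\<lambda>n. \<kappa> ` E' n)"
      unfolding disjoint_family_on_def
    proof (intro ballI impI equals0I)
      fix k l y assume "k \<noteq> l" and y: "y \<in> \<kappa> ` E' k \<inter> \<kappa> ` E' l"
      then obtain x x' where x: "x \<in> E' k" "x' \<in> E' l" "y = \<kappa> x" "y = \<kappa> x'" by blast
      then have "x = x'"
        using \<kappa>(2) E'_sub by (metis subsetD)
      then show False
        using disjoint_family_onD[OF disj, of k l] \<open>k \<noteq> l\<close> x by blast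
    qed
    then have "(\<Sum>n. emeasure ?\<nu> (\<kappa> ` E' n)) = emeasure ?\<nu> (\<Union>n. \<kappa> ` E' n)"
      using borel[OF E'_sets E'_sub] by (intro suminf_emeasure) auto
    then show ?thesis
      using cover by (simp add: image_UN[symmetric])
  qed
  ultimately have "emeasure v E = emeasure ?\<nu> (\<kappa> ` E)"
    by simp
  also have "\<dots> = (\<integral>\<^sup>+y\<in>\<kappa> ` E. ennreal (sqrt (det (gram (m y)))) \<partial>lborel)"
    unfolding \<nu>[OF E] by (intro nn_integral_cong) (simp add: indicator_def)
  finally show ?thesis .
qed

end

text \<open>A continuous positive density lies between two positive constants on a compact ball,
  whose Lebesgue measure is finite and positive.\<close>

lemma density_integral_cball:
  fixes m :: "real ^ 'n::finite \<Rightarrow> real ^ 'n \<Rightarrow> real ^ 'n \<Rightarrow> real"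
  assumes "metric_on (cball a r) m" "r > 0"
  shows "(\<integral>\<^sup>+y\<in>cball a r. ennreal (sqrt (det (gram (m y)))) \<partial>lborel) < \<infinity>"
    and "(\<integral>\<^sup>+y\<in>cball a r. ennreal (sqrt (det (gram (m y)))) \<partial>lborel) > 0"
proof -
  let ?\<theta> = "\<lambda>y. sqrt (det (gram (m y)))"
  note cont = metric_on_density(1)[OF assms(1)] and pos = metric_on_density(2)[OF assms(1)]
  have ne: "cball a r \<noteq> {}" using assms(2) by auto
  obtain z where z: "z \<in> cball a r" "\<And>y. y \<in> cball a r \<Longrightarrow> ?\<theta> y \<le> ?\<theta> z"
    using continuous_attains_sup[OF compact_cball ne cont] by blast
  obtain w where w: "w \<in> cball a r" "\<And>y. y \<in> cball a r \<Longrightarrow> ?\<theta> w \<le> ?\<theta> y"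
    using continuous_attains_inf[OF compact_cball ne cont] by blast
  have "(\<integral>\<^sup>+y\<in>cball a r. ennreal (?\<theta> y) \<partial>lborel) \<le> (\<integral>\<^sup>+y. ennreal (?\<theta> z) * indicator (cball a r) y \<partial>lborel)"
    using z by (intro nn_integral_mono) (auto simp: indicator_def intro: ennreal_leI)
  also have "\<dots> = ennreal (?\<theta> z) * emeasure lborel (cball a r)"
    by (simp add: nn_integral_cmult_indicator)
  also have "\<dots> < \<infinity>"
    using emeasure_lborel_cball_finite[of a r] by (simp add: ennreal_mult_less_top)
  finally show "(\<integral>\<^sup>+y\<in>cball a r. ennreal (?\<theta> y) \<partial>lborel) < \<infinity>" .
  have "(0::ennreal) < ennreal (?\<theta> w) * emeasure lborel (cball a r)"
  proof -
    have "emeasure lborel (ball a r) \<noteq> 0"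
      using assms(2) open_not_negligible[of "ball a r"] by (auto simp: negligible_iff_null_sets null_sets_def)
    moreover have "emeasure lborel (ball a r) \<le> emeasure lborel (cball a r)"
      by (intro emeasure_mono) auto
    ultimately have "emeasure lborel (cball a r) \<noteq> 0"
      by auto
    moreover have "ennreal (?\<theta> w) \<noteq> 0"
      using pos[OF w(1)] by simp
    ultimately show ?thesis
      by (simp add: zero_less_iff_neq_zero)
  qed
  also have "\<dots> = (\<integral>\<^sup>+y. ennreal (?\<theta> w) * indicator (cball a r) y \<partial>lborel)"
    by (simp add: nn_integral_cmult_indicator)
  also have "\<dots> \<le> (\<integral>\<^sup>+y\<in>cball a r. ennreal (?\<theta> y) \<partial>lborel)"
    using w by (intro nn_integral_mono) (auto simp: indicator_def intro: ennreal_leI)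
  finally show "(\<integral>\<^sup>+y\<in>cball a r. ennreal (?\<theta> y) \<partial>lborel) > 0" .
qed

section \<open>Curves and the Riemannian distance\<close>

lemma C1_differentiable_on_cong_open:
  assumes "open S" "f C1_differentiable_on S" "\<And>t. t \<in> S \<Longrightarrow> f t = h t"
  shows "h C1_differentiable_on S"
proof -
  obtain D where D: "\<And>t. t \<in> S \<Longrightarrow> (f has_vector_derivative D t) (at t)" "continuous_on S D"
    using assms(2) unfolding C1_differentiable_on_def by blast
  have "(h has_vector_derivative D t) (at t)" if "t \<in> S" for t
    using has_vector_derivative_transform_within_open[OF D(1)[OF that] assms(1) that assms(3)] .
  then show ?thesis
    using D(2) unfolding C1_differentiable_on_def by blast
qed

lemma C1_differentiable_on_affine:
  fixes a b :: real
  assumes "f C1_differentiable_on S"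
  shows "(\<lambda>t. f (a * t + b)) C1_differentiable_on {t. a * t + b \<in> S}"
proof -
  obtain D where D: "\<And>t. t \<in> S \<Longrightarrow> (f has_vector_derivative D t) (at t)" "continuous_on S D"
    using assms unfolding C1_differentiable_on_def by blast
  have "((\<lambda>t. f (a * t + b)) has_vector_derivative a *\<^sub>R D (a * t + b)) (at t)" if "a * t + b \<in> S" for t
  proof -
    have "((\<lambda>t. a * t + b) has_vector_derivative a) (at t)"
      by (auto intro!: derivative_eq_intros simp: has_real_derivative_iff_has_vector_derivative[symmetric])
    from vector_diff_chain_at[OF this D(1)[OF that]] show ?thesis
      by (simp add: comp_def)
  qed
  moreover have "continuous_on {t. a * t + b \<in> S} (\<lambda>t. a *\<^sub>R D (a * t + b))"
    by (intro continuous_intros continuous_on_compose2[OF D(2)]) auto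
  ultimately show ?thesis
    unfolding C1_differentiable_on_def by (intro exI[of _ "\<lambda>t. a *\<^sub>R D (a * t + b)"]) simp
qed

lemma C1_differentiable_on_Un_open:
  assumes "open S" "open T" "f C1_differentiable_on S" "f C1_differentiable_on T"
  shows "f C1_differentiable_on (S \<union> T)"
  using assms unfolding C1_differentiable_on_eq by (auto intro: continuous_on_open_Un)

context riemannian
begin

lemma curve_preimage_open:
  fixes \<gamma> :: "real \<Rightarrow> 'u"
  assumes "path \<gamma>" "finite F" "open W"
  shows "open {t \<in> {0<..<1} - F. \<gamma> t \<in> W}"
proof -
  have "continuous_on ({0<..<1} - F) \<gamma>"
    using assms(1) unfolding path_def by (rule continuous_on_subset) auto
  then have "open (({0<..<1} - F) \<inter> \<gamma> -` W)"
    using assms(2,3) by (intro continuous_open_preimage open_Diff finite_imp_closed) auto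
  moreover have "{t \<in> {0<..<1} - F. \<gamma> t \<in> W} = ({0<..<1} - F) \<inter> \<gamma> -` W"
    by auto
  ultimately show ?thesis
    by metis
qed

lemma transition_derivative:
  assumes c: "c \<in> A" "c' \<in> A" "x \<in> fst c" "x \<in> fst c'"
  defines "D \<equiv> frechet_derivative (snd c' \<circ> chart_inv c) (at (snd c x))"
  shows "(snd c' \<circ> chart_inv c has_derivative D) (at (snd c x))" "g c' x (D u) (D w) = g c x u w"
proof -
  have "smooth_on (snd c ` (fst c \<inter> fst c')) (snd c' \<circ> chart_inv c)"
    using manifold c unfolding riemannian_manifold_def smooth_atlas_def by blast
  then show "(snd c' \<circ> chart_inv c has_derivative D) (at (snd c x))"
    unfolding D_def using c by (intro smooth_on_has_derivative) auto
  have "\<forall>c\<in>A. \<forall>c'\<in>A. \<forall>x\<in>fst c \<inter> fst c'. \<forall>u w.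
        (let D = frechet_derivative (snd c' \<circ> chart_inv c) (at (snd c x)) in g c' x (D u) (D w) = g c x u w)"
    using manifold unfolding riemannian_manifold_def riemannian_metric_def by blast
  then show "g c' x (D u) (D w) = g c x u w"
    unfolding D_def Let_def using c by blast
qed

text \<open>\<open>curve_speed\<close> uses the chart selected by \<open>chart_at\<close>, which may
  jump along the curve. Transition maps preserve the metric, so the chart \<open>c\<close> gives the
  same speed.\<close>

lemma curve_speed_chart:
  assumes c: "c \<in> A" "\<gamma> t \<in> fst c" and \<gamma>: "open T" "t \<in> T" "\<And>s. s \<in> T \<Longrightarrow> \<gamma> s \<in> fst c"
    and u: "(snd c \<circ> \<gamma> has_vector_derivative u) (at t)"
  shows "curve_speed A g \<gamma> t = sqrt (g c (\<gamma> t) u u)"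
proof -
  define c' where "c' = chart_at A (\<gamma> t)"
  have c': "c' \<in> A" "\<gamma> t \<in> fst c'"
    using chart_at by (auto simp: c'_def)
  define D where "D = frechet_derivative (snd c' \<circ> chart_inv c) (at (snd c (\<gamma> t)))"
  note tr = transition_derivative[OF c(1) c'(1) c(2) c'(2), folded D_def]
  have "(snd c \<circ> \<gamma> has_derivative (\<lambda>h. h *\<^sub>R u)) (at t)"
    using u by (simp add: has_vector_derivative_def)
  moreover have "(snd c' \<circ> chart_inv c has_derivative D) (at ((snd c \<circ> \<gamma>) t))"
    using tr(1) by simp
  ultimately have "((\<lambda>s. (snd c' \<circ> chart_inv c) ((snd c \<circ> \<gamma>) s)) has_derivative (\<lambda>h. D (h *\<^sub>R u))) (at t)"
    by (rule has_derivative_compose)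
  then have "(snd c' \<circ> \<gamma> has_derivative (\<lambda>h. D (h *\<^sub>R u))) (at t)"
    by (rule has_derivative_transform_within_open[OF _ \<gamma>(1,2)])
      (use \<gamma>(3) chart_inv_snd[OF c(1)] in simp)
  moreover have "D (h *\<^sub>R u) = h *\<^sub>R D u" for h
    using tr(1) has_derivative_linear linear_cmul by blast
  ultimately have "(snd c' \<circ> \<gamma> has_vector_derivative D u) (at t)"
    by (simp add: has_vector_derivative_def)
  then have "vector_derivative (snd c' \<circ> \<gamma>) (at t) = D u"
    by (rule vector_derivative_at)
  then show ?thesis
    unfolding curve_speed_def Let_def c'_def[symmetric] by (simp add: tr(2))
qed

lemma continuous_on_curve_speed:
  assumes \<gamma>: "path \<gamma>" "finite F"
    and C1: "\<And>c. c \<in> A \<Longrightarrow> (snd c \<circ> \<gamma>) C1_differentiable_on {t \<in> {0<..<1} - F. \<gamma> t \<in> fst c}"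
  shows "continuous_on ({0<..<1} - F) (curve_speed A g \<gamma>)"
proof (rule continuous_at_imp_continuous_on, intro ballI)
  fix t assume t: "t \<in> {0<..<1} - F"
  obtain c where c: "c \<in> A" "\<gamma> t \<in> fst c"
    using chart_cover by blast
  let ?S = "{t \<in> {0<..<1} - F. \<gamma> t \<in> fst c}"
  have S: "open ?S"
    using curve_preimage_open[OF \<gamma> chart(1)[OF c(1)]] .
  obtain D where D: "\<And>s. s \<in> ?S \<Longrightarrow> (snd c \<circ> \<gamma> has_vector_derivative D s) (at s)" "continuous_on ?S D"
    using C1[OF c(1)] unfolding C1_differentiable_on_def by blast
  have speed: "sqrt (g c (chart_inv c ((snd c \<circ> \<gamma>) s)) (D s) (D s)) = curve_speed A g \<gamma> s" if s: "s \<in> ?S" for s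
  proof -
    have mem: "\<gamma> s \<in> fst c" using s by blast
    have "curve_speed A g \<gamma> s = sqrt (g c (\<gamma> s) (D s) (D s))"
      by (rule curve_speed_chart[OF c(1) mem S s _ D(1)[OF s]]) blast
    then show ?thesis
      using chart_inv_snd[OF c(1) mem] by simp
  qed
  have "continuous_on ?S (snd c \<circ> \<gamma>)"
    using D(1) by (intro continuous_at_imp_continuous_on) (metis has_vector_derivative_continuous)
  then have "continuous_on ?S (\<lambda>s. sqrt (g c (chart_inv c ((snd c \<circ> \<gamma>) s)) (D s) (D s)))"
    using D(2) snd_mem[OF c(1)]
    by (intro continuous_on_real_sqrt metric_on_continuous_on[OF metric_on_chart[OF c(1)]]) auto
  then have "continuous_on ?S (curve_speed A g \<gamma>)"
    by (rule continuous_on_eq) (rule speed)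
  then show "isCont (curve_speed A g \<gamma>) t"
    using t c S continuous_on_eq_continuous_at[of ?S "curve_speed A g \<gamma>"] by blast
qed

lemma AE_not_in_finite: "finite F \<Longrightarrow> AE t in lborel. (t :: real) \<notin> F"
  by (intro AE_not_in finite_imp_null_set_lborel)

text \<open>With the exceptional times of a piecewise curve removed, the integrand is continuous on
  an open set, hence Borel, at the cost of a null set.\<close>

lemma curve_length_off_finite:
  assumes "finite F"
  shows "curve_length A g \<gamma> = (\<integral>\<^sup>+t. ennreal (indicator ({0<..<1} - F) t * curve_speed A g \<gamma> t) \<partial>lborel)"
  unfolding curve_length_def
proof (rule nn_integral_cong_AE)
  have "finite (F \<union> {0, 1})" using assms by simp
  from AE_not_in_finite[OF this]
  show "AE t in lborel. ennreal (curve_speed A g \<gamma> t) * indicator {0..1} t =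
      ennreal (indicator ({0<..<1} - F) t * curve_speed A g \<gamma> t)"
    by eventually_elim (auto simp: indicator_def)
qed

text \<open>Each half is run through at twice the speed in half the time.\<close>

lemma curve_join:
  assumes \<gamma>1: "piecewise_C1_curve A \<gamma>1" and \<gamma>2: "piecewise_C1_curve A \<gamma>2"
    and join: "pathfinish \<gamma>1 = pathstart \<gamma>2"
  shows "piecewise_C1_curve A (\<gamma>1 +++ \<gamma>2)" "curve_length A g (\<gamma>1 +++ \<gamma>2) = curve_length A g \<gamma>1 + curve_length A g \<gamma>2"
proof -
  let ?\<gamma> = "\<gamma>1 +++ \<gamma>2"
  obtain F1 where F1: "finite F1" and p1: "path \<gamma>1"
    and C1: "\<And>c. c \<in> A \<Longrightarrow> (snd c \<circ> \<gamma>1) C1_differentiable_on {t \<in> {0<..<1} - F1. \<gamma>1 t \<in> fst c}"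
    using \<gamma>1 unfolding piecewise_C1_curve_def by blast
  obtain F2 where F2: "finite F2" and p2: "path \<gamma>2"
    and C2: "\<And>c. c \<in> A \<Longrightarrow> (snd c \<circ> \<gamma>2) C1_differentiable_on {t \<in> {0<..<1} - F2. \<gamma>2 t \<in> fst c}"
    using \<gamma>2 unfolding piecewise_C1_curve_def by blast
  let ?a1 = "\<lambda>t::real. 2 * t + 0" and ?a2 = "\<lambda>t::real. 2 * t + (- 1)"
  \<comment> \<open>The exceptional times of both curves after reparametrisation, and the midpoint,
    where the two velocities need not match.\<close>
  define F where "F = {1 / 2} \<union> (\<lambda>t. t / 2) ` F1 \<union> (\<lambda>t. (t + 1) / 2) ` F2"
  have F: "finite F" using F1 F2 by (simp add: F_def)
  have p: "path ?\<gamma>" using p1 p2 join by simp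
  have in1: "?a1 t \<in> {0<..<1} - F1" if "t \<in> {0<..<1} - F" "t < 1 / 2" for t
  proof -
    have "2 * t \<notin> F1"
    proof
      assume "2 * t \<in> F1"
      then have "t \<in> (\<lambda>t. t / 2) ` F1"
        by (intro image_eqI[of _ _ "2 * t"]) auto
      then show False using that by (simp add: F_def)
    qed
    then show ?thesis using that by simp
  qed
  have in2: "?a2 t \<in> {0<..<1} - F2" if "t \<in> {0<..<1} - F" "t > 1 / 2" for t
  proof -
    have "2 * t - 1 \<notin> F2"
    proof
      assume "2 * t - 1 \<in> F2"
      then have "t \<in> (\<lambda>t. (t + 1) / 2) ` F2"
        by (intro image_eqI[of _ _ "2 * t - 1"]) auto
      then show False using that by (simp add: F_def)
    qed
    then show ?thesis using that by simp
  qed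
  have halves: "t < 1 / 2 \<or> t > 1 / 2" if "t \<in> {0<..<1} - F" for t
    using that by (auto simp: F_def)
  have openaff: "open {t. 2 * t + b \<in> S}" if "open S" for S and b :: real
    using open_vimage[OF that, of "\<lambda>t. 2 * t + b"] by (simp add: vimage_def continuous_intros)
  have eq1: "?\<gamma> t = \<gamma>1 (?a1 t)" if "?a1 t < 1" for t
    using that by (simp add: joinpaths_def)
  have eq2: "?\<gamma> t = \<gamma>2 (?a2 t)" if "?a2 t > 0" for t
    using that by (simp add: joinpaths_def)
  have "(snd c \<circ> ?\<gamma>) C1_differentiable_on {t \<in> {0<..<1} - F. ?\<gamma> t \<in> fst c}" if c: "c \<in> A" for c
  proof -
    let ?S1 = "{t \<in> {0<..<1} - F1. \<gamma>1 t \<in> fst c}" and ?S2 = "{t \<in> {0<..<1} - F2. \<gamma>2 t \<in> fst c}"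
    let ?O1 = "{t. ?a1 t \<in> ?S1}" and ?O2 = "{t. ?a2 t \<in> ?S2}"
    have O1: "open ?O1" and O2: "open ?O2"
      by (rule openaff curve_preimage_open p1 F1 p2 F2 chart(1) c)+
    have "(snd c \<circ> ?\<gamma>) C1_differentiable_on ?O1"
      by (rule C1_differentiable_on_cong_open[OF O1 C1_differentiable_on_affine[OF C1[OF c]]]) (simp add: eq1)
    moreover have "(snd c \<circ> ?\<gamma>) C1_differentiable_on ?O2"
      by (rule C1_differentiable_on_cong_open[OF O2 C1_differentiable_on_affine[OF C2[OF c]]]) (simp add: eq2)
    ultimately have "(snd c \<circ> ?\<gamma>) C1_differentiable_on (?O1 \<union> ?O2)"
      using O1 O2 by (intro C1_differentiable_on_Un_open)
    moreover have "{t \<in> {0<..<1} - F. ?\<gamma> t \<in> fst c} \<subseteq> ?O1 \<union> ?O2"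
    proof
      fix t assume "t \<in> {t \<in> {0<..<1} - F. ?\<gamma> t \<in> fst c}"
      then have t: "t \<in> {0<..<1} - F" "?\<gamma> t \<in> fst c" by auto
      from halves[OF t(1)] show "t \<in> ?O1 \<union> ?O2"
      proof
        assume "t < 1 / 2"
        then show ?thesis using in1[OF t(1)] t(2) eq1[of t] by simp
      next
        assume "t > 1 / 2"
        then show ?thesis using in2[OF t(1)] t(2) eq2[of t] by simp
      qed
    qed
    ultimately show ?thesis
      by (rule C1_differentiable_on_subset)
  qed
  then show "piecewise_C1_curve A ?\<gamma>"
    unfolding piecewise_C1_curve_def using p F by blast
  let ?s1 = "\<lambda>t. ennreal (indicator ({0<..<1} - F1) t * curve_speed A g \<gamma>1 t)"
  let ?s2 = "\<lambda>t. ennreal (indicator ({0<..<1} - F2) t * curve_speed A g \<gamma>2 t)"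
  have meas: "(\<lambda>t. ennreal (indicator ({0<..<1} - F') t * curve_speed A g \<gamma>' t)) \<in> borel_measurable borel"
    if "path \<gamma>'" "finite F'" "\<And>c. c \<in> A \<Longrightarrow> (snd c \<circ> \<gamma>') C1_differentiable_on {t \<in> {0<..<1} - F'. \<gamma>' t \<in> fst c}" for \<gamma>' F'
  proof -
    have "(\<lambda>t. indicator ({0<..<1} - F') t *\<^sub>R curve_speed A g \<gamma>' t) \<in> borel_measurable borel"
      using continuous_on_curve_speed[OF that] finite_imp_closed[OF that(2)]
      by (intro borel_measurable_continuous_on_indicator) auto
    then show ?thesis by simp
  qed
  have meas1: "?s1 \<in> borel_measurable borel" and meas2: "?s2 \<in> borel_measurable borel"
    using meas[OF p1 F1 C1] meas[OF p2 F2 C2] by blast+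
  \<comment> \<open>Treats both halves at once: \<open>b\<close> is 0 for the first curve and -1 for
    the second.\<close>
  have speed: "curve_speed A g ?\<gamma> t = 2 * curve_speed A g \<gamma>' (2 * t + b)"
    if \<gamma>': "finite F'" "path \<gamma>'" "\<And>c. c \<in> A \<Longrightarrow> (snd c \<circ> \<gamma>') C1_differentiable_on {t \<in> {0<..<1} - F'. \<gamma>' t \<in> fst c}"
      and t: "2 * t + b \<in> {0<..<1} - F'"
      and eq: "\<And>s. 2 * s + b \<in> {0<..<1} \<Longrightarrow> ?\<gamma> s = \<gamma>' (2 * s + b)" for \<gamma>' F' and b t :: real
  proof -
    define c where "c = chart_at A (\<gamma>' (2 * t + b))"
    have c: "c \<in> A" "\<gamma>' (2 * t + b) \<in> fst c"
      using chart_at by (auto simp: c_def)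
    have "2 * t + b \<in> {t \<in> {0<..<1} - F'. \<gamma>' t \<in> fst c}"
      using t c by simp
    then obtain u where u: "(snd c \<circ> \<gamma>' has_vector_derivative u) (at (2 * t + b))"
      using \<gamma>'(3)[OF c(1)] unfolding C1_differentiable_on_def by blast
    have "((\<lambda>t. 2 * t + b) has_vector_derivative 2) (at t)"
      by (auto intro!: derivative_eq_intros simp: has_real_derivative_iff_has_vector_derivative[symmetric])
    from vector_diff_chain_at[OF this u]
    have "((\<lambda>s. (snd c \<circ> \<gamma>') (2 * s + b)) has_vector_derivative 2 *\<^sub>R u) (at t)"
      by (simp add: comp_def)
    then have "(snd c \<circ> ?\<gamma> has_vector_derivative 2 *\<^sub>R u) (at t)"
      by (rule has_vector_derivative_transform_within_open[of _ _ _ "{s. 2 * s + b \<in> {0<..<1}}"])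
        (use t eq openaff[of "{0<..<1}"] in auto)
    then have "vector_derivative (snd c \<circ> ?\<gamma>) (at t) = 2 *\<^sub>R u"
      by (rule vector_derivative_at)
    moreover have "?\<gamma> t = \<gamma>' (2 * t + b)"
      using eq t by blast
    moreover have "g c (\<gamma>' (2 * t + b)) (2 *\<^sub>R u) (2 *\<^sub>R u) = 2\<^sup>2 * g c (\<gamma>' (2 * t + b)) u u"
      using metric_properties(1)[OF c] by (rule bilinear_scale_square)
    ultimately show ?thesis
      using vector_derivative_at[OF u] unfolding curve_speed_def Let_def
      by (simp add: c_def[symmetric] real_sqrt_mult)
  qed
  \<comment> \<open>The arguments 0 + 2 t and -1 + 2 t have the shape of the affine substitution
    rule, whose factor 2 uses up the doubled speed.\<close>
  have "curve_length A g ?\<gamma> = (\<integral>\<^sup>+t. 2 * ?s1 (0 + 2 * t) + 2 * ?s2 (- 1 + 2 * t) \<partial>lborel)"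
    unfolding curve_length_off_finite[OF F]
  proof (rule nn_integral_cong_AE)
    have "finite (F \<union> {0, 1})" using F by simp
    from AE_not_in_finite[OF this]
    show "AE t in lborel. ennreal (indicator ({0<..<1} - F) t * curve_speed A g ?\<gamma> t) =
        2 * ?s1 (0 + 2 * t) + 2 * ?s2 (- 1 + 2 * t)"
    proof eventually_elim
      case (elim t)
      have "t \<noteq> 0" "t \<noteq> 1" "t \<notin> F"
        using elim by simp_all
      then have "t \<in> {0<..<1} - F \<or> (t < 0 \<or> t > 1)"
        by (simp add: not_less) linarith
      then consider "t \<in> {0<..<1} - F" "t < 1 / 2" | "t \<in> {0<..<1} - F" "t > 1 / 2" | "t < 0 \<or> t > 1"
        using halves[of t] by blast
      then show ?case
      proof cases
        case 1
        have "curve_speed A g ?\<gamma> t = 2 * curve_speed A g \<gamma>1 (2 * t + 0)"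
          by (rule speed[OF F1 p1 C1 in1[OF 1]]) (use eq1 in auto)
        then show ?thesis
          using 1 in1[OF 1] by (simp add: ennreal_mult')
      next
        case 2
        have "curve_speed A g ?\<gamma> t = 2 * curve_speed A g \<gamma>2 (2 * t + (- 1))"
          by (rule speed[OF F2 p2 C2 in2[OF 2]]) (use eq2 in auto)
        then show ?thesis
          using 2 in2[OF 2] by (simp add: ennreal_mult' add.commute)
      qed (auto simp: indicator_def)
    qed
  qed
  also have "\<dots> = ennreal \<bar>2\<bar> * (\<integral>\<^sup>+t. ?s1 (0 + 2 * t) \<partial>lborel) + ennreal \<bar>2\<bar> * (\<integral>\<^sup>+t. ?s2 (- 1 + 2 * t) \<partial>lborel)"
    using meas1 meas2 by (simp add: nn_integral_add nn_integral_cmult)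
  also have "\<dots> = (\<integral>\<^sup>+t. ?s1 t \<partial>lborel) + (\<integral>\<^sup>+t. ?s2 t \<partial>lborel)"
    using nn_integral_real_affine[OF meas1, of 2 0] nn_integral_real_affine[OF meas2, of 2 "-1"] by simp
  also have "\<dots> = curve_length A g \<gamma>1 + curve_length A g \<gamma>2"
    by (simp only: curve_length_off_finite[OF F1, of \<gamma>1] curve_length_off_finite[OF F2, of \<gamma>2])
  finally show "curve_length A g ?\<gamma> = curve_length A g \<gamma>1 + curve_length A g \<gamma>2" .
qed

section \<open>Distance bounds witnessed by curves\<close>

text \<open>Witnesses add up along concatenation, and the convention that \<open>enn2real\<close>
  sends \<infinity> to 0 cannot interfere.\<close>

definition reach :: "'u \<Rightarrow> 'u \<Rightarrow> ennreal \<Rightarrow> bool" where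
  "reach x y r \<longleftrightarrow>
     (\<exists>\<gamma>. piecewise_C1_curve A \<gamma> \<and> pathstart \<gamma> = x \<and> pathfinish \<gamma> = y \<and> curve_length A g \<gamma> \<le> r)"

lemma reach_trans: "reach x y r \<Longrightarrow> reach y z s \<Longrightarrow> reach x z (r + s)"
proof -
  assume "reach x y r" "reach y z s"
  then obtain \<gamma> \<delta> where *: "piecewise_C1_curve A \<gamma>" "pathstart \<gamma> = x" "pathfinish \<gamma> = y" "curve_length A g \<gamma> \<le> r"
    "piecewise_C1_curve A \<delta>" "pathstart \<delta> = y" "pathfinish \<delta> = z" "curve_length A g \<delta> \<le> s"
    unfolding reach_def by (elim exE conjE)
  then show "reach x z (r + s)"
    unfolding reach_def using curve_join[of \<gamma> \<delta>] by (intro exI[of _ "\<gamma> +++ \<delta>"]) (simp add: add_mono)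
qed

lemma reach_mono: "reach x y r \<Longrightarrow> r \<le> s \<Longrightarrow> reach x y s"
  unfolding reach_def using order_trans by blast

lemma riemannian_dist_le:
  assumes "reach x y (ennreal r)" "r \<ge> 0"
  shows "riemannian_dist A g x y \<le> r"
proof -
  obtain \<gamma> where \<gamma>: "\<gamma> \<in> {\<gamma>. piecewise_C1_curve A \<gamma> \<and> pathstart \<gamma> = x \<and> pathfinish \<gamma> = y}" "curve_length A g \<gamma> \<le> ennreal r"
    using assms(1) unfolding reach_def by blast
  have "(INF \<gamma>\<in>{\<gamma>. piecewise_C1_curve A \<gamma> \<and> pathstart \<gamma> = x \<and> pathfinish \<gamma> = y}. curve_length A g \<gamma>) \<le> ennreal r"
    by (rule INF_lower2[where f = "curve_length A g", OF \<gamma>])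
  then show ?thesis
    unfolding riemannian_dist_def using assms(2) by (simp add: enn2real_leI)
qed

lemma riemannian_dist_nonneg: "riemannian_dist A g x y \<ge> 0"
  by (simp add: riemannian_dist_def)

text \<open>Before \<open>enn2real\<close> is applied the distance is upper semicontinuous: a curve
  shorter than r leaves room to start at any nearby point instead.\<close>

lemma riemannian_dist_measurable:
  assumes local: "\<And>x \<epsilon>. \<epsilon> > 0 \<Longrightarrow> \<exists>W. open W \<and> x \<in> W \<and> (\<forall>y\<in>W. reach y x (ennreal \<epsilon>))"
  shows "(\<lambda>x. riemannian_dist A g x x\<^sub>0) \<in> borel_measurable borel"
proof -
  let ?d = "\<lambda>x. INF \<gamma>\<in>{\<gamma>. piecewise_C1_curve A \<gamma> \<and> pathstart \<gamma> = x \<and> pathfinish \<gamma> = x\<^sub>0}. curve_length A g \<gamma>"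
  have "?d \<in> borel_measurable borel"
  proof (rule borel_measurableI_less)
    fix r :: ennreal
    have "open {x. ?d x < r}"
    proof (subst open_subopen, intro ballI)
      fix x assume "x \<in> {x. ?d x < r}"
      then obtain \<gamma> where \<gamma>: "piecewise_C1_curve A \<gamma>" "pathstart \<gamma> = x" "pathfinish \<gamma> = x\<^sub>0" "curve_length A g \<gamma> < r"
        by (auto simp: INF_less_iff)
      \<comment> \<open>The length is finite and strictly below r, which leaves a positive real
        margin.\<close>
      obtain \<epsilon> where \<epsilon>: "\<epsilon> > 0" "ennreal \<epsilon> + curve_length A g \<gamma> < r"
      proof -
        obtain s where s: "curve_length A g \<gamma> < s" "s < r"
          using dense[OF \<gamma>(4)] by blast
        then obtain s' where s': "s = ennreal s'" "s' \<ge> 0"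
          using s(2) by (cases s) auto
        obtain l where l: "curve_length A g \<gamma> = ennreal l" "l \<ge> 0"
          using s(1) by (cases "curve_length A g \<gamma>") auto
        have "l < s'"
          using s(1) l s' by (simp add: ennreal_less_iff)
        then have "ennreal (s' - l) + curve_length A g \<gamma> = s"
          using l s' by (simp add: ennreal_plus[symmetric] del: ennreal_plus)
        then show ?thesis
          using that[of "s' - l"] \<open>l < s'\<close> s(2) by simp
      qed
      obtain W where W: "open W" "x \<in> W" "\<And>y. y \<in> W \<Longrightarrow> reach y x (ennreal \<epsilon>)"
        using local[OF \<epsilon>(1)] by metis
      have "?d y < r" if y: "y \<in> W" for y
      proof -
        have "reach x x\<^sub>0 (curve_length A g \<gamma>)"
          unfolding reach_def using \<gamma> by blast
        then have "reach y x\<^sub>0 (ennreal \<epsilon> + curve_length A g \<gamma>)"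
          using W(3)[OF y] reach_trans by blast
        then obtain \<delta> where "piecewise_C1_curve A \<delta>" "pathstart \<delta> = y" "pathfinish \<delta> = x\<^sub>0"
            "curve_length A g \<delta> \<le> ennreal \<epsilon> + curve_length A g \<gamma>"
          unfolding reach_def by blast
        then show ?thesis
          using \<epsilon>(2) by (auto simp: INF_less_iff intro: order.strict_trans1)
      qed
      then show "\<exists>T. open T \<and> x \<in> T \<and> T \<subseteq> {x. ?d x < r}"
        using W by blast
    qed
    then show "{x \<in> space borel. ?d x < r} \<in> sets borel"
      by simp
  qed
  then show ?thesis
    unfolding riemannian_dist_def by measurable
qed

end

lemma continuous_on_det:
  fixes M :: "'a::topological_space \<Rightarrow> real ^ 'n ^ 'n::finite"
  assumes "\<And>i j. continuous_on S (\<lambda>t. M t $ i $ j)"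
  shows "continuous_on S (\<lambda>t. det (M t))"
  unfolding det_def by (intro continuous_intros assms)

lemma linear_preimage_cramer:
  fixes D :: "real ^ 'n::finite \<Rightarrow> real ^ 'n"
  assumes "linear D" "inj D"
  shows "det (matrix D) \<noteq> 0"
    and "D u = w \<Longrightarrow> u = (\<chi> k. det (\<chi> i j. if j = k then w $ i else D (axis j 1) $ i) / det (matrix D))"
proof -
  have "(*v) (matrix D) = D"
    using assms(1) matrix_vector_mul by metis
  then have inv: "invertible (matrix D)"
    using assms(2) by (metis invertible_left_inverse matrix_left_invertible_injective)
  then show det: "det (matrix D) \<noteq> 0"
    by (simp add: invertible_det_nz)
  assume "D u = w"
  then have "matrix D *v u = w"
    using \<open>(*v) (matrix D) = D\<close> by simp
  then show "u = (\<chi> k. det (\<chi> i j. if j = k then w $ i else D (axis j 1) $ i) / det (matrix D))"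
    unfolding cramer[OF det] by (simp add: matrix_def cong: if_cong)
qed

context riemannian
begin

text \<open>Straight segments in isometric coordinates. The velocity of such a segment in a chart is the
  solution of a linear system, hence continuous by Cramer's rule.\<close>

theorem reach_in_coordinates:
  assumes V: "isometric_coordinates A g V \<kappa> m" and hom: "homeomorphism V B \<kappa> j"
    and B: "open B" "convex B" and bound: "\<And>y w. y \<in> B \<Longrightarrow> sqrt (m y w w) \<le> \<Lambda> * norm w"
    and m: "\<And>y. y \<in> B \<Longrightarrow> m y 0 0 = 0"
    and xy: "x \<in> V" "y \<in> V"
  shows "reach x y (ennreal (\<Lambda> * norm (\<kappa> y - \<kappa> x)))"
proof -
  have \<kappa>j: "\<And>z. z \<in> V \<Longrightarrow> \<kappa> z \<in> B" "\<And>z. z \<in> V \<Longrightarrow> j (\<kappa> z) = z" "\<And>q. q \<in> B \<Longrightarrow> j q \<in> V" "\<And>q. q \<in> B \<Longrightarrow> \<kappa> (j q) = q"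
    and jc: "continuous_on B j" and \<kappa>c: "continuous_on V \<kappa>"
    using hom unfolding homeomorphism_def by blast+
  have openV: "open V" by (rule isometric_coordinatesD(1)[OF V])
  define w where "w = \<kappa> y - \<kappa> x"
  define seg where "seg t = \<kappa> x + t *\<^sub>R w" for t :: real
  have seg: "seg t \<in> B" if "t \<in> {0..1}" for t
  proof -
    have "seg t = (1 - t) *\<^sub>R \<kappa> x + t *\<^sub>R \<kappa> y"
      by (simp add: seg_def w_def algebra_simps)
    then show ?thesis
      using that B(2) \<kappa>j(1) xy by (simp add: convexD)
  qed
  have seg_cont: "continuous_on T seg" for T
    unfolding seg_def by (intro continuous_intros)
  have seg_der: "(seg has_vector_derivative w) (at t)" for t
    unfolding seg_def by (auto intro!: derivative_eq_intros)
  define \<gamma> where "\<gamma> t = j (seg t)" for t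
  have path: "path \<gamma>"
    unfolding path_def \<gamma>_def by (rule continuous_on_compose2[OF jc seg_cont]) (use seg in blast)
  have \<gamma>V: "\<gamma> t \<in> V" "\<kappa> (\<gamma> t) = seg t" if "t \<in> {0..1}" for t
    using seg[OF that] \<kappa>j by (auto simp: \<gamma>_def)
  have main: "\<exists>u. (\<forall>t\<in>{t \<in> {0<..<1}. \<gamma> t \<in> fst c}. (snd c \<circ> \<gamma> has_vector_derivative u t) (at t) \<and>
      g c (\<gamma> t) (u t) (u t) = m (seg t) w w) \<and> continuous_on {t \<in> {0<..<1}. \<gamma> t \<in> fst c} u"
    if c: "c \<in> A" for c
  proof -
    let ?S = "{t \<in> {0<..<1}. \<gamma> t \<in> fst c}" and ?T = "snd c ` (fst c \<inter> V)" and ?F = "\<kappa> \<circ> chart_inv c"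
    let ?D = "\<lambda>z. frechet_derivative ?F (at z)"
    have smooth: "smooth_on ?T ?F"
      by (rule isometric_coordinatesD(2)[OF V c])
    let ?Q = "\<kappa> ` (fst c \<inter> V)"
    have Q: "open ?Q"
    proof -
      have "openin (top_of_set V) (fst c \<inter> V)"
        using chart(1)[OF c] by (metis inf_commute openin_open_Int)
      then have "openin (top_of_set B) ?Q"
        by (rule homeomorphism_imp_open_map[OF hom])
      then show ?thesis
        using B(1) openin_open_eq by blast
    qed
    have lin: "linear (?D (snd c z))" and inj: "inj (?D (snd c z))"
      and der: "(?F has_derivative ?D (snd c z)) (at (snd c z))" if z: "z \<in> fst c \<inter> V" for z
    proof -
      show der: "(?F has_derivative ?D (snd c z)) (at (snd c z))"
        by (rule isometric_coordinates_derivative[OF V c z])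
      then show lin: "linear (?D (snd c z))"
        by (rule has_derivative_linear)
      \<comment> \<open>A vector killed by the differential would have length 0 for
        \<open>g\<close>, which is the pulled-back metric.\<close>
      have "u = 0" if "?D (snd c z) u = 0" for u
      proof (rule ccontr)
        assume "u \<noteq> 0"
        then have "g c z u u > 0"
          using metric_properties(3)[OF c] z by blast
        moreover have "g c z u u = m (\<kappa> z) 0 0"
          using isometric_coordinatesD(3)[OF V c, of z u u] z that by simp
        ultimately show False
          using m \<kappa>j(1) z by simp
      qed
      then show "inj (?D (snd c z))"
        using linear_injective_0[OF lin] by blast
    qed
    define u where "u t = (\<chi> k. det (\<chi> i j. if j = k then w $ i else ?D (snd c (\<gamma> t)) (axis j 1) $ i) /
        det (matrix (?D (snd c (\<gamma> t)))))" for t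
    have S: "\<gamma> t \<in> fst c \<inter> V" "t \<in> {0..1}" if "t \<in> ?S" for t
      using that \<gamma>V(1)[of t] by auto
    have sol: "?D (snd c (\<gamma> t)) (u t) = w" if t: "t \<in> ?S" for t
    proof -
      have "surj (?D (snd c (\<gamma> t)))"
        using linear_injective_imp_surjective[OF lin inj] S(1)[OF t] by blast
      then obtain v where v: "?D (snd c (\<gamma> t)) v = w"
        by (metis surjD)
      have "v = u t"
        unfolding u_def by (rule linear_preimage_cramer(2)[OF lin[OF S(1)[OF t]] inj[OF S(1)[OF t]] v])
      then show ?thesis using v by simp
    qed
    have "(snd c \<circ> \<gamma> has_vector_derivative u t) (at t)" if t: "t \<in> ?S" for t
    proof -
      let ?d = "?D (snd c (\<gamma> t))"
      have z: "\<gamma> t \<in> fst c \<inter> V" using S(1)[OF t] .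
      obtain d' where d': "linear d'" "d' \<circ> ?d = id"
        using linear_injective_left_inverse[OF lin[OF z] inj[OF z]] by blast
      \<comment> \<open>Derivative of an inverse map: \<open>snd c \<circ> j\<close> is continuous
        and inverts \<open>?F\<close>, so it is differentiated by the left inverse of the derivative
        of \<open>?F\<close>.\<close>
      have "(snd c \<circ> j has_derivative d') (at (seg t))"
      proof (rule has_derivative_inverse_basic[where f = ?F and f' = ?d and T = ?Q])
        show "(?F has_derivative ?d) (at ((snd c \<circ> j) (seg t)))"
          using der[OF z] by (simp add: \<gamma>_def)
        show "bounded_linear d'"
          using d'(1) by (simp add: linear_conv_bounded_linear)
        show "seg t \<in> ?Q"
          using z \<gamma>V(2)[OF S(2)[OF t]] by (metis image_eqI)
        have "continuous_on ?Q (snd c \<circ> j)"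
        proof (rule continuous_on_compose)
          show "continuous_on ?Q j"
            using jc by (rule continuous_on_subset) (use \<kappa>j(1) in blast)
          show "continuous_on (j ` ?Q) (snd c)"
            using chart_cont[OF c] by (rule continuous_on_subset) (use \<kappa>j(2) in auto)
        qed
        then show "isCont (snd c \<circ> j) (seg t)"
          using Q \<open>seg t \<in> ?Q\<close> continuous_on_eq_continuous_at by blast
        show "?F ((snd c \<circ> j) q) = q" if "q \<in> ?Q" for q
          using that \<kappa>j(2) chart_inv_snd[OF c] by auto
      qed (use d'(2) Q in auto)
      from has_derivative_compose[OF seg_der[unfolded has_vector_derivative_def] this]
      have "(snd c \<circ> \<gamma> has_derivative (\<lambda>h. d' (h *\<^sub>R w))) (at t)"
        by (simp add: \<gamma>_def comp_def)
      moreover have "d' w = u t"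
        using d'(2) sol[OF t] by (metis comp_apply id_apply)
      ultimately show ?thesis
        using d'(1) by (simp add: has_vector_derivative_def linear_cmul)
    qed
    moreover have "g c (\<gamma> t) (u t) (u t) = m (seg t) w w" if t: "t \<in> ?S" for t
      using isometric_coordinatesD(3)[OF V c, of "\<gamma> t" "u t" "u t"] S[OF t] sol[OF t] \<gamma>V(2) by simp
    moreover have "continuous_on ?S u"
    proof -
      have "continuous_on {0..1} \<gamma>"
        using path by (simp add: path_def)
      then have "continuous_on ?S \<gamma>"
        by (rule continuous_on_subset) auto
      then have "continuous_on ?S (\<lambda>t. snd c (\<gamma> t))"
        by (rule continuous_on_compose2[OF chart_cont[OF c]]) auto
      then have entry: "continuous_on ?S (\<lambda>t. ?D (snd c (\<gamma> t)) v)" for v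
        by (rule continuous_on_compose2[OF smooth_on_imp_continuous_on[OF smooth_on_derivative[OF smooth]]])
          (use S(1) in blast)
      have entry2: "continuous_on ?S (\<lambda>t. ?D (snd c (\<gamma> t)) v $ i)" for v i
        by (rule continuous_on_component[OF entry])
      have "continuous_on ?S (\<lambda>t. det (matrix (?D (snd c (\<gamma> t)))))"
        by (rule continuous_on_det, unfold matrix_def vec_lambda_beta, rule entry2)
      moreover have "continuous_on ?S (\<lambda>t. det (\<chi> i j. if j = k then w $ i else ?D (snd c (\<gamma> t)) (axis j 1) $ i))" for k
      proof -
        have "continuous_on ?S (\<lambda>t. if j = k then w $ i else ?D (snd c (\<gamma> t)) (axis j 1) $ i)" for i j
        proof (cases "j = k")
          case False
          show ?thesis
            unfolding if_not_P[OF False] by (rule entry2)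
        qed simp
        then show ?thesis
          by (intro continuous_on_det, unfold vec_lambda_beta)
      qed
      moreover have "det (matrix (?D (snd c (\<gamma> t)))) \<noteq> 0" if "t \<in> ?S" for t
        using linear_preimage_cramer(1)[OF lin inj] S(1)[OF that] by blast
      ultimately show ?thesis
        unfolding u_def by (intro continuous_on_vec_lambda continuous_on_divide) auto
    qed
    ultimately show ?thesis by blast
  qed
  have "piecewise_C1_curve A \<gamma>"
    unfolding piecewise_C1_curve_def
  proof (intro conjI exI[of _ "{}"] ballI)
    show "(snd c \<circ> \<gamma>) C1_differentiable_on {t \<in> {0<..<1} - {}. \<gamma> t \<in> fst c}" if "c \<in> A" for c
      using main[OF that] unfolding C1_differentiable_on_def by auto
  qed (use path in auto)
  moreover have "pathstart \<gamma> = x" "pathfinish \<gamma> = y"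
    using \<kappa>j(2) xy by (simp_all add: pathstart_def pathfinish_def \<gamma>_def seg_def w_def)
  moreover have "curve_length A g \<gamma> \<le> ennreal (\<Lambda> * norm w)"
  proof -
    have speed: "curve_speed A g \<gamma> t \<le> \<Lambda> * norm w" if t: "t \<in> {0<..<1}" for t
    proof -
      obtain c where c: "c \<in> A" "\<gamma> t \<in> fst c"
        using chart_cover by blast
      have S: "open {t \<in> {0<..<1} - {}. \<gamma> t \<in> fst c}"
        by (rule curve_preimage_open[OF path _ chart(1)[OF c(1)]]) simp
      obtain u where u: "(snd c \<circ> \<gamma> has_vector_derivative u) (at t)" "g c (\<gamma> t) u u = m (seg t) w w"
        using main[OF c(1)] t c(2) by blast
      have "curve_speed A g \<gamma> t = sqrt (g c (\<gamma> t) u u)"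
        by (rule curve_speed_chart[OF c S _ _ u(1)]) (use t c in auto)
      then show ?thesis
        using u(2) bound[OF seg, of t w] t by simp
    qed
    have "curve_length A g \<gamma> \<le> (\<integral>\<^sup>+t. ennreal (\<Lambda> * norm w) * indicator {0..1 :: real} t \<partial>lborel)"
      unfolding curve_length_off_finite[of "{}", OF finite.emptyI]
    proof (rule nn_integral_mono)
      fix t :: real
      show "ennreal (indicator ({0<..<1} - {}) t * curve_speed A g \<gamma> t) \<le> ennreal (\<Lambda> * norm w) * indicator {0..1} t"
        using ennreal_leI[OF speed[of t]] by (cases "t \<in> {0<..<1}") (auto simp: indicator_def)
    qed
    also have "\<dots> = ennreal (\<Lambda> * norm w)"
      by (simp add: nn_integral_cmult_indicator)
    finally show ?thesis .
  qed
  ultimately show ?thesis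
    unfolding reach_def w_def by blast
qed

end

section \<open>Cells and sheets\<close>

text \<open>Compactness reduces witnesses chosen near each point to finitely many.\<close>

lemma finite_image_locally_constant:
  fixes K :: "'a::topological_space set"
  assumes "compact K" "\<And>q. q \<in> K \<Longrightarrow> \<exists>N e. open N \<and> q \<in> N \<and> P N e"
  obtains F where "finite F" "\<And>q. q \<in> K \<Longrightarrow> \<exists>N e. q \<in> N \<and> e \<in> F \<and> P N e"
proof -
  have "\<forall>q\<in>K. \<exists>Ne. open (fst Ne) \<and> q \<in> fst Ne \<and> P (fst Ne) (snd Ne)"
    using assms(2) by (metis fst_conv snd_conv)
  then obtain h where h: "\<And>q. q \<in> K \<Longrightarrow> open (fst (h q)) \<and> q \<in> fst (h q) \<and> P (fst (h q)) (snd (h q))"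
    by metis
  obtain Q where Q: "Q \<subseteq> K" "finite Q" "K \<subseteq> (\<Union>q\<in>Q. fst (h q))"
    using compactE_image[OF assms(1), of K "\<lambda>q. fst (h q)"] h by blast
  show ?thesis
  proof (rule that[of "(\<lambda>q. snd (h q)) ` Q"])
    fix q assume "q \<in> K"
    then obtain q' where "q' \<in> Q" "q \<in> fst (h q')" using Q(3) by blast
    then show "\<exists>N e. q \<in> N \<and> e \<in> (\<lambda>q. snd (h q)) ` Q \<and> P N e"
      using h Q(1) by blast
  qed (use Q in auto)
qed

lemma (in covering) lifts_in_sheet:
  assumes "homeomorphism V U p q" "path n" "path_image n \<subseteq> U" "x \<in> V" "p x = pathstart n"
  shows "lifts p n x (q (pathfinish n))" "q (pathfinish n) \<in> V"
proof -
  have q: "continuous_on U q" "q (p x) = x" "\<And>y. y \<in> U \<Longrightarrow> p (q y) = y" "\<And>y. y \<in> U \<Longrightarrow> q y \<in> V"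
    using assms(1,4) by (auto simp: homeomorphism_def)
  have nU: "n t \<in> U" if "t \<in> {0..1}" for t
    using assms(3) that by (auto simp: path_image_def)
  show "lifts p n x (q (pathfinish n))"
  proof (rule liftsI[of "q \<circ> n"])
    show "path (q \<circ> n)"
      using assms(2,3) q(1) by (intro path_continuous_image) (auto intro: continuous_on_subset)
  qed (use q nU assms(5) in \<open>auto simp: pathstart_def pathfinish_def\<close>)
  show "q (pathfinish n) \<in> V"
    using nU[of 1] q(4) by (simp add: pathfinish_def)
qed

locale riemannian_covering =
  M: riemannian A g + riemannian A' g' + universal_covering p b
  for A :: "('m::{t2_space,second_countable_topology}, 'n::finite) chart set" and g :: "('m, 'n) metric_field"
    and A' :: "('u::{t2_space,second_countable_topology}, 'n) chart set" and g' :: "('u, 'n) metric_field"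
    and p :: "'u \<Rightarrow> 'm" and b :: 'u +
  assumes local_isometry: "local_isometry A' g' p A g" and compact_base: "compact (UNIV :: 'm set)"
begin

text \<open>A cell consists of a chart and of the centre and radius of a ball in its image.\<close>

definition cell :: "('m, 'n) chart \<times> (real ^ 'n) \<times> real \<Rightarrow> bool" where
  "cell = (\<lambda>(c, a, r). c \<in> A \<and> r > 0 \<and> cball a r \<subseteq> chart_image c \<and>
      (\<exists>\<V>. evenly_covered p (chart_inv c ` ball a r) \<V>))"

definition cell_domain :: "('m, 'n) chart \<times> (real ^ 'n) \<times> real \<Rightarrow> 'm set" where
  "cell_domain = (\<lambda>(c, a, r). chart_inv c ` ball a r)"

definition coord :: "('m, 'n) chart \<times> (real ^ 'n) \<times> real \<Rightarrow> 'u \<Rightarrow> real ^ 'n" where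
  "coord = (\<lambda>(c, a, r) x. snd c (p x))"

definition cell_metric :: "('m, 'n) chart \<times> (real ^ 'n) \<times> real \<Rightarrow> real ^ 'n \<Rightarrow> real ^ 'n \<Rightarrow> real ^ 'n \<Rightarrow> real" where
  "cell_metric = (\<lambda>(c, a, r) y. g c (chart_inv c y))"

abbreviation cell_ball :: "('m, 'n) chart \<times> (real ^ 'n) \<times> real \<Rightarrow> (real ^ 'n) set" where
  "cell_ball i \<equiv> ball (fst (snd i)) (snd (snd i))"

text \<open>Three concentric balls are in play: radius r / 3 covers the base, r / 2 is the compact
  core that carries the bump, and r is evenly covered, with the metric still defined on its
  closure.\<close>

abbreviation cell_core :: "('m, 'n) chart \<times> (real ^ 'n) \<times> real \<Rightarrow> (real ^ 'n) set" where
  "cell_core i \<equiv> cball (fst (snd i)) (snd (snd i) / 2)"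

lemma cellD:
  assumes "cell i"
  shows "fst i \<in> A" "snd (snd i) > 0" "cball (fst (snd i)) (snd (snd i)) \<subseteq> chart_image (fst i)"
    "\<exists>\<V>. evenly_covered p (cell_domain i) \<V>" "cell_core i \<subseteq> cell_ball i" "cell_ball i \<subseteq> chart_image (fst i)"
    "coord i = snd (fst i) \<circ> p" "cell_metric i = (\<lambda>y. g (fst i) (chart_inv (fst i) y))"
    "cell_domain i = chart_inv (fst i) ` cell_ball i"
proof -
  obtain c a r where i: "i = (c, a, r)" by (cases i)
  show "fst i \<in> A" "snd (snd i) > 0" and sub: "cball (fst (snd i)) (snd (snd i)) \<subseteq> chart_image (fst i)"
    and "\<exists>\<V>. evenly_covered p (cell_domain i) \<V>"
    using assms by (auto simp: i cell_def cell_domain_def)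
  show "cell_core i \<subseteq> cell_ball i"
    using assms by (auto simp: i cell_def)
  show "cell_ball i \<subseteq> chart_image (fst i)"
    using sub ball_subset_cball by blast
qed (auto simp: coord_def cell_metric_def cell_domain_def fun_eq_iff split: prod.splits)

lemma mem_cell_domain:
  assumes "cell i"
  shows "q \<in> cell_domain i \<longleftrightarrow> q \<in> fst (fst i) \<and> snd (fst i) q \<in> cell_ball i"
proof -
  note c = cellD(1)[OF assms] and sub = cellD(6)[OF assms] and dom = cellD(9)[OF assms]
  show ?thesis
  proof
    assume "q \<in> cell_domain i"
    then obtain y where y: "y \<in> cell_ball i" "q = chart_inv (fst i) y"
      unfolding dom by blast
    then have "y \<in> chart_image (fst i)"
      using sub by blast
    then show "q \<in> fst (fst i) \<and> snd (fst i) q \<in> cell_ball i"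
      using y M.snd_chart_inv[OF c] M.chart_inv_mem[OF c] by metis
  next
    assume "q \<in> fst (fst i) \<and> snd (fst i) q \<in> cell_ball i"
    then show "q \<in> cell_domain i"
      unfolding dom using M.chart_inv_snd[OF c] by (metis image_eqI)
  qed
qed

lemma open_cell_domain: "cell i \<Longrightarrow> open (cell_domain i)"
  using cellD(4) by (auto simp: evenly_covered_def)

lemma cell_exists:
  obtains i where "cell i" "q \<in> cell_domain i" "snd (fst i) q = fst (snd i)"
proof -
  obtain c where c: "c \<in> A" "q \<in> fst c"
    using M.chart_cover by blast
  obtain T \<V> where T: "q \<in> T" "evenly_covered p T \<V>"
    using evenly_covered_nhd .
  let ?W = "snd c ` (fst c \<inter> T)"
  have "open T"
    using T(2) by (simp add: evenly_covered_def)
  then have "open ?W"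
    using M.open_chart_image[OF c(1)] by blast
  moreover have "snd c q \<in> ?W"
    using c T by blast
  ultimately obtain r where r: "r > 0" "cball (snd c q) r \<subseteq> ?W"
    by (meson open_contains_cball)
  have W: "?W \<subseteq> chart_image c"
    by (auto simp: chart_image_def)
  have sub: "chart_inv c ` ball (snd c q) r \<subseteq> T"
    using r(2) ball_subset_cball[of "snd c q" r] M.chart_inv_snd[OF c(1)] by fastforce
  have "openin (top_of_set (chart_image c)) (ball (snd c q) r)"
    using order_trans[OF ball_subset_cball order_trans[OF r(2) W]] by (intro open_subset) auto
  then have "openin (top_of_set (fst c)) (chart_inv c ` ball (snd c q) r)"
    by (rule homeomorphism_imp_open_map[OF homeomorphism_symD[OF M.chart(3)[OF c(1)]]])
  then have "open (chart_inv c ` ball (snd c q) r)"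
    using M.chart(1)[OF c(1)] openin_open_eq by blast
  then have "evenly_covered p (chart_inv c ` ball (snd c q) r) ((\<lambda>V. V \<inter> p -` (chart_inv c ` ball (snd c q) r)) ` \<V>)"
    by (rule evenly_covered_subset[OF T(2) _ sub cont])
  then have cell: "cell (c, snd c q, r)"
    using c r W unfolding cell_def by blast
  then show ?thesis
    using that[of "(c, snd c q, r)"] c r(1) mem_cell_domain[OF cell] by simp
qed

lemma metric_on_cell:
  assumes "cell i"
  shows "metric_on (cball (fst (snd i)) (snd (snd i))) (cell_metric i)"
  unfolding cellD(8)[OF assms] using M.metric_on_chart[OF cellD(1)[OF assms]] cellD(3)[OF assms]
  by (rule metric_on_subset)

text \<open>A chart of the base composed with the local isometry \<open>p\<close> expresses the
  metric of the cover by that of the base. So bounds found in the coordinates of a cell hold on all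
  of its sheets.\<close>

lemma isometric_coordinates_cell:
  assumes "cell i"
  shows "isometric_coordinates A' g' (p -` cell_domain i) (coord i) (cell_metric i)"
  unfolding isometric_coordinates_def
proof (intro conjI ballI allI)
  show "open (p -` cell_domain i)"
    using open_cell_domain[OF assms] cont open_vimage by blast
  fix c' assume c': "c' \<in> A'"
  let ?c = "fst i"
  have loc: "let U = fst c' \<inter> p -` fst ?c; F = snd ?c \<circ> p \<circ> chart_inv c'
        in smooth_on (snd c' ` U) F \<and>
           (\<forall>x\<in>U. \<forall>u w. let D = frechet_derivative F (at (snd c' x)) in g' c' x u w = g ?c (p x) (D u) (D w))"
    using local_isometry c' cellD(1)[OF assms] unfolding local_isometry_def by blast
  have sub: "p -` cell_domain i \<subseteq> p -` fst ?c"
    using mem_cell_domain[OF assms] by auto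
  have "snd c' ` (fst c' \<inter> p -` cell_domain i) \<subseteq> snd c' ` (fst c' \<inter> p -` fst ?c)"
    using sub by blast
  then show "smooth_on (snd c' ` (fst c' \<inter> p -` cell_domain i)) (coord i \<circ> chart_inv c')"
    unfolding cellD(7)[OF assms] using loc smooth_on_subset unfolding Let_def by blast
  fix x u w assume x: "x \<in> fst c' \<inter> p -` cell_domain i"
  then have "p x \<in> fst ?c"
    using sub by auto
  then have "chart_inv ?c (coord i x) = p x"
    using M.chart_inv_snd[OF cellD(1)[OF assms]] by (simp add: cellD(7)[OF assms])
  moreover have "g' c' x u w = g ?c (p x) (frechet_derivative (snd ?c \<circ> p \<circ> chart_inv c') (at (snd c' x)) u)
      (frechet_derivative (snd ?c \<circ> p \<circ> chart_inv c') (at (snd c' x)) w)"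
    using loc x \<open>p x \<in> fst ?c\<close> unfolding Let_def by simp
  ultimately show "g' c' x u w = cell_metric i (coord i x) (frechet_derivative (coord i \<circ> chart_inv c') (at (snd c' x)) u)
      (frechet_derivative (coord i \<circ> chart_inv c') (at (snd c' x)) w)"
    unfolding cellD(8)[OF assms] by (simp add: cellD(7)[OF assms])
qed

lemma homeomorphism_coord:
  assumes i: "cell i" and V: "homeomorphism V (cell_domain i) p q"
  shows "homeomorphism V (cell_ball i) (coord i) (q \<circ> chart_inv (fst i))"
proof -
  note h = M.chart(3)[OF cellD(1)[OF i]]
  have "homeomorphism (cell_domain i) (cell_ball i) (snd (fst i)) (chart_inv (fst i))"
  proof (rule homeomorphismI)
    show "continuous_on (cell_domain i) (snd (fst i))" "continuous_on (cell_ball i) (chart_inv (fst i))"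
      using h mem_cell_domain[OF i] cellD(6)[OF i] unfolding homeomorphism_def
      by (auto intro: continuous_on_subset)
    show "snd (fst i) ` cell_domain i \<subseteq> cell_ball i"
      using mem_cell_domain[OF i] by blast
    show "chart_inv (fst i) ` cell_ball i \<subseteq> cell_domain i"
      unfolding cellD(9)[OF i] by (rule order_refl)
    show "chart_inv (fst i) (snd (fst i) x) = x" if "x \<in> cell_domain i" for x
      using that mem_cell_domain[OF i] M.chart_inv_snd[OF cellD(1)[OF i]] by blast
    show "snd (fst i) (chart_inv (fst i) y) = y" if "y \<in> cell_ball i" for y
      using that cellD(6)[OF i] M.snd_chart_inv[OF cellD(1)[OF i]] by blast
  qed
  then show ?thesis
    unfolding cellD(7)[OF i] using V homeomorphism_compose by blast
qed

text \<open>The constant comes from the metric of the base on the closed coordinate ball, so it is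
  the same for all sheets.\<close>

lemma reach_in_cell:
  assumes "cell i"
  shows "\<exists>\<Lambda>>0. \<forall>V q x y. open V \<longrightarrow> homeomorphism V (cell_domain i) p q \<longrightarrow> x \<in> V \<longrightarrow> y \<in> V \<longrightarrow>
           reach x y (ennreal (\<Lambda> * norm (coord i y - coord i x)))"
proof -
  note metric = metric_on_cell[OF assms]
  obtain \<Lambda> where \<Lambda>: "\<Lambda> > 0" "\<And>y w. y \<in> cball (fst (snd i)) (snd (snd i)) \<Longrightarrow> sqrt (cell_metric i y w w) \<le> \<Lambda> * norm w"
    using metric_on_bounds(2)[OF metric compact_cball] by blast
  have "reach x y (ennreal (\<Lambda> * norm (coord i y - coord i x)))"
    if V: "open V" "homeomorphism V (cell_domain i) p q" and xy: "x \<in> V" "y \<in> V" for V q x y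
  proof (rule reach_in_coordinates[OF _ homeomorphism_coord[OF assms V(2)] _ _ _ _ xy])
    show "isometric_coordinates A' g' V (coord i) (cell_metric i)"
      by (rule isometric_coordinates_subset[OF isometric_coordinates_cell[OF assms] V(1)])
        (use V(2) in \<open>auto simp: homeomorphism_def\<close>)
    show "cell_metric i y 0 0 = 0" if "y \<in> cell_ball i" for y
    proof -
      have "bilinear (cell_metric i y)"
        using metric that ball_subset_cball unfolding metric_on_def by blast
      then show ?thesis by (rule bilinear_lzero)
    qed
    show "sqrt (cell_metric i y w w) \<le> \<Lambda> * norm w" if "y \<in> cell_ball i" for y w
      using that ball_subset_cball by (intro \<Lambda>(2)) blast
  qed auto
  then show ?thesis
    using \<Lambda>(1) by blast
qed

lemma reach_local:
  assumes "\<epsilon> > 0"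
  shows "\<exists>W. open W \<and> x \<in> W \<and> (\<forall>y\<in>W. reach y x (ennreal \<epsilon>))"
proof -
  obtain i where i: "cell i" "p x \<in> cell_domain i"
    using cell_exists[of "p x"] by metis
  obtain \<V> where "evenly_covered p (cell_domain i) \<V>"
    using cellD(4)[OF i(1)] by blast
  then obtain V q where V: "x \<in> V" "open V" "homeomorphism V (cell_domain i) p q"
    using evenly_covered_sheet i(2) by metis
  obtain \<Lambda> where \<Lambda>: "\<Lambda> > 0" "\<And>y. y \<in> V \<Longrightarrow> reach y x (ennreal (\<Lambda> * norm (coord i x - coord i y)))"
    using reach_in_cell[OF i(1)] V by metis
  have "continuous_on V (coord i)"
    using homeomorphism_coord[OF i(1) V(3)] by (simp add: homeomorphism_def)
  then have op: "open (V \<inter> coord i -` ball (coord i x) (\<epsilon> / \<Lambda>))"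
    using V(2) by (intro continuous_open_preimage) auto
  show ?thesis
  proof (intro exI conjI ballI)
    show "x \<in> V \<inter> coord i -` ball (coord i x) (\<epsilon> / \<Lambda>)"
      using V(1) assms \<Lambda>(1) by simp
    fix y assume y: "y \<in> V \<inter> coord i -` ball (coord i x) (\<epsilon> / \<Lambda>)"
    then have "\<Lambda> * norm (coord i x - coord i y) \<le> \<epsilon>"
      using \<Lambda>(1) by (simp add: dist_norm pos_less_divide_eq mult.commute)
    then show "reach y x (ennreal \<epsilon>)"
      using \<Lambda>(2) y reach_mono ennreal_leI by blast
  qed (rule op)
qed

text \<open>The bound depends on the path in the base and not on the lift. A lift is merely
  continuous and may have no length, so it is replaced by segments: while \<open>l\<close> stays in
  a cell, a lift stays in one sheet, where \<open>reach_in_cell\<close> applies.\<close>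

lemma reach_lifts:
  assumes l: "path l"
  shows "\<exists>N\<ge>0. \<forall>x y. lifts p l x y \<longrightarrow> reach x y (ennreal N) \<and> reach y x (ennreal N)"
proof -
  let ?I = "{0..1::real}"
  \<comment> \<open>Quantified over all lifts at once. Recording both directions makes the relation
    symmetric; it is then an equivalence relation with open classes on [0, 1].\<close>
  define R where "R s t \<longleftrightarrow> (\<exists>N\<ge>0. \<forall>\<sigma>. path \<sigma> \<longrightarrow> (\<forall>t\<in>?I. p (\<sigma> t) = l t) \<longrightarrow>
      reach (\<sigma> s) (\<sigma> t) (ennreal N) \<and> reach (\<sigma> t) (\<sigma> s) (ennreal N))" for s t
  have "R 0 1"
  proof (rule connected_equivalence_relation[of ?I])
    show "R t s" if "R s t" for s t
      using that unfolding R_def by blast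
    show "R s u" if "R s t" "R t u" for s t u
    proof -
      obtain N1 where N1: "N1 \<ge> 0" "\<forall>\<sigma>. path \<sigma> \<longrightarrow> (\<forall>t\<in>?I. p (\<sigma> t) = l t) \<longrightarrow>
          reach (\<sigma> s) (\<sigma> t) (ennreal N1) \<and> reach (\<sigma> t) (\<sigma> s) (ennreal N1)"
        using \<open>R s t\<close> unfolding R_def by blast
      obtain N2 where N2: "N2 \<ge> 0" "\<forall>\<sigma>. path \<sigma> \<longrightarrow> (\<forall>t\<in>?I. p (\<sigma> t) = l t) \<longrightarrow>
          reach (\<sigma> t) (\<sigma> u) (ennreal N2) \<and> reach (\<sigma> u) (\<sigma> t) (ennreal N2)"
        using \<open>R t u\<close> unfolding R_def by blast
      have sum: "ennreal (N1 + N2) = ennreal N1 + ennreal N2" "ennreal (N1 + N2) = ennreal N2 + ennreal N1"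
        using N1(1) N2(1) by (simp_all add: add.commute)
      have "reach (\<sigma> s) (\<sigma> u) (ennreal (N1 + N2)) \<and> reach (\<sigma> u) (\<sigma> s) (ennreal (N1 + N2))"
        if "path \<sigma>" "\<forall>t\<in>?I. p (\<sigma> t) = l t" for \<sigma>
        using reach_trans[of "\<sigma> s" "\<sigma> t" "ennreal N1" "\<sigma> u" "ennreal N2"]
          reach_trans[of "\<sigma> u" "\<sigma> t" "ennreal N2" "\<sigma> s" "ennreal N1"] N1(2) N2(2) that sum by metis
      then show ?thesis
        unfolding R_def using N1(1) N2(1) by (intro exI[of _ "N1 + N2"]) simp
    qed
    fix a assume a: "a \<in> ?I"
    obtain i where i: "cell i" "l a \<in> cell_domain i"
      using cell_exists[of "l a"] by metis
    obtain \<V> where \<V>: "evenly_covered p (cell_domain i) \<V>"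
      using cellD(4)[OF i(1)] by blast
    obtain \<Lambda> where \<Lambda>: "\<Lambda> > 0" "\<forall>V q x y. open V \<longrightarrow> homeomorphism V (cell_domain i) p q \<longrightarrow> x \<in> V \<longrightarrow> y \<in> V \<longrightarrow>
           reach x y (ennreal (\<Lambda> * norm (coord i y - coord i x)))"
      using reach_in_cell[OF i(1)] by metis
    have "continuous_on ?I l"
      using l by (simp add: path_def)
    then have "\<forall>\<^sub>F s in at a within ?I. l s \<in> cell_domain i"
      using a i(2) open_cell_domain[OF i(1)] by (auto simp: continuous_on_def tendsto_def)
    then obtain d where d: "d > 0" "\<And>s. s \<in> ?I \<Longrightarrow> dist s a < d \<Longrightarrow> l s \<in> cell_domain i"
      unfolding eventually_at using i(2) by (metis dist_pos_lt)
    let ?J = "?I \<inter> ball a d"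
    have J: "connected ?J"
      by (intro convex_connected convex_Int) auto
    have lJ: "l s \<in> cell_domain i" if "s \<in> ?J" for s
      using d(2)[of s] that by (simp add: dist_commute)
    have "R a t" if t: "t \<in> ?J" for t
      unfolding R_def
    proof (intro exI conjI allI impI)
      \<comment> \<open>\<open>\<Lambda>\<close> times the diameter of the coordinate ball.\<close>
      let ?N = "\<Lambda> * (2 * snd (snd i))"
      show "0 \<le> ?N"
        using \<Lambda>(1) cellD(2)[OF i(1)] by simp
      fix \<sigma> assume \<sigma>: "path \<sigma>" "\<forall>t\<in>?I. p (\<sigma> t) = l t"
      have "p (\<sigma> a) \<in> cell_domain i"
        using \<sigma>(2) a i(2) by simp
      then obtain V q where V: "\<sigma> a \<in> V" "open V" "homeomorphism V (cell_domain i) p q"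
        using evenly_covered_sheet[OF \<V>] by metis
      have "continuous_on ?J \<sigma>"
        using \<sigma>(1) unfolding path_def by (rule continuous_on_subset) auto
      then have \<sigma>t: "\<sigma> t \<in> V"
        using lift_in_sheet(2)[OF V(3) J, of \<sigma> a t] lJ \<sigma>(2) a d(1) V(1) t by simp
      have ball: "coord i (\<sigma> s) \<in> cell_ball i" if "\<sigma> s \<in> V" for s
        using homeomorphism_coord[OF i(1) V(3)] that unfolding homeomorphism_def by blast
      have "norm (coord i x - coord i y) \<le> 2 * snd (snd i)" if "coord i x \<in> cell_ball i" "coord i y \<in> cell_ball i" for x y
        using that norm_triangle_ineq4[of "coord i x - fst (snd i)" "coord i y - fst (snd i)"]
        by (simp add: dist_norm norm_minus_commute)
      then have le: "\<Lambda> * norm (coord i (\<sigma> t) - coord i (\<sigma> a)) \<le> ?N" "\<Lambda> * norm (coord i (\<sigma> a) - coord i (\<sigma> t)) \<le> ?N"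
        using ball \<sigma>t V(1) \<Lambda>(1) by auto
      show "reach (\<sigma> a) (\<sigma> t) (ennreal ?N)"
        using \<Lambda>(2) V \<sigma>t reach_mono ennreal_leI[OF le(1)] by blast
      show "reach (\<sigma> t) (\<sigma> a) (ennreal ?N)"
        using \<Lambda>(2) V \<sigma>t reach_mono ennreal_leI[OF le(2)] by blast
    qed
    then show "\<exists>T. openin (top_of_set ?I) T \<and> a \<in> T \<and> (\<forall>x\<in>T. R a x)"
      using a d(1) openin_open_Int[OF open_ball, of ?I a d] centre_in_ball[of a d] by (intro exI[of _ ?J]) blast
  qed auto
  then obtain N where N: "N \<ge> 0" "\<And>\<sigma>. path \<sigma> \<Longrightarrow> (\<forall>t\<in>?I. p (\<sigma> t) = l t) \<Longrightarrow>
      reach (\<sigma> 0) (\<sigma> 1) (ennreal N) \<and> reach (\<sigma> 1) (\<sigma> 0) (ennreal N)"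
    unfolding R_def by metis
  then show ?thesis
    unfolding lifts_def pathstart_def pathfinish_def by metis
qed

end

section \<open>Sheets over a cell, indexed by the fundamental group\<close>

context riemannian_covering
begin

definition sheets :: "('m, 'n) chart \<times> (real ^ 'n) \<times> real \<Rightarrow> 'u set set" where
  "sheets i = (SOME \<V>. evenly_covered p (cell_domain i) \<V>)"

definition cell_centre :: "('m, 'n) chart \<times> (real ^ 'n) \<times> real \<Rightarrow> 'm" where
  "cell_centre i = chart_inv (fst i) (fst (snd i))"

text \<open>One path per cell, fixed once: its lifts attach to every point of the fibre over
  \<open>p b\<close> a point over the cell centre, at a distance bounded by
  \<open>reach_lifts\<close>.\<close>

definition spoke :: "('m, 'n) chart \<times> (real ^ 'n) \<times> real \<Rightarrow> real \<Rightarrow> 'm" where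
  "spoke i = (SOME l. path l \<and> pathstart l = p b \<and> pathfinish l = cell_centre i)"

definition hub :: "('m, 'n) chart \<times> (real ^ 'n) \<times> real \<Rightarrow> (real \<Rightarrow> 'm) set \<Rightarrow> 'u" where
  "hub i X = (SOME y. lifts p (spoke i) (orbit_point X) y)"

text \<open>Stands for the translate by \<open>X\<close> of a fixed sheet. By
  \<open>sheet_unique\<close> and \<open>sheet_cover\<close> it indexes the sheets over a cell
  bijectively by \<open>\<Gamma>\<close>.\<close>

definition sheet :: "('m, 'n) chart \<times> (real ^ 'n) \<times> real \<Rightarrow> (real \<Rightarrow> 'm) set \<Rightarrow> 'u set" where
  "sheet i X = (SOME V. V \<in> sheets i \<and> hub i X \<in> V)"

lemma sheets: "cell i \<Longrightarrow> evenly_covered p (cell_domain i) (sheets i)"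
  unfolding sheets_def by (rule someI_ex) (rule cellD(4))

lemma spoke: "path (spoke i)" "pathstart (spoke i) = p b" "pathfinish (spoke i) = cell_centre i"
proof -
  have "\<exists>l. path l \<and> pathstart l = p b \<and> pathfinish l = cell_centre i"
    using path_between by metis
  then have "path (spoke i) \<and> pathstart (spoke i) = p b \<and> pathfinish (spoke i) = cell_centre i"
    unfolding spoke_def by (rule someI_ex)
  then show "path (spoke i)" "pathstart (spoke i) = p b" "pathfinish (spoke i) = cell_centre i"
    by auto
qed

lemma hub:
  assumes "X \<in> carrier \<Gamma>"
  shows "lifts p (spoke i) (orbit_point X) (hub i X)" "p (hub i X) = cell_centre i"
proof -
  have "\<exists>y. lifts p (spoke i) (orbit_point X) y"
    using lifts_exists[OF spoke(1)] p_orbit_point[OF assms] spoke(2) by metis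
  then show "lifts p (spoke i) (orbit_point X) (hub i X)"
    unfolding hub_def by (rule someI_ex)
  then show "p (hub i X) = cell_centre i"
    using lifts_endpoints(2) spoke(3) by metis
qed

lemma cell_centre_mem: "cell i \<Longrightarrow> cell_centre i \<in> cell_domain i"
  unfolding cell_centre_def using cellD(2,9) by simp

lemma sheet_in_sheets:
  assumes "cell i" "X \<in> carrier \<Gamma>"
  shows "sheet i X \<in> sheets i" "hub i X \<in> sheet i X"
proof -
  have "p (hub i X) \<in> cell_domain i"
    using hub(2)[OF assms(2)] cell_centre_mem[OF assms(1)] by simp
  then have "\<exists>V. V \<in> sheets i \<and> hub i X \<in> V"
    using evenly_covered_sheet[OF sheets[OF assms(1)]] by metis
  then have "sheet i X \<in> sheets i \<and> hub i X \<in> sheet i X"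
    unfolding sheet_def by (rule someI_ex)
  then show "sheet i X \<in> sheets i" "hub i X \<in> sheet i X" by auto
qed

lemma sheet_homeomorphism:
  assumes "cell i" "X \<in> carrier \<Gamma>"
  obtains q where "open (sheet i X)" "homeomorphism (sheet i X) (cell_domain i) p q"
  using sheets[OF assms(1)] sheet_in_sheets(1)[OF assms] unfolding evenly_covered_def by blast

lemma sheet_domain: "cell i \<Longrightarrow> X \<in> carrier \<Gamma> \<Longrightarrow> x \<in> sheet i X \<Longrightarrow> p x \<in> cell_domain i"
  by (rule sheet_homeomorphism[of i X]) (auto simp: homeomorphism_def)

text \<open>A sheet contains one point over the centre, so equal sheets have equal hubs; lifting the
  spoke backwards from the hub recovers the orbit point.\<close>

lemma sheet_unique:
  assumes i: "cell i" and X: "X \<in> carrier \<Gamma>" "Y \<in> carrier \<Gamma>" and x: "x \<in> sheet i X" "x \<in> sheet i Y"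
  shows "X = Y"
proof -
  have eq: "sheet i X = sheet i Y"
    using evenly_covered_disjoint[OF sheets[OF i] sheet_in_sheets(1)[OF i X(1)] sheet_in_sheets(1)[OF i X(2)] x] .
  obtain q where "homeomorphism (sheet i X) (cell_domain i) p q"
    using sheet_homeomorphism[OF i X(1)] .
  moreover have "hub i Y \<in> sheet i X" "hub i X \<in> sheet i X"
    using eq sheet_in_sheets(2)[OF i] X by auto
  ultimately have "hub i X = hub i Y"
    using hub(2) X unfolding homeomorphism_def by metis
  then have "orbit_point X = orbit_point Y"
    using lifts_reversepath[OF hub(1)[OF X(1), of i]] lifts_reversepath[OF hub(1)[OF X(2), of i]] lifts_unique by metis
  then show ?thesis
    using inj_orbit_point X by (simp add: inj_on_def)
qed

lemma path_in_cell:
  assumes i: "cell i" and q: "q \<in> cell_domain i" "q' \<in> cell_domain i"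
  obtains n where "path n" "pathstart n = q" "pathfinish n = q'" "path_image n \<subseteq> cell_domain i"
proof -
  let ?c = "fst i"
  let ?s = "linepath (snd ?c q) (snd ?c q')"
  have mem: "q \<in> fst ?c" "snd ?c q \<in> cell_ball i" "q' \<in> fst ?c" "snd ?c q' \<in> cell_ball i"
    using q mem_cell_domain[OF i] by blast+
  have im: "path_image ?s \<subseteq> cell_ball i"
    using mem by (simp add: closed_segment_subset)
  then have "path (chart_inv ?c \<circ> ?s)"
    using cellD(6)[OF i] M.chart_inv_cont[OF cellD(1)[OF i]]
    by (intro path_continuous_image) (auto intro: continuous_on_subset)
  moreover have "path_image (chart_inv ?c \<circ> ?s) \<subseteq> cell_domain i"
    using im unfolding cellD(9)[OF i] path_image_compose by blast
  ultimately show ?thesis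
    using that[of "chart_inv ?c \<circ> ?s"] mem M.chart_inv_snd[OF cellD(1)[OF i]]
    by (simp add: pathstart_compose pathfinish_compose)
qed

text \<open>The spoke, lifted backwards from the point of the sheet over the centre, ends in the
  fibre over \<open>p b\<close>; the class belonging to this end indexes the sheet.\<close>

lemma sheet_cover:
  assumes i: "cell i" and x: "p x \<in> cell_domain i"
  obtains X where "X \<in> carrier \<Gamma>" "x \<in> sheet i X"
proof -
  obtain V q where V: "V \<in> sheets i" "x \<in> V" "homeomorphism V (cell_domain i) p q"
    using evenly_covered_sheet[OF sheets[OF i] x] by metis
  obtain n where n: "path n" "pathstart n = p x" "pathfinish n = cell_centre i" "path_image n \<subseteq> cell_domain i"
    using path_in_cell[OF i x cell_centre_mem[OF i]] .
  let ?y = "q (cell_centre i)"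
  have y: "?y \<in> V" "p ?y = cell_centre i"
    using V(3) cell_centre_mem[OF i] unfolding homeomorphism_def by auto
  obtain z where z: "lifts p (reversepath (spoke i)) ?y z"
    using lifts_exists[of "reversepath (spoke i)" ?y] spoke y(2) by auto
  then have "p z = p b"
    using lifts_endpoints(2)[OF z] spoke(2) by simp
  then obtain X where X: "X \<in> carrier \<Gamma>" "orbit_point X = z"
    by (rule orbit_point_surj)
  have "lifts p (spoke i) (orbit_point X) ?y"
    using lifts_reversepath[OF z] X(2) by simp
  then have "hub i X = ?y"
    using hub(1)[OF X(1)] lifts_unique by blast
  then have "sheet i X = V"
    using evenly_covered_disjoint[OF sheets[OF i] sheet_in_sheets(1)[OF i X(1)] V(1), of ?y] sheet_in_sheets(2)[OF i X(1)] y(1)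
    by simp
  then show ?thesis
    using that X(1) V(2) by blast
qed

text \<open>Two sheets that meet over a neighbourhood of \<open>q\<close> differ by the class of a fixed loop through
  the two centres and \<open>q\<close>.\<close>

lemma sheet_overlap_local:
  assumes i: "cell i" and j: "cell j" and q: "q \<in> cell_domain i" "q \<in> cell_domain j"
  shows "\<exists>N e. open N \<and> q \<in> N \<and> e \<in> carrier \<Gamma> \<and>
    (\<forall>X\<in>carrier \<Gamma>. \<forall>Y\<in>carrier \<Gamma>. \<forall>x. x \<in> sheet i X \<longrightarrow> x \<in> sheet j Y \<longrightarrow> p x \<in> N \<longrightarrow> Y = X \<otimes>\<^bsub>\<Gamma>\<^esub> e)"
proof -
  let ?c = "fst i"
  have c: "?c \<in> A" by (rule cellD(1)[OF i])
  obtain ai where ai: "path ai" "pathstart ai = cell_centre i" "pathfinish ai = q" "path_image ai \<subseteq> cell_domain i"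
    using path_in_cell[OF i cell_centre_mem[OF i] q(1)] .
  obtain aj where aj: "path aj" "pathstart aj = cell_centre j" "pathfinish aj = q" "path_image aj \<subseteq> cell_domain j"
    using path_in_cell[OF j cell_centre_mem[OF j] q(2)] .
  \<comment> \<open>From \<open>p b\<close> to the centre of \<open>i\<close>, to \<open>q\<close>,
    to the centre of \<open>j\<close> and back: a loop that does not depend on the sheets.\<close>
  define l where "l = spoke i +++ (ai +++ (reversepath aj +++ reversepath (spoke j)))"
  have l: "l \<in> loops_at (p b)"
    unfolding l_def loops_at_def using ai aj spoke by simp
  have qc: "q \<in> fst ?c" using q(1) mem_cell_domain[OF i] by blast
  let ?W = "snd ?c ` (fst ?c \<inter> (cell_domain i \<inter> cell_domain j))"
  have "open ?W"
    by (intro M.open_chart_image[OF c] open_Int open_cell_domain i j)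
  moreover have "snd ?c q \<in> ?W"
    using q qc by blast
  ultimately obtain r where r: "r > 0" "ball (snd ?c q) r \<subseteq> ?W"
    by (meson open_contains_ball)
  \<comment> \<open>A coordinate ball, so that each of its points is joined to \<open>q\<close> by a
    coordinate segment inside both cells.\<close>
  define N where "N = fst ?c \<inter> snd ?c -` ball (snd ?c q) r"
  have openN: "open N"
    unfolding N_def using M.chart_cont[OF c] M.chart(1)[OF c] by (intro continuous_open_preimage) auto
  have qN: "q \<in> N"
    unfolding N_def using qc r(1) by simp
  have Nsub: "chart_inv ?c y \<in> cell_domain i \<inter> cell_domain j" if "y \<in> ball (snd ?c q) r" for y
    using that r(2) M.chart_inv_snd[OF c] by fastforce
  have Nimg: "y \<in> chart_image ?c" if "y \<in> ball (snd ?c q) r" for y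
    using that r(2) by (auto simp: chart_image_def)
  have "Y = X \<otimes>\<^bsub>\<Gamma>\<^esub> homotopy_class l"
    if X: "X \<in> carrier \<Gamma>" "Y \<in> carrier \<Gamma>" and x: "x \<in> sheet i X" "x \<in> sheet j Y" "p x \<in> N" for X Y x
  proof -
    obtain h where h: "homeomorphism (sheet i X) (cell_domain i) p h"
      using sheet_homeomorphism[OF i X(1)] .
    obtain k where k: "homeomorphism (sheet j Y) (cell_domain j) p k"
      using sheet_homeomorphism[OF j X(2)] .
    let ?s = "linepath (snd ?c (p x)) (snd ?c q)"
    let ?n = "chart_inv ?c \<circ> ?s"
    have px: "p x \<in> fst ?c" "snd ?c (p x) \<in> ball (snd ?c q) r"
      using x(3) by (auto simp: N_def)
    then have im: "path_image ?s \<subseteq> ball (snd ?c q) r"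
      using r(1) by (simp add: closed_segment_subset)
    then have "path_image ?s \<subseteq> chart_image ?c"
      using Nimg by blast
    then have n: "path ?n"
      using continuous_on_subset[OF M.chart_inv_cont[OF c]] path_linepath by (intro path_continuous_image) blast+
    have n_ends: "pathstart ?n = p x" "pathfinish ?n = q"
      using M.chart_inv_snd[OF c] px qc by (simp_all add: pathstart_compose pathfinish_compose)
    have n_im: "path_image ?n \<subseteq> cell_domain i" "path_image ?n \<subseteq> cell_domain j"
      using im Nsub unfolding path_image_compose by blast+
    have "lifts p ?n x (h q)" "lifts p ?n x (k q)"
      using lifts_in_sheet(1)[OF h n n_im(1) x(1)] lifts_in_sheet(1)[OF k n n_im(2) x(2)] n_ends by auto
    \<comment> \<open>Both sheets lift the same segment from \<open>x\<close>, so they contain the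
      same point over \<open>q\<close>; there the two halves of the lift of \<open>l\<close>
      meet.\<close>
    then have hk: "h q = k q"
      by (rule lifts_unique)
    have "lifts p ai (hub i X) (h q)"
      using lifts_in_sheet(1)[OF h ai(1,4) sheet_in_sheets(2)[OF i X(1)]] hub(2)[OF X(1)] ai by simp
    moreover have "lifts p aj (hub j Y) (k q)"
      using lifts_in_sheet(1)[OF k aj(1,4) sheet_in_sheets(2)[OF j X(2)]] hub(2)[OF X(2)] aj by simp
    ultimately have "lifts p l (orbit_point X) (orbit_point Y)"
      unfolding l_def hk
      by (intro lifts_join[OF hub(1)[OF X(1)] lifts_join]
          lifts_join[OF lifts_reversepath lifts_reversepath[OF hub(1)[OF X(2)]]])
    then have "orbit_point Y = orbit_point (X \<otimes>\<^bsub>\<Gamma>\<^esub> homotopy_class l)"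
      using orbit_point_mult[OF X(1) l] by blast
    moreover have "X \<otimes>\<^bsub>\<Gamma>\<^esub> homotopy_class l \<in> carrier \<Gamma>"
      using X(1) mem_carrier_fundamental_group[OF l] group_fundamental_group
      by (meson group.is_monoid monoid.m_closed)
    ultimately show ?thesis
      using inj_orbit_point X(2) by (simp add: inj_on_def)
  qed
  then show ?thesis
    using openN qN mem_carrier_fundamental_group[OF l] by (intro exI[of _ N] exI[of _ "homotopy_class l"]) blast
qed

section \<open>Compact cores and finitely many overlaps\<close>

definition core :: "('m, 'n) chart \<times> (real ^ 'n) \<times> real \<Rightarrow> 'm set" where
  "core i = chart_inv (fst i) ` cell_core i"

lemma core_subset: "cell i \<Longrightarrow> core i \<subseteq> cell_domain i"
  unfolding core_def using cellD(5,9) by blast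

lemma compact_core:
  assumes "cell i"
  shows "compact (core i)"
proof -
  have "continuous_on (cell_core i) (chart_inv (fst i))"
    using continuous_on_subset[OF M.chart_inv_cont[OF cellD(1)[OF assms]]] cellD(5,6)[OF assms] by blast
  then show ?thesis
    unfolding core_def by (intro compact_continuous_image compact_cball)
qed

lemma mem_core:
  assumes "cell i"
  shows "q \<in> core i \<longleftrightarrow> q \<in> cell_domain i \<and> snd (fst i) q \<in> cell_core i"
proof
  assume "q \<in> core i"
  then obtain y where y: "y \<in> cell_core i" "q = chart_inv (fst i) y"
    unfolding core_def by blast
  then have "snd (fst i) q = y"
    using cellD(5,6)[OF assms] M.snd_chart_inv[OF cellD(1)[OF assms]] by blast
  then show "q \<in> cell_domain i \<and> snd (fst i) q \<in> cell_core i"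
    using y \<open>q \<in> core i\<close> core_subset[OF assms] by blast
next
  assume *: "q \<in> cell_domain i \<and> snd (fst i) q \<in> cell_core i"
  then have "chart_inv (fst i) (snd (fst i) q) = q"
    using mem_cell_domain[OF assms] M.chart_inv_snd[OF cellD(1)[OF assms]] by blast
  then show "q \<in> core i"
    unfolding core_def using * by (metis image_eqI)
qed

text \<open>Locally the two indices differ by right multiplication with one class, and compactness
  of the cores leaves finitely many classes. So sheets that meet over the cores have indices at
  bounded word distance.\<close>

lemma sheet_overlap:
  assumes i: "cell i" and j: "cell j"
  shows "\<exists>E. finite E \<and> E \<subseteq> carrier \<Gamma> \<and> (\<forall>X\<in>carrier \<Gamma>. \<forall>Y\<in>carrier \<Gamma>. \<forall>x. x \<in> sheet i X \<longrightarrow> x \<in> sheet j Y \<longrightarrow>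
    p x \<in> core i \<longrightarrow> p x \<in> core j \<longrightarrow> (\<exists>e\<in>E. Y = X \<otimes>\<^bsub>\<Gamma>\<^esub> e))"
proof -
  let ?P = "\<lambda>N e. e \<in> carrier \<Gamma> \<and>
    (\<forall>X\<in>carrier \<Gamma>. \<forall>Y\<in>carrier \<Gamma>. \<forall>x. x \<in> sheet i X \<longrightarrow> x \<in> sheet j Y \<longrightarrow> p x \<in> N \<longrightarrow> Y = X \<otimes>\<^bsub>\<Gamma>\<^esub> e)"
  have "compact (core i \<inter> core j)"
    using compact_core[OF i] compact_core[OF j] by (rule compact_Int)
  moreover have "\<exists>N e. open N \<and> q \<in> N \<and> ?P N e" if "q \<in> core i \<inter> core j" for q
  proof -
    have "q \<in> cell_domain i" "q \<in> cell_domain j"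
      using that core_subset i j by blast+
    then show ?thesis
      by (rule sheet_overlap_local[OF i j])
  qed
  ultimately obtain F where F: "finite F" "\<And>q. q \<in> core i \<inter> core j \<Longrightarrow> \<exists>N e. q \<in> N \<and> e \<in> F \<and> ?P N e"
    by (rule finite_image_locally_constant[where P = ?P]) (assumption | blast)+
  show ?thesis
  proof (intro exI conjI ballI allI impI)
    fix X Y x assume *: "X \<in> carrier \<Gamma>" "Y \<in> carrier \<Gamma>" "x \<in> sheet i X" "x \<in> sheet j Y" "p x \<in> core i" "p x \<in> core j"
    obtain N e where "p x \<in> N" "e \<in> F" "?P N e"
      using F(2)[of "p x"] *(5,6) by blast
    then show "\<exists>e\<in>F \<inter> carrier \<Gamma>. Y = X \<otimes>\<^bsub>\<Gamma>\<^esub> e"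
      using * by blast
  qed (use F in auto)
qed

end

lemma (in riemannian_covering) cell_cover_exists:
  obtains I where "finite I" "\<And>i. i \<in> I \<Longrightarrow> cell i"
    "\<And>q. \<exists>i\<in>I. q \<in> cell_domain i \<and> norm (snd (fst i) q - fst (snd i)) \<le> snd (snd i) / 3"
proof -
  let ?U = "\<lambda>i. fst (fst i) \<inter> snd (fst i) -` ball (fst (snd i)) (snd (snd i) / 3)"
  have openU: "open (?U i)" if "cell i" for i
    using M.chart(1)[OF cellD(1)[OF that]] M.chart_cont[OF cellD(1)[OF that]] by (intro continuous_open_preimage) auto
  have ex: "\<exists>i. cell i \<and> q \<in> cell_domain i \<and> snd (fst i) q = fst (snd i)" for q
    by (rule cell_exists[of q]) blast
  define h where "h q = (SOME i. cell i \<and> q \<in> cell_domain i \<and> snd (fst i) q = fst (snd i))" for q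
  have h: "cell (h q) \<and> q \<in> cell_domain (h q) \<and> snd (fst (h q)) q = fst (snd (h q))" for q
    unfolding h_def by (rule someI_ex[OF ex])
  have hU: "q \<in> ?U (h q)" for q
    using h[of q] mem_cell_domain[of "h q" q] cellD(2)[of "h q"] by simp
  have op: "open (?U (h q))" for q
    using openU h by blast
  have cov: "UNIV \<subseteq> (\<Union>q\<in>UNIV. ?U (h q))"
    using hU by (intro subsetI UN_I) auto
  obtain Q where Q: "finite Q" "UNIV \<subseteq> (\<Union>q\<in>Q. ?U (h q))"
    by (rule compactE_image[OF compact_base op cov])
  show ?thesis
  proof (rule that[of "h ` Q"])
    fix q
    have "q \<in> (\<Union>q\<in>Q. ?U (h q))"
      using Q(2) by (rule subsetD) simp
    then obtain q' where q': "q' \<in> Q" "q \<in> ?U (h q')"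
      by (rule UN_E)
    let ?i = "h q'"
    have cell: "cell ?i" using h by blast
    have "q \<in> cell_domain ?i"
      unfolding mem_cell_domain[OF cell] using q'(2) cellD(2)[OF cell] by (auto simp: dist_norm)
    moreover have "norm (snd (fst ?i) q - fst (snd ?i)) \<le> snd (snd ?i) / 3"
      using q'(2) by (simp add: dist_norm norm_minus_commute)
    ultimately show "\<exists>i\<in>h ` Q. q \<in> cell_domain i \<and> norm (snd (fst i) q - fst (snd i)) \<le> snd (snd i) / 3"
      using q'(1) by blast
  qed (use Q(1) h in auto)
qed

section \<open>Extension of functions from the group to the cover\<close>

lemma flat_exp_mono: "0 < s \<Longrightarrow> s \<le> t \<Longrightarrow> flat_exp 0 s \<le> flat_exp 0 t"
  by (simp add: flat_exp_def frac_le)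

lemma flat_exp_pos: "0 < t \<Longrightarrow> flat_exp 0 t > 0"
  by (simp add: flat_exp_def)

text \<open>\<open>R\<close> will be a bound for the word lengths of the finitely many classes in
  \<open>sheet_overlap\<close>.\<close>

locale cell_cover =
  riemannian_covering A g A' g' p b + word_metric "fundamental_group (p b)" S
  for A :: "('m::{t2_space,second_countable_topology}, 'n::finite) chart set" and g :: "('m, 'n) metric_field"
    and A' :: "('u::{t2_space,second_countable_topology}, 'n) chart set" and g' :: "('u, 'n) metric_field"
    and p :: "'u \<Rightarrow> 'm" and b :: 'u and S :: "(real \<Rightarrow> 'm) set set" +
  fixes I :: "(('m, 'n) chart \<times> (real ^ 'n) \<times> real) set" and R :: nat
  assumes finite_I: "finite I" and cells: "\<And>i. i \<in> I \<Longrightarrow> cell i"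
    and cover: "\<And>q. \<exists>i\<in>I. q \<in> cell_domain i \<and> norm (snd (fst i) q - fst (snd i)) \<le> snd (snd i) / 3"
    and overlap: "\<And>i j X Y x. i \<in> I \<Longrightarrow> j \<in> I \<Longrightarrow> X \<in> carrier \<Gamma> \<Longrightarrow> Y \<in> carrier \<Gamma> \<Longrightarrow>
      x \<in> sheet i X \<Longrightarrow> x \<in> sheet j Y \<Longrightarrow> p x \<in> core i \<Longrightarrow> p x \<in> core j \<Longrightarrow> Y \<in> nbhd R X"
begin

definition sheet_index :: "('m, 'n) chart \<times> (real ^ 'n) \<times> real \<Rightarrow> 'u \<Rightarrow> (real \<Rightarrow> 'm) set" where
  "sheet_index i x = (THE X. X \<in> carrier \<Gamma> \<and> x \<in> sheet i X)"

definition cell_bump :: "('m, 'n) chart \<times> (real ^ 'n) \<times> real \<Rightarrow> real ^ 'n \<Rightarrow> real" where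
  "cell_bump i = bump (fst (snd i)) (snd (snd i) / 2)"

definition bump_on :: "('m, 'n) chart \<times> (real ^ 'n) \<times> real \<Rightarrow> 'u \<Rightarrow> real" where
  "bump_on i x = (if x \<in> p -` cell_domain i then cell_bump i (coord i x) else 0)"

definition total :: "'u \<Rightarrow> real" where
  "total x = (\<Sum>i\<in>I. bump_on i x)"

text \<open>The case distinction has the form required by \<open>coordinate_smooth\<close>;
  \<open>sheet_index\<close> is meaningful only over the cell.\<close>

definition numerator :: "((real \<Rightarrow> 'm) set \<Rightarrow> real) \<Rightarrow> 'u \<Rightarrow> real" where
  "numerator h x = (\<Sum>i\<in>I. if x \<in> p -` cell_domain i then h (sheet_index i x) * cell_bump i (coord i x) else 0)"

definition extend :: "((real \<Rightarrow> 'm) set \<Rightarrow> real) \<Rightarrow> 'u \<Rightarrow> real" where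
  "extend h x = numerator h x / total x"

text \<open>A sum in place of a maximum: it bounds each single difference, and its square is
  compared with the energy by Cauchy-Schwarz.\<close>

definition oscillation :: "((real \<Rightarrow> 'm) set \<Rightarrow> real) \<Rightarrow> (real \<Rightarrow> 'm) set \<Rightarrow> real" where
  "oscillation h X = (\<Sum>Y\<in>nbhd R X. \<bar>h Y - h X\<bar>)"

lemma sheet_index_eq: "i \<in> I \<Longrightarrow> X \<in> carrier \<Gamma> \<Longrightarrow> x \<in> sheet i X \<Longrightarrow> sheet_index i x = X"
  unfolding sheet_index_def by (rule the_equality) (use sheet_unique[OF cells] in blast)+

lemma sheet_index:
  assumes "i \<in> I" "p x \<in> cell_domain i"
  shows "sheet_index i x \<in> carrier \<Gamma>" "x \<in> sheet i (sheet_index i x)"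
proof -
  obtain X where "X \<in> carrier \<Gamma>" "x \<in> sheet i X"
    using sheet_cover[OF cells[OF assms(1)] assms(2)] .
  then show "sheet_index i x \<in> carrier \<Gamma>" "x \<in> sheet i (sheet_index i x)"
    using sheet_index_eq[OF assms(1)] by auto
qed

lemma coord_eq: "coord i x = snd (fst i) (p x)"
  by (simp add: coord_def split: prod.splits)

lemma cell_bump_zero:
  assumes "cell i" "y \<notin> cell_core i"
  shows "cell_bump i y = 0"
  unfolding cell_bump_def using assms(2) cellD(2)[OF assms(1)]
  by (intro bump_zero) (auto simp: dist_norm norm_minus_commute)

lemma numerator_eq: "numerator h x = (\<Sum>i\<in>I. h (sheet_index i x) * bump_on i x)"
  unfolding numerator_def bump_on_def by (intro sum.cong) auto

lemma bump_on_nonneg: "bump_on i x \<ge> 0"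
  by (simp add: bump_on_def cell_bump_def bump_nonneg)

lemma bump_on_zero:
  assumes "i \<in> I" "p x \<notin> core i"
  shows "bump_on i x = 0"
  using cell_bump_zero[OF cells[OF assms(1)]] mem_core[OF cells[OF assms(1)]] assms(2)
  by (auto simp: bump_on_def coord_eq)

lemma core_cover: "\<exists>i\<in>I. \<exists>X\<in>carrier \<Gamma>. x \<in> sheet i X \<and> p x \<in> core i"
proof -
  obtain i where i: "i \<in> I" "p x \<in> cell_domain i" "norm (snd (fst i) (p x) - fst (snd i)) \<le> snd (snd i) / 3"
    using cover by blast
  then have "snd (fst i) (p x) \<in> cell_core i"
    using cellD(2)[OF cells[OF i(1)]] by (simp add: dist_norm norm_minus_commute)
  then have "p x \<in> core i"
    using mem_core[OF cells[OF i(1)]] i(2) by blast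
  then show ?thesis
    using sheet_index[OF i(1,2)] i(1) by blast
qed

definition total_bound :: real where
  "total_bound = Min ((\<lambda>i. flat_exp 0 ((snd (snd i) / 2)\<^sup>2 - (snd (snd i) / 3)\<^sup>2)) ` I)"

text \<open>Every point lies within r / 3 of some centre, where the bump of radius r / 2 is at least
  its value at distance r / 3. A positive lower bound uniform over the cover keeps the gradient of
  the quotient under control.\<close>

lemma total_bound: "total_bound > 0" "total_bound \<le> total x"
proof -
  let ?m = "\<lambda>i. flat_exp 0 ((snd (snd i) / 2)\<^sup>2 - (snd (snd i) / 3)\<^sup>2)"
  have pos: "(snd (snd i) / 2)\<^sup>2 - (snd (snd i) / 3)\<^sup>2 > 0" if "i \<in> I" for i
    using power_strict_mono[of "snd (snd i) / 3" "snd (snd i) / 2" 2] cellD(2)[OF cells[OF that]] by simp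
  have ne: "I \<noteq> {}" using cover by blast
  show "total_bound > 0"
    unfolding total_bound_def using finite_I ne pos flat_exp_pos by (subst Min_gr_iff) auto
  obtain i where i: "i \<in> I" "p x \<in> cell_domain i" "norm (snd (fst i) (p x) - fst (snd i)) \<le> snd (snd i) / 3"
    using cover by blast
  have "total_bound \<le> ?m i"
    unfolding total_bound_def using finite_I i(1) by simp
  also have "\<dots> \<le> bump_on i x"
  proof -
    have "(norm (snd (fst i) (p x) - fst (snd i)))\<^sup>2 \<le> (snd (snd i) / 3)\<^sup>2"
      using i(3) by (intro power_mono) auto
    then have "?m i \<le> flat_exp 0 ((snd (snd i) / 2)\<^sup>2 - (norm (snd (fst i) (p x) - fst (snd i)))\<^sup>2)"
      using pos[OF i(1)] by (intro flat_exp_mono) auto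
    then show ?thesis
      using i(2) by (simp add: bump_on_def cell_bump_def bump_def coord_eq)
  qed
  also have "\<dots> \<le> total x"
    unfolding total_def using finite_I i(1) bump_on_nonneg by (intro member_le_sum) auto
  finally show "total_bound \<le> total x" .
qed

lemma total_pos: "total x > 0"
  using total_bound by (rule less_le_trans)

lemma closed_core_preimage: "i \<in> I \<Longrightarrow> closed (p -` core i)"
  using compact_imp_closed[OF compact_core[OF cells]] cont closed_vimage by blast

lemma coordinate_smooth:
  assumes i: "i \<in> I" and H: "\<And>x. p x \<in> cell_domain i \<Longrightarrow> \<exists>W. open W \<and> x \<in> W \<and> W \<subseteq> p -` cell_domain i \<and> (\<forall>y\<in>W. H y = H x)"
  shows "smooth_real_function A' (\<lambda>x. if x \<in> p -` cell_domain i then H x * cell_bump i (coord i x) else 0)"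
proof (rule coordinate_function_smooth[OF isometric_coordinates_cell[OF cells[OF i]]])
  show "smooth_on UNIV (cell_bump i)"
    unfolding cell_bump_def by (rule smooth_on_bump)
  show "closed (p -` core i)"
    by (rule closed_core_preimage[OF i])
  show "p -` core i \<subseteq> p -` cell_domain i"
    using core_subset[OF cells[OF i]] by blast
  show "cell_bump i (coord i x) = 0" if "x \<in> p -` cell_domain i - p -` core i" for x
    using that mem_core[OF cells[OF i]] by (intro cell_bump_zero[OF cells[OF i]]) (auto simp: coord_eq)
qed (use H in auto)

lemma sheet_nbhd:
  assumes i: "i \<in> I" and x: "p x \<in> cell_domain i"
  shows "open (sheet i (sheet_index i x))" "x \<in> sheet i (sheet_index i x)"
    "sheet i (sheet_index i x) \<subseteq> p -` cell_domain i"
    "y \<in> sheet i (sheet_index i x) \<Longrightarrow> sheet_index i y = sheet_index i x"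
proof -
  note X = sheet_index[OF i x]
  show "open (sheet i (sheet_index i x))"
    by (rule sheet_homeomorphism[OF cells[OF i] X(1)])
  show "x \<in> sheet i (sheet_index i x)" by (rule X(2))
  show "sheet i (sheet_index i x) \<subseteq> p -` cell_domain i"
    using sheet_domain[OF cells[OF i] X(1)] by blast
  show "y \<in> sheet i (sheet_index i x) \<Longrightarrow> sheet_index i y = sheet_index i x"
    by (rule sheet_index_eq[OF i X(1)])
qed

lemma smooth_bump_on:
  assumes "i \<in> I"
  shows "smooth_real_function A' (bump_on i)"
proof -
  have "smooth_real_function A' (\<lambda>x. if x \<in> p -` cell_domain i then 1 * cell_bump i (coord i x) else 0)"
  proof (rule coordinate_smooth[OF assms, of "\<lambda>_. 1"])
    fix x assume "p x \<in> cell_domain i"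
    note n = sheet_nbhd(1-3)[OF assms this]
    show "\<exists>W. open W \<and> x \<in> W \<and> W \<subseteq> p -` cell_domain i \<and> (\<forall>y\<in>W. (1::real) = 1)"
      using n by (intro exI[of _ "sheet i (sheet_index i x)"]) simp
  qed
  then show ?thesis
    unfolding bump_on_def[abs_def] mult_1_left .
qed

text \<open>\<open>sheet_index\<close> is constant on each sheet, hence locally constant over a
  cell, and the bump vanishes before the cell ends.\<close>

lemma smooth_extend: "smooth_real_function A' (extend h)"
proof -
  have "smooth_real_function A' (\<lambda>x. if x \<in> p -` cell_domain i then h (sheet_index i x) * cell_bump i (coord i x) else 0)"
    if i: "i \<in> I" for i
  proof (rule coordinate_smooth[OF i, of "\<lambda>x. h (sheet_index i x)"])
    fix x assume "p x \<in> cell_domain i"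
    note n = sheet_nbhd[OF i this]
    have "\<forall>y\<in>sheet i (sheet_index i x). h (sheet_index i y) = h (sheet_index i x)"
      using n(4) by simp
    then show "\<exists>W. open W \<and> x \<in> W \<and> W \<subseteq> p -` cell_domain i \<and> (\<forall>y\<in>W. h (sheet_index i y) = h (sheet_index i x))"
      using n(1-3) by (intro exI[of _ "sheet i (sheet_index i x)"] conjI)
  qed
  then have "smooth_real_function A' (numerator h)"
    unfolding numerator_def[abs_def] by (rule smooth_real_function_sum)
  moreover have "smooth_real_function A' total"
    unfolding total_def[abs_def] by (rule smooth_real_function_sum) (rule smooth_bump_on)
  moreover have "total x \<noteq> 0" for x
    using total_pos[of x] by simp
  ultimately show ?thesis
    unfolding extend_def[abs_def] by (rule smooth_real_function_divide)
qed

lemma index_in_nbhd: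
  assumes "i \<in> I" "X \<in> carrier \<Gamma>" "x \<in> sheet i X" "p x \<in> core i" "j \<in> I" "p x \<in> core j"
  shows "sheet_index j x \<in> nbhd R X"
proof -
  have "p x \<in> cell_domain j"
    using core_subset[OF cells[OF assms(5)]] assms(6) by blast
  note j = sheet_index[OF assms(5) this]
  show ?thesis
    using overlap[OF assms(1,5,2) j(1) assms(3) j(2) assms(4,6)] .
qed

lemma diff_le_oscillation:
  assumes "X \<in> carrier \<Gamma>" "Y \<in> nbhd R X"
  shows "\<bar>h Y - h X\<bar> \<le> oscillation h X"
  unfolding oscillation_def using assms finite_nbhd by (intro member_le_sum[where f = "\<lambda>Y. \<bar>h Y - h X\<bar>"]) auto

text \<open>The difference is an average of the values h (sheet_index j x) - h X with the normalised
  bumps as weights. Only cells with \<open>p x\<close> in their core have positive weight, and their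
  indices lie in \<open>nbhd R X\<close>.\<close>

lemma extend_close:
  assumes i: "i \<in> I" and X: "X \<in> carrier \<Gamma>" and x: "x \<in> sheet i X" "p x \<in> core i"
  shows "\<bar>extend h x - h X\<bar> \<le> oscillation h X"
proof -
  have "extend h x - h X = (\<Sum>j\<in>I. (h (sheet_index j x) - h X) * bump_on j x) / total x"
    using total_pos[of x] unfolding extend_def numerator_eq
    by (simp add: left_diff_distrib sum_subtractf sum_distrib_left[symmetric] total_def[symmetric] diff_divide_distrib)
  also have "\<bar>\<dots>\<bar> = \<bar>\<Sum>j\<in>I. (h (sheet_index j x) - h X) * bump_on j x\<bar> / total x"
    using total_pos[of x] by simp
  also have "\<dots> \<le> (\<Sum>j\<in>I. oscillation h X * bump_on j x) / total x"
  proof (rule divide_right_mono[OF order_trans[OF sum_abs sum_mono]])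
    fix j assume j: "j \<in> I"
    show "\<bar>(h (sheet_index j x) - h X) * bump_on j x\<bar> \<le> oscillation h X * bump_on j x"
    proof (cases "p x \<in> core j")
      case True
      then show ?thesis
        using diff_le_oscillation[OF X index_in_nbhd[OF i X x j]] bump_on_nonneg[of j x]
        by (simp add: abs_mult mult_right_mono)
    qed (simp add: bump_on_zero[OF j])
  qed (use total_pos[of x] in simp)
  also have "\<dots> = oscillation h X"
    using total_pos[of x] by (simp add: sum_distrib_left[symmetric] total_def[symmetric])
  finally show ?thesis .
qed

text \<open>The bound is computed on the compact core in base coordinates and then pulled back, so
  one \<open>G\<close> serves every sheet and every chart of the cover.\<close>

lemma bump_on_derivative_bound:
  assumes i: "i \<in> I"
  shows "\<exists>G\<ge>0. \<forall>c\<in>A'. \<forall>x\<in>fst c. \<exists>d. (bump_on i \<circ> chart_inv c has_derivative d) (at (snd c x)) \<and>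
    (\<forall>u. \<bar>d u\<bar> \<le> G * sqrt (g' c x u u)) \<and> (p x \<notin> core i \<longrightarrow> (\<forall>u. d u = 0))"
proof -
  note ci = cells[OF i]
  have "metric_on (cell_core i) (cell_metric i)"
    by (rule metric_on_subset[OF metric_on_cell[OF ci]]) (use cellD(5)[OF ci] ball_subset_cball in blast)
  then obtain G where G: "G \<ge> 0" "\<And>y w. y \<in> cell_core i \<Longrightarrow>
      \<bar>frechet_derivative (cell_bump i) (at y) w\<bar> \<le> G * sqrt (cell_metric i y w w)"
    using derivative_bound[of "cell_core i" "cell_metric i" "cell_bump i"] cell_bump_zero[OF ci] smooth_on_bump
    unfolding cell_bump_def by (metis compact_cball)
  have smooth: "smooth_on UNIV (cell_bump i)"
    unfolding cell_bump_def by (rule smooth_on_bump)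
  have "\<exists>d. (bump_on i \<circ> chart_inv c has_derivative d) (at (snd c x)) \<and>
    (\<forall>u. \<bar>d u\<bar> \<le> G * sqrt (g' c x u u)) \<and> (p x \<notin> core i \<longrightarrow> (\<forall>u. d u = 0))"
    if c: "c \<in> A'" and x: "x \<in> fst c" for c x
  proof (cases "p x \<in> core i")
    case False
    let ?W = "- (p -` core i)" and ?T = "snd c ` (fst c \<inter> - (p -` core i))"
    have "open ?W" using closed_core_preimage[OF i] by blast
    then have T: "open ?T" by (rule open_chart_image[OF c])
    have "snd c x \<in> ?T" using x False by blast
    have "((\<lambda>_. 0) has_derivative (\<lambda>_. 0)) (at (snd c x))"
      by simp
    then have "(bump_on i \<circ> chart_inv c has_derivative (\<lambda>_. 0)) (at (snd c x))"
    proof (rule has_derivative_transform_within_open[OF _ T \<open>snd c x \<in> ?T\<close>])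
      fix y assume "y \<in> ?T"
      then have "p (chart_inv c y) \<notin> core i"
        using chart_inv_snd[OF c] by auto
      then show "0 = (bump_on i \<circ> chart_inv c) y"
        using bump_on_zero[OF i] by simp
    qed
    then show ?thesis
      using G(1) metric_nonneg[OF c x] by (intro exI[of _ "\<lambda>_. 0"]) simp
  next
    case True
    let ?P = "p -` cell_domain i" and ?T = "snd c ` (fst c \<inter> p -` cell_domain i)"
    let ?D = "frechet_derivative (coord i \<circ> chart_inv c) (at (snd c x))"
    let ?b = "frechet_derivative (cell_bump i) (at (coord i x))"
    note iso = isometric_coordinates_cell[OF ci]
    have xP: "x \<in> fst c \<inter> ?P"
      using x True core_subset[OF ci] by blast
    have T: "open ?T" by (rule open_chart_image[OF c isometric_coordinatesD(1)[OF iso]])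
    have "(cell_bump i has_derivative ?b) (at ((coord i \<circ> chart_inv c) (snd c x)))"
      using smooth_on_has_derivative[OF smooth, of "coord i x"] chart_inv_snd[OF c x] by simp
    from has_derivative_compose[OF isometric_coordinates_derivative[OF iso c xP] this]
    have "((\<lambda>y. cell_bump i ((coord i \<circ> chart_inv c) y)) has_derivative (\<lambda>u. ?b (?D u))) (at (snd c x))" .
    then have "(bump_on i \<circ> chart_inv c has_derivative (\<lambda>u. ?b (?D u))) (at (snd c x))"
    proof (rule has_derivative_transform_within_open[OF _ T])
      fix y assume "y \<in> ?T"
      then have "chart_inv c y \<in> ?P"
        using chart_inv_snd[OF c] by auto
      then show "cell_bump i ((coord i \<circ> chart_inv c) y) = (bump_on i \<circ> chart_inv c) y"
        by (simp add: bump_on_def)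
    qed (use xP in blast)
    moreover have "\<bar>?b (?D u)\<bar> \<le> G * sqrt (g' c x u u)" for u
    proof -
      have "coord i x \<in> cell_core i"
        using True mem_core[OF ci] by (simp add: coord_eq)
      then show ?thesis
        using G(2) isometric_coordinatesD(3)[OF iso c, of x u u] xP by simp
    qed
    ultimately show ?thesis
      using True by blast
  qed
  then show ?thesis
    using G(1) by blast
qed

text \<open>On a sheet the differential of the extension of \<open>h\<close> only involves the differences of \<open>h\<close>,
  because the normalised bumps add up to one.\<close>

theorem gradient_extend_bound:
  "\<exists>G\<ge>0. \<forall>h. \<forall>i\<in>I. \<forall>X\<in>carrier \<Gamma>. \<forall>x. x \<in> sheet i X \<longrightarrow> p x \<in> core i \<longrightarrow>
     gradient_norm A' g' (extend h) x \<le> G * oscillation h X"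
proof -
  have "\<forall>i\<in>I. \<exists>G\<ge>0. \<forall>c\<in>A'. \<forall>x\<in>fst c. \<exists>d. (bump_on i \<circ> chart_inv c has_derivative d) (at (snd c x)) \<and>
    (\<forall>u. \<bar>d u\<bar> \<le> G * sqrt (g' c x u u)) \<and> (p x \<notin> core i \<longrightarrow> (\<forall>u. d u = 0))"
    using bump_on_derivative_bound by blast
  then obtain G where G: "\<forall>i\<in>I. G i \<ge> 0 \<and> (\<forall>c\<in>A'. \<forall>x\<in>fst c. \<exists>d. (bump_on i \<circ> chart_inv c has_derivative d) (at (snd c x)) \<and>
    (\<forall>u. \<bar>d u\<bar> \<le> G i * sqrt (g' c x u u)) \<and> (p x \<notin> core i \<longrightarrow> (\<forall>u. d u = 0)))"
    by (rule bchoice[THEN exE])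
  \<comment> \<open>The factor 2 comes from
    \<open>\<bar>a j - extend h x\<bar> \<le> 2 * oscillation h X\<close>, and
    \<open>total_bound\<close> from the division by \<open>total x\<close>.\<close>
  define K where "K = (\<Sum>j\<in>I. 2 * G j / total_bound)"
  have "K \<ge> 0"
    unfolding K_def using G total_bound(1) by (intro sum_nonneg) auto
  moreover have "gradient_norm A' g' (extend h) x \<le> K * oscillation h X"
    if i: "i \<in> I" and X: "X \<in> carrier \<Gamma>" and x: "x \<in> sheet i X" "p x \<in> core i" for h i X x
  proof -
    define c where "c = chart_at A' x"
    have c: "c \<in> A'" "x \<in> fst c"
      using chart_at by (auto simp: c_def)
    have "\<forall>j\<in>I. \<exists>d. (bump_on j \<circ> chart_inv c has_derivative d) (at (snd c x)) \<and>
      (\<forall>u. \<bar>d u\<bar> \<le> G j * sqrt (g' c x u u)) \<and> (p x \<notin> core j \<longrightarrow> (\<forall>u. d u = 0))"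
      using G c by blast
    then obtain d where d: "\<forall>j\<in>I. (bump_on j \<circ> chart_inv c has_derivative d j) (at (snd c x)) \<and>
      (\<forall>u. \<bar>d j u\<bar> \<le> G j * sqrt (g' c x u u)) \<and> (p x \<notin> core j \<longrightarrow> (\<forall>u. d j u = 0))"
      by (rule bchoice[THEN exE])
    define a where "a j = h (sheet_index j x)" for j
    have inv_x: "chart_inv c (snd c x) = x"
      by (rule chart_inv_snd[OF c])
    have osc_nonneg: "oscillation h X \<ge> 0"
      by (simp add: oscillation_def sum_nonneg)
    let ?N = "\<lambda>y. \<Sum>j\<in>I. a j * (bump_on j \<circ> chart_inv c) y" and ?P = "\<lambda>y. \<Sum>j\<in>I. (bump_on j \<circ> chart_inv c) y"
    let ?y = "snd c x"
    have P: "?P ?y = total x" and N: "?N ?y = numerator h x"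
      by (simp_all add: total_def numerator_eq a_def inv_x)
    have dN: "(?N has_derivative (\<lambda>u. \<Sum>j\<in>I. a j * d j u)) (at ?y)"
      using d by (intro has_derivative_sum has_derivative_mult_right) blast
    have dP: "(?P has_derivative (\<lambda>u. \<Sum>j\<in>I. d j u)) (at ?y)"
      using d by (intro has_derivative_sum) blast
    \<comment> \<open>The quotient rule gives (N' - (N / P) P') / P, and N / P is
      \<open>extend h x\<close> at the point; so the values a j enter through differences
      only.\<close>
    have quot: "((\<lambda>y. ?N y / ?P y) has_derivative (\<lambda>u. \<Sum>j\<in>I. (a j - extend h x) * d j u / total x)) (at ?y)"
    proof -
      have "((\<lambda>y. ?N y / ?P y) has_derivative
          (\<lambda>u. ((\<Sum>j\<in>I. a j * d j u) * ?P ?y - ?N ?y * (\<Sum>j\<in>I. d j u)) / (?P ?y * ?P ?y))) (at ?y)"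
        by (rule has_derivative_divide'[OF dN dP]) (use P total_pos[of x] in linarith)
      moreover have "((\<Sum>j\<in>I. a j * d j u) * ?P ?y - ?N ?y * (\<Sum>j\<in>I. d j u)) / (?P ?y * ?P ?y) =
          (\<Sum>j\<in>I. (a j - extend h x) * d j u / total x)" for u
        unfolding P N using total_pos[of x]
        by (simp add: extend_def left_diff_distrib sum_subtractf sum_divide_distrib[symmetric]
            sum_distrib_left[symmetric] diff_divide_distrib)
      ultimately show ?thesis by simp
    qed
    \<comment> \<open>Near \<open>x\<close> the index can be frozen: on the sheet through
      \<open>x\<close>, or away from the core, where the bump is 0.\<close>
    have "\<exists>W. open W \<and> x \<in> W \<and> (\<forall>z\<in>W. h (sheet_index j z) * bump_on j z = a j * bump_on j z)" if j: "j \<in> I" for j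
    proof (cases "p x \<in> cell_domain j")
      case True
      note n = sheet_nbhd[OF j True]
      have "\<forall>z\<in>sheet j (sheet_index j x). h (sheet_index j z) * bump_on j z = a j * bump_on j z"
        using n(4) by (simp add: a_def)
      then show ?thesis
        using n(1,2) by (intro exI[of _ "sheet j (sheet_index j x)"] conjI)
    next
      case False
      then have "x \<in> - (p -` core j)"
        using core_subset[OF cells[OF j]] by blast
      moreover have "open (- (p -` core j))"
        using closed_core_preimage[OF j] by blast
      moreover have "\<forall>z\<in>- (p -` core j). h (sheet_index j z) * bump_on j z = a j * bump_on j z"
        using bump_on_zero[OF j] by simp
      ultimately show ?thesis
        by (intro exI[of _ "- (p -` core j)"] conjI)
    qed
    then have "\<forall>j\<in>I. \<exists>W. open W \<and> x \<in> W \<and> (\<forall>z\<in>W. h (sheet_index j z) * bump_on j z = a j * bump_on j z)"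
      by blast
    then obtain W where W: "\<forall>j\<in>I. open (W j) \<and> x \<in> W j \<and> (\<forall>z\<in>W j. h (sheet_index j z) * bump_on j z = a j * bump_on j z)"
      by (rule bchoice[THEN exE])
    let ?W = "\<Inter>j\<in>I. W j"
    have openW: "open ?W" and xW: "x \<in> ?W"
      using W finite_I by auto
    let ?T = "snd c ` (fst c \<inter> ?W)"
    have T: "open ?T"
      by (rule open_chart_image[OF c(1) openW])
    have yT: "?y \<in> ?T"
      using c(2) xW by blast
    have der: "(extend h \<circ> chart_inv c has_derivative (\<lambda>u. \<Sum>j\<in>I. (a j - extend h x) * d j u / total x)) (at ?y)"
    proof (rule has_derivative_transform_within_open[OF quot T yT])
      fix y assume "y \<in> ?T"
      then have "chart_inv c y \<in> ?W"
        using chart_inv_snd[OF c(1)] by auto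
      then have "a j * bump_on j (chart_inv c y) = h (sheet_index j (chart_inv c y)) * bump_on j (chart_inv c y)"
        if j: "j \<in> I" for j
        using W[THEN bspec, OF j] j by (metis INT_E)
      then have "?N y = numerator h (chart_inv c y)"
        unfolding numerator_eq comp_def by (intro sum.cong refl)
      then show "?N y / ?P y = (extend h \<circ> chart_inv c) y"
        by (simp add: extend_def total_def)
    qed
    show ?thesis
    proof (rule gradient_norm_le[OF c_def _ der])
      show "0 \<le> K * oscillation h X"
        using \<open>K \<ge> 0\<close> osc_nonneg by simp
      fix u
      have s: "sqrt (g' c x u u) \<ge> 0"
        using metric_nonneg[OF c] by simp
      have "\<bar>(a j - extend h x) * d j u / total x\<bar> \<le> 2 * G j / total_bound * oscillation h X * sqrt (g' c x u u)"
        if j: "j \<in> I" for j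
      proof (cases "p x \<in> core j")
        case True
        have "\<bar>a j - h X\<bar> \<le> oscillation h X"
          unfolding a_def by (rule diff_le_oscillation[OF X index_in_nbhd[OF i X x j True]])
        then have "\<bar>a j - extend h x\<bar> \<le> 2 * oscillation h X"
          using extend_close[OF i X x, of h] by linarith
        moreover have "\<bar>d j u\<bar> \<le> G j * sqrt (g' c x u u)"
          using d j by blast
        ultimately have "\<bar>a j - extend h x\<bar> * \<bar>d j u\<bar> \<le> (2 * oscillation h X) * (G j * sqrt (g' c x u u))"
          using osc_nonneg by (intro mult_mono) auto
        then have "\<bar>a j - extend h x\<bar> * \<bar>d j u\<bar> / total x \<le> (2 * oscillation h X) * (G j * sqrt (g' c x u u)) / total_bound"
          using total_bound s osc_nonneg G j by (intro frac_le) auto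
        then show ?thesis
          using total_pos[of x] by (simp add: abs_mult mult_ac)
      next
        case False
        then have "d j u = 0" using d j by blast
        then show ?thesis
          using s osc_nonneg G j total_bound(1) by simp
      qed
      then have "\<bar>\<Sum>j\<in>I. (a j - extend h x) * d j u / total x\<bar> \<le>
          (\<Sum>j\<in>I. 2 * G j / total_bound * oscillation h X * sqrt (g' c x u u))"
        by (intro order_trans[OF sum_abs sum_mono])
      also have "\<dots> = K * oscillation h X * sqrt (g' c x u u)"
        by (simp add: K_def sum_distrib_right)
      finally show "\<bar>\<Sum>j\<in>I. (a j - extend h x) * d j u / total x\<bar> \<le> K * oscillation h X * sqrt (g' c x u u)" .
    qed
  qed
  ultimately show ?thesis by blast
qed

lemma gradient_norm_nonneg: "gradient_norm A' g' \<eta> x \<ge> 0"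
  unfolding gradient_norm_def Let_def using metric_nonneg[OF chart_at] by simp

end

section \<open>From the cover to the group\<close>

text \<open>Cauchy-Schwarz moves the square into the sum at the price of the ball size. Of the
  remaining ordered pairs only those with an end in \<open>T\<close> count, and each of them or its
  reversal starts in \<open>T\<close>, hence the factor 2.\<close>

lemma (in word_metric) oscillation_energy:
  fixes h :: "'g \<Rightarrow> real"
  assumes T: "finite T" "T \<subseteq> carrier G" "\<And>x. x \<notin> T \<Longrightarrow> h x = 0" and T': "finite T'" "T' \<subseteq> carrier G"
  shows "(\<Sum>x\<in>T'. (\<Sum>y\<in>nbhd R x. \<bar>h y - h x\<bar>)\<^sup>2)
    \<le> 2 * real (card {s \<in> carrier G. wlen s \<le> R}) * (\<Sum>x\<in>T. \<Sum>y\<in>nbhd R x. (h y - h x)\<^sup>2)"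
proof -
  let ?W = "real (card {s \<in> carrier G. wlen s \<le> R})"
  let ?d = "\<lambda>(x, y). (h y - h x)\<^sup>2"
  let ?P = "Sigma T' (nbhd R)" and ?Q = "Sigma T (nbhd R)"
  have fin: "finite ?P" "finite ?Q"
    by (rule finite_SigmaI; use T T' finite_nbhd in blast)+
  have "(\<Sum>x\<in>T'. (\<Sum>y\<in>nbhd R x. \<bar>h y - h x\<bar>)\<^sup>2) \<le> (\<Sum>x\<in>T'. ?W * (\<Sum>y\<in>nbhd R x. (h y - h x)\<^sup>2))"
  proof (rule sum_mono)
    fix x assume "x \<in> T'"
    then have x: "x \<in> carrier G" using T' by blast
    have "(\<Sum>y\<in>nbhd R x. \<bar>h y - h x\<bar>)\<^sup>2 \<le> (\<Sum>y\<in>nbhd R x. (\<bar>h y - h x\<bar>)\<^sup>2) * card (nbhd R x)"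
      by (rule sum_squared_le_sum_of_squares)
    also have "\<dots> \<le> (\<Sum>y\<in>nbhd R x. (\<bar>h y - h x\<bar>)\<^sup>2) * ?W"
      using card_nbhd_le[OF x] by (intro mult_left_mono sum_nonneg) auto
    finally show "(\<Sum>y\<in>nbhd R x. \<bar>h y - h x\<bar>)\<^sup>2 \<le> ?W * (\<Sum>y\<in>nbhd R x. (h y - h x)\<^sup>2)"
      by (simp add: mult.commute)
  qed
  also have "\<dots> = ?W * sum ?d ?P"
    using T' finite_nbhd by (subst sum.Sigma[symmetric]) (auto simp: sum_distrib_left)
  also have "sum ?d ?P \<le> 2 * sum ?d ?Q"
  proof -
    let ?Q' = "prod.swap ` ?Q"
    have "sum ?d ?P = sum ?d (?P \<inter> (?Q \<union> ?Q'))"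
    proof (rule sum.mono_neutral_right)
      show "\<forall>z\<in>?P - ?P \<inter> (?Q \<union> ?Q'). ?d z = 0"
      proof
        fix z assume z: "z \<in> ?P - ?P \<inter> (?Q \<union> ?Q')"
        obtain x y where xy: "z = (x, y)" by (cases z)
        have mem: "x \<in> T'" "y \<in> nbhd R x" "(x, y) \<notin> ?Q" "(x, y) \<notin> ?Q'"
          using z xy by auto
        have "x \<in> carrier G" "y \<in> carrier G"
          using mem T' by (auto simp: nbhd_def)
        then have "x \<in> nbhd R y"
          using mem(2) nbhd_sym by blast
        moreover have "(y, x) \<in> ?Q \<Longrightarrow> (x, y) \<in> ?Q'"
          by force
        ultimately have "x \<notin> T" "y \<notin> T"
          using mem by blast+
        then show "?d z = 0"
          using T(3) by (simp add: xy)
      qed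
    qed (use fin in auto)
    also have "\<dots> \<le> sum ?d (?Q \<union> ?Q')"
      using fin by (intro sum_mono2) auto
    also have "\<dots> \<le> sum ?d ?Q + sum ?d ?Q'"
    proof -
      have "sum ?d (?Q \<inter> ?Q') \<ge> 0"
        by (intro sum_nonneg) auto
      then show ?thesis
        using sum.union_inter[of ?Q ?Q' ?d] fin by auto
    qed
    also have "sum ?d ?Q' = sum ?d ?Q"
      by (subst sum.reindex) (auto simp: power2_commute split_def intro!: sum.cong)
    finally show ?thesis by simp
  qed
  also have "sum ?d ?Q = (\<Sum>x\<in>T. \<Sum>y\<in>nbhd R x. (h y - h x)\<^sup>2)"
    using T finite_nbhd by (subst sum.Sigma[symmetric]) auto
  finally show ?thesis
    by (simp add: mult_left_mono)
qed

section \<open>Volumes of the pieces over the cores\<close>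

context riemannian_covering
begin

definition piece :: "('m, 'n) chart \<times> (real ^ 'n) \<times> real \<Rightarrow> (real \<Rightarrow> 'm) set \<Rightarrow> 'u set" where
  "piece i X = sheet i X \<inter> p -` core i"

definition cell_volume :: "('m, 'n) chart \<times> (real ^ 'n) \<times> real \<Rightarrow> ennreal" where
  "cell_volume i = (\<integral>\<^sup>+y\<in>cell_core i. ennreal (sqrt (det (gram (cell_metric i y)))) \<partial>lborel)"

lemma compact_piece:
  assumes "cell i" "X \<in> carrier \<Gamma>"
  shows "compact (piece i X)"
proof -
  obtain q where q: "homeomorphism (sheet i X) (cell_domain i) p q"
    using sheet_homeomorphism[OF assms] .
  have "piece i X = q ` core i"
  proof (intro equalityI subsetI)
    fix x assume "x \<in> piece i X"
    then have "q (p x) = x" "p x \<in> core i"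
      using q by (auto simp: piece_def homeomorphism_def)
    then show "x \<in> q ` core i" by (metis image_eqI)
  next
    fix x assume "x \<in> q ` core i"
    then obtain y where y: "y \<in> core i" "x = q y" by blast
    moreover have "y \<in> cell_domain i"
      using y core_subset[OF assms(1)] by blast
    ultimately show "x \<in> piece i X"
      using q by (auto simp: piece_def homeomorphism_def)
  qed
  moreover have "continuous_on (core i) q"
    using q core_subset[OF assms(1)] by (auto simp: homeomorphism_def intro: continuous_on_subset)
  ultimately show ?thesis
    using compact_continuous_image compact_core[OF assms(1)] by metis
qed

lemma coord_piece:
  assumes "cell i" "X \<in> carrier \<Gamma>"
  shows "coord i ` piece i X = cell_core i"
proof (intro equalityI subsetI)
  fix y assume "y \<in> coord i ` piece i X"
  then show "y \<in> cell_core i"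
    using mem_core[OF assms(1)] by (auto simp: piece_def cellD(7)[OF assms(1)])
next
  fix y assume y: "y \<in> cell_core i"
  let ?z = "chart_inv (fst i) y"
  obtain q where q: "homeomorphism (sheet i X) (cell_domain i) p q"
    using sheet_homeomorphism[OF assms] .
  have z: "?z \<in> core i"
    using y by (auto simp: core_def)
  then have "?z \<in> cell_domain i"
    using core_subset[OF assms(1)] by blast
  then have "q ?z \<in> sheet i X" "p (q ?z) = ?z"
    using q by (auto simp: homeomorphism_def)
  moreover have "snd (fst i) ?z = y"
    using y cellD(5,6)[OF assms(1)] M.snd_chart_inv[OF cellD(1)[OF assms(1)]] by blast
  ultimately show "y \<in> coord i ` piece i X"
    using z by (intro image_eqI[of _ _ "q ?z"]) (auto simp: piece_def cellD(7)[OF assms(1)])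
qed

text \<open>In base coordinates every piece over the cell is the same core with the same density, so
  its volume does not depend on \<open>X\<close>.\<close>

lemma emeasure_piece:
  assumes v: "riemannian_volume A' g' v" and i: "cell i" and X: "X \<in> carrier \<Gamma>"
  shows "emeasure v (piece i X) = cell_volume i"
proof -
  obtain q where q: "open (sheet i X)" "homeomorphism (sheet i X) (cell_domain i) p q"
    using sheet_homeomorphism[OF i X] .
  have "sheet i X \<subseteq> p -` cell_domain i"
    using sheet_domain[OF i X] by blast
  then have iso: "isometric_coordinates A' g' (sheet i X) (coord i) (cell_metric i)"
    by (rule isometric_coordinates_subset[OF isometric_coordinates_cell[OF i] q(1)])
  have "metric_on (cell_ball i) (cell_metric i)"
    by (rule metric_on_subset[OF metric_on_cell[OF i] ball_subset_cball])
  moreover have "piece i X \<in> sets borel"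
    using compact_piece[OF i X] by (intro borel_closed compact_imp_closed)
  moreover have "piece i X \<subseteq> sheet i X"
    by (auto simp: piece_def)
  ultimately have "emeasure v (piece i X) = (\<integral>\<^sup>+y\<in>coord i ` piece i X. ennreal (sqrt (det (gram (cell_metric i y)))) \<partial>lborel)"
    by (intro volume_in_coordinates[OF v iso homeomorphism_coord[OF i q(2)] open_ball])
  then show ?thesis
    unfolding coord_piece[OF i X] cell_volume_def .
qed

lemma cell_volume:
  assumes "cell i"
  shows "cell_volume i < \<infinity>" "cell_volume i > 0"
proof -
  have "metric_on (cell_core i) (cell_metric i)"
    by (rule metric_on_subset[OF metric_on_cell[OF assms]]) (use cellD(5)[OF assms] ball_subset_cball in blast)
  from density_integral_cball[OF this] show "cell_volume i < \<infinity>" "cell_volume i > 0"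
    unfolding cell_volume_def using cellD(2)[OF assms] by auto
qed

lemma measure_piece:
  assumes v: "riemannian_volume A' g' v" and i: "cell i" and X: "X \<in> carrier \<Gamma>"
  shows "measure v (piece i X) = enn2real (cell_volume i)" "emeasure v (piece i X) < \<infinity>"
  using emeasure_piece[OF assms] cell_volume[OF i] by (simp_all add: measure_def)

lemma enn2real_cell_volume_pos: "cell i \<Longrightarrow> enn2real (cell_volume i) > 0"
  using cell_volume[of i] by (simp add: enn2real_positive_iff)

lemma piece_sets:
  assumes v: "riemannian_volume A' g' v" and i: "cell i" and X: "X \<in> carrier \<Gamma>"
  shows "piece i X \<in> sets v"
proof -
  have "piece i X \<in> sets borel"
    using compact_piece[OF i X] by (intro borel_closed compact_imp_closed)
  then show ?thesis
    using v by (simp add: riemannian_volume_def)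
qed

end

section \<open>Word length against Riemannian distance\<close>

context cell_cover
begin

text \<open>By \<open>orbit_point_mult\<close> one more letter moves the orbit point along a lift of
  the loop of that letter, and \<open>reach_lifts\<close> bounds the move independently of where it
  starts.\<close>

lemma reach_orbit_point:
  "\<exists>N\<ge>0. \<forall>X\<in>carrier \<Gamma>. reach (orbit_point X) b (ennreal (N * (real (wlen X) + 1)))"
proof -
  have "\<forall>s\<in>S. \<exists>N. N \<ge> 0 \<and> (\<forall>X\<in>carrier \<Gamma>. reach (orbit_point (X \<otimes>\<^bsub>\<Gamma>\<^esub> s)) (orbit_point X) (ennreal N))"
  proof
    fix s assume "s \<in> S"
    then have "s \<in> carrier \<Gamma>" using S_carrier by blast
    then obtain l where l: "l \<in> loops_at (p b)" "s = homotopy_class l"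
      by (rule carrier_fundamental_groupE)
    have path: "path l" "pathstart l = p b"
      using l(1) by (auto simp: loops_at_def)
    obtain N where N: "N \<ge> 0" "\<And>x y. lifts p l x y \<Longrightarrow> reach y x (ennreal N)"
      using reach_lifts[OF path(1)] by blast
    have "reach (orbit_point (X \<otimes>\<^bsub>\<Gamma>\<^esub> s)) (orbit_point X) (ennreal N)" if X: "X \<in> carrier \<Gamma>" for X
    proof -
      obtain y where y: "lifts p l (orbit_point X) y"
        using lifts_exists[OF path(1)] p_orbit_point[OF X] path(2) by metis
      show ?thesis
        using N(2)[OF y] orbit_point_mult[OF X l(1) y] l(2) by simp
    qed
    then show "\<exists>N. N \<ge> 0 \<and> (\<forall>X\<in>carrier \<Gamma>. reach (orbit_point (X \<otimes>\<^bsub>\<Gamma>\<^esub> s)) (orbit_point X) (ennreal N))"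
      using N(1) by blast
  qed
  then obtain N where N: "\<forall>s\<in>S. N s \<ge> 0 \<and> (\<forall>X\<in>carrier \<Gamma>. reach (orbit_point (X \<otimes>\<^bsub>\<Gamma>\<^esub> s)) (orbit_point X) (ennreal (N s)))"
    by (rule bchoice[THEN exE])
  \<comment> \<open>For the empty word: a curve from \<open>b\<close> to \<open>b\<close>, obtained
    from the constant loop.\<close>
  obtain N0 where N0: "N0 \<ge> 0" "\<And>x y. lifts p (\<lambda>_. p b) x y \<Longrightarrow> reach x y (ennreal N0)"
    using reach_lifts[OF path_const] by blast
  define K where "K = N0 + sum N S"
  have NK: "N s \<le> K" if "s \<in> S" for s
    using member_le_sum[of s S N] that finite_S N N0(1) unfolding K_def by force
  have K: "K \<ge> 0" "N0 \<le> K"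
    unfolding K_def using N N0(1) by (auto intro!: add_nonneg_nonneg sum_nonneg)
  have words: "set ws \<subseteq> S \<Longrightarrow> reach (orbit_point (word_prod ws)) b (ennreal (K * (real (length ws) + 1)))" for ws
  \<comment> \<open>Letters are split off at the end, because right multiplication is what follows a
    lifted loop.\<close>
  proof (induction ws rule: rev_induct)
    case Nil
    have "lifts p (\<lambda>_. p b) b b"
      by (rule liftsI[of "\<lambda>_. b"]) (auto simp: path_const)
    then have "reach b b (ennreal N0)" by (rule N0(2))
    then have "reach b b (ennreal K)"
      using reach_mono ennreal_leI[OF K(2)] by blast
    then show ?case
      by (simp add: orbit_point_one)
  next
    case (snoc s ws)
    then have s: "s \<in> S" "s \<in> carrier \<Gamma>" and ws: "set ws \<subseteq> carrier \<Gamma>"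
      and IH: "reach (orbit_point (word_prod ws)) b (ennreal (K * (real (length ws) + 1)))"
      using S_carrier by auto
    have eq: "word_prod (ws @ [s]) = word_prod ws \<otimes>\<^bsub>\<Gamma>\<^esub> s"
      using word_prod_append[OF ws, of "[s]"] s(2) by simp
    have "reach (orbit_point (word_prod ws \<otimes>\<^bsub>\<Gamma>\<^esub> s)) (orbit_point (word_prod ws)) (ennreal (N s))"
      using N s(1) word_prod_closed[OF ws] by blast
    then have "reach (orbit_point (word_prod ws \<otimes>\<^bsub>\<Gamma>\<^esub> s)) (orbit_point (word_prod ws)) (ennreal K)"
      using reach_mono ennreal_leI[OF NK[OF s(1)]] by blast
    from reach_trans[OF this IH] show ?case
      unfolding eq using K(1) by (simp add: ennreal_plus[symmetric] algebra_simps del: ennreal_plus)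
  qed
  have "reach (orbit_point X) b (ennreal (K * (real (wlen X) + 1)))" if X: "X \<in> carrier \<Gamma>" for X
  proof -
    obtain ws where "set ws \<subseteq> S" "word_prod ws = X" "length ws = wlen X"
      using obtain_word[OF X] .
    then show ?thesis using words[of ws] by simp
  qed
  then show ?thesis
    using K(1) by blast
qed

text \<open>From \<open>x\<close> inside the sheet to the hub, back along the spoke to the orbit
  point, along the word to \<open>b\<close>, and on to \<open>x\<^sub>0\<close>; only the stretch
  along the word grows with \<open>X\<close>.\<close>

lemma riemannian_dist_sheet:
  "\<exists>L>0. \<forall>i\<in>I. \<forall>X\<in>carrier \<Gamma>. \<forall>x\<in>sheet i X. riemannian_dist A' g' x x\<^sub>0 \<le> L * (real (wlen X) + 1)"
proof -
  obtain N where N: "N \<ge> 0" "\<And>X. X \<in> carrier \<Gamma> \<Longrightarrow> reach (orbit_point X) b (ennreal (N * (real (wlen X) + 1)))"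
    using reach_orbit_point by blast
  obtain \<sigma> where \<sigma>: "path \<sigma>" "pathstart \<sigma> = b" "pathfinish \<sigma> = x\<^sub>0"
    using simply_connected_path_connected[OF simply_connected] .
  have "path (p \<circ> \<sigma>)"
    using \<sigma>(1) continuous_on_subset[OF cont] by (intro path_continuous_image) auto
  then obtain D where D: "D \<ge> 0" "\<And>x y. lifts p (p \<circ> \<sigma>) x y \<Longrightarrow> reach x y (ennreal D)"
    using reach_lifts by blast
  have reach_D: "reach b x\<^sub>0 (ennreal D)"
    by (rule D(2)) (rule liftsI[OF \<sigma>], simp)
  have "\<forall>i\<in>I. \<exists>M. M \<ge> 0 \<and> (\<forall>X\<in>carrier \<Gamma>. \<forall>x\<in>sheet i X. reach x (orbit_point X) (ennreal M))"
  proof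
    fix i assume "i \<in> I"
    note i = cells[OF this]
    obtain N1 where N1: "N1 \<ge> 0" "\<And>x y. lifts p (spoke i) x y \<Longrightarrow> reach y x (ennreal N1)"
      using reach_lifts[OF spoke(1)] by blast
    obtain \<Lambda> where \<Lambda>: "\<Lambda> > 0" "\<And>V q x y. open V \<Longrightarrow> homeomorphism V (cell_domain i) p q \<Longrightarrow> x \<in> V \<Longrightarrow> y \<in> V \<Longrightarrow>
        reach x y (ennreal (\<Lambda> * norm (coord i y - coord i x)))"
      using reach_in_cell[OF i] by blast
    have "reach x (orbit_point X) (ennreal (\<Lambda> * (2 * snd (snd i)) + N1))" if X: "X \<in> carrier \<Gamma>" and x: "x \<in> sheet i X" for X x
    proof -
      obtain q where q: "open (sheet i X)" "homeomorphism (sheet i X) (cell_domain i) p q"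
        using sheet_homeomorphism[OF i X] .
      note hx = sheet_in_sheets(2)[OF i X]
      have ball: "coord i z \<in> cell_ball i" if "z \<in> sheet i X" for z
        using sheet_domain[OF i X that] mem_cell_domain[OF i] by (simp add: cellD(7)[OF i])
      have "norm (coord i (hub i X) - coord i x) \<le> 2 * snd (snd i)"
        using ball[OF hx] ball[OF x] dist_triangle2[of "coord i (hub i X)" "coord i x" "fst (snd i)"]
        by (simp add: dist_norm norm_minus_commute)
      then have "\<Lambda> * norm (coord i (hub i X) - coord i x) \<le> \<Lambda> * (2 * snd (snd i))"
        using \<Lambda>(1) by (intro mult_left_mono) auto
      then have "reach x (hub i X) (ennreal (\<Lambda> * (2 * snd (snd i))))"
        using reach_mono[OF \<Lambda>(2)[OF q x hx]] ennreal_leI by blast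
      from reach_trans[OF this N1(2)[OF hub(1)[OF X]]] show ?thesis
        using \<Lambda>(1) N1(1) cellD(2)[OF i] by (simp add: ennreal_plus[symmetric] del: ennreal_plus)
    qed
    moreover have "\<Lambda> * (2 * snd (snd i)) + N1 \<ge> 0"
      using \<Lambda>(1) N1(1) cellD(2)[OF i] by simp
    ultimately show "\<exists>M. M \<ge> 0 \<and> (\<forall>X\<in>carrier \<Gamma>. \<forall>x\<in>sheet i X. reach x (orbit_point X) (ennreal M))"
      by blast
  qed
  then obtain M where M: "\<forall>i\<in>I. M i \<ge> 0 \<and> (\<forall>X\<in>carrier \<Gamma>. \<forall>x\<in>sheet i X. reach x (orbit_point X) (ennreal (M i)))"
    by (rule bchoice[THEN exE])
  define L where "L = N + D + sum M I + 1"
  have L: "L > 0"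
    unfolding L_def using N(1) D(1) M by (intro add_nonneg_pos add_nonneg_nonneg sum_nonneg) auto
  moreover have "riemannian_dist A' g' x x\<^sub>0 \<le> L * (real (wlen X) + 1)"
    if i: "i \<in> I" and X: "X \<in> carrier \<Gamma>" and x: "x \<in> sheet i X" for i X x
  proof -
    let ?n = "real (wlen X)"
    have Mi: "M i \<ge> 0" "reach x (orbit_point X) (ennreal (M i))"
      using M i X x by blast+
    have "reach x x\<^sub>0 (ennreal (M i) + (ennreal (N * (?n + 1)) + ennreal D))"
      by (rule reach_trans[OF Mi(2) reach_trans[OF N(2)[OF X] reach_D]])
    then have "reach x x\<^sub>0 (ennreal (M i + (N * (?n + 1) + D)))"
      using Mi(1) N(1) D(1) by (simp add: ennreal_plus[symmetric] del: ennreal_plus)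
    then have "riemannian_dist A' g' x x\<^sub>0 \<le> M i + (N * (?n + 1) + D)"
      using Mi(1) N(1) D(1) by (intro riemannian_dist_le) auto
    also have "\<dots> \<le> L * (?n + 1)"
    proof -
      have "M i \<le> sum M I"
        using i finite_I M by (intro member_le_sum) auto
      then have "M i + D \<le> (sum M I + D + 1) * 1"
        by simp
      also have "\<dots> \<le> (sum M I + D + 1) * (?n + 1)"
        using M D(1) by (intro mult_left_mono add_nonneg_nonneg sum_nonneg) auto
      finally show ?thesis
        by (simp add: L_def algebra_simps)
    qed
    finally show ?thesis .
  qed
  ultimately show ?thesis by blast
qed

text \<open>The distance bound passes through the non-decreasing f, and the two growth conditions of
  a control function turn f (L (n + 1)) into a multiple of f n.\<close>

lemma weight_lower_bound:
  assumes f: "control_function f"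
  shows "\<exists>c>0. \<forall>i\<in>I. \<forall>X\<in>carrier \<Gamma>. \<forall>x\<in>sheet i X. c / f (wlen X) \<le> 1 / f (riemannian_dist A' g' x x\<^sub>0)"
proof -
  note f_mono = control_functionD(1)[OF f] and f_ge_1 = control_functionD(2)[OF f]
  obtain L where L: "L > 0" "\<And>i X x. i \<in> I \<Longrightarrow> X \<in> carrier \<Gamma> \<Longrightarrow> x \<in> sheet i X \<Longrightarrow>
      riemannian_dist A' g' x x\<^sub>0 \<le> L * (real (wlen X) + 1)"
    using riemannian_dist_sheet by blast
  obtain L1 where L1: "L1 > 0" "\<And>t. t > 0 \<Longrightarrow> f (L * t) \<le> L1 * f t"
    using control_functionD(3)[OF f L(1)] by blast
  obtain L2 where L2: "L2 > 0" "\<And>t. t > 0 \<Longrightarrow> f (t + 1) \<le> L2 * f t"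
    using control_functionD(3)[OF f, of 1] by auto
  \<comment> \<open>The summand f L serves n = 0, since the growth conditions speak of positive
    arguments.\<close>
  define K where "K = L1 * L2 + f L"
  have K: "K > 0"
    using L1(1) L2(1) f_ge_1[of L] L(1) by (simp add: K_def add_pos_pos)
  have bound: "f (L * (real n + 1)) \<le> K * f n" for n
  proof (cases "n = 0")
    case True
    have "f L \<le> K * 1"
      using L1(1) L2(1) by (simp add: K_def)
    also have "\<dots> \<le> K * f 0"
      using K f_ge_1[of 0] by (intro mult_left_mono) auto
    finally show ?thesis using True by simp
  next
    case False
    have "f (L * (real n + 1)) \<le> L1 * f (real n + 1)"
      by (rule L1(2)) simp
    also have "\<dots> \<le> L1 * (L2 * f n)"
      using L2(2)[of n] False L1(1) by (intro mult_left_mono) auto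
    also have "\<dots> \<le> K * f n"
      using f_ge_1[of n] f_ge_1[of L] L(1) by (simp add: K_def algebra_simps)
    finally show ?thesis .
  qed
  have "1 / K / f (wlen X) \<le> 1 / f (riemannian_dist A' g' x x\<^sub>0)"
    if "i \<in> I" "X \<in> carrier \<Gamma>" "x \<in> sheet i X" for i X x
  proof -
    have d: "riemannian_dist A' g' x x\<^sub>0 \<ge> 0" by (rule riemannian_dist_nonneg)
    have "f (riemannian_dist A' g' x x\<^sub>0) \<le> K * f (wlen X)"
      using f_mono[OF d L(2)[OF that]] bound by (rule order_trans)
    moreover have "f (riemannian_dist A' g' x x\<^sub>0) > 0"
      using f_ge_1[OF d] by simp
    ultimately have "1 / (K * f (wlen X)) \<le> 1 / f (riemannian_dist A' g' x x\<^sub>0)"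
      using K f_ge_1[of "wlen X"] by (intro divide_left_mono mult_pos_pos) auto
    then show ?thesis by simp
  qed
  then show ?thesis
    using K by (intro exI[of _ "1 / K"]) simp
qed

lemma weight_measurable:
  assumes f: "control_function f"
  shows "(\<lambda>x. 1 / f (riemannian_dist A' g' x x\<^sub>0)) \<in> borel_measurable borel"
proof -
  \<comment> \<open>f is known to be monotone on nonnegative arguments; distances are nonnegative,
    so cutting off at 0 changes no value that occurs.\<close>
  have "mono (\<lambda>t. f (max 0 t))"
    using control_functionD(1)[OF f] by (intro monoI) (auto simp: max.coboundedI2 max_def)
  then have "(\<lambda>t. f (max 0 t)) \<in> borel_measurable borel"
    by (rule borel_measurable_mono)
  moreover have "(\<lambda>x. riemannian_dist A' g' x x\<^sub>0) \<in> borel_measurable borel"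
    by (rule riemannian_dist_measurable[OF reach_local])
  ultimately have "(\<lambda>x. f (max 0 (riemannian_dist A' g' x x\<^sub>0))) \<in> borel_measurable borel"
    using measurable_compose by blast
  then show ?thesis
    using riemannian_dist_nonneg by (simp add: max_def)
qed

end

section \<open>Integral estimates for the extension\<close>

context cell_cover
begin

lemma pieceD: "x \<in> piece i X \<Longrightarrow> x \<in> sheet i X" "x \<in> piece i X \<Longrightarrow> p x \<in> core i"
  by (auto simp: piece_def)

lemma extend_support:
  assumes h: "\<And>X. X \<notin> T \<Longrightarrow> h X = 0" and x: "extend h x \<noteq> 0"
  shows "\<exists>i\<in>I. \<exists>X\<in>T \<inter> carrier \<Gamma>. x \<in> piece i X"
proof -
  have "(\<Sum>i\<in>I. h (sheet_index i x) * bump_on i x) \<noteq> 0"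
    using x by (auto simp: extend_def numerator_eq)
  then obtain i where i: "i \<in> I" "h (sheet_index i x) * bump_on i x \<noteq> 0"
    by (rule sum.not_neutral_contains_not_neutral)
  have core: "p x \<in> core i"
    using i bump_on_zero[OF i(1)] by auto
  have T: "sheet_index i x \<in> T"
    using i(2) h by auto
  have "p x \<in> cell_domain i"
    using core core_subset[OF cells[OF i(1)]] by blast
  note X = sheet_index[OF i(1) this]
  then show ?thesis
    using i(1) T core unfolding piece_def by blast
qed

lemma extend_bounded:
  assumes T: "finite T" "\<And>X. X \<notin> T \<Longrightarrow> h X = 0"
  shows "\<bar>extend h x\<bar> \<le> (\<Sum>X\<in>T. \<bar>h X\<bar>)"
proof -
  let ?B = "\<Sum>X\<in>T. \<bar>h X\<bar>"
  have bound: "\<bar>h X\<bar> \<le> ?B" for X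
  proof (cases "X \<in> T")
    case True
    then show ?thesis using T(1) by (intro member_le_sum[where f = "\<lambda>X. \<bar>h X\<bar>"]) auto
  qed (simp add: T(2) sum_nonneg)
  have "\<bar>numerator h x\<bar> \<le> (\<Sum>i\<in>I. \<bar>h (sheet_index i x) * bump_on i x\<bar>)"
    unfolding numerator_eq by (rule sum_abs)
  also have "\<dots> \<le> (\<Sum>i\<in>I. ?B * bump_on i x)"
    using bound bump_on_nonneg by (intro sum_mono) (simp add: abs_mult mult_right_mono)
  also have "\<dots> = ?B * total x"
    by (simp add: total_def sum_distrib_left)
  finally show ?thesis
    using total_pos[of x] by (simp add: extend_def abs_divide pos_divide_le_eq)
qed

lemma compact_pieces:
  assumes "finite T" "T \<subseteq> carrier \<Gamma>"
  shows "compact (\<Union>i\<in>I. \<Union>X\<in>T. piece i X)"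
  using assms cells by (intro compact_UN finite_I compact_piece) auto

lemma compactly_supported_extend:
  assumes T: "finite T" "T \<subseteq> carrier \<Gamma>" "\<And>X. X \<notin> T \<Longrightarrow> h X = 0"
  shows "compactly_supported (extend h)"
proof -
  let ?K = "\<Union>i\<in>I. \<Union>X\<in>T. piece i X"
  have K: "compact ?K" by (rule compact_pieces[OF T(1,2)])
  have "{x. extend h x \<noteq> 0} \<subseteq> ?K"
  proof
    fix x assume "x \<in> {x. extend h x \<noteq> 0}"
    then have "\<exists>i\<in>I. \<exists>X\<in>T \<inter> carrier \<Gamma>. x \<in> piece i X"
      by (intro extend_support[of T h x, OF T(3)]) auto
    then show "x \<in> ?K" by blast
  qed
  then have "closure {x. extend h x \<noteq> 0} \<subseteq> ?K"
    using compact_imp_closed[OF K] by (rule closure_minimal)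
  then have "closure {x. extend h x \<noteq> 0} = ?K \<inter> closure {x. extend h x \<noteq> 0}"
    by blast
  then show ?thesis
    unfolding compactly_supported_def using compact_Int_closed[OF K closed_closure] by metis
qed

text \<open>The Bochner integral of a non-integrable function is 0, so the lower bound in
  \<open>integral_extend_lower\<close> depends on integrability: the integrand is bounded and
  vanishes off a set of finite volume.\<close>

lemma integrable_extend:
  assumes v: "riemannian_volume A' g' v" and f: "control_function f"
    and T: "finite T" "T \<subseteq> carrier \<Gamma>" "\<And>X. X \<notin> T \<Longrightarrow> h X = 0"
  shows "integrable v (\<lambda>x. (extend h x)\<^sup>2 * (1 / f (riemannian_dist A' g' x x\<^sub>0)))"
proof (rule integrableI_bounded_set[where A = "\<Union>i\<in>I. \<Union>X\<in>T. piece i X" and B = "(\<Sum>X\<in>T. \<bar>h X\<bar>)\<^sup>2"])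
  have sets: "sets v = sets borel"
    using v by (simp add: riemannian_volume_def)
  show "(\<Union>i\<in>I. \<Union>X\<in>T. piece i X) \<in> sets v"
    unfolding sets using compact_pieces[OF T(1,2)] by (intro borel_closed compact_imp_closed)
  have "extend h \<in> borel_measurable borel"
    using smooth_real_function_imp_continuous[OF smooth_extend] by (rule borel_measurable_continuous_onI)
  then have "(\<lambda>x. (extend h x)\<^sup>2 * (1 / f (riemannian_dist A' g' x x\<^sub>0))) \<in> borel_measurable borel"
    using weight_measurable[OF f] by (intro borel_measurable_times borel_measurable_power)
  then show "(\<lambda>x. (extend h x)\<^sup>2 * (1 / f (riemannian_dist A' g' x x\<^sub>0))) \<in> borel_measurable v"
    using measurable_cong_sets[OF sets refl] by blast
  have "emeasure v (\<Union>i\<in>I. \<Union>X\<in>T. piece i X) = emeasure v (\<Union>z\<in>I \<times> T. piece (fst z) (snd z))"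
    by (rule arg_cong[where f = "emeasure v"]) (auto, blast)
  also have "\<dots> \<le> (\<Sum>z\<in>I \<times> T. emeasure v (piece (fst z) (snd z)))"
    using finite_I T cells piece_sets[OF v] by (intro emeasure_subadditive_finite) auto
  also have "\<dots> < \<infinity>"
    using finite_I T cells measure_piece(2)[OF v] by (auto simp: less_top[symmetric])
  finally show "emeasure v (\<Union>i\<in>I. \<Union>X\<in>T. piece i X) < \<infinity>" .
  have "norm ((extend h x)\<^sup>2 * (1 / f (riemannian_dist A' g' x x\<^sub>0))) \<le> (\<Sum>X\<in>T. \<bar>h X\<bar>)\<^sup>2" for x
  proof -
    have f1: "f (riemannian_dist A' g' x x\<^sub>0) \<ge> 1"
      by (rule control_functionD(2)[OF f riemannian_dist_nonneg])
    have "(extend h x)\<^sup>2 \<le> (\<Sum>X\<in>T. \<bar>h X\<bar>)\<^sup>2"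
      using extend_bounded[of T h x, OF T(1,3)] by (intro abs_le_square_iff[THEN iffD1]) (simp add: sum_nonneg)
    then have "(extend h x)\<^sup>2 * (1 / f (riemannian_dist A' g' x x\<^sub>0)) \<le> (\<Sum>X\<in>T. \<bar>h X\<bar>)\<^sup>2 * 1"
      using f1 by (intro mult_mono) auto
    then show ?thesis
      using f1 by simp
  qed
  then show "AE x\<in>\<Union>i\<in>I. \<Union>X\<in>T. piece i X in v. norm ((extend h x)\<^sup>2 * (1 / f (riemannian_dist A' g' x x\<^sub>0))) \<le> (\<Sum>X\<in>T. \<bar>h X\<bar>)\<^sup>2"
    by simp
  have "(extend h x)\<^sup>2 * (1 / f (riemannian_dist A' g' x x\<^sub>0)) = 0" if "x \<notin> (\<Union>i\<in>I. \<Union>X\<in>T. piece i X)" for x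
  proof -
    have "extend h x = 0"
    proof (rule ccontr)
      assume "extend h x \<noteq> 0"
      then have "\<exists>i\<in>I. \<exists>X\<in>T \<inter> carrier \<Gamma>. x \<in> piece i X"
        by (intro extend_support[of T h x, OF T(3)])
      then show False using that by blast
    qed
    then show ?thesis by simp
  qed
  then show "AE x in v. x \<notin> (\<Union>i\<in>I. \<Union>X\<in>T. piece i X) \<longrightarrow> (extend h x)\<^sup>2 * (1 / f (riemannian_dist A' g' x x\<^sub>0)) = 0"
    by (intro AE_I2 impI)
qed

lemma integral_step:
  assumes v: "riemannian_volume A' g' v" and i: "i \<in> I" and T: "T \<subseteq> carrier \<Gamma>"
  shows "integrable v (\<lambda>x. \<Sum>X\<in>T. indicator (piece i X) x *\<^sub>R w X)"
    "(LINT x|v. (\<Sum>X\<in>T. indicator (piece i X) x *\<^sub>R w X)) = enn2real (cell_volume i) * (\<Sum>X\<in>T. w X :: real)"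
proof -
  have *: "has_bochner_integral v (\<lambda>x. indicator (piece i X) x *\<^sub>R w X) (measure v (piece i X) *\<^sub>R w X)" if "X \<in> T" for X
    using that T piece_sets[OF v cells[OF i]] measure_piece(2)[OF v cells[OF i]]
    by (intro has_bochner_integral_indicator) auto
  then have "has_bochner_integral v (\<lambda>x. \<Sum>X\<in>T. indicator (piece i X) x *\<^sub>R w X) (\<Sum>X\<in>T. measure v (piece i X) *\<^sub>R w X)"
    by (rule has_bochner_integral_sum)
  moreover have "(\<Sum>X\<in>T. measure v (piece i X) *\<^sub>R w X) = enn2real (cell_volume i) * (\<Sum>X\<in>T. w X)"
    unfolding sum_distrib_left using T measure_piece(1)[OF v cells[OF i]] by (intro sum.cong) auto
  ultimately show "integrable v (\<lambda>x. \<Sum>X\<in>T. indicator (piece i X) x *\<^sub>R w X)"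
    "(LINT x|v. (\<Sum>X\<in>T. indicator (piece i X) x *\<^sub>R w X)) = enn2real (cell_volume i) * (\<Sum>X\<in>T. w X)"
    by (auto simp: has_bochner_integral_iff)
qed

text \<open>A single cell suffices: its pieces are disjoint for different indices, so at most one
  term of the step function is nonzero at a point, and on a piece \<open>extend h\<close> is within
  \<open>oscillation h X\<close> of \<open>h X\<close>.\<close>

lemma integral_extend_lower:
  assumes v: "riemannian_volume A' g' v" and f: "control_function f" and i: "i \<in> I"
    and c: "c \<ge> 0" "\<And>X x. X \<in> carrier \<Gamma> \<Longrightarrow> x \<in> sheet i X \<Longrightarrow> c / f (wlen X) \<le> 1 / f (riemannian_dist A' g' x x\<^sub>0)"
    and T: "finite T" "T \<subseteq> carrier \<Gamma>" "\<And>X. X \<notin> T \<Longrightarrow> h X = 0"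
  shows "enn2real (cell_volume i) * (\<Sum>X\<in>T. c / f (wlen X) * ((h X)\<^sup>2 / 2 - (oscillation h X)\<^sup>2))
    \<le> (LINT x|v. (extend h x)\<^sup>2 * (1 / f (riemannian_dist A' g' x x\<^sub>0)))"
proof -
  let ?w = "\<lambda>X. c / f (wlen X) * ((h X)\<^sup>2 / 2 - (oscillation h X)\<^sup>2)"
  let ?\<rho> = "\<lambda>x. 1 / f (riemannian_dist A' g' x x\<^sub>0)"
  have \<rho>: "?\<rho> x \<ge> 0" for x
    using control_functionD(2)[OF f riemannian_dist_nonneg, of x x\<^sub>0] by simp
  have "(LINT x|v. (\<Sum>X\<in>T. indicator (piece i X) x *\<^sub>R ?w X)) \<le> (LINT x|v. (extend h x)\<^sup>2 * ?\<rho> x)"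
  proof (rule integral_mono'[OF integrable_extend[OF v f T]])
    fix x
    show nonneg: "0 \<le> (extend h x)\<^sup>2 * ?\<rho> x"
      using \<rho> by simp
    show "(\<Sum>X\<in>T. indicator (piece i X) x *\<^sub>R ?w X) \<le> (extend h x)\<^sup>2 * ?\<rho> x"
    proof (cases "\<exists>X\<in>T. x \<in> piece i X")
      case False
      then have "(\<Sum>X\<in>T. indicator (piece i X) x *\<^sub>R ?w X) = 0"
        by (intro sum.neutral) auto
      then show ?thesis using nonneg by simp
    next
      case True
      then obtain X where X: "X \<in> T" "x \<in> piece i X" by blast
      then have XG: "X \<in> carrier \<Gamma>" using T(2) by blast
      note x = pieceD[OF X(2)]
      have "indicator (piece i Y) x *\<^sub>R ?w Y = (if Y = X then ?w X else 0)" if Y: "Y \<in> T" for Y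
      proof (cases "Y = X")
        case False
        have "Y \<in> carrier \<Gamma>" using T(2) Y by blast
        then have "x \<notin> piece i Y"
          using False pieceD(1)[of x i Y] sheet_unique[OF cells[OF i] XG _ x(1), of Y] by blast
        then show ?thesis using False by simp
      qed (use X in simp)
      then have "(\<Sum>Y\<in>T. indicator (piece i Y) x *\<^sub>R ?w Y) = ?w X"
        using T(1) X(1) by (simp add: sum.delta')
      also have "\<dots> \<le> (extend h x)\<^sup>2 * ?\<rho> x"
      proof (cases "(h X)\<^sup>2 / 2 - (oscillation h X)\<^sup>2 \<ge> 0")
        case True
        have "(extend h x - h X)\<^sup>2 \<le> (oscillation h X)\<^sup>2"
          using extend_close[OF i XG x, of h] by (metis abs_ge_zero power2_abs power_mono)
        \<comment> \<open>From h = e - (e - h) and (s - t)^2 \<le> 2 (s^2 + t^2).\<close>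
        moreover have "(h X)\<^sup>2 \<le> 2 * ((extend h x)\<^sup>2 + (extend h x - h X)\<^sup>2)"
          using zero_le_power2[of "2 * extend h x - h X"] by (simp add: power2_eq_square algebra_simps)
        ultimately have "(h X)\<^sup>2 / 2 - (oscillation h X)\<^sup>2 \<le> (extend h x)\<^sup>2"
          by simp
        then have "?w X \<le> ?\<rho> x * (extend h x)\<^sup>2"
          using c(2)[OF XG x(1)] True \<rho>[of x] by (intro mult_mono) auto
        then show ?thesis by (simp add: mult.commute)
      next
        case False
        \<comment> \<open>If the oscillation dominates, the lower bound is not positive while the
          integrand is nonnegative.\<close>
        then have "?w X \<le> 0"
          using c(1) control_functionD(2)[OF f, of "wlen X"] by (intro mult_nonneg_nonpos) auto
        then show ?thesis using nonneg by linarith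
      qed
      finally show ?thesis .
    qed
  qed
  then show ?thesis
    using integral_step(2)[OF v i T(2), of ?w] by simp
qed

text \<open>The pieces of all cells cover, so at each point one of them bounds the gradient;
  overlaps only increase the right side.\<close>

lemma integral_gradient_upper:
  assumes v: "riemannian_volume A' g' v"
    and G: "\<And>i X x. i \<in> I \<Longrightarrow> X \<in> carrier \<Gamma> \<Longrightarrow> x \<in> sheet i X \<Longrightarrow> p x \<in> core i \<Longrightarrow>
      gradient_norm A' g' (extend h) x \<le> G * oscillation h X"
    and T': "finite T'" "T' \<subseteq> carrier \<Gamma>" "\<And>X. X \<in> carrier \<Gamma> \<Longrightarrow> X \<notin> T' \<Longrightarrow> oscillation h X = 0"
  shows "(LINT x|v. (gradient_norm A' g' (extend h) x)\<^sup>2)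
    \<le> (\<Sum>i\<in>I. enn2real (cell_volume i)) * (\<Sum>X\<in>T'. (G * oscillation h X)\<^sup>2)"
proof -
  let ?w = "\<lambda>X. (G * oscillation h X)\<^sup>2"
  have "(LINT x|v. (gradient_norm A' g' (extend h) x)\<^sup>2) \<le> (LINT x|v. (\<Sum>i\<in>I. \<Sum>X\<in>T'. indicator (piece i X) x *\<^sub>R ?w X))"
  \<comment> \<open>Integrability is asked of the dominating step function; a squared gradient norm
    that is not integrable has integral 0.\<close>
  proof (rule integral_mono')
    show "integrable v (\<lambda>x. \<Sum>i\<in>I. \<Sum>X\<in>T'. indicator (piece i X) x *\<^sub>R ?w X)"
      by (rule Bochner_Integration.integrable_sum) (rule integral_step(1)[OF v _ T'(2)])
    fix x
    show nonneg: "0 \<le> (\<Sum>i\<in>I. \<Sum>X\<in>T'. indicator (piece i X) x *\<^sub>R ?w X)"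
      by (intro sum_nonneg) auto
    obtain i X where i: "i \<in> I" and X: "X \<in> carrier \<Gamma>" and x: "x \<in> sheet i X" "p x \<in> core i"
      using core_cover[of x] by blast
    have grad: "(gradient_norm A' g' (extend h) x)\<^sup>2 \<le> ?w X"
      using G[OF i X x] gradient_norm_nonneg by (intro power_mono) auto
    show "(gradient_norm A' g' (extend h) x)\<^sup>2 \<le> (\<Sum>i\<in>I. \<Sum>X\<in>T'. indicator (piece i X) x *\<^sub>R ?w X)"
    proof (cases "X \<in> T'")
      case True
      have "?w X = indicator (piece i X) x *\<^sub>R ?w X"
        using x by (simp add: piece_def)
      also have "\<dots> \<le> (\<Sum>X\<in>T'. indicator (piece i X) x *\<^sub>R ?w X)"
        using True T'(1) by (intro member_le_sum[where f = "\<lambda>X. indicator (piece i X) x *\<^sub>R ?w X"]) auto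
      also have "\<dots> \<le> (\<Sum>i\<in>I. \<Sum>X\<in>T'. indicator (piece i X) x *\<^sub>R ?w X)"
        using i finite_I by (intro member_le_sum[where f = "\<lambda>i. \<Sum>X\<in>T'. indicator (piece i X) x *\<^sub>R ?w X"] sum_nonneg) auto
      finally show ?thesis
        using grad by linarith
    next
      case False
      then show ?thesis
        using grad nonneg T'(3)[OF X] by simp
    qed
  qed
  also have "\<dots> = (\<Sum>i\<in>I. LINT x|v. (\<Sum>X\<in>T'. indicator (piece i X) x *\<^sub>R ?w X))"
    by (rule Bochner_Integration.integral_sum) (rule integral_step(1)[OF v _ T'(2)])
  also have "\<dots> = (\<Sum>i\<in>I. enn2real (cell_volume i) * (\<Sum>X\<in>T'. ?w X))"
    by (intro sum.cong refl integral_step(2)[OF v _ T'(2)])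
  finally show ?thesis
    by (simp add: sum_distrib_right)
qed

theorem discrete_poincare_inequality:
  assumes v: "riemannian_volume A' g' v" and f: "control_function f" and C: "C > 0"
    and poinc: "\<And>\<eta>. smooth_real_function A' \<eta> \<Longrightarrow> compactly_supported \<eta> \<Longrightarrow>
      (LINT x|v. (\<eta> x)\<^sup>2 * (1 / f (riemannian_dist A' g' x x\<^sub>0))) \<le> C * (LINT x|v. (gradient_norm A' g' \<eta> x)\<^sup>2)"
  shows "\<exists>C'>0. poincare_inequality f R C'"
proof -
  obtain G where G: "G \<ge> 0" "\<And>h i X x. i \<in> I \<Longrightarrow> X \<in> carrier \<Gamma> \<Longrightarrow> x \<in> sheet i X \<Longrightarrow> p x \<in> core i \<Longrightarrow>
      gradient_norm A' g' (extend h) x \<le> G * oscillation h X"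
    using gradient_extend_bound by metis
  obtain c where c: "c > 0" "\<And>i X x. i \<in> I \<Longrightarrow> X \<in> carrier \<Gamma> \<Longrightarrow> x \<in> sheet i X \<Longrightarrow>
      c / f (wlen X) \<le> 1 / f (riemannian_dist A' g' x x\<^sub>0)"
    using weight_lower_bound[OF f] by metis
  obtain i where i: "i \<in> I" using cover by blast
  define \<omega> where "\<omega> = enn2real (cell_volume i)"
  define \<Omega> where "\<Omega> = (\<Sum>i\<in>I. enn2real (cell_volume i))"
  define W where "W = real (card {s \<in> carrier \<Gamma>. wlen s \<le> R})"
  \<comment> \<open>Collects the two terms with squared oscillation: the one from the gradient, and
    the one from replacing \<open>extend h\<close> by \<open>h\<close>.\<close>
  define B where "B = C * \<Omega> * G\<^sup>2 + \<omega> * c"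
  have \<omega>: "\<omega> > 0"
    unfolding \<omega>_def by (rule enn2real_cell_volume_pos[OF cells[OF i]])
  have \<Omega>: "\<Omega> \<ge> 0"
    by (simp add: \<Omega>_def sum_nonneg)
  have B: "B > 0"
    unfolding B_def using C \<Omega> \<omega> c(1) by (intro add_nonneg_pos) auto
  \<comment> \<open>The factor 4 is 2 from h^2 / 2 times 2 from \<open>oscillation_energy\<close>;
    the summand 1 makes the constant positive.\<close>
  have "(\<Sum>x\<in>T. (h x)\<^sup>2 / f (wlen x)) \<le> (4 * B * W / (\<omega> * c) + 1) * (\<Sum>x\<in>T. \<Sum>y\<in>nbhd R x. (h y - h x)\<^sup>2)"
    if T: "finite T" "T \<subseteq> carrier \<Gamma>" "\<And>x. x \<notin> T \<Longrightarrow> h x = 0" for T and h :: "(real \<Rightarrow> 'm) set \<Rightarrow> real"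
  proof -
    let ?osc = "\<lambda>X. (oscillation h X)\<^sup>2"
    let ?E = "\<Sum>x\<in>T. \<Sum>y\<in>nbhd R x. (h y - h x)\<^sup>2"
    have f1: "f (wlen X) \<ge> 1" for X
      by (rule control_functionD(2)[OF f]) simp
    \<comment> \<open>The \<open>R\<close>-neighbourhood of \<open>T\<close>: around a point outside
      it \<open>h\<close> vanishes on the whole ball, and so does the oscillation.\<close>
    define T' where "T' = (\<Union>X\<in>T. nbhd R X)"
    have T': "finite T'" "T' \<subseteq> carrier \<Gamma>"
      unfolding T'_def using T finite_nbhd by (auto simp: nbhd_def)
    have sub: "T \<subseteq> T'"
      unfolding T'_def using T(2) word_dist_self by (force simp: nbhd_def)
    have zero: "oscillation h X = 0" if X: "X \<in> carrier \<Gamma>" "X \<notin> T'" for X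
    proof -
      have "h Y = 0" if "Y \<in> nbhd R X" for Y
      proof -
        have "Y \<in> carrier \<Gamma>"
          using that by (simp add: nbhd_def)
        then have "X \<in> nbhd R Y"
          using nbhd_sym X(1) that by blast
        then have "Y \<notin> T"
          using X(2) unfolding T'_def by blast
        then show ?thesis by (rule T(3))
      qed
      moreover have "h X = 0"
        using X(2) sub T(3) by blast
      ultimately show ?thesis by (simp add: oscillation_def)
    qed
    have "\<omega> * (\<Sum>X\<in>T. c / f (wlen X) * ((h X)\<^sup>2 / 2 - ?osc X)) \<le> C * (\<Omega> * (\<Sum>X\<in>T'. (G * oscillation h X)\<^sup>2))"
    proof -
      have "\<omega> * (\<Sum>X\<in>T. c / f (wlen X) * ((h X)\<^sup>2 / 2 - ?osc X))
          \<le> (LINT x|v. (extend h x)\<^sup>2 * (1 / f (riemannian_dist A' g' x x\<^sub>0)))"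
        unfolding \<omega>_def using c(1) by (intro integral_extend_lower[OF v f i _ c(2)[OF i] T]) auto
      also have "\<dots> \<le> C * (LINT x|v. (gradient_norm A' g' (extend h) x)\<^sup>2)"
        by (rule poinc[OF smooth_extend compactly_supported_extend[OF T]])
      also have "\<dots> \<le> C * (\<Omega> * (\<Sum>X\<in>T'. (G * oscillation h X)\<^sup>2))"
        unfolding \<Omega>_def using C by (intro mult_left_mono integral_gradient_upper[OF v G(2) T' zero]) auto
      finally show ?thesis .
    qed
    moreover have "(\<Sum>X\<in>T. c / f (wlen X) * ((h X)\<^sup>2 / 2 - ?osc X)) =
        c / 2 * (\<Sum>X\<in>T. (h X)\<^sup>2 / f (wlen X)) - c * (\<Sum>X\<in>T. ?osc X / f (wlen X))"
      by (simp add: sum_distrib_left sum_subtractf[symmetric] algebra_simps)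
    moreover have "(\<Sum>X\<in>T. ?osc X / f (wlen X)) \<le> (\<Sum>X\<in>T'. ?osc X)"
    proof -
      have "(\<Sum>X\<in>T. ?osc X / f (wlen X)) \<le> (\<Sum>X\<in>T. ?osc X)"
      proof (rule sum_mono)
        fix X
        show "?osc X / f (wlen X) \<le> ?osc X"
          using divide_left_mono[of 1 "f (wlen X)" "?osc X"] f1[of X] by simp
      qed
      also have "\<dots> \<le> (\<Sum>X\<in>T'. ?osc X)"
        using T' sub by (intro sum_mono2) auto
      finally show ?thesis .
    qed
    moreover have "(\<Sum>X\<in>T'. (G * oscillation h X)\<^sup>2) = G\<^sup>2 * (\<Sum>X\<in>T'. ?osc X)"
      by (simp add: power_mult_distrib sum_distrib_left)
    ultimately have "\<omega> * (c / 2 * (\<Sum>X\<in>T. (h X)\<^sup>2 / f (wlen X))) \<le>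
        C * (\<Omega> * (G\<^sup>2 * (\<Sum>X\<in>T'. ?osc X))) + \<omega> * (c * (\<Sum>X\<in>T'. ?osc X))"
      using \<omega> c(1) by (smt (verit) mult_left_mono right_diff_distrib)
    also have "\<dots> = B * (\<Sum>X\<in>T'. ?osc X)"
      by (simp add: B_def algebra_simps)
    also have "\<dots> \<le> B * (2 * W * ?E)"
      unfolding W_def oscillation_def using B by (intro mult_left_mono oscillation_energy[of T h T', OF T T']) auto
    finally have "(\<Sum>X\<in>T. (h X)\<^sup>2 / f (wlen X)) \<le> 4 * B * W / (\<omega> * c) * ?E"
      using \<omega> c(1) by (simp add: field_simps)
    also have "\<dots> \<le> (4 * B * W / (\<omega> * c) + 1) * ?E"
      by (intro mult_right_mono sum_nonneg) auto
    finally show ?thesis .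
  qed
  moreover have "4 * B * W / (\<omega> * c) + 1 > 0"
    using B \<omega> c(1) by (intro add_nonneg_pos) (auto simp: W_def)
  ultimately show ?thesis
    unfolding poincare_inequality_def by blast
qed

end

theorem theorem6p1:
  fixes f :: "real \<Rightarrow> real"
    and A :: "('m::{t2_space,second_countable_topology}, 'n::finite) chart set"
    and g :: "('m, 'n) metric_field"
    and A' :: "('u::{t2_space,second_countable_topology}, 'n) chart set"
    and g' :: "('u, 'n) metric_field"
    and p :: "'u \<Rightarrow> 'm" and x\<^sub>0 :: 'u and v :: "'u measure" and C :: real
    and a :: 'm and S :: "(real \<Rightarrow> 'm) set set"
  assumes "control_function f" and "slowly_growing f"
    and "riemannian_manifold A g"
    and "compact (UNIV :: 'm set)" and "connected (UNIV :: 'm set)"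
    and "riemannian_universal_cover A' g' p A g"
    and "riemannian_volume A' g' v"
    and "C > 0"
    and "\<And>\<eta> :: 'u \<Rightarrow> real. smooth_real_function A' \<eta> \<Longrightarrow> compactly_supported \<eta> \<Longrightarrow>
           (LINT x|v. (\<eta> x)\<^sup>2 * (1 / f (riemannian_dist A' g' x x\<^sub>0)))
             \<le> C * (LINT x|v. (gradient_norm A' g' \<eta> x)\<^sup>2)"
    and "finite_symmetric_generating_set (fundamental_group a) S"
  shows "fundamental_class (fundamental_group a) S f
           = \<one>\<^bsub>homology (fundamental_group a) S f 0\<^esub>"
proof -
  have cover: "riemannian_manifold A' g'" "simply_connected (UNIV :: 'u set)" "covering_space UNIV p UNIV"
    "local_isometry A' g' p A g"
    using assms(6) by (auto simp: riemannian_universal_cover_def)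
  have "p ` UNIV = UNIV"
    using cover(3) by (simp add: covering_space_def)
  \<comment> \<open>Any point over the base point \<open>a\<close> can serve as origin of the
    fibre.\<close>
  then obtain b where b: "a = p b"
    by (metis UNIV_I imageE)
  interpret riemannian_covering A g A' g' p b
    by unfold_locales (use assms cover in auto)
  have "group (fundamental_group (p b))"
    by (rule group_fundamental_group)
  then have word: "word_metric (fundamental_group (p b)) S"
    using assms(10) unfolding b by (intro word_metric.intro word_metric_axioms.intro)
  interpret W: word_metric "fundamental_group (p b)" S
    by (rule word)
  obtain I where I: "finite I" "\<And>i. i \<in> I \<Longrightarrow> cell i"
    "\<And>q. \<exists>i\<in>I. q \<in> cell_domain i \<and> norm (snd (fst i) q - fst (snd i)) \<le> snd (snd i) / 3"
    using cell_cover_exists by metis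
  have "\<forall>z\<in>I \<times> I. \<exists>E. finite E \<and> E \<subseteq> carrier \<Gamma> \<and> (\<forall>X\<in>carrier \<Gamma>. \<forall>Y\<in>carrier \<Gamma>. \<forall>x. x \<in> sheet (fst z) X \<longrightarrow> x \<in> sheet (snd z) Y \<longrightarrow>
    p x \<in> core (fst z) \<longrightarrow> p x \<in> core (snd z) \<longrightarrow> (\<exists>e\<in>E. Y = X \<otimes>\<^bsub>\<Gamma>\<^esub> e))"
    using sheet_overlap I(2) by (metis mem_Times_iff)
  then obtain E where E: "\<forall>z\<in>I \<times> I. finite (E z) \<and> E z \<subseteq> carrier \<Gamma> \<and> (\<forall>X\<in>carrier \<Gamma>. \<forall>Y\<in>carrier \<Gamma>. \<forall>x. x \<in> sheet (fst z) X \<longrightarrow> x \<in> sheet (snd z) Y \<longrightarrow>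
    p x \<in> core (fst z) \<longrightarrow> p x \<in> core (snd z) \<longrightarrow> (\<exists>e\<in>E z. Y = X \<otimes>\<^bsub>\<Gamma>\<^esub> e))"
    by (rule bchoice[THEN exE])
  \<comment> \<open>The element 1 keeps the set nonempty and ensures R \<ge> 1, which puts every
    generator in range.\<close>
  define R where "R = Max (insert 1 (W.wlen ` (\<Union>z\<in>I \<times> I. E z)))"
  have fin: "finite (insert 1 (W.wlen ` (\<Union>z\<in>I \<times> I. E z)))"
    using I(1) E by blast
  have R: "R \<ge> 1" "\<And>z e. z \<in> I \<times> I \<Longrightarrow> e \<in> E z \<Longrightarrow> W.wlen e \<le> R"
    unfolding R_def using fin by (auto intro!: Max_ge)
  interpret cell_cover A g A' g' p b S I R
  proof unfold_locales
    fix i j X Y x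
    assume "i \<in> I" "j \<in> I" and X: "X \<in> carrier \<Gamma>" "Y \<in> carrier \<Gamma>"
      and x: "x \<in> sheet i X" "x \<in> sheet j Y" "p x \<in> core i" "p x \<in> core j"
    then have z: "(i, j) \<in> I \<times> I" by blast
    obtain e where e: "e \<in> E (i, j)" "Y = X \<otimes>\<^bsub>\<Gamma>\<^esub> e"
      using E[THEN bspec, OF z] X x unfolding fst_conv snd_conv by blast
    have "e \<in> carrier \<Gamma>"
      using E[THEN bspec, OF z] e(1) by blast
    then show "Y \<in> W.nbhd R X"
      unfolding e(2) using W.mem_nbhd_mult[OF X(1)] R(2)[OF z e(1)] by blast
  qed (use I in auto)
  have "\<exists>C'>0. W.poincare_inequality f R C'"
    by (rule discrete_poincare_inequality[OF assms(7,1,8)]) (rule assms(9))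
  then obtain C' where "C' > 0" "W.poincare_inequality f R C'" by blast
  then show ?thesis
    unfolding b using W.poincare_imp_fundamental_class_trivial[OF assms(1,2)] R(1) by blast
qed

end
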